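(* Let $q$ be a prime and let $\mathbb{F}$ be a field such that $\mathbb{F}^\times$ has an element of order $q$. Let $\mathcal{N}=\{H_1\}\cup\mathcal{H}\cup\mathcal{G}$, where $H_1,\mathcal{H},\mathcal{G}$ are as defined in the context. Then a subgroup of $\mathrm{GL}(q,\mathbb{F})$ is an absolutely irreducible maximal locally nilpotent subgroup of $\mathrm{GL}(q,\mathbb{F})$ if and only if it is $\mathrm{GL}(q,\mathbb{F})$-conjugate to a group in $\mathcal{N}$, with the following exceptions (groups in $\mathcal{N}$ that are not maximal locally nilpotent) when $q=2$ and $\mathbb{F}$ contains no square root of $-1$: (i) $H_1$ is a proper subgroup of $G(-1,1)\in\mathcal{G}$ (here $b$ is the identity matrix); (ii) if $G(\alpha,b)\in\mathcal{G}$ with $\alpha\notin-(\mathbb{F}^\times)^2$ and either $\det(b)\in-(\mathbb{F}^\times)^2$ or $\det(b)\in\alpha(\mathbb{F}^\times)^2$, then $G(\alpha,b)$ is conjugate to a proper subgroup of $G(-1,c)$ for some $c\in\Delta_{-1}^\times$ with $\det(c)=\alpha$.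
   Context: A group is locally nilpotent if every finite subset generates a nilpotent subgroup. A maximal locally nilpotent subgroup of $\mathrm{GL}(q,\mathbb{F})$ is a locally nilpotent subgroup not properly contained in any other locally nilpotent subgroup of $\mathrm{GL}(q,\mathbb{F})$. A subgroup is primitive if it is irreducible and does not preserve any nontrivial direct sum decomposition (system of imprimitivity) of $\mathbb{F}^q$. $\mathrm{Syl}_q(A)$ denotes the Sylow $q$-subgroup of an abelian group $A$, i.e. the subgroup of all elements of $q$-power order. $1_m$ is the $m\times m$ identity matrix. For $\alpha\in\mathbb{F}^\times$, $I_\alpha=\begin{bmatrix}0&1_{q-1}\\ \alpha&0\end{bmatrix}\in\mathrm{GL}(q,\mathbb{F})$. Let $D=\{\mathrm{diag}(\beta\beta_1,\ldots,\beta\beta_q)\mid \beta_i\in\mathrm{Syl}_q(\mathbb{F}^\times),\ \beta\in\mathbb{F}^\times\}$, $H_\alpha=\langle D,I_\alpha\rangle$, $S=\mathrm{Syl}_q(\mathbb{F}^\times)(\mathbb{F}^\times)^q$, and $\mathcal{H}=\{H_\alpha\mid\alpha\in\mathbb{F}^\times\setminus S\}$. Fix $\xi\in\mathbb{F}^\times$ of order $q$ and let $d=\mathrm{diag}(1,\xi,\ldots,\xi^{q-1})$. For $\alpha\in\mathbb{F}^\times\setminus(\mathbb{F}^\times)^q$, let $\Delta_\alpha=\langle I_\alpha\rangle_{\mathbb{F}}$ be the $\mathbb{F}$-algebra generated by $I_\alpha$ (a field extension of $\mathbb{F}1_q$ of degree $q$), let $A_\alpha\le\Delta_\alpha^\times$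 be the subgroup containing $\mathbb{F}^\times1_q$ such that $A_\alpha/\mathbb{F}^\times1_q=\mathrm{Syl}_q(\Delta_\alpha^\times/\mathbb{F}^\times1_q)$, and for $b\in\Delta_\alpha^\times$ let $G(\alpha,b)=\langle A_\alpha,db\rangle$. Case $( * )$ means: $q=2$ and $\alpha\in-(\mathbb{F}^\times)^2$. $\mathcal{G}$ is the set consisting of all primitive $G(\alpha,b)$ not in case $( * )$ together with (when $q=2$ and $-1\notin(\mathbb{F}^\times)^2$) all the primitive groups $G(-1,b)$, $b\in\Delta_{-1}^\times$; that is, the only case $( * )$ groups in $\mathcal{G}$ are those with $\alpha=-1$. *)

theory Defs
  imports
    "Jordan_Normal_Form.VS_Connect"
    "HOL-Algebra.Generated_Groups"
    "HOL-Algebra.Generated_Rings"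
    "HOL-Algebra.Multiplicative_Group"
    "HOL-Algebra.Algebraic_Closure_Type"
    "HOL-Computational_Algebra.Primes"
begin

section \<open>Locally nilpotent groups\<close>

primrec lower_central :: "('a, 'b) monoid_scheme \<Rightarrow> nat \<Rightarrow> 'a set" where
  "lower_central G 0 = carrier G"
| "lower_central G (Suc n) = generate G
     (\<Union>x \<in> lower_central G n. \<Union>y \<in> carrier G.
        {x \<otimes>\<^bsub>G\<^esub> y \<otimes>\<^bsub>G\<^esub> inv\<^bsub>G\<^esub> x \<otimes>\<^bsub>G\<^esub> inv\<^bsub>G\<^esub> y})"

definition nilpotent_group :: "('a, 'b) monoid_scheme \<Rightarrow> bool" where
  "nilpotent_group G \<longleftrightarrow> group G \<and> (\<exists>n. lower_central G n = {\<one>\<^bsub>G\<^esub>})"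

definition locally_nilpotent :: "('a, 'b) monoid_scheme \<Rightarrow> bool" where
  "locally_nilpotent G \<longleftrightarrow> group G \<and>
     (\<forall>B. finite B \<and> B \<subseteq> carrier G \<longrightarrow> nilpotent_group (G\<lparr>carrier := generate G B\<rparr>))"

definition locally_nilpotent_subgroup :: "'a set \<Rightarrow> ('a, 'b) monoid_scheme \<Rightarrow> bool" where
  "locally_nilpotent_subgroup K G \<longleftrightarrow> subgroup K G \<and> locally_nilpotent (G\<lparr>carrier := K\<rparr>)"

definition maximal_locally_nilpotent :: "'a set \<Rightarrow> ('a, 'b) monoid_scheme \<Rightarrow> bool" where
  "maximal_locally_nilpotent K G \<longleftrightarrow> locally_nilpotent_subgroup K G \<and>
     \<not> (\<exists>L. locally_nilpotent_subgroup L G \<and> K \<subset> L)"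

definition conj_set :: "('a, 'b) monoid_scheme \<Rightarrow> 'a \<Rightarrow> 'a set \<Rightarrow> 'a set" where
  "conj_set G g K = (\<lambda>x. g \<otimes>\<^bsub>G\<^esub> x \<otimes>\<^bsub>G\<^esub> inv\<^bsub>G\<^esub> g) ` K"

definition conjugate_in :: "('a, 'b) monoid_scheme \<Rightarrow> 'a set \<Rightarrow> 'a set \<Rightarrow> bool" where
  "conjugate_in G K L \<longleftrightarrow> (\<exists>g \<in> carrier G. L = conj_set G g K)"

text \<open>Used for abelian groups only, where the elements of \<open>q\<close>-power order form a subgroup.\<close>

definition Syl :: "nat \<Rightarrow> ('a, 'b) monoid_scheme \<Rightarrow> 'a set" where
  "Syl q G = {x \<in> carrier G. \<exists>k. group.ord G x = q ^ k}"


section \<open>Linear groups\<close>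

abbreviation Mat_ring :: "nat \<Rightarrow> 'a::field mat ring" where
  "Mat_ring n \<equiv> ring_mat TYPE('a) n ()"

definition GL :: "nat \<Rightarrow> 'a::field mat monoid" where
  "GL n = units_of (Mat_ring n)"

definition vec_subspace :: "nat \<Rightarrow> 'a::field vec set \<Rightarrow> bool" where
  "vec_subspace n W \<longleftrightarrow> VectorSpace.subspace class_ring W (module_vec TYPE('a) n)"

definition irreducible_lin :: "nat \<Rightarrow> 'a::field mat set \<Rightarrow> bool" where
  "irreducible_lin n K \<longleftrightarrow> n > 0 \<and>
     (\<forall>W. vec_subspace n W \<and> (\<forall>g \<in> K. \<forall>w \<in> W. g *\<^sub>v w \<in> W)
        \<longrightarrow> W = {0\<^sub>v n} \<or> W = carrier_vec n)"

text \<open>Irreducibility over the algebraic closure of the ground field.\<close>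

definition absolutely_irreducible :: "nat \<Rightarrow> 'a::field mat set \<Rightarrow> bool" where
  "absolutely_irreducible n K \<longleftrightarrow> irreducible_lin n (map_mat to_ac ` K)"

text \<open>The internal direct sum of the members of \<open>\<V>\<close> is the whole space.\<close>

definition direct_decomposition :: "nat \<Rightarrow> 'a::field vec set set \<Rightarrow> bool" where
  "direct_decomposition n \<V> \<longleftrightarrow> finite \<V> \<and>
     (\<forall>V \<in> \<V>. vec_subspace n V \<and> V \<noteq> {0\<^sub>v n}) \<and>
     (\<forall>v \<in> carrier_vec n. \<exists>!f. f \<in> (\<Pi>\<^sub>E V \<in> \<V>. V) \<and> v = finsum_vec TYPE('a) n f \<V>)"

definition system_of_imprimitivity :: "nat \<Rightarrow> 'a::field mat set \<Rightarrow> 'a vec set set \<Rightarrow> bool" where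
  "system_of_imprimitivity n K \<V> \<longleftrightarrow> direct_decomposition n \<V> \<and> card \<V> > 1 \<and>
     (\<forall>g \<in> K. \<forall>V \<in> \<V>. (\<lambda>v. g *\<^sub>v v) ` V \<in> \<V>)"

definition primitive_lin :: "nat \<Rightarrow> 'a::field mat set \<Rightarrow> bool" where
  "primitive_lin n K \<longleftrightarrow> irreducible_lin n K \<and> \<not> (\<exists>\<V>. system_of_imprimitivity n K \<V>)"


section \<open>The groups in the classification\<close>

abbreviation Fx :: "'a::field monoid" where
  "Fx \<equiv> mult_of class_ring"

definition Fx_powers :: "nat \<Rightarrow> 'a::field set" where
  "Fx_powers k = {x ^ k | x. x \<in> carrier Fx}"

definition I_mat :: "nat \<Rightarrow> 'a::field \<Rightarrow> 'a mat" where
  "I_mat q \<alpha> = four_block_mat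
     (0\<^sub>m (q - 1) 1)    (1\<^sub>m (q - 1))
     (\<alpha> \<cdot>\<^sub>m 1\<^sub>m 1)     (0\<^sub>m 1 (q - 1))"

definition D_set :: "nat \<Rightarrow> 'a::field mat set" where
  "D_set q = {mat_diag q (\<lambda>i. \<beta> * \<gamma> i) | \<beta> \<gamma>.
     \<beta> \<in> carrier Fx \<and> (\<forall>i < q. \<gamma> i \<in> Syl q Fx)}"

definition H_grp :: "nat \<Rightarrow> 'a::field \<Rightarrow> 'a mat set" where
  "H_grp q \<alpha> = generate (GL q) (D_set q \<union> {I_mat q \<alpha>})"

definition S_set :: "nat \<Rightarrow> 'a::field set" where
  "S_set q = {s * t | s t. s \<in> Syl q Fx \<and> t \<in> Fx_powers q}"

definition H_family :: "nat \<Rightarrow> 'a::field mat set set" where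
  "H_family q = {H_grp q \<alpha> | \<alpha>. \<alpha> \<in> carrier Fx - S_set q}"

definition d_mat :: "nat \<Rightarrow> 'a::field \<Rightarrow> 'a mat" where
  "d_mat q \<xi> = mat_diag q (\<lambda>i. \<xi> ^ i)"

text \<open>The \<open>F\<close>-algebra generated by a matrix is the ring generated by it and the scalar matrices.\<close>

definition Delta_ring :: "nat \<Rightarrow> 'a::field \<Rightarrow> 'a mat ring" where
  "Delta_ring q \<alpha> = (Mat_ring q)
     \<lparr>carrier := generate_ring (Mat_ring q) (insert (I_mat q \<alpha>) {c \<cdot>\<^sub>m 1\<^sub>m q | c. True})\<rparr>"

definition Delta_units :: "nat \<Rightarrow> 'a::field \<Rightarrow> 'a mat monoid" where
  "Delta_units q \<alpha> = units_of (Delta_ring q \<alpha>)"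

definition scalar_group :: "nat \<Rightarrow> 'a::field mat set" where
  "scalar_group q = {c \<cdot>\<^sub>m 1\<^sub>m q | c. c \<in> carrier Fx}"

text \<open>The full preimage in \<open>\<Delta>\<^sub>\<alpha>\<^sup>\<times>\<close> of the Sylow \<open>q\<close>-subgroup of its quotient by the scalars.\<close>

definition A_grp :: "nat \<Rightarrow> 'a::field \<Rightarrow> 'a mat set" where
  "A_grp q \<alpha> = {x \<in> carrier (Delta_units q \<alpha>).
     scalar_group q #>\<^bsub>Delta_units q \<alpha>\<^esub> x \<in> Syl q (Delta_units q \<alpha> Mod scalar_group q)}"

definition G_grp :: "nat \<Rightarrow> 'a::field \<Rightarrow> 'a \<Rightarrow> 'a mat \<Rightarrow> 'a mat set" where
  "G_grp q \<xi> \<alpha> b = generate (GL q) (A_grp q \<alpha> \<union> {d_mat q \<xi> * b})"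

definition case_star :: "nat \<Rightarrow> 'a::field \<Rightarrow> bool" where
  "case_star q \<alpha> \<longleftrightarrow> q = 2 \<and> \<alpha> \<in> uminus ` Fx_powers 2"

definition G_family :: "nat \<Rightarrow> 'a::field \<Rightarrow> 'a mat set set" where
  "G_family q \<xi> =
     {G_grp q \<xi> \<alpha> b | \<alpha> b.
        \<alpha> \<in> carrier Fx - Fx_powers q \<and> b \<in> carrier (Delta_units q \<alpha>) \<and>
        primitive_lin q (G_grp q \<xi> \<alpha> b) \<and> \<not> case_star q \<alpha>} \<union>
     {G_grp q \<xi> (- 1) b | b.
        q = 2 \<and> - 1 \<notin> (Fx_powers 2 :: 'a set) \<and> b \<in> carrier (Delta_units q (- 1)) \<and>
        primitive_lin q (G_grp q \<xi> (- 1) b)}"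

definition N_family :: "nat \<Rightarrow> 'a::field \<Rightarrow> 'a mat set set" where
  "N_family q \<xi> = {H_grp q 1} \<union> H_family q \<union> G_family q \<xi>"

text \<open>The parameters of the second kind of exception; they are only relevant for \<open>q = 2\<close>
  and \<open>F\<close> without a square root of \<open>-1\<close>.\<close>

definition exceptional_params :: "nat \<Rightarrow> 'a::field \<Rightarrow> ('a \<times> 'a mat) set" where
  "exceptional_params q \<xi> = {(\<alpha>, b).
     \<alpha> \<in> carrier Fx - Fx_powers q \<and> b \<in> carrier (Delta_units q \<alpha>) \<and>
     G_grp q \<xi> \<alpha> b \<in> G_family q \<xi> \<and>
     \<alpha> \<notin> uminus ` Fx_powers 2 \<and>
     (det b \<in> uminus ` Fx_powers 2 \<or> det b \<in> (\<lambda>x. \<alpha> * x) ` Fx_powers 2)}"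

definition exceptions :: "nat \<Rightarrow> 'a::field \<Rightarrow> 'a mat set set" where
  "exceptions q \<xi> =
     (if q = 2 \<and> \<not> (\<exists>x::'a. x ^ 2 = - 1)
      then insert (H_grp q 1) {G_grp q \<xi> \<alpha> b | \<alpha> b. (\<alpha>, b) \<in> exceptional_params q \<xi>}
      else {})"

end

theory Submission
  imports Defs "Jordan_Normal_Form.Char_Poly" "HOL-Library.Function_Algebras"
begin

text \<open>
Call \<open>(x, h)\<close> a Weyl pair if \<open>h x = w x h\<close> for a scalar \<open>w \<noteq> 1\<close>. Then \<open>w\<close> is a primitive
\<open>q\<close>-th root of unity, \<open>x\<^sup>q\<close> and \<open>h\<^sup>q\<close> are scalar, and the centralizer of \<open>x\<close> is abelian, as
\<open>x\<close> is diagonalizable with distinct eigenvalues over the algebraic closure. Let \<open>E(x, h)\<close> be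
generated by \<open>h\<close> and the elements of the centralizer of \<open>x\<close> of \<open>q\<close>-power order modulo
scalars. With \<open>d\<close> the diagonal matrix of the powers of \<open>\<xi>\<close> one has \<open>H\<^sub>\<alpha> = E(d, I\<^sub>\<alpha>)\<close> and
\<open>G(\<alpha>, b) = E(I\<^sub>\<alpha>, d b)\<close>.

The group \<open>E(x, h)\<close> is locally nilpotent: expanding the \<open>q\<close>-fold iterate of
\<open>a \<mapsto> a (h a h\<^sup>-\<^sup>1)\<^sup>-\<^sup>1\<close> by binomial coefficients shows that it lowers the order modulo scalars.
Conversely, an absolutely irreducible locally nilpotent \<open>K\<close> has a finitely generated subgroup
with scalar centralizer, whose second center yields a Weyl pair with \<open>K \<le> E(x, h)\<close>. So one
has to classify the groups \<open>E(x, h)\<close> and the inclusions between them.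

If \<open>x\<^sup>q\<close> is the scalar of a \<open>q\<close>-th power, \<open>x\<close> is diagonalizable and \<open>E(x, h)\<close> is conjugate to some
\<open>H\<^sub>\<beta>\<close>; otherwise \<open>x\<close> is conjugate to \<open>I\<^sub>\<alpha>\<close> by Kummer theory, and \<open>E(x, h)\<close> to some \<open>G(\<alpha>, b)\<close>. In
the latter case, a system of imprimitivity consists of \<open>q\<close> lines permuted cyclically, which puts the
group inside a conjugate of some \<open>H\<^sub>\<beta>\<close>. A proper inclusion \<open>E(x, h) < E(x', h')\<close> forces the torsion
part of the centralizer of \<open>x\<close> to consist of scalar multiples of powers of \<open>x\<close>, but not so for \<open>x'\<close>.
This happens only for \<open>q = 2\<close> and \<open>-x'\<^sup>2\<close> a square, and then the determinant of \<open>h\<close> or of \<open>x h\<close> is a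
square, which gives the exceptions.
\<close>

text \<open>Local nilpotency controls only finitely generated subgroups, so an element that commutes
  up to scalars with one of them may fail to do so with a larger one. A finiteness rescues the
  argument: once a Weyl pair \<open>x0\<close>, \<open>h0\<close> is found, every element that
  commutes with both up to scalars is a scalar times \<open>x0 ^ a * h0 ^ b\<close> with
  \<open>a, b < q\<close>. One counterexample for each failing candidate is adjoined to the
  generators, and the next semicentral element then works for all of \<open>K\<close>.

  Kummer theory is done without constructing the extension of degree \<open>q\<close>: a polynomial
  relation of degree below \<open>q\<close> is pushed to the algebraic closure and refuted there by
  \<open>kummer_degree\<close>.

  The prime 2 is special through two accidents. The determinant of \<open>I_mat\<close> is then
  \<open>- \<alpha>\<close> instead of \<alpha>, and may be a square although \<alpha> is not. And
  for \<open>i ^ 2 = -1\<close> the element \<open>1 + i\<close> has the nonscalar square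
  \<open>2 i\<close> but the scalar fourth power \<open>-4\<close>, so it is torsion modulo scalars
  without being a scalar times a power of \<open>i\<close>.\<close>

lemma (in group) inv_cancel_left:
  assumes "x \<in> carrier G" "y \<in> carrier G"
  shows "x \<otimes> (inv x \<otimes> y) = y" and "inv x \<otimes> (x \<otimes> y) = y"
  using assms by (simp_all flip: m_assoc)

section \<open>Iterated differences in abelian groups\<close>

lemma (in comm_group) finprod_inv_atMost:
  assumes "\<And>i. f i \<in> carrier G"
  shows "finprod G (\<lambda>i. inv (f i)) {..k::nat} = inv (finprod G f {..k})"
  by (induction k) (use assms in \<open>simp_all add: inv_mult Pi_def\<close>)

text \<open>In additive notation the map is \<open>1 - \<sigma>\<close>, and this is the binomial
  expansion of its \<open>k\<close>-th power in the commutative ring generated by \<sigma>. Integer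
  exponents carry the alternating signs.\<close>

lemma (in comm_group) iterated_difference_binomial:
  fixes k :: nat
  assumes \<sigma>: "\<sigma> \<in> hom G G" and a: "a \<in> carrier G"
  shows "((\<lambda>y. y \<otimes> inv (\<sigma> y)) ^^ k) a
    = finprod G (\<lambda>i. (\<sigma> ^^ i) a [^] ((- 1) ^ i * int (k choose i))) {..k}"
proof (induction k)
  case 0
  then show ?case using a by (simp add: finprod_0 int_pow_1)
next
  case (Suc k)
  have s: "(\<sigma> ^^ i) a \<in> carrier G" for i
    by (induction i) (use a \<sigma> in \<open>auto simp: hom_in_carrier\<close>)
  define c :: "nat \<Rightarrow> nat \<Rightarrow> int" where "c = (\<lambda>k i. (- 1) ^ i * int (k choose i))"
  let ?t = "\<lambda>k i. (\<sigma> ^^ i) a [^] c k i"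
  interpret h: group_hom G G \<sigma> using \<sigma> by unfold_locales
  have shift: "\<sigma> (finprod G (?t k) {..k}) = finprod G (\<lambda>i. (\<sigma> ^^ Suc i) a [^] c k i) {..k}"
  proof -
    have "\<sigma> (finprod G (?t k) {..m}) = finprod G (\<lambda>i. (\<sigma> ^^ Suc i) a [^] c k i) {..m}" for m
    proof (induction m)
      case 0 show ?case using s[of 1] s[of 0] by (simp add: h.hom_int_pow[symmetric] int_pow_closed)
    next
      case (Suc m) 
      then show ?case using s s[of "Suc _"]
        by (simp add: h.hom_int_pow h.hom_mult finprod_closed Pi_def del: funpow.simps) (simp)
    qed
    then show ?thesis .
  qed
  \<comment> \<open>Pascal's rule with signs: \<open>c k (Suc i)\<close> comes from the factor
    \<open>y\<close>, and \<open>- c k i\<close> from \<open>inv (\<sigma> y)\<close>, whose index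
    is shifted by one.\<close>
  have cS: "c (Suc k) (Suc i) = c k (Suc i) + - c k i" for i
    by (simp add: c_def algebra_simps)
  have "finprod G (?t (Suc k)) {..Suc k}
     = finprod G (\<lambda>i. ?t (Suc k) (Suc i)) {..k} \<otimes> ?t (Suc k) 0"
    by (rule finprod_Suc2) (use s in auto)
  also have "finprod G (\<lambda>i. ?t (Suc k) (Suc i)) {..k} =
     finprod G (\<lambda>i. ?t k (Suc i) \<otimes> inv ((\<sigma> ^^ Suc i) a [^] c k i)) {..k}"
    using s by (intro finprod_cong' refl) (auto simp only: cS int_pow_mult int_pow_neg Pi_iff int_pow_closed m_closed inv_closed)
  also have "\<dots> = finprod G (\<lambda>i. ?t k (Suc i)) {..k} \<otimes> finprod G (\<lambda>i. inv ((\<sigma> ^^ Suc i) a [^] c k i)) {..k}"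
    by (rule finprod_multf) (use s in \<open>simp_all only: Pi_iff int_pow_closed inv_closed\<close>, simp_all)
  also have "finprod G (\<lambda>i. inv ((\<sigma> ^^ Suc i) a [^] c k i)) {..k} = inv (finprod G (\<lambda>i. (\<sigma> ^^ Suc i) a [^] c k i) {..k})"
    by (rule finprod_inv_atMost) (use s in \<open>simp_all only: int_pow_closed\<close>)
  finally have e: "finprod G (?t (Suc k)) {..Suc k} = (finprod G (\<lambda>i. ?t k (Suc i)) {..k} \<otimes> ?t k 0) \<otimes> inv (\<sigma> (finprod G (?t k) {..k}))"
    unfolding shift using s s[of "Suc _"] s[of 0]
    by (simp add: m_ac finprod_closed Pi_def c_def del: funpow.simps)
  \<comment> \<open>Extending the range to \<open>Suc k\<close> is harmless, because the exponent
    with \<open>k choose Suc k\<close> is zero.\<close>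
  have "finprod G (\<lambda>i. ?t k (Suc i)) {..k} \<otimes> ?t k 0 = finprod G (?t k) {..Suc k}"
    by (rule finprod_Suc2[symmetric]) (use s in auto)
  also have "\<dots> = finprod G (?t k) {..k}"
    using s s[of "Suc _"] by (simp add: Pi_def c_def binomial_eq_0 del: funpow.simps)
  finally show ?case using e Suc.IH by (simp add: c_def)
qed

lemma (in comm_group) finprod_pow_atMost:
  assumes "\<And>i. f i \<in> carrier G"
  shows "finprod G (\<lambda>i. f i [^] (n::nat)) {..k::nat} = finprod G f {..k} [^] n"
  by (induction k) (use assms in \<open>simp_all add: nat_pow_distrib Pi_def\<close>)

text \<open>All inner binomial coefficients are divisible by \<open>q\<close>. As \<sigma> has
  period \<open>q\<close> at \<open>a\<close>, the two outer terms combine to \<open>a\<close> with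
  exponent \<open>1 + (- 1) ^ q\<close>, which is zero for odd \<open>q\<close> and two for
  \<open>q = 2\<close>; in both cases the result is a \<open>q\<close>-th power.\<close>

lemma (in comm_group) iterated_difference_prime:
  assumes \<sigma>: "\<sigma> \<in> hom G G" and q: "Factorial_Ring.prime q"
    and a: "a \<in> carrier G" and per: "(\<sigma> ^^ q) a = a"
  shows "\<exists>b \<in> carrier G. ((\<lambda>y. y \<otimes> inv (\<sigma> y)) ^^ q) a = b [^] q"
proof -
  have q2: "q \<ge> 2" using q by (simp add: prime_ge_2_nat)
  define r where "r = q - 2"
  have qr: "q = Suc (Suc r)" using q2 by (simp add: r_def)
  have s: "(\<sigma> ^^ i) a \<in> carrier G" for i
    by (induction i) (use a \<sigma> in \<open>auto simp: hom_in_carrier\<close>)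
  define f where "f = (\<lambda>i. (\<sigma> ^^ i) a [^] ((- 1) ^ i * int (q choose i)))"
  define e where "e = (\<lambda>i. (- 1) ^ i * int ((q choose i) div q))"
  define b where "b = finprod G (\<lambda>i. (\<sigma> ^^ Suc i) a [^] e (Suc i)) {..r}"
  have b: "b \<in> carrier G" using s[of "Suc _"] by (simp add: b_def Pi_def del: funpow.simps)
  have fc: "f i \<in> carrier G" for i using s by (simp add: f_def)
  have mid: "f (Suc i) = ((\<sigma> ^^ Suc i) a [^] e (Suc i)) [^] q" if "i \<le> r" for i
  proof -
    have "q dvd (q choose Suc i)" using that qr by (intro dvd_choose_prime q) auto
    then have "(- 1) ^ Suc i * int (q choose Suc i) = e (Suc i) * int q"
      by (auto simp: e_def elim!: dvdE)
    then show ?thesis using s[of "Suc i"] 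
      by (simp only: f_def int_pow_pow int_pow_int[symmetric])
  qed
  \<comment> \<open>The outer terms are split off at both ends; the inner indices are
    \<open>Suc i\<close> with \<open>i \<le> r\<close>.\<close>
  have "finprod G f {..q} = f q \<otimes> (finprod G (\<lambda>i. f (Suc i)) {..r} \<otimes> f 0)"
    unfolding qr using fc by (subst finprod_Suc, simp, subst finprod_Suc2) auto
  also have "finprod G (\<lambda>i. f (Suc i)) {..r} = finprod G (\<lambda>i. ((\<sigma> ^^ Suc i) a [^] e (Suc i)) [^] q) {..r}"
    using s[of "Suc _"] by (intro finprod_cong' refl mid) (auto simp del: funpow.simps)
  also have "\<dots> = b [^] q"
    unfolding b_def using s[of "Suc _"] by (intro finprod_pow_atMost) (simp del: funpow.simps)
  also have "f 0 = a" using a by (simp add: f_def)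
  also have "f q = a [^] ((- 1) ^ q :: int)" by (simp add: f_def per)
  finally have eq: "((\<lambda>y. y \<otimes> inv (\<sigma> y)) ^^ q) a = a [^] ((- 1) ^ q :: int) \<otimes> (b [^] q \<otimes> a)"
    using iterated_difference_binomial[OF \<sigma> a, of q] by (simp add: f_def)
  show ?thesis
  proof (cases "odd q")
    case True
    then have "a [^] ((- 1) ^ q :: int) = inv a" using a by (simp add: int_pow_neg)
    then show ?thesis using eq a b by (intro bexI[of _ b]) (simp_all add: m_comm[of "b [^] q" a] inv_cancel_left)
  next
    case False
    then have "q = 2" using q primes_dvd_imp_eq[of 2 q] by auto
    then have "((\<lambda>y. y \<otimes> inv (\<sigma> y)) ^^ q) a = (b \<otimes> a) [^] q"
      using eq a b by (simp add: m_ac numeral_2_eq_2)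
    then show ?thesis using a b by blast
  qed
qed

section \<open>Local nilpotency of subgroups\<close>

context group
begin

lemma lower_central_subset:
  assumes N: "subgroup N G"
  shows "lower_central (G\<lparr>carrier := N\<rparr>) n \<subseteq> N"
proof (induction n)
  case (Suc n)
  interpret N: subgroup N G by fact
  have "(\<Union>x \<in> lower_central (G\<lparr>carrier := N\<rparr>) n. \<Union>y \<in> N.
        {x \<otimes> y \<otimes> inv\<^bsub>G\<lparr>carrier := N\<rparr>\<^esub> x \<otimes> inv\<^bsub>G\<lparr>carrier := N\<rparr>\<^esub> y}) \<subseteq> N"
    using Suc m_inv_consistent[OF N] by (auto simp: subset_eq)
  then show ?case
    using group.generate_incl[OF N.subgroup_is_group[OF is_group]] by simp
qed simp

lemma lower_central_subgroup_Suc: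
  assumes N: "subgroup N G"
  shows "lower_central (G\<lparr>carrier := N\<rparr>) (Suc n) =
    generate G (\<Union>x \<in> lower_central (G\<lparr>carrier := N\<rparr>) n. \<Union>y \<in> N. {x \<otimes> y \<otimes> inv x \<otimes> inv y})"
proof -
  interpret N: subgroup N G by fact
  have "(\<Union>x \<in> lower_central (G\<lparr>carrier := N\<rparr>) n. \<Union>y \<in> N.
        {x \<otimes> y \<otimes> inv\<^bsub>G\<lparr>carrier := N\<rparr>\<^esub> x \<otimes> inv\<^bsub>G\<lparr>carrier := N\<rparr>\<^esub> y}) =
      (\<Union>x \<in> lower_central (G\<lparr>carrier := N\<rparr>) n. \<Union>y \<in> N. {x \<otimes> y \<otimes> inv x \<otimes> inv y})" (is "?A = ?B")
    using lower_central_subset[OF N, of n] m_inv_consistent[OF N] by (intro SUP_cong refl) (simp add: subset_eq)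
  moreover have "?B \<subseteq> N" using lower_central_subset[OF N, of n] by (auto simp: subset_eq)
  ultimately show ?thesis using generate_consistent[OF _ N] by simp
qed

lemma one_in_lower_central:
  assumes N: "subgroup N G"
  shows "\<one> \<in> lower_central (G\<lparr>carrier := N\<rparr>) n"
  by (cases n) (use subgroup.one_closed[OF N] lower_central_subgroup_Suc[OF N] generate.one in \<open>auto simp del: lower_central.simps(2)\<close>)

text \<open>Induction along the series: each term is generated by commutators of the previous term
  with \<open>N\<close>. This lets an explicitly described chain of subgroups bound the lower
  central series.\<close>

lemma lower_central_subset_chain:
  assumes N: "subgroup N G" and sub: "N \<subseteq> f 0" and f: "\<And>k. subgroup (f k) G"
    and comm: "\<And>k x y. x \<in> f k \<Longrightarrow> y \<in> N \<Longrightarrow> x \<otimes> y \<otimes> inv x \<otimes> inv y \<in> f (Suc k)"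
  shows "lower_central (G\<lparr>carrier := N\<rparr>) k \<subseteq> f k"
proof (induction k)
  case 0 then show ?case using sub by simp
next
  case (Suc k)
  then show ?case unfolding lower_central_subgroup_Suc[OF N]
    by (intro generate_subgroup_incl f) (use comm in auto)
qed

lemma nilpotent_subgroup_iff:
  assumes N: "subgroup N G"
  shows "nilpotent_group (G\<lparr>carrier := N\<rparr>) \<longleftrightarrow> (\<exists>n. lower_central (G\<lparr>carrier := N\<rparr>) n \<subseteq> {\<one>})"
  unfolding nilpotent_group_def
  using subgroup.subgroup_is_group[OF N is_group] one_in_lower_central[OF N] by auto

lemma locally_nilpotent_subgroup_iff:
  "locally_nilpotent_subgroup K G \<longleftrightarrow> subgroup K G \<and>
     (\<forall>B. finite B \<and> B \<subseteq> K \<longrightarrow> nilpotent_group (G\<lparr>carrier := generate G B\<rparr>))"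
proof (cases "subgroup K G")
  case True
  then show ?thesis
    unfolding locally_nilpotent_subgroup_def locally_nilpotent_def
    using generate_consistent[OF _ True] subgroup.subgroup_is_group[OF True is_group] by auto
qed (simp add: locally_nilpotent_subgroup_def)

lemma locally_nilpotent_subgroupD:
  assumes "locally_nilpotent_subgroup K G"
  shows "subgroup K G"
    and "finite B \<Longrightarrow> B \<subseteq> K \<Longrightarrow> \<exists>n. lower_central (G\<lparr>carrier := generate G B\<rparr>) n \<subseteq> {\<one>}"
proof -
  show K: "subgroup K G" using assms by (simp add: locally_nilpotent_subgroup_iff)
  assume B: "finite B" "B \<subseteq> K"
  then have "subgroup (generate G B) G" using subgroup.subset[OF K] by (intro generate_is_subgroup) auto
  then show "\<exists>n. lower_central (G\<lparr>carrier := generate G B\<rparr>) n \<subseteq> {\<one>}"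
    using assms B unfolding locally_nilpotent_subgroup_iff by (simp flip: nilpotent_subgroup_iff)
qed

text \<open>Take the last term of the lower central series that is not central in \<open>N\<close>
  and a noncentral \<open>x\<close> in it. Its commutators with \<open>N\<close> lie in the next
  term, which is central.\<close>

lemma nilpotent_second_center:
  assumes N: "subgroup N G" and nilp: "lower_central (G\<lparr>carrier := N\<rparr>) n \<subseteq> {\<one>}"
    and nonab: "a \<in> N" "b \<in> N" "a \<otimes> b \<noteq> b \<otimes> a"
  shows "\<exists>x \<in> N. (\<exists>y \<in> N. x \<otimes> y \<noteq> y \<otimes> x) \<and>
    (\<forall>y \<in> N. \<exists>c \<in> N. (\<forall>g \<in> N. c \<otimes> g = g \<otimes> c) \<and> x \<otimes> y = c \<otimes> (y \<otimes> x))"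
proof -
  interpret N: subgroup N G by fact
  let ?L = "\<lambda>k. lower_central (G\<lparr>carrier := N\<rparr>) k"
  define P where "P k \<longleftrightarrow> (\<forall>x \<in> ?L k. \<forall>y \<in> N. x \<otimes> y = y \<otimes> x)" for k
  have "\<not> P 0" using nonab by (auto simp: P_def)
  moreover have "P n" using nilp by (auto simp: P_def)
  ultimately obtain k where k: "\<not> P k" "P (Suc k)"
    using ex_least_nat_less[of P n] by auto
  then obtain x where x: "x \<in> ?L k" "\<exists>y \<in> N. x \<otimes> y \<noteq> y \<otimes> x" by (auto simp: P_def)
  have xN: "x \<in> N" using x lower_central_subset[OF N] by blast
  have "\<exists>c \<in> N. (\<forall>g \<in> N. c \<otimes> g = g \<otimes> c) \<and> x \<otimes> y = c \<otimes> (y \<otimes> x)" if y: "y \<in> N" for y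
  proof (intro bexI conjI)
    let ?c = "x \<otimes> y \<otimes> inv x \<otimes> inv y"
    have "?c \<in> ?L (Suc k)" unfolding lower_central_subgroup_Suc[OF N] using x y
      by (intro generate.incl) blast
    then show "\<forall>g \<in> N. ?c \<otimes> g = g \<otimes> ?c" "?c \<in> N" using k(2) lower_central_subset[OF N] unfolding P_def by blast+
    have "x \<in> carrier G" "y \<in> carrier G" using xN y by auto
    then show "x \<otimes> y = ?c \<otimes> (y \<otimes> x)" by (simp add: m_assoc inv_cancel_left)
  qed
  then show ?thesis using x xN by blast
qed

end

section \<open>Weyl pairs\<close>

text \<open>The properties of \<open>GL(q, F)\<close> with its group \<open>Z\<close> of scalars on which the group-theoretic part
  of the argument rests.\<close>

locale weyl_context = group G for G (structure) +
  fixes Z :: "'a set" and q :: nat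
  assumes Z_subgroup: "subgroup Z G"
    and Z_central: "z \<in> Z \<Longrightarrow> g \<in> carrier G \<Longrightarrow> g \<otimes> z = z \<otimes> g"
    and prime_q: "Factorial_Ring.prime q"
    and commutator_torsion:
      "g \<in> carrier G \<Longrightarrow> x \<in> carrier G \<Longrightarrow> z \<in> Z \<Longrightarrow> g \<otimes> x = z \<otimes> (x \<otimes> g) \<Longrightarrow> z [^] q = \<one>"
    and torsion_cyclic:
      "z \<in> Z \<Longrightarrow> w \<in> Z \<Longrightarrow> z [^] q = \<one> \<Longrightarrow> w [^] q = \<one> \<Longrightarrow> w \<noteq> \<one> \<Longrightarrow> \<exists>i<q. z = w [^] (i::nat)"
    and centralizer_abelian:
      "g \<in> carrier G \<Longrightarrow> x \<in> carrier G \<Longrightarrow> z \<in> Z \<Longrightarrow> z \<noteq> \<one> \<Longrightarrow> g \<otimes> x = z \<otimes> (x \<otimes> g) \<Longrightarrow>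
       y \<in> carrier G \<Longrightarrow> y' \<in> carrier G \<Longrightarrow> y \<otimes> x = x \<otimes> y \<Longrightarrow> y' \<otimes> x = x \<otimes> y' \<Longrightarrow> y \<otimes> y' = y' \<otimes> y"
    and centralizer_pair:
      "g \<in> carrier G \<Longrightarrow> x \<in> carrier G \<Longrightarrow> z \<in> Z \<Longrightarrow> z \<noteq> \<one> \<Longrightarrow> g \<otimes> x = z \<otimes> (x \<otimes> g) \<Longrightarrow>
       y \<in> carrier G \<Longrightarrow> y \<otimes> x = x \<otimes> y \<Longrightarrow> y \<otimes> g = g \<otimes> y \<Longrightarrow> y \<in> Z"
begin

definition cent :: "'a \<Rightarrow> 'a set" where
  "cent x = {y \<in> carrier G. y \<otimes> x = x \<otimes> y}"

definition weyl :: "'a \<Rightarrow> 'a \<Rightarrow> 'a \<Rightarrow> bool" where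
  "weyl w x h \<longleftrightarrow> x \<in> carrier G \<and> h \<in> carrier G \<and> w \<in> Z \<and> w \<noteq> \<one> \<and> h \<otimes> x = w \<otimes> (x \<otimes> h)"

definition conjg :: "'a \<Rightarrow> 'a \<Rightarrow> 'a" where
  "conjg h y = h \<otimes> y \<otimes> inv h"

definition torsion_level :: "nat \<Rightarrow> 'a \<Rightarrow> 'a set" where
  "torsion_level m x = {y \<in> cent x. y [^] (q ^ m) \<in> Z}"

definition torsion_cent :: "'a \<Rightarrow> 'a set" where
  "torsion_cent x = (\<Union>m. torsion_level m x)"

text \<open>Natural exponents suffice: for a Weyl pair the power \<open>h [^] q\<close> lies in
  \<open>Z\<close>, so negative powers of \<open>h\<close> are natural powers up to scalars.\<close>

definition ext :: "'a set \<Rightarrow> 'a \<Rightarrow> 'a set" where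
  "ext Q h = {y \<otimes> h [^] i | y i. y \<in> Q \<and> i \<in> (UNIV :: nat set)}"

text \<open>The group \<open>E(x, h)\<close> of the overview, in a form that displays each element
  as a torsion element of \<open>cent x\<close> times a power of \<open>h\<close>;
  \<open>weyl_group_generate\<close> recovers the description by generators.\<close>

definition weyl_group :: "'a \<Rightarrow> 'a \<Rightarrow> 'a set" where
  "weyl_group x h = ext (torsion_cent x) h"

lemma Z_closed [simp]: "z \<in> Z \<Longrightarrow> z \<in> carrier G"
  using Z_subgroup subgroup.mem_carrier by metis

lemma Z_mult [simp]: "z \<in> Z \<Longrightarrow> w \<in> Z \<Longrightarrow> z \<otimes> w \<in> Z"
  using Z_subgroup subgroup.m_closed by metis

lemma Z_one [simp]: "\<one> \<in> Z"
  using Z_subgroup subgroup.one_closed by metis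

lemma Z_inv [simp]: "z \<in> Z \<Longrightarrow> inv z \<in> Z"
  using Z_subgroup subgroup.m_inv_closed by metis

lemma Z_pow [simp]: "z \<in> Z \<Longrightarrow> z [^] (n::nat) \<in> Z"
  by (induction n) auto

lemma Z_left_commute: "z \<in> Z \<Longrightarrow> a \<in> carrier G \<Longrightarrow> b \<in> carrier G \<Longrightarrow> a \<otimes> (z \<otimes> b) = z \<otimes> (a \<otimes> b)"
  using Z_central by (simp flip: m_assoc)

lemma q_gt_1: "q > 1"
  using prime_q prime_gt_1_nat by blast

lemma conjg_closed [simp]: "h \<in> carrier G \<Longrightarrow> y \<in> carrier G \<Longrightarrow> conjg h y \<in> carrier G"
  by (simp add: conjg_def)

lemma conjg_mult: "h \<in> carrier G \<Longrightarrow> a \<in> carrier G \<Longrightarrow> b \<in> carrier G \<Longrightarrow> conjg h (a \<otimes> b) = conjg h a \<otimes> conjg h b"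
  by (simp add: conjg_def m_assoc inv_cancel_left)

lemma conjg_one [simp]: "h \<in> carrier G \<Longrightarrow> conjg h \<one> = \<one>"
  by (simp add: conjg_def)

lemma conjg_pow: "h \<in> carrier G \<Longrightarrow> a \<in> carrier G \<Longrightarrow> conjg h (a [^] (n::nat)) = conjg h a [^] n"
  by (induction n) (simp_all add: conjg_mult)

lemma conjg_Z [simp]: "h \<in> carrier G \<Longrightarrow> z \<in> Z \<Longrightarrow> conjg h z = z"
  by (simp add: conjg_def Z_central[of z h] m_assoc)

lemma conjg_conjg: "h \<in> carrier G \<Longrightarrow> g \<in> carrier G \<Longrightarrow> y \<in> carrier G \<Longrightarrow> conjg h (conjg g y) = conjg (h \<otimes> g) y"
  by (simp add: conjg_def m_assoc inv_mult_group)

lemma conjg_inv: "h \<in> carrier G \<Longrightarrow> y \<in> carrier G \<Longrightarrow> conjg h (inv y) = inv (conjg h y)"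
  by (simp add: conjg_def m_assoc inv_mult_group)

lemma conjg_by_inv: "h \<in> carrier G \<Longrightarrow> y \<in> carrier G \<Longrightarrow> conjg (inv h) (conjg h y) = y"
  "h \<in> carrier G \<Longrightarrow> y \<in> carrier G \<Longrightarrow> conjg h (conjg (inv h) y) = y"
  by (simp_all add: conjg_def m_assoc inv_cancel_left)

lemma conjg_commute: "h \<in> carrier G \<Longrightarrow> y \<in> carrier G \<Longrightarrow> h \<otimes> y = y \<otimes> h \<Longrightarrow> conjg h y = y"
  by (simp add: conjg_def m_assoc)

lemma conjg_swap: "h \<in> carrier G \<Longrightarrow> y \<in> carrier G \<Longrightarrow> h \<otimes> y = conjg h y \<otimes> h"
  by (simp add: conjg_def m_assoc)

lemma conjg_mem_Z_iff: "h \<in> carrier G \<Longrightarrow> y \<in> carrier G \<Longrightarrow> conjg h y \<in> Z \<longleftrightarrow> y \<in> Z"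
  by (metis conjg_Z conjg_by_inv(1) inv_closed)

lemma cent_subgroup: assumes "x \<in> carrier G" shows "subgroup (cent x) G"
proof (rule subgroupI)
  fix a assume a: "a \<in> cent x"
  then show "inv a \<in> cent x" using assms
    by (auto simp: cent_def) (metis inv_cancel_left(1) inv_closed inv_solve_left inv_solve_right m_assoc m_closed)
next
  fix a b assume "a \<in> cent x" "b \<in> cent x"
  then show "a \<otimes> b \<in> cent x" using assms
    by (auto simp: cent_def m_assoc) (simp flip: m_assoc)
qed (use assms in \<open>auto simp: cent_def\<close>)

lemma cent_closed: "y \<in> cent x \<Longrightarrow> y \<in> carrier G"
  by (simp add: cent_def)

lemma Z_subset_cent: "x \<in> carrier G \<Longrightarrow> Z \<subseteq> cent x"
  by (auto simp: cent_def Z_central)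

lemma cent_pow: "x \<in> carrier G \<Longrightarrow> y \<in> cent x \<Longrightarrow> y [^] (n::nat) \<in> cent x"
  using cent_subgroup subgroup.m_closed[of "cent x" G] subgroup.one_closed[of "cent x" G]
  by (induction n) auto

lemma cent_Z_mult: "x \<in> carrier G \<Longrightarrow> z \<in> Z \<Longrightarrow> cent (z \<otimes> x) = cent x"
  using Z_left_commute[of z _ x] by (auto simp: cent_def m_assoc)

text \<open>Commuting up to a scalar, the trivial one included: \<open>cent\<close> is the case
  \<open>\<one>\<close>, \<open>weyl\<close> the opposite case. For fixed \<open>x\<close> the
  scalar is multiplicative in \<open>g\<close>, and exchanging \<open>x\<close> and \<open>g\<close>
  inverts it, so it behaves like a pairing.\<close>

definition semi :: "'a \<Rightarrow> 'a \<Rightarrow> 'a \<Rightarrow> bool" where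
  "semi z x g \<longleftrightarrow> x \<in> carrier G \<and> g \<in> carrier G \<and> z \<in> Z \<and> g \<otimes> x = z \<otimes> (x \<otimes> g)"

lemma weyl_semi: "weyl w x h \<longleftrightarrow> semi w x h \<and> w \<noteq> \<one>"
  by (auto simp: weyl_def semi_def)

lemma semi_cent: "y \<in> cent x \<longleftrightarrow> semi \<one> x y" if "x \<in> carrier G"
  using that by (auto simp: cent_def semi_def)

lemma semi_conjg: "semi z x g \<Longrightarrow> conjg g x = z \<otimes> x"
  by (simp add: semi_def conjg_def m_assoc)

lemma semi_mult: assumes "semi z x g" "semi z' x g'" shows "semi (z \<otimes> z') x (g \<otimes> g')"
proof -
  have c: "x \<in> carrier G" "g \<in> carrier G" "g' \<in> carrier G" "z \<in> Z" "z' \<in> Z"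
    using assms by (auto simp: semi_def)
  have "g \<otimes> g' \<otimes> x = g \<otimes> (z' \<otimes> (x \<otimes> g'))" using assms c by (simp add: semi_def m_assoc)
  also have "\<dots> = z' \<otimes> (g \<otimes> x \<otimes> g')" using c Z_left_commute[of z' g "x \<otimes> g'"] by (simp add: m_assoc)
  also have "\<dots> = z' \<otimes> (z \<otimes> (x \<otimes> g) \<otimes> g')" using assms by (simp add: semi_def)
  also have "\<dots> = z \<otimes> z' \<otimes> (x \<otimes> (g \<otimes> g'))" using c Z_left_commute[of z z'] by (simp add: m_assoc)
  finally show ?thesis using c by (simp add: semi_def)
qed

lemma semi_inv: assumes "semi z x g" shows "semi (inv z) x (inv g)"
proof -
  have c: "x \<in> carrier G" "g \<in> carrier G" "z \<in> Z" using assms by (auto simp: semi_def)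
  have "conjg (inv g) (z \<otimes> x) = x" using semi_conjg[OF assms] conjg_by_inv(1)[of g x] c by simp
  then have "z \<otimes> conjg (inv g) x = x" using c by (simp add: conjg_mult)
  then have "conjg (inv g) x = inv z \<otimes> x" using c by (metis Z_closed conjg_closed inv_cancel_left(2) inv_closed)
  then show ?thesis using c conjg_swap[of "inv g" x] by (simp add: semi_def m_assoc)
qed

lemma semi_pow: assumes "semi z x g" shows "semi (z [^] (n::nat)) x (g [^] n)"
proof (induction n)
  case 0 then show ?case using assms by (simp add: semi_def)
next
  case (Suc n) then show ?case using semi_mult[OF Suc assms] by simp
qed

lemma semi_unique: "semi z x g \<Longrightarrow> semi z' x g \<Longrightarrow> z = z'"
  by (auto simp: semi_def)

lemma semi_sym: assumes "semi z x g" shows "semi (inv z) g x"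
  using assms by (auto simp: semi_def Z_left_commute inv_cancel_left)

lemma semi_torsion: "semi z x g \<Longrightarrow> z [^] q = \<one>"
  using commutator_torsion by (auto simp: semi_def)

text \<open>Conjugation by \<open>g\<close> sends \<open>x\<close> to the scalar multiple
  \<open>z \<otimes> x\<close>, which has the same centralizer as \<open>x\<close>.\<close>

lemma semi_conjg_cent: assumes "semi z x g" and y: "y \<in> cent x" shows "conjg g y \<in> cent x"
proof -
  have c: "x \<in> carrier G" "g \<in> carrier G" "z \<in> Z" "y \<in> carrier G"
    using assms by (auto simp: semi_def cent_def)
  have "conjg g (y \<otimes> x) = conjg g (x \<otimes> y)" using y by (simp add: cent_def)
  then have "conjg g y \<otimes> (z \<otimes> x) = (z \<otimes> x) \<otimes> conjg g y"
    using c semi_conjg[OF assms(1)] by (simp add: conjg_mult)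
  then show ?thesis using c by (simp add: cent_def Z_left_commute m_assoc)
qed

section \<open>Consequences of a single Weyl pair\<close>

context
  fixes w x h
  assumes weyl: "weyl w x h"
begin

lemma weyl_closed: "x \<in> carrier G" "h \<in> carrier G" "w \<in> Z" "w \<noteq> \<one>"
  using weyl by (auto simp: weyl_def)

lemma weyl_sym: "weyl (inv w) h x"
  using weyl semi_sym by (auto simp: weyl_semi semi_def)

lemma weyl_root_pow: "w [^] (i::nat) = \<one> \<longleftrightarrow> q dvd i"
proof -
  have "w [^] q = \<one>" using weyl semi_torsion by (auto simp: weyl_semi)
  then have "ord w dvd q" using weyl_closed by (simp add: pow_eq_id)
  moreover have "ord w \<noteq> 1" using weyl_closed ord_eq_1[of w] by auto
  ultimately have "ord w = q" using prime_q by (metis prime_nat_iff)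
  then show ?thesis using weyl_closed by (simp add: pow_eq_id)
qed

lemma weyl_cent_abelian: "y \<in> cent x \<Longrightarrow> y' \<in> cent x \<Longrightarrow> y \<otimes> y' = y' \<otimes> y"
  using weyl centralizer_abelian[of h x w y y'] by (auto simp: weyl_def cent_def)

lemma weyl_cent_pair: "y \<in> cent x \<Longrightarrow> y \<in> cent h \<Longrightarrow> y \<in> Z"
  using weyl centralizer_pair[of h x w y] by (auto simp: weyl_def cent_def)

lemma weyl_x_cent: "x \<in> cent x"
  using weyl_closed by (simp add: cent_def)

text \<open>Both \<open>x\<close> and \<open>y\<close> belong to Weyl pairs, so both centralizers
  are abelian. Each of the two elements lies in the centralizer of the other, which gives both
  inclusions.\<close>

lemma weyl_cent_eq: assumes "y \<in> cent x" "weyl w' y g" shows "cent y = cent x"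
proof
  show "cent x \<subseteq> cent y"
    using weyl_cent_abelian[OF _ assms(1)] by (auto simp: cent_def)
  have "x \<in> cent y" using assms weyl_closed by (auto simp: cent_def)
  then show "cent y \<subseteq> cent x"
    using assms(2) centralizer_abelian[of g y w' _ x] by (auto simp: weyl_def cent_def)
qed

lemma weyl_semi_pow: "semi (w [^] (i::nat)) x (h [^] i)"
  using weyl semi_pow by (auto simp: weyl_semi)

text \<open>Such a power of \<open>h\<close> commutes with \<open>x\<close>, because the same power
  of \<open>w\<close> is trivial, and it commutes with \<open>h\<close>. What centralizes both
  members of a Weyl pair is scalar.\<close>

lemma weyl_pow_Z: "q dvd i \<Longrightarrow> h [^] (i::nat) \<in> Z"
proof -
  assume i: "q dvd i"
  have "semi \<one> x (h [^] i)" using weyl_semi_pow[of i] i weyl_root_pow[of i] by simp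
  then have "h [^] i \<in> cent x" using weyl_closed by (simp add: semi_cent)
  moreover have "h [^] i \<in> cent h" using weyl_closed by (simp add: cent_def nat_pow_comm pow_mult_distrib group_commutes_pow)
  ultimately show ?thesis by (rule weyl_cent_pair)
qed

lemma weyl_cent_conjg: "y \<in> cent x \<Longrightarrow> conjg h y \<in> cent x"
  using weyl semi_conjg_cent by (auto simp: weyl_semi)

lemma torsion_level_subgroup: "subgroup (torsion_level m x) G"
proof -
  interpret C: subgroup "cent x" G using cent_subgroup weyl_closed by blast
  show ?thesis
  proof (rule subgroupI)
    fix a b assume "a \<in> torsion_level m x" "b \<in> torsion_level m x"
    then show "a \<otimes> b \<in> torsion_level m x"
      using weyl_cent_abelian[of a b] by (auto simp: torsion_level_def pow_mult_distrib)
  next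
    fix a assume "a \<in> torsion_level m x"
    then show "inv a \<in> torsion_level m x" by (auto simp: torsion_level_def nat_pow_inv)
  next
    have "\<one> \<in> torsion_level m x" using C.one_closed by (auto simp: torsion_level_def)
    then show "torsion_level m x \<noteq> {}" by blast
  qed (auto simp: torsion_level_def)
qed

lemma torsion_level_mono: assumes "m \<le> n" shows "torsion_level m x \<subseteq> torsion_level n x"
proof
  fix y assume y: "y \<in> torsion_level m x"
  obtain k where "n = m + k" using assms le_Suc_ex by blast
  then have "y [^] (q ^ n) = (y [^] (q ^ m)) [^] (q ^ k)"
    using y by (simp add: power_add nat_pow_pow torsion_level_def cent_def)
  then show "y \<in> torsion_level n x" using y by (simp add: torsion_level_def)
qed

lemma Z_torsion_level: "Z \<subseteq> torsion_level m x"
  using Z_subset_cent weyl_closed by (auto simp: torsion_level_def)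

lemma torsion_level_conjg: "y \<in> torsion_level m x \<Longrightarrow> conjg h y \<in> torsion_level m x"
  using weyl_cent_conjg weyl_closed by (auto simp: torsion_level_def conjg_pow[symmetric] cent_closed)

lemma torsion_cent_subgroup: "subgroup (torsion_cent x) G"
proof (rule subgroupI)
  fix a b assume "a \<in> torsion_cent x" "b \<in> torsion_cent x"
  then obtain m n where "a \<in> torsion_level m x" "b \<in> torsion_level n x" by (auto simp: torsion_cent_def)
  then have "a \<in> torsion_level (max m n) x" "b \<in> torsion_level (max m n) x"
    using torsion_level_mono by (meson max.cobounded1 max.cobounded2 subsetD)+
  then show "a \<otimes> b \<in> torsion_cent x"
    using subgroup.m_closed[OF torsion_level_subgroup] by (auto simp: torsion_cent_def)
next
  fix a assume "a \<in> torsion_cent x"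
  then show "inv a \<in> torsion_cent x"
    using subgroup.m_inv_closed[OF torsion_level_subgroup] by (auto simp: torsion_cent_def)
next
  show "torsion_cent x \<noteq> {}"
    using subgroup.one_closed[OF torsion_level_subgroup] by (auto simp: torsion_cent_def)
qed (use subgroup.subset[OF torsion_level_subgroup] in \<open>auto simp: torsion_cent_def\<close>)

lemma torsion_cent_cent: "torsion_cent x \<subseteq> cent x"
  by (auto simp: torsion_cent_def torsion_level_def)

lemma Z_torsion_cent: "Z \<subseteq> torsion_cent x"
  using Z_torsion_level by (auto simp: torsion_cent_def)

lemma torsion_cent_conjg: "y \<in> torsion_cent x \<Longrightarrow> conjg h y \<in> torsion_cent x"
  using torsion_level_conjg by (auto simp: torsion_cent_def)

section \<open>Extension of an invariant subgroup of the centralizer by \<open>h\<close>\<close>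

context
  fixes Q
  assumes Q: "subgroup Q G" "Z \<subseteq> Q" "Q \<subseteq> cent x" "\<And>y. y \<in> Q \<Longrightarrow> conjg h y \<in> Q"
begin

lemma Q_conjg_pow: "y \<in> Q \<Longrightarrow> conjg (h [^] (i::nat)) y \<in> Q"
proof (induction i)
  case 0
  then show ?case using Q(3) weyl_closed by (auto simp: conjg_def cent_def)
next
  case (Suc i)
  then have "conjg h (conjg (h [^] i) y) \<in> Q" using Q(4) by blast
  then show ?case using Suc.prems Q(3) weyl_closed nat_pow_Suc2[of h i] by (simp add: conjg_conjg cent_def subset_eq)
qed

text \<open>Products are straightened by moving \<open>h [^] i\<close> past the factor from
  \<open>Q\<close>, which conjugates that factor inside \<open>Q\<close>. The subgroup
  \<open>Q\<close> is left general because both the whole torsion part and its single levels get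
  extended.\<close>

lemma ext_subgroup: "subgroup (ext Q h) G"
proof (rule subgroupI)
  have c: "y \<in> Q \<Longrightarrow> y \<in> carrier G" for y using Q(1) subgroup.mem_carrier by metis
  show "ext Q h \<subseteq> carrier G" using c weyl_closed by (auto simp: ext_def)
  have "\<one> \<otimes> h [^] (0::nat) \<in> ext Q h" using Q(2) Z_one unfolding ext_def by blast
  then show "ext Q h \<noteq> {}" by blast
  fix a assume "a \<in> ext Q h"
  then obtain y i where y: "y \<in> Q" and a: "a = y \<otimes> h [^] (i::nat)" by (auto simp: ext_def)
  {
    \<comment> \<open>With this exponent \<open>k + i = q * i\<close>, so \<open>h [^] k\<close>
      inverts \<open>h [^] i\<close> up to the scalar \<open>z\<close>.\<close>
    define k where "k = (q - 1) * i"
    define z where "z = h [^] (k + i)"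
    have ki: "k + i = q * i" using q_gt_1 by (simp add: k_def algebra_simps)
    have z: "z \<in> Z" unfolding z_def ki by (rule weyl_pow_Z) simp
    have zz: "z = h [^] k \<otimes> h [^] i" using weyl_closed by (simp add: z_def nat_pow_mult)
    have "inv (h [^] i) = inv z \<otimes> h [^] k"
      using z weyl_closed by (intro inv_equality) (simp_all add: m_assoc flip: zz)
    then have "inv a = h [^] k \<otimes> (inv z \<otimes> inv y)"
      using z weyl_closed c[OF y] Z_left_commute[of "inv z" "h [^] k" "inv y"] by (simp add: a inv_mult_group m_assoc)
    also have "\<dots> = conjg (h [^] k) (inv z \<otimes> inv y) \<otimes> h [^] k"
      using z weyl_closed c[OF y] by (intro conjg_swap) auto
    finally show "inv a \<in> ext Q h"
      using Q_conjg_pow[of "inv z \<otimes> inv y" k] y z Q(2) subgroup.m_closed[OF Q(1)] subgroup.m_inv_closed[OF Q(1)]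
      by (auto simp: ext_def)
  }
  fix b assume "b \<in> ext Q h"
  then obtain y' j where y': "y' \<in> Q" and b: "b = y' \<otimes> h [^] (j::nat)" by (auto simp: ext_def)
  have "a \<otimes> b = y \<otimes> conjg (h [^] i) y' \<otimes> h [^] (i + j)"
    using c[OF y] c[OF y'] weyl_closed
    by (simp add: a b conjg_def m_assoc inv_cancel_left flip: nat_pow_mult)
  then show "a \<otimes> b \<in> ext Q h"
    using Q_conjg_pow[OF y', of i] y subgroup.m_closed[OF Q(1)] by (auto simp: ext_def)
qed

lemma ext_incl: "Q \<subseteq> ext Q h" "h \<in> ext Q h"
proof -
  show "Q \<subseteq> ext Q h"
  proof
    fix y assume "y \<in> Q"
    then show "y \<in> ext Q h" using subgroup.mem_carrier[OF Q(1)] by (auto simp: ext_def intro!: exI[of _ y] exI[of _ 0])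
  qed
  show "h \<in> ext Q h" using weyl_closed Q(2) Z_one by (auto simp: ext_def intro!: exI[of _ \<one>] exI[of _ 1])
qed

lemma ext_generate: "ext Q h = generate G (Q \<union> {h})"
proof
  have c: "Q \<union> {h} \<subseteq> carrier G" using subgroup.subset[OF Q(1)] weyl_closed by auto
  show "generate G (Q \<union> {h}) \<subseteq> ext Q h"
    by (rule generate_subgroup_incl) (use ext_incl ext_subgroup in auto)
  have "h [^] i \<in> generate G (Q \<union> {h})" for i :: nat
    by (induction i) (auto intro: generate.intros)
  then show "ext Q h \<subseteq> generate G (Q \<union> {h})"
    by (auto simp: ext_def intro: generate.eng[OF generate.incl])
qed

lemma ext_semi: "g \<in> ext Q h \<Longrightarrow> \<exists>i. semi (w [^] (i::nat)) x g"
proof -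
  assume "g \<in> ext Q h"
  then obtain y i where y: "y \<in> Q" and g: "g = y \<otimes> h [^] (i::nat)" by (auto simp: ext_def)
  have "semi \<one> x y" using y Q(3) weyl_closed semi_cent[of x y] by auto
  from semi_mult[OF this weyl_semi_pow[of i]] show ?thesis using weyl_closed by (auto simp: g)
qed

text \<open>In \<open>y \<otimes> h [^] i\<close> the exponent measures the failure to commute with
  \<open>x\<close>: centralizing \<open>x\<close> means \<open>w [^] i = \<one>\<close>, so
  \<open>q\<close> divides \<open>i\<close> and \<open>h [^] i\<close> is a scalar, hence in
  \<open>Q\<close>.\<close>

lemma ext_cent: "g \<in> ext Q h \<Longrightarrow> g \<in> cent x \<Longrightarrow> g \<in> Q"
proof -
  assume "g \<in> ext Q h" and gc: "g \<in> cent x"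
  then obtain y i where y: "y \<in> Q" and g: "g = y \<otimes> h [^] (i::nat)" by (auto simp: ext_def)
  have yc: "y \<in> cent x" using y Q(3) by auto
  have "h [^] i = inv y \<otimes> g" using yc weyl_closed by (simp add: g inv_cancel_left cent_closed)
  then have "h [^] i \<in> cent x" using yc gc subgroup.m_closed[OF cent_subgroup] subgroup.m_inv_closed[OF cent_subgroup] weyl_closed by metis
  then have "w [^] i = \<one>" using semi_cent[of x "h [^] i"] weyl_semi_pow[of i] semi_unique weyl_closed by blast
  then have "h [^] i \<in> Q" using weyl_root_pow weyl_pow_Z Q(2) by blast
  then show "g \<in> Q" unfolding g using y subgroup.m_closed[OF Q(1)] by blast
qed

end
end
end

context weyl_context
begin

lemma torsion_cent_eqI: "cent x = cent x' \<Longrightarrow> torsion_cent x = torsion_cent x'"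
  by (simp add: torsion_cent_def torsion_level_def)

lemma weyl_group_eqI: "cent x = cent x' \<Longrightarrow> weyl_group x h = weyl_group x' h"
  using torsion_cent_eqI[of x x'] by (simp add: weyl_group_def)

lemma semi_mult_Z_iff: "c \<in> Z \<Longrightarrow> u \<in> carrier G \<Longrightarrow> semi z (c \<otimes> u) g \<longleftrightarrow> semi z u g"
proof -
  assume c: "c \<in> Z" "u \<in> carrier G"
  have "g \<otimes> (c \<otimes> u) = z \<otimes> (c \<otimes> u \<otimes> g) \<longleftrightarrow> g \<otimes> u = z \<otimes> (u \<otimes> g)" if "g \<in> carrier G" "z \<in> Z"
    using c that Z_left_commute[of c g u] Z_left_commute[of c z "u \<otimes> g"] by (simp add: m_assoc)
  then show ?thesis using c by (auto simp: semi_def)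
qed

text \<open>All commutation scalars are \<open>q\<close>-torsion, hence powers of \<open>w\<close>
  by \<open>torsion_cyclic\<close>; a suitable power of \<open>g\<close> therefore cancels the
  scalar of \<open>k\<close>.\<close>

lemma semi_quotient:
  assumes "weyl w x g" "semi z x k"
  shows "\<exists>j<q. k \<otimes> inv (g [^] (j::nat)) \<in> cent x"
proof -
  have c: "x \<in> carrier G" "z \<in> Z" "w \<in> Z" "w \<noteq> \<one>" "g \<in> carrier G" "k \<in> carrier G"
    using assms by (auto simp: semi_def weyl_def)
  obtain j where j: "j < q" "z = w [^] (j::nat)"
    using torsion_cyclic[of z w] c semi_torsion assms by (metis weyl_semi)
  have "semi (z \<otimes> inv z) x (k \<otimes> inv (g [^] j))"
    using semi_mult[OF assms(2) semi_inv[OF weyl_semi_pow[OF assms(1), of j]]] j by simp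
  then show ?thesis using c j semi_cent[of x] by auto
qed

text \<open>Choose \<open>b\<close> to match the scalar of \<open>y\<close> against \<open>x\<close>
  and \<open>a\<close> to match the one against \<open>h\<close>. The quotient of \<open>y\<close>
  by \<open>x [^] a \<otimes> h [^] b\<close> then centralizes both and is scalar. Modulo scalars
  only \<open>q * q\<close> elements are possible.\<close>

lemma semi_pair:
  assumes "weyl w x h" "semi z x y" "semi z' h y"
  shows "\<exists>c \<in> Z. \<exists>a<q. \<exists>b<q. y = c \<otimes> (x [^] (a::nat) \<otimes> h [^] (b::nat))"
proof -
  have c: "x \<in> carrier G" "h \<in> carrier G" "w \<in> Z" "w \<noteq> \<one>" "y \<in> carrier G" "z \<in> Z" "z' \<in> Z"
    using assms by (auto simp: semi_def weyl_def)
  note s = weyl_sym[OF assms(1)]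
  obtain b where b: "b < q" "z = w [^] (b::nat)"
    using torsion_cyclic[of z w] c semi_torsion assms by (metis weyl_semi)
  obtain a where a: "a < q" "z' = (inv w) [^] (a::nat)"
    using torsion_cyclic[of z' "inv w"] c semi_torsion assms s by (metis weyl_semi Z_inv)
  define u where "u = x [^] a \<otimes> h [^] b"
  have xa: "semi \<one> x (x [^] a)" "semi z' h (x [^] a)"
    using semi_pow[of \<one> x x a] c weyl_semi_pow[OF s, of a] a by (auto simp: semi_def)
  have hb: "semi \<one> h (h [^] b)" "semi z x (h [^] b)"
    using semi_pow[of \<one> h h b] c weyl_semi_pow[OF assms(1), of b] b by (auto simp: semi_def)
  have u: "semi z x u" "semi z' h u"
    using semi_mult[OF xa(1) hb(2)] semi_mult[OF xa(2) hb(1)] c by (simp_all add: u_def)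
  have "y \<otimes> inv u \<in> cent x" "y \<otimes> inv u \<in> cent h"
    using semi_mult[OF assms(2) semi_inv[OF u(1)]] semi_mult[OF assms(3) semi_inv[OF u(2)]] c
    by (auto simp: semi_cent)
  then have "y \<otimes> inv u \<in> Z" by (rule weyl_cent_pair[OF assms(1)])
  moreover have "u \<in> carrier G" using u by (auto simp: semi_def)
  then have "y = (y \<otimes> inv u) \<otimes> u" using c by (simp add: m_assoc)
  ultimately show ?thesis using a b unfolding u_def by blast
qed

subsection \<open>Weyl groups\<close>

context
  fixes w x h
  assumes weyl: "weyl w x h"
begin

lemmas torsion_cent_facts = torsion_cent_subgroup[OF weyl] Z_torsion_cent[OF weyl] torsion_cent_cent[OF weyl] torsion_cent_conjg[OF weyl]

lemma weyl_group_subgroup: "subgroup (weyl_group x h) G"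
  unfolding weyl_group_def by (rule ext_subgroup[OF weyl]) (use torsion_cent_facts in auto)

lemma weyl_group_generate: "weyl_group x h = generate G (torsion_cent x \<union> {h})"
  unfolding weyl_group_def by (rule ext_generate[OF weyl]) (use torsion_cent_facts in auto)

lemma weyl_group_incl: "torsion_cent x \<subseteq> weyl_group x h" "h \<in> weyl_group x h" "Z \<subseteq> weyl_group x h"
  unfolding weyl_group_generate using Z_torsion_cent[OF weyl] by (auto intro: generate.incl)

lemma weyl_torsion_x: "x \<in> torsion_cent x"
proof -
  have "x [^] q \<in> Z" using weyl_pow_Z[OF weyl_sym[OF weyl], of q] by simp
  then have "x \<in> torsion_level 1 x" using weyl_x_cent[OF weyl] by (simp add: torsion_level_def)
  then show ?thesis unfolding torsion_cent_def by blast
qed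

lemma weyl_group_x: "x \<in> weyl_group x h"
  using weyl_torsion_x weyl_group_incl by blast

lemma weyl_group_semi: "g \<in> weyl_group x h \<Longrightarrow> \<exists>i. semi (w [^] (i::nat)) x g"
  unfolding weyl_group_def by (rule ext_semi[OF weyl]) (use torsion_cent_facts in auto)

lemma weyl_group_cent: "g \<in> weyl_group x h \<Longrightarrow> g \<in> cent x \<Longrightarrow> g \<in> torsion_cent x"
  unfolding weyl_group_def by (rule ext_cent[OF weyl, of "torsion_cent x"]) (use torsion_cent_facts in auto)

lemma weyl_group_noncent:
  assumes "g \<in> weyl_group x h" "g \<notin> cent x"
  shows "\<exists>w'. weyl w' x g"
proof -
  obtain i where i: "semi (w [^] (i::nat)) x g" using weyl_group_semi assms by blast
  then have "w [^] i \<noteq> \<one>" using assms semi_cent[of x g] weyl_closed[OF weyl] by auto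
  then show ?thesis using i by (auto simp: weyl_semi)
qed

lemma weyl_group_noncent_pow: "g \<in> weyl_group x h \<Longrightarrow> g \<notin> cent x \<Longrightarrow> g [^] q \<in> Z"
  using weyl_group_noncent weyl_pow_Z[of _ x g q] by auto

lemma weyl_group_torsion: "g \<in> weyl_group x h \<Longrightarrow> \<exists>k. g [^] (q ^ k) \<in> Z"
proof (cases "g \<in> cent x")
  case True
  assume "g \<in> weyl_group x h"
  then show ?thesis using True weyl_group_cent by (auto simp: torsion_cent_def torsion_level_def)
next
  case False
  assume "g \<in> weyl_group x h"
  then show ?thesis using weyl_group_noncent_pow False by (metis power_one_right)
qed

text \<open>For \<open>k\<close> in \<open>K\<close> some power of \<open>h\<close> has the same
  commutation scalar with \<open>x\<close>. The quotient stays in \<open>K\<close> and centralizes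
  \<open>x\<close>, so it is torsion by assumption.\<close>

lemma subset_weyl_group:
  assumes K: "subgroup K G" "h \<in> K"
    and "\<And>k. k \<in> K \<Longrightarrow> \<exists>z. semi z x k" "\<And>y. y \<in> K \<Longrightarrow> y \<in> cent x \<Longrightarrow> y \<in> torsion_cent x"
  shows "K \<subseteq> weyl_group x h"
proof
  fix k assume k: "k \<in> K"
  interpret K: subgroup K G by fact
  obtain j where j: "k \<otimes> inv (h [^] (j::nat)) \<in> cent x"
    using semi_quotient[OF weyl] assms(3)[OF k] by blast
  have hj: "h [^] j \<in> K" using K(2) by (induction j) auto
  then have "k \<otimes> inv (h [^] j) \<in> torsion_cent x" using assms(4) j k by auto
  moreover have "k = k \<otimes> inv (h [^] j) \<otimes> h [^] j" using k weyl_closed[OF weyl] K.subset by (simp add: m_assoc subset_eq)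
  ultimately show "k \<in> weyl_group x h" unfolding weyl_group_def ext_def by blast
qed

text \<open>The nontrivial commutation scalar of \<open>g\<close> with \<open>x\<close> generates
  all \<open>q\<close>-th roots of unity in \<open>Z\<close>, so every element of the group differs
  from a power of \<open>g\<close> by an element of \<open>cent x\<close>. Thus the group depends
  only on the centralizer of \<open>x\<close> and on any one element outside it.\<close>

lemma weyl_group_change:
  assumes "g \<in> weyl_group x h" "g \<notin> cent x"
  shows "weyl_group x g = weyl_group x h"
proof
  obtain w' where w': "weyl w' x g" using weyl_group_noncent assms by blast
  have "weyl_group x g = generate G (torsion_cent x \<union> {g})"
    unfolding weyl_group_def using torsion_cent_facts torsion_cent_conjg[OF w'] by (intro ext_generate[OF w'])
  then show "weyl_group x g \<subseteq> weyl_group x h"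
    using generate_subgroup_incl[OF _ weyl_group_subgroup, of "torsion_cent x \<union> {g}"] assms weyl_group_incl by auto
  have w: "semi w' x g" using w' weyl_semi by blast
  show "weyl_group x h \<subseteq> weyl_group x g"
  proof
    fix k assume k: "k \<in> weyl_group x h"
    interpret H: subgroup "weyl_group x h" G by (rule weyl_group_subgroup)
    obtain i where "semi (w [^] (i::nat)) x k" using weyl_group_semi k by blast
    then obtain j where j: "k \<otimes> inv (g [^] (j::nat)) \<in> cent x" using semi_quotient[OF w'] by blast
    have "g [^] j \<in> weyl_group x h" using assms(1) by (induction j) auto
    then have "k \<otimes> inv (g [^] j) \<in> torsion_cent x" using weyl_group_cent j k by auto
    moreover have "k = k \<otimes> inv (g [^] j) \<otimes> g [^] j" using k assms by (simp add: m_assoc)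
    ultimately show "k \<in> weyl_group x g" unfolding weyl_group_def ext_def by blast
  qed
qed

lemma weyl_conjg:
  assumes g: "g \<in> carrier G"
  shows "weyl w (conjg g x) (conjg g h)"
proof -
  have "conjg g (h \<otimes> x) = conjg g (w \<otimes> (x \<otimes> h))" using weyl by (simp add: weyl_def)
  then show ?thesis using weyl_closed[OF weyl] g by (simp add: weyl_def conjg_mult)
qed

lemma cent_conjg:
  assumes g: "g \<in> carrier G" and a: "a \<in> carrier G"
  shows "conjg g a \<in> cent (conjg g x) \<longleftrightarrow> a \<in> cent x"
proof -
  have "conjg g a \<in> cent (conjg g x) \<longleftrightarrow> conjg g (a \<otimes> x) = conjg g (x \<otimes> a)"
    using weyl_closed[OF weyl] g a by (simp add: cent_def conjg_mult)
  also have "\<dots> \<longleftrightarrow> a \<otimes> x = x \<otimes> a"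
    using conjg_by_inv(1)[OF g, of "a \<otimes> x"] conjg_by_inv(1)[OF g, of "x \<otimes> a"] weyl_closed[OF weyl] a by (metis m_closed)
  finally show ?thesis using a by (simp add: cent_def)
qed

lemma torsion_cent_conjg_image:
  assumes g: "g \<in> carrier G"
  shows "torsion_cent (conjg g x) = conjg g ` torsion_cent x"
proof (intro equalityI subsetI)
  have iff: "conjg g a \<in> torsion_cent (conjg g x) \<longleftrightarrow> a \<in> torsion_cent x" if "a \<in> carrier G" for a
    using that g cent_conjg[OF g that] conjg_mem_Z_iff[OF g] 
    by (auto simp: torsion_cent_def torsion_level_def conjg_pow[symmetric])
  {
    fix y assume y: "y \<in> torsion_cent (conjg g x)"
    then have "y \<in> carrier G" by (auto simp: torsion_cent_def torsion_level_def cent_def)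
    then have "y = conjg g (conjg (inv g) y)" "conjg (inv g) y \<in> carrier G" using g by (simp_all add: conjg_by_inv)
    then show "y \<in> conjg g ` torsion_cent x" using iff y by (metis imageI)
  next
    fix y assume "y \<in> conjg g ` torsion_cent x"
    then show "y \<in> torsion_cent (conjg g x)" using iff torsion_cent_cent[OF weyl] cent_closed by blast
  }
qed

lemma weyl_group_conjg:
  assumes g: "g \<in> carrier G"
  shows "conjg g ` weyl_group x h = weyl_group (conjg g x) (conjg g h)"
proof -
  have "conjg g (y \<otimes> h [^] i) = conjg g y \<otimes> conjg g h [^] i" if "y \<in> torsion_cent x" for y and i :: nat
  proof -
    have "y \<in> carrier G" using that torsion_cent_cent[OF weyl] cent_closed by blast
    then show ?thesis using g weyl_closed[OF weyl] by (simp add: conjg_mult conjg_pow)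
  qed
  then show ?thesis
    unfolding weyl_group_def ext_def torsion_cent_conjg_image[OF g]
    by (auto simp: image_iff) metis+
qed

end

lemma conj_set_conjg: "conj_set G g K = conjg g ` K"
  by (simp add: conj_set_def conjg_def)

subsection \<open>Local nilpotency of Weyl groups\<close>

context
  fixes w x h
  assumes weyl: "weyl w x h"
begin

text \<open>Conjugation by \<open>h\<close> has period \<open>q\<close> on the abelian group of this
  level, since \<open>h [^] q\<close> is scalar. The iterated difference is therefore a
  \<open>q\<close>-th power of an element of the same level, and a \<open>q\<close>-th power lies
  one level lower.\<close>

lemma torsion_level_difference_pow:
  assumes y: "y \<in> torsion_level (Suc m) x"
  shows "((\<lambda>a. a \<otimes> inv (conjg h a)) ^^ q) y \<in> torsion_level m x"
proof -
  let ?A = "torsion_level (Suc m) x" let ?H = "G\<lparr>carrier := torsion_level (Suc m) x\<rparr>"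
  interpret A: subgroup ?A G by (rule torsion_level_subgroup[OF weyl])
  have Acent: "?A \<subseteq> cent x" by (auto simp: torsion_level_def)
  interpret H: comm_group ?H
    by (rule group.group_comm_groupI) 
       (use A.subgroup_is_group weyl_cent_abelian[OF weyl] Acent in auto)
  have hc: "h \<in> carrier G" using weyl_closed[OF weyl] by blast
  have hom: "conjg h \<in> hom ?H ?H"
    using torsion_level_conjg[OF weyl] hc by (auto simp: hom_def conjg_mult)
  have iter: "(conjg h ^^ i) y = conjg (h [^] i) y" for i
  proof (induction i)
    case 0 then show ?case using y A.mem_carrier[OF y] by (simp add: conjg_def)
  next
    case (Suc i) then show ?case using A.mem_carrier[OF y] hc nat_pow_Suc2[of h i] by (simp add: conjg_conjg)
  qed
  have "(conjg h ^^ q) y = y"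
    unfolding iter using weyl_pow_Z[OF weyl, of q] A.mem_carrier[OF y] Z_central[of "h [^] q" y]
    by (intro conjg_commute) auto
  then obtain b where b: "b \<in> ?A" "((\<lambda>a. a \<otimes> inv\<^bsub>?H\<^esub> (conjg h a)) ^^ q) y = b [^]\<^bsub>?H\<^esub> q"
    using H.iterated_difference_prime[OF hom prime_q] y by auto
  have "((\<lambda>a. a \<otimes> inv\<^bsub>?H\<^esub> (conjg h a)) ^^ k) y = ((\<lambda>a. a \<otimes> inv (conjg h a)) ^^ k) y
     \<and> ((\<lambda>a. a \<otimes> inv (conjg h a)) ^^ k) y \<in> ?A" for k
    by (induction k) (use y torsion_level_conjg[OF weyl] m_inv_consistent[OF A.subgroup_axioms] in auto)
  then have "((\<lambda>a. a \<otimes> inv (conjg h a)) ^^ q) y = b [^] q" using b by (simp add: nat_pow_consistent[symmetric])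
  moreover have "b [^] q \<in> torsion_level m x"
    using b(1) cent_pow[of x b q] weyl_closed[OF weyl] cent_closed[of b x] by (simp add: torsion_level_def nat_pow_pow)
  ultimately show ?thesis by simp
qed

text \<open>An explicit chain bounds the lower central series. Commutators of the extension fall
  into the abelian group \<open>?A\<close>, and commutators with the image of one power of \<phi>
  fall into the image of the next. Each block of \<open>q\<close> applications of \<phi> lowers the
  torsion level, so scalars are reached after \<open>q * m\<close> of them, and \<phi> is trivial on
  scalars.\<close>

lemma weyl_level_nilpotent:
  assumes N: "subgroup N G" "N \<subseteq> ext (torsion_level m x) h"
  shows "\<exists>n. lower_central (G\<lparr>carrier := N\<rparr>) n \<subseteq> {\<one>}"
proof -
  let ?A = "torsion_level m x"
  define \<phi> where "\<phi> a = a \<otimes> inv (conjg h a)" for a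
  have hc: "h \<in> carrier G" and xc: "x \<in> carrier G" using weyl_closed[OF weyl] by auto
  interpret A: subgroup ?A G by (rule torsion_level_subgroup[OF weyl])
  have Acent: "a \<in> ?A \<Longrightarrow> a \<in> cent x" for a by (auto simp: torsion_level_def)
  have Acomm: "a \<in> ?A \<Longrightarrow> b \<in> ?A \<Longrightarrow> a \<otimes> b = b \<otimes> a" for a b
    using weyl_cent_abelian[OF weyl] Acent by blast
  have \<phi>A: "a \<in> ?A \<Longrightarrow> \<phi> a \<in> ?A" for a using torsion_level_conjg[OF weyl] by (simp add: \<phi>_def)
  have \<phi>mult: "\<phi> (a \<otimes> b) = \<phi> a \<otimes> \<phi> b" if "a \<in> ?A" "b \<in> ?A" for a b
  proof -
    let ?a = "conjg h a" let ?b = "conjg h b"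
    have 1: "?a \<in> ?A" "?b \<in> ?A" using torsion_level_conjg[OF weyl] that by auto
    have "\<phi> (a \<otimes> b) = a \<otimes> (b \<otimes> (inv ?b \<otimes> inv ?a))"
      using that 1 hc by (simp add: \<phi>_def conjg_mult inv_mult_group m_assoc)
    also have "b \<otimes> (inv ?b \<otimes> inv ?a) = (b \<otimes> inv ?b) \<otimes> inv ?a" using that 1 hc by (simp add: m_assoc)
    also have "\<dots> = inv ?a \<otimes> (b \<otimes> inv ?b)" using that 1 by (intro Acomm) auto
    finally show ?thesis using that 1 hc by (simp add: \<phi>_def m_assoc)
  qed
  have \<phi>kA: "a \<in> ?A \<Longrightarrow> (\<phi> ^^ k) a \<in> ?A" for a k by (induction k) (auto intro: \<phi>A)
  have \<phi>kmult: "(\<phi> ^^ k) (a \<otimes> b) = (\<phi> ^^ k) a \<otimes> (\<phi> ^^ k) b" if "a \<in> ?A" "b \<in> ?A" for a b k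
    by (induction k) (use that \<phi>mult \<phi>kA in auto)
  have \<phi>conj: "conjg h (\<phi> a) = \<phi> (conjg h a)" if "a \<in> ?A" for a
    using that hc A.mem_carrier[OF that] by (simp add: \<phi>_def conjg_mult conjg_inv)
  have \<phi>kconj: "conjg h ((\<phi> ^^ k) a) = (\<phi> ^^ k) (conjg h a)" if "a \<in> ?A" for a k
    by (induction k) (use that \<phi>conj \<phi>kA in auto)
  have \<phi>Z: "\<phi> z = \<one>" if "z \<in> Z" for z using that hc by (simp add: \<phi>_def)
  define S where "S k = (\<phi> ^^ k) ` ?A" for k
  have Ssub: "subgroup (S k) G" for k
  proof (rule subgroupI)
    show "S k \<subseteq> carrier G" using \<phi>kA A.subset by (auto simp: S_def)
    show "S k \<noteq> {}" using A.one_closed unfolding S_def by blast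
    fix a assume "a \<in> S k"
    then obtain a0 where a0: "a0 \<in> ?A" "a = (\<phi> ^^ k) a0" by (auto simp: S_def)
    have "(\<phi> ^^ k) \<one> = \<one>" by (induction k) (use \<phi>Z[OF Z_one] in auto)
    then have "(\<phi> ^^ k) (inv a0) \<otimes> a = \<one>" using \<phi>kmult[of "inv a0" a0 k] a0 by simp
    then have "inv a = (\<phi> ^^ k) (inv a0)" using a0 \<phi>kA[of a0 k] \<phi>kA[of "inv a0" k] by (intro inv_equality) auto
    then show "inv a \<in> S k" using a0 by (auto simp: S_def)
    fix b assume "b \<in> S k"
    then obtain b0 where b0: "b0 \<in> ?A" "b = (\<phi> ^^ k) b0" by (auto simp: S_def)
    then have "a \<otimes> b = (\<phi> ^^ k) (a0 \<otimes> b0)" using a0 \<phi>kmult by simp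
    then show "a \<otimes> b \<in> S k" using a0 b0 by (auto simp: S_def)
  qed
  have SA: "S k \<subseteq> ?A" for k using \<phi>kA by (auto simp: S_def)
  have Sconj: "conjg (h [^] i) a \<in> S k" if "a \<in> S k" for a k and i :: nat
  proof (induction i)
    case 0 then show ?case using that SA[of k] by (auto simp: conjg_def)
  next
    case (Suc i)
    then obtain a0 where "a0 \<in> ?A" "conjg (h [^] i) a = (\<phi> ^^ k) a0" by (auto simp: S_def)
    then have "conjg h (conjg (h [^] i) a) \<in> S k"
      using \<phi>kconj torsion_level_conjg[OF weyl] by (auto simp: S_def)
    then show ?case using that SA[of k] hc nat_pow_Suc2[of h i] by (simp add: conjg_conjg subset_eq)
  qed
  \<comment> \<open>Telescoping: with \<open>b\<close> the conjugate of \<open>a\<close> by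
    \<open>h [^] i\<close>, the difference for \<open>Suc i\<close> is the difference for
    \<open>i\<close> times \<open>\<phi> b\<close>.\<close>
  have Sdiff: "a \<otimes> inv (conjg (h [^] i) a) \<in> S (Suc k)" if "a \<in> S k" for a k and i :: nat
  proof (induction i)
    case 0 
    have "a \<in> carrier G" using that SA[of k] by auto
    then show ?case using subgroup.one_closed[OF Ssub] by (simp add: conjg_def)
  next
    case (Suc i)
    let ?b = "conjg (h [^] i) a"
    have ac: "a \<in> carrier G" using that SA[of k] by auto
    have "\<phi> ?b \<in> S (Suc k)" using Sconj[OF that, of i] by (auto simp: S_def)
    then have "(a \<otimes> inv ?b) \<otimes> \<phi> ?b \<in> S (Suc k)" using Suc subgroup.m_closed[OF Ssub] by blast
    moreover have "\<phi> ?b = ?b \<otimes> inv (conjg (h [^] Suc i) a)"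
      using ac hc nat_pow_Suc2[of h i] by (simp add: \<phi>_def conjg_conjg)
    ultimately show ?case using ac hc by (simp add: m_assoc inv_cancel_left)
  qed
  have pre: "subgroup ?A G" "Z \<subseteq> ?A" "?A \<subseteq> cent x" "\<And>y. y \<in> ?A \<Longrightarrow> conjg h y \<in> ?A"
    using A.subgroup_axioms Z_torsion_level[OF weyl] Acent torsion_level_conjg[OF weyl] by auto
  interpret E: subgroup "ext ?A h" G by (rule ext_subgroup[OF weyl]) (use pre in auto)
  \<comment> \<open>The index is shifted by one, as the first commutator only leads from the
    extension into \<open>?A\<close>, which is \<open>S 0\<close>.\<close>
  define f where "f k = (case k of 0 \<Rightarrow> ext ?A h | Suc k \<Rightarrow> S k)" for k
  have fsub: "subgroup (f k) G" for k using Ssub E.subgroup_axioms by (auto simp: f_def split: nat.split)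
  have fcomm: "a \<otimes> y \<otimes> inv a \<otimes> inv y \<in> f (Suc k)" if a: "a \<in> f k" and "y \<in> N" for k a y
  proof -
    have y: "y \<in> ext ?A h" using that N by auto
    have yc: "y \<in> carrier G" using y by simp
    show ?thesis
    proof (cases k)
      case 0
      then have aE: "a \<in> ext ?A h" using a by (simp add: f_def)
      obtain i j where "semi (w [^] (i::nat)) x a" "semi (w [^] (j::nat)) x y"
        using ext_semi[OF weyl pre, of a] ext_semi[OF weyl pre, of y] aE y by blast
      then have s: "semi (w [^] i \<otimes> w [^] j \<otimes> inv (w [^] i) \<otimes> inv (w [^] j)) x (a \<otimes> y \<otimes> inv a \<otimes> inv y)"
        by (intro semi_mult semi_inv)
      have "w [^] i \<otimes> w [^] j \<otimes> inv (w [^] i) \<otimes> inv (w [^] j) = \<one>"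
        using weyl_closed[OF weyl] by (simp add: Z_central[of "w [^] j" "w [^] i"]) (simp add: m_assoc inv_cancel_left)
      then have "a \<otimes> y \<otimes> inv a \<otimes> inv y \<in> cent x" using s xc by (simp add: semi_cent)
      moreover have "a \<otimes> y \<otimes> inv a \<otimes> inv y \<in> ext ?A h" using aE y by simp
      ultimately have "a \<otimes> y \<otimes> inv a \<otimes> inv y \<in> ?A" using ext_cent[OF weyl pre] by blast
      then show ?thesis using 0 by (simp add: f_def S_def)
    next
      case (Suc k')
      then have aS: "a \<in> S k'" using a by (simp add: f_def)
      then have aA: "a \<in> ?A" using SA by blast
      obtain c i where c: "c \<in> ?A" "y = c \<otimes> h [^] (i::nat)" using y by (auto simp: ext_def)
      have b: "conjg (h [^] i) a \<in> ?A" using Sconj[OF aS] SA by blast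
      have "conjg y a = conjg c (conjg (h [^] i) a)" using c aA hc by (simp add: conjg_conjg)
      also have "\<dots> = conjg (h [^] i) a" using c b by (intro conjg_commute Acomm) auto
      finally have "conjg y a = conjg (h [^] i) a" .
      moreover have "a \<otimes> y \<otimes> inv a \<otimes> inv y = a \<otimes> inv (conjg y a)"
        using aA yc by (simp add: conjg_def inv_mult_group m_assoc)
      ultimately show ?thesis using Sdiff[OF aS] Suc by (simp add: f_def)
    qed
  qed
  have lc: "lower_central (G\<lparr>carrier := N\<rparr>) k \<subseteq> f k" for k
    by (rule lower_central_subset_chain[where f = f]) (use N fsub fcomm in \<open>auto simp: f_def\<close>)
  \<comment> \<open>Each block of \<open>q\<close> applications of \<phi> costs one torsion
    level.\<close>
  have down: "j \<le> m \<Longrightarrow> S (q * j) \<subseteq> torsion_level (m - j) x" for j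
  proof (induction j)
    case 0 then show ?case by (simp add: S_def)
  next
    case (Suc j)
    show ?case
    proof
      fix b assume "b \<in> S (q * Suc j)"
      then obtain a where a: "a \<in> ?A" "b = (\<phi> ^^ (q + q * j)) a" by (auto simp: S_def)
      then have "b = (\<phi> ^^ q) ((\<phi> ^^ (q * j)) a)" by (simp add: funpow_add)
      moreover have "(\<phi> ^^ (q * j)) a \<in> torsion_level (Suc (m - Suc j)) x"
        using Suc a by (auto simp: S_def Suc_diff_Suc)
      ultimately show "b \<in> torsion_level (m - Suc j) x"
        using torsion_level_difference_pow unfolding \<phi>_def by auto
    qed
  qed
  have "S (q * m) \<subseteq> Z" using down[of m] cent_closed by (force simp: torsion_level_def)
  then have "S (Suc (q * m)) \<subseteq> {\<one>}" using \<phi>Z by (auto simp: S_def)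
  then have "lower_central (G\<lparr>carrier := N\<rparr>) (Suc (Suc (q * m))) \<subseteq> {\<one>}"
    using lc[of "Suc (Suc (q * m))"] unfolding f_def nat.case by (rule order_trans[rotated])
  then show ?thesis by blast
qed

text \<open>The torsion levels increase, so finitely many elements already lie in the extension of a
  single level, where nilpotency is known.\<close>

lemma weyl_group_locally_nilpotent: "locally_nilpotent_subgroup (weyl_group x h) G"
  unfolding locally_nilpotent_subgroup_iff
proof (intro conjI allI impI)
  show "subgroup (weyl_group x h) G" by (rule weyl_group_subgroup[OF weyl])
  fix B assume "finite B \<and> B \<subseteq> weyl_group x h"
  then have B: "finite B" "B \<subseteq> weyl_group x h" by auto
  then have "\<exists>m. B \<subseteq> ext (torsion_level m x) h"
  proof (induction B rule: finite_induct)
    case (insert b B)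
    then obtain m where m: "B \<subseteq> ext (torsion_level m x) h" by auto
    obtain n y i where n: "y \<in> torsion_level n x" "b = y \<otimes> h [^] (i::nat)"
      using insert.prems by (auto simp: weyl_group_def ext_def torsion_cent_def)
    have "ext (torsion_level m x) h \<subseteq> ext (torsion_level (max m n) x) h"
      using torsion_level_mono[OF weyl, of m "max m n"] by (auto simp: ext_def)
    moreover have "y \<in> torsion_level (max m n) x" using torsion_level_mono[OF weyl, of n "max m n"] n by auto
    then have "b \<in> ext (torsion_level (max m n) x) h" using n by (auto simp: ext_def)
    ultimately show ?case using m by blast
  qed simp
  then obtain m where m: "B \<subseteq> ext (torsion_level m x) h" by blast
  have "subgroup (ext (torsion_level m x) h) G"
    by (rule ext_subgroup[OF weyl]) (use torsion_level_subgroup[OF weyl] Z_torsion_level[OF weyl] torsion_level_conjg[OF weyl] in \<open>auto simp: torsion_level_def\<close>)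
  then have "generate G B \<subseteq> ext (torsion_level m x) h" using m by (rule generate_subgroup_incl[rotated])
  moreover have "subgroup (generate G B) G"
    using B subgroup.subset[OF weyl_group_subgroup[OF weyl]] by (intro generate_is_subgroup) auto
  ultimately show "nilpotent_group (G\<lparr>carrier := generate G B\<rparr>)"
    using weyl_level_nilpotent nilpotent_subgroup_iff by blast
qed

end
end

context weyl_context
begin

subsection \<open>Locally nilpotent subgroups with small centralizer\<close>

text \<open>The generated group is not abelian: otherwise the generators would be scalars, every
  element of \<open>G\<close> would commute with them, and \<open>G\<close> would be contained in
  \<open>Z\<close>. Its central elements are scalars, so a noncentral element of the second center
  commutes with everything up to scalars.\<close>

lemma nilpotent_semicentral:
  assumes nZ: "\<not> carrier G \<subseteq> Z" and B: "B \<subseteq> carrier G"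
    and cB: "\<And>y. y \<in> carrier G \<Longrightarrow> (\<And>b. b \<in> B \<Longrightarrow> y \<otimes> b = b \<otimes> y) \<Longrightarrow> y \<in> Z"
    and nilp: "lower_central (G\<lparr>carrier := generate G B\<rparr>) n \<subseteq> {\<one>}"
  shows "\<exists>x \<in> generate G B. x \<notin> Z \<and> (\<forall>y \<in> generate G B. \<exists>z. semi z x y)"
proof -
  let ?N = "generate G B"
  have N: "subgroup ?N G" using B by (rule generate_is_subgroup)
  interpret N: subgroup ?N G by fact
  have "\<exists>a \<in> ?N. \<exists>b \<in> ?N. a \<otimes> b \<noteq> b \<otimes> a"
  proof (rule ccontr)
    assume "\<not> ?thesis"
    then have "b \<in> Z" if "b \<in> B" for b
      using cB[of b] that B generate.incl[of _ B G] by blast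
    then have "y \<in> Z" if "y \<in> carrier G" for y using cB[OF that] Z_central that by blast
    then show False using nZ by blast
  qed
  then obtain a b where ab: "a \<in> ?N" "b \<in> ?N" "a \<otimes> b \<noteq> b \<otimes> a" by blast
  from nilpotent_second_center[OF N nilp ab] obtain x where xN: "x \<in> ?N" and x': "(\<exists>y \<in> ?N. x \<otimes> y \<noteq> y \<otimes> x) \<and>
    (\<forall>y \<in> ?N. \<exists>c \<in> ?N. (\<forall>g \<in> ?N. c \<otimes> g = g \<otimes> c) \<and> x \<otimes> y = c \<otimes> (y \<otimes> x))"
    by (rule bexE)
  note x = xN conjunct1[OF x'] conjunct2[OF x']
  have "\<exists>z. semi z x y" if y: "y \<in> ?N" for y
  proof -
    obtain c where c: "c \<in> ?N" "\<forall>g \<in> ?N. c \<otimes> g = g \<otimes> c" "x \<otimes> y = c \<otimes> (y \<otimes> x)"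
      using bspec[OF x(3) y] by (elim bexE conjE)
    have "c \<in> Z" using c cB[of c] generate.incl[of _ B G] by auto
    then have "semi c y x" using c y x(1) by (auto simp: semi_def)
    then show ?thesis using semi_sym by blast
  qed
  moreover have "x \<notin> Z" using x(2) Z_central N.mem_carrier by metis
  ultimately show ?thesis using x(1) by blast
qed

text \<open>Commutators with \<open>h\<close> are iterated from \<open>y\<close> until they become
  trivial. On the way back each step costs one factor \<open>q\<close>: if \<open>[c, h]\<close> has
  a scalar \<open>q ^ m\<close>-th power, then \<open>u = c [^] (q ^ m)\<close> commutes with
  \<open>h\<close> up to a \<open>q\<close>-torsion scalar, so \<open>u [^] q\<close> centralizes
  both \<open>x\<close> and \<open>h\<close> and is itself a scalar.\<close>

lemma nilpotent_torsion:
  assumes weyl: "weyl w x h" and y: "y \<in> cent x"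
    and N: "subgroup N G" "h \<in> N" "y \<in> N" and nilp: "lower_central (G\<lparr>carrier := N\<rparr>) n \<subseteq> {\<one>}"
  shows "y \<in> torsion_cent x"
proof -
  interpret N: subgroup N G by fact
  interpret C: subgroup "cent x" G using cent_subgroup weyl_closed[OF weyl] by blast
  have hc: "h \<in> carrier G" using N by auto
  have step: "c [^] (q ^ Suc m) \<in> Z" if c: "c \<in> cent x" "(c \<otimes> h \<otimes> inv c \<otimes> inv h) [^] (q ^ m) \<in> Z" for c m
  proof -
    define u where "u = c [^] (q ^ m)"
    have cc: "c \<in> carrier G" using c by simp
    have uc: "u \<in> cent x" using c cent_pow weyl_closed[OF weyl] by (simp add: u_def)
    have hcc: "conjg h c \<in> cent x" using c weyl_cent_conjg[OF weyl] by blast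
    have "c \<otimes> h \<otimes> inv c \<otimes> inv h = c \<otimes> inv (conjg h c)"
      using cc hc by (simp add: conjg_def inv_mult_group m_assoc)
    moreover have "(c \<otimes> inv (conjg h c)) [^] (q ^ m) = c [^] (q ^ m) \<otimes> inv (conjg h c) [^] (q ^ m)"
      by (rule pow_mult_distrib[OF weyl_cent_abelian[OF weyl c(1)]]) (use hcc cc in auto)
    ultimately have "(c \<otimes> h \<otimes> inv c \<otimes> inv h) [^] (q ^ m) = c [^] (q ^ m) \<otimes> inv (conjg h c) [^] (q ^ m)"
      by simp
    also have "\<dots> = u \<otimes> inv (conjg h u)"
      using cc hc by (simp add: u_def conjg_pow nat_pow_inv)
    finally have z: "u \<otimes> inv (conjg h u) \<in> Z" using c by simp
    have "u \<otimes> h = u \<otimes> inv (conjg h u) \<otimes> (h \<otimes> u)"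
      using uc hc by (simp add: conjg_swap[of h u] m_assoc inv_cancel_left)
    then have s: "semi (u \<otimes> inv (conjg h u)) h u" using z hc uc by (auto simp: semi_def)
    from semi_pow[OF s, of q] semi_torsion[OF s] have "u [^] q \<in> cent h" using hc by (simp add: semi_cent)
    then have "u [^] q \<in> Z" using weyl_cent_pair[OF weyl] cent_pow uc weyl_closed[OF weyl] by blast
    then show ?thesis using cc by (simp add: u_def nat_pow_pow mult.commute)
  qed
  define c where "c k = ((\<lambda>c. c \<otimes> h \<otimes> inv c \<otimes> inv h) ^^ k) y" for k
  have cx: "c k \<in> cent x" for k
  proof (induction k)
    case (Suc k)
    have "c (Suc k) = c k \<otimes> inv (conjg h (c k))"
      using cent_closed[OF Suc] hc by (simp add: c_def conjg_def inv_mult_group m_assoc)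
    then show ?case using Suc weyl_cent_conjg[OF weyl Suc] by simp
  qed (simp add: c_def y)
  have lc: "c k \<in> lower_central (G\<lparr>carrier := N\<rparr>) k" for k
  proof (induction k)
    case (Suc k)
    then show ?case unfolding lower_central_subgroup_Suc[OF N(1)] c_def using N(2) by (intro generate.incl UN_I[of "((\<lambda>c. c \<otimes> h \<otimes> inv c \<otimes> inv h) ^^ k) y"] UN_I[of h]) auto
  qed (simp add: c_def N)
  have "c n = \<one>" using nilp lc[of n] by (simp add: subset_iff)
  then have "c n \<in> Z" by simp
  have "j \<le> n \<Longrightarrow> c (n - j) [^] (q ^ j) \<in> Z" for j
  proof (induction j)
    case 0 then show ?case using \<open>c n \<in> Z\<close> by simp
  next
    case (Suc j)
    then have "c (Suc (n - Suc j)) [^] (q ^ j) \<in> Z" by (simp add: Suc_diff_Suc)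
    then show ?case using step[OF cx, of "n - Suc j" j] by (simp add: c_def)
  qed
  from this[of n] have "y [^] (q ^ n) \<in> Z" by (simp add: c_def)
  then show ?thesis using y by (auto simp: torsion_cent_def torsion_level_def)
qed

text \<open>The first semicentral element only provides the pair \<open>x0\<close>,
  \<open>h0\<close>. The second one, taken in the group generated by this pair and the elements
  \<open>bad a b\<close>, commutes with \<open>x0\<close> and \<open>h0\<close> up to scalars and so
  is one of the candidates \<open>u a b\<close> modulo scalars. The partner \<open>h\<close> is
  whichever of \<open>x0\<close> and \<open>h0\<close> fails to commute with it.\<close>

theorem locally_nilpotent_subset_weyl_group:
  assumes nZ: "\<not> carrier G \<subseteq> Z" and K: "locally_nilpotent_subgroup K G"
    and B: "finite B" "B \<subseteq> K"
    and cB: "\<And>y. y \<in> carrier G \<Longrightarrow> (\<And>b. b \<in> B \<Longrightarrow> y \<otimes> b = b \<otimes> y) \<Longrightarrow> y \<in> Z"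
  shows "\<exists>w x h. weyl w x h \<and> x \<in> K \<and> h \<in> K \<and> K \<subseteq> weyl_group x h"
proof -
  have Ks: "subgroup K G" using K by (rule locally_nilpotent_subgroupD)
  interpret K: subgroup K G by fact
  have gen: "\<exists>x \<in> generate G B'. x \<notin> Z \<and> (\<forall>y \<in> generate G B'. \<exists>z. semi z x y)"
    if B': "finite B'" "B' \<subseteq> K"
      and cB': "\<And>y. y \<in> carrier G \<Longrightarrow> (\<And>b. b \<in> B' \<Longrightarrow> y \<otimes> b = b \<otimes> y) \<Longrightarrow> y \<in> Z" for B'
    using nilpotent_semicentral[OF nZ _ cB'] locally_nilpotent_subgroupD(2)[OF K B'] B' K.subset by blast
  have genK: "generate G B' \<subseteq> K" if "B' \<subseteq> K" for B'
    using that Ks by (rule generate_subgroup_incl)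
  obtain x0 where x0: "x0 \<in> generate G B" "x0 \<notin> Z" "\<And>y. y \<in> generate G B \<Longrightarrow> \<exists>z. semi z x0 y"
    using gen[OF B cB] by blast
  have x0K: "x0 \<in> K" using x0 genK B by blast
  obtain h0 where h0: "h0 \<in> B" "x0 \<otimes> h0 \<noteq> h0 \<otimes> x0" using cB[of x0] K.mem_carrier[OF x0K] x0(2) by blast
  have h0K: "h0 \<in> K" using h0 B by blast
  obtain z0 where "semi z0 x0 h0" using x0(3) h0 generate.incl[of h0 B G] by blast
  then have w0: "weyl z0 x0 h0" using h0 x0K h0K by (auto simp: weyl_semi semi_def)
  define u where "u a b = x0 [^] (a::nat) \<otimes> h0 [^] (b::nat)" for a b
  have powK: "k [^] (n::nat) \<in> K" if "k \<in> K" for k n by (induction n) (use that in auto)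
  have uK: "u a b \<in> K" for a b using x0K h0K powK by (simp add: u_def)
  \<comment> \<open>A witness in \<open>K\<close> against the candidate \<open>u a b\<close>; if the
    candidate commutes with all of \<open>K\<close> up to scalars, just some element of
    \<open>K\<close>.\<close>
  define bad where "bad a b = (SOME g. g \<in> K \<and> ((\<exists>k \<in> K. \<not> (\<exists>z. semi z (u a b) k)) \<longrightarrow> \<not> (\<exists>z. semi z (u a b) g)))" for a b
  have bad: "bad a b \<in> K \<and> ((\<exists>k \<in> K. \<not> (\<exists>z. semi z (u a b) k)) \<longrightarrow> \<not> (\<exists>z. semi z (u a b) (bad a b)))" for a b
    unfolding bad_def by (rule someI_ex) (use K.one_closed in blast)
  define B' where "B' = {x0, h0} \<union> (\<lambda>(a, b). bad a b) ` ({..<q} \<times> {..<q})"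
  have B': "finite B'" "B' \<subseteq> K" using x0K h0K bad by (auto simp: B'_def)
  have cB': "y \<in> Z" if "y \<in> carrier G" "\<And>b. b \<in> B' \<Longrightarrow> y \<otimes> b = b \<otimes> y" for y
    by (rule weyl_cent_pair[OF w0]) (use that in \<open>auto simp: B'_def cent_def\<close>)
  obtain x1 where x1: "x1 \<in> generate G B'" "x1 \<notin> Z" "\<And>y. y \<in> generate G B' \<Longrightarrow> \<exists>z. semi z x1 y"
    using gen[OF B' cB'] by blast
  have in': "b \<in> generate G B'" if "b \<in> B'" for b using that by (rule generate.incl)
  have "\<exists>z. semi z x0 x1" "\<exists>z. semi z h0 x1"
    using x1(3)[OF in', of x0] x1(3)[OF in', of h0] semi_sym by (auto simp: B'_def)
  then obtain c a b where cab: "c \<in> Z" "a < q" "b < q" "x1 = c \<otimes> u a b"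
    using semi_pair[OF w0] unfolding u_def by metis
  \<comment> \<open>The element \<open>x1\<close> is a scalar multiple of this candidate, and the
    candidate's witness is among the generators \<open>B'\<close>; hence it has no counterexample in
    \<open>K\<close>.\<close>
  define x where "x = u a b"
  have xK: "x \<in> K" using uK by (simp add: x_def)
  have xc: "x \<in> carrier G" using xK by simp
  have xZ: "x \<notin> Z" using cab x1(2) by (auto simp: x_def)
  have "bad a b \<in> B'" using cab by (auto simp: B'_def)
  then have "\<exists>z. semi z x (bad a b)" using x1(3)[OF in'] cab semi_mult_Z_iff[OF cab(1) xc] by (auto simp: x_def)
  then have semiK: "\<exists>z. semi z x k" if "k \<in> K" for k using bad[of a b] that unfolding x_def by blast
  have "\<exists>h \<in> {x0, h0}. x \<otimes> h \<noteq> h \<otimes> x"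
    using weyl_cent_pair[OF w0, of x] xZ xc by (auto simp: cent_def)
  then obtain h where h: "h \<in> K" "x \<otimes> h \<noteq> h \<otimes> x" using x0K h0K by auto
  obtain w where "semi w x h" using semiK h by blast
  then have w: "weyl w x h" using h xK by (auto simp: weyl_semi semi_def)
  \<comment> \<open>Here local nilpotency is used once more, now for the subgroup generated by
    \<open>h\<close> and \<open>y\<close>.\<close>
  have "y \<in> torsion_cent x" if y: "y \<in> K" "y \<in> cent x" for y
  proof -
    have sub: "{h, y} \<subseteq> K" using h y by auto
    obtain n where "lower_central (G\<lparr>carrier := generate G {h, y}\<rparr>) n \<subseteq> {\<one>}"
      using locally_nilpotent_subgroupD(2)[OF K _ sub] by auto
    moreover have "subgroup (generate G {h, y}) G" using sub K.subset by (intro generate_is_subgroup) auto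
    ultimately show ?thesis using nilpotent_torsion[OF w y(2)] generate.incl[of _ "{h, y}" G] by blast
  qed
  then have "K \<subseteq> weyl_group x h" using subset_weyl_group[OF w Ks h(1)] semiK by blast
  then show ?thesis using w xK h by blast
qed

subsection \<open>Inclusions between Weyl groups\<close>

text \<open>A locally nilpotent enlargement contains \<open>x\<close> and \<open>h\<close>, whose
  common centralizer is \<open>Z\<close>; so \<open>{x, h}\<close> can serve as the finite set in
  the embedding theorem, and the enlargement lies in a Weyl group.\<close>

lemma maximal_weyl_group_iff:
  assumes weyl: "weyl w x h"
  shows "maximal_locally_nilpotent (weyl_group x h) G \<longleftrightarrow>
    (\<forall>w' x' h'. weyl w' x' h' \<longrightarrow> weyl_group x h \<subseteq> weyl_group x' h' \<longrightarrow> weyl_group x' h' \<subseteq> weyl_group x h)"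
    (is "?M \<longleftrightarrow> ?R")
proof
  assume ?M
  then show ?R unfolding maximal_locally_nilpotent_def
    using weyl_group_locally_nilpotent by blast
next
  assume R: ?R
  have nZ: "\<not> carrier G \<subseteq> Z"
  proof
    assume "carrier G \<subseteq> Z"
    then have "h \<otimes> x = x \<otimes> h" using weyl_closed[OF weyl] by (intro Z_central) auto
    then have "w \<otimes> (x \<otimes> h) = \<one> \<otimes> (x \<otimes> h)" using weyl by (simp add: weyl_def)
    then show False using weyl_closed[OF weyl] right_cancel[of "x \<otimes> h" w \<one>] by simp
  qed
  show ?M unfolding maximal_locally_nilpotent_def
  proof (intro conjI notI)
    show "locally_nilpotent_subgroup (weyl_group x h) G" by (rule weyl_group_locally_nilpotent[OF weyl])
    assume "\<exists>L. locally_nilpotent_subgroup L G \<and> weyl_group x h \<subset> L"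
    then obtain L where L: "locally_nilpotent_subgroup L G" "weyl_group x h \<subset> L" by blast
    have B: "{x, h} \<subseteq> L" using L(2) weyl_group_x[OF weyl] weyl_group_incl[OF weyl] by auto
    have "y \<in> Z" if "y \<in> carrier G" "\<And>b. b \<in> {x, h} \<Longrightarrow> y \<otimes> b = b \<otimes> y" for y
      using weyl_cent_pair[OF weyl, of y] that by (auto simp: cent_def)
    then obtain w' x' h' where "weyl w' x' h'" "L \<subseteq> weyl_group x' h'"
      using locally_nilpotent_subset_weyl_group[OF nZ L(1) _ B] by blast
    then show False using R L(2) by blast
  qed
qed

lemma maximal_weyl_group_conjg:
  assumes weyl: "weyl w x h" and g: "g \<in> carrier G"
    and max: "maximal_locally_nilpotent (weyl_group x h) G"
  shows "maximal_locally_nilpotent (weyl_group (conjg g x) (conjg g h)) G"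
  unfolding maximal_weyl_group_iff[OF weyl_conjg[OF weyl g]]
proof (intro allI impI)
  fix w' x' h' assume w': "weyl w' x' h'" and sub: "weyl_group (conjg g x) (conjg g h) \<subseteq> weyl_group x' h'"
  let ?c = "conjg (inv g)"
  have wg: "weyl_group (?c x') (?c h') = ?c ` weyl_group x' h'" using weyl_group_conjg[OF w'] g by simp
  have bk: "?c ` conjg g ` S = S" if "S \<subseteq> carrier G" for S
    using that g by (auto simp: image_iff conjg_by_inv subset_eq)
  have fk: "conjg g ` ?c ` S = S" if "S \<subseteq> carrier G" for S
    using that g by (auto simp: image_iff conjg_by_inv subset_eq)
  have c1: "weyl_group x h \<subseteq> carrier G" "weyl_group x' h' \<subseteq> carrier G"
    using subgroup.subset[OF weyl_group_subgroup] weyl w' by blast+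
  have "?c ` conjg g ` weyl_group x h \<subseteq> ?c ` weyl_group x' h'" using sub unfolding weyl_group_conjg[OF weyl g, symmetric] by blast
  then have "weyl_group x h \<subseteq> weyl_group (?c x') (?c h')" using bk c1 wg by simp
  then have "weyl_group (?c x') (?c h') \<subseteq> weyl_group x h"
    using max weyl_conjg[OF w', of "inv g"] g unfolding maximal_weyl_group_iff[OF weyl] by blast
  then have "conjg g ` ?c ` weyl_group x' h' \<subseteq> conjg g ` weyl_group x h" unfolding wg by blast
  then show "weyl_group x' h' \<subseteq> weyl_group (conjg g x) (conjg g h)"
    using fk c1 weyl_group_conjg[OF weyl g] by simp
qed

text \<open>For a Weyl pair with small \<open>x\<close> the group \<open>weyl_group x h\<close> is,
  modulo scalars, just generated by the commuting images of \<open>x\<close> and \<open>h\<close>,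
  elementary abelian of order \<open>q * q\<close>.\<close>

definition small :: "'a \<Rightarrow> bool" where
  "small x \<longleftrightarrow> (\<forall>y \<in> torsion_cent x. \<exists>z \<in> Z. \<exists>i. y = z \<otimes> x [^] (i::nat))"

text \<open>If \<open>x\<close> centralizes \<open>x'\<close>, the centralizers coincide and
  \<open>weyl_group_change\<close> identifies the groups. Otherwise \<open>x\<close> is itself a
  partner of \<open>x'\<close>: an element of \<open>torsion_cent x\<close> agrees with a power of
  \<open>x\<close> up to an element of \<open>cent x'\<close>, and this element also centralizes
  \<open>x\<close>, hence is scalar.\<close>

lemma weyl_group_subset_cases:
  assumes w: "weyl w x h" and w': "weyl w' x' h'" and sub: "weyl_group x h \<subseteq> weyl_group x' h'"
  shows "weyl_group x h = weyl_group x' h' \<or> x \<notin> cent x' \<and> small x"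
proof (cases "x \<in> cent x'")
  case True
  then have c: "cent x = cent x'" using weyl_cent_eq[OF w'] w by blast
  have "h \<notin> cent x" using w weyl_closed[OF w] by (auto simp: weyl_def cent_def)
  moreover have "h \<in> weyl_group x' h'" using weyl_group_incl[OF w] sub by blast
  ultimately have "weyl_group x' h = weyl_group x' h'" using weyl_group_change[OF w'] c by simp
  then show ?thesis using weyl_group_eqI[OF c] by simp
next
  case False
  have x: "x \<in> weyl_group x' h'" using weyl_group_x[OF w] sub by blast
  obtain w'' where w'': "weyl w'' x' x" using weyl_group_noncent[OF w' x False] by blast
  have "\<exists>z \<in> Z. \<exists>i. y = z \<otimes> x [^] (i::nat)" if y: "y \<in> torsion_cent x" for y
  proof -
    have yc: "y \<in> cent x" using y torsion_cent_cent[OF w] by blast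
    have "y \<in> weyl_group x' h'" using y weyl_group_incl[OF w] sub by blast
    then obtain j where j: "y \<otimes> inv (x [^] (j::nat)) \<in> cent x'"
      using weyl_group_semi[OF w'] semi_quotient[OF w''] by blast
    have "x [^] j \<in> cent x" using weyl_closed[OF w] weyl_x_cent[OF w] cent_pow by blast
    then have "y \<otimes> inv (x [^] j) \<in> cent x"
      using yc cent_subgroup[of x] weyl_closed[OF w] subgroup.m_closed subgroup.m_inv_closed by metis
    then have "y \<otimes> inv (x [^] j) \<in> Z" using weyl_cent_pair[OF w''] j by blast
    moreover have "y = y \<otimes> inv (x [^] j) \<otimes> x [^] j" using weyl_closed[OF w] cent_closed[OF yc] by (simp add: m_assoc)
    ultimately show ?thesis by blast
  qed
  then show ?thesis using False by (auto simp: small_def)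
qed

text \<open>All elements have the form \<open>z x^j h^i\<close>, so the group is abelian modulo
  scalars. The last conclusion later separates these groups from those containing an element with
  nonscalar \<open>q\<close>-th power.\<close>

lemma small_weyl_group_semi:
  assumes w: "weyl w x h" and small: "small x" and g: "g \<in> weyl_group x h"
  shows "\<exists>z. semi z h g" and "\<exists>z. semi z x g"
    and "g [^] q \<in> Z"
proof -
  obtain y i where y: "y \<in> torsion_cent x" "g = y \<otimes> h [^] (i::nat)" using g by (auto simp: weyl_group_def ext_def)
  obtain z j where z: "z \<in> Z" "y = z \<otimes> x [^] (j::nat)" using small y by (auto simp: small_def)
  have c: "x \<in> carrier G" "h \<in> carrier G" using weyl_closed[OF w] by auto
  have sz: "semi \<one> a z" "semi \<one> a a" if "a \<in> carrier G" for a using that z(1) Z_central[OF z(1) that] by (auto simp: semi_def)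
  show "\<exists>z. semi z h g"
    using semi_mult[OF semi_mult[OF sz(1) weyl_semi_pow[OF weyl_sym[OF w], of j]] semi_pow[OF sz(2), of h i]] c y z by auto
  show "\<exists>z. semi z x g"
    using semi_mult[OF semi_mult[OF sz(1) semi_pow[OF sz(2), of x j]] weyl_semi_pow[OF w, of i]] c y z by auto
  show "g [^] q \<in> Z"
  proof (cases "g \<in> cent x")
    case True
    then have "g \<in> torsion_cent x" using weyl_group_cent[OF w g] by blast
    then obtain z' j' where z': "z' \<in> Z" "g = z' \<otimes> x [^] (j'::nat)" using small by (auto simp: small_def)
    have "g [^] q = z' [^] q \<otimes> (x [^] (j' * q))"
      using z' c Z_central[of z' "x [^] j'"] by (simp add: pow_mult_distrib nat_pow_pow)
    moreover have "x [^] (j' * q) \<in> Z" using weyl_pow_Z[OF weyl_sym[OF w], of "j' * q"] by simp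
    ultimately show ?thesis using z' by simp
  next
    case False then show ?thesis using weyl_group_noncent_pow[OF w g] by blast
  qed
qed

text \<open>The outer group is abelian modulo scalars, so \<open>x'\<close> and \<open>h'\<close>
  commute up to scalars with \<open>x\<close> and \<open>h\<close>, and by \<open>semi_pair\<close>
  they already lie in the inner group.\<close>

lemma small_weyl_group_subset:
  assumes w: "weyl w x h" and w': "weyl w' x' h'" and sub: "weyl_group x h \<subseteq> weyl_group x' h'" and small: "small x'"
  shows "weyl_group x' h' \<subseteq> weyl_group x h"
proof -
  have xh: "x \<in> weyl_group x' h'" "h \<in> weyl_group x' h'"
    using weyl_group_x[OF w] weyl_group_incl[OF w] sub by blast+
  interpret H: subgroup "weyl_group x h" G by (rule weyl_group_subgroup[OF w])
  have pow: "a [^] (i::nat) \<in> weyl_group x h" if "a \<in> weyl_group x h" for a i by (induction i) (use that in auto)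
  have mem: "y \<in> weyl_group x h" if sx: "\<exists>z. semi z y x" and sh: "\<exists>z. semi z y h" for y
  proof -
    obtain c a b where "c \<in> Z" "y = c \<otimes> (x [^] (a::nat) \<otimes> h [^] (b::nat))"
      using sx sh semi_pair[OF w] semi_sym by meson
    then show ?thesis using pow weyl_group_x[OF w] weyl_group_incl[OF w] by auto
  qed
  have x': "x' \<in> weyl_group x h" using small_weyl_group_semi(2)[OF w' small] xh by (intro mem) auto
  have h': "h' \<in> weyl_group x h" using small_weyl_group_semi(1)[OF w' small] xh by (intro mem) auto
  have "torsion_cent x' \<subseteq> weyl_group x h"
  proof
    fix y assume "y \<in> torsion_cent x'"
    then obtain z i where "z \<in> Z" "y = z \<otimes> x' [^] (i::nat)" using small by (auto simp: small_def)
    then show "y \<in> weyl_group x h" using pow[OF x'] weyl_group_incl[OF w] by auto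
  qed
  then show ?thesis unfolding weyl_group_generate[OF w'] using h' H.subgroup_axioms
    by (intro generate_subgroup_incl) auto
qed

end

hide_const (open) Divisibility.prime up_ring.monom up_ring.coeff Polynomials.degree Polynomials.lead_coeff
no_notation fps_nth (infixl "$" 75)

section \<open>Roots of unity and Kummer polynomials\<close>

locale prime_root =
  fixes q :: nat and \<xi> :: "'a::field"
  assumes prime_q: "Factorial_Ring.prime q" and root: "\<xi> ^ q = 1" and root_neq: "\<xi> \<noteq> 1"
begin

lemma q_gt_1: "q > 1" using prime_q prime_gt_1_nat by blast

lemma q_pos: "q > 0" using q_gt_1 by simp

lemma root_neq_0: "\<xi> \<noteq> 0" using root q_pos by (metis power_0_left zero_neq_one not_gr_zero)

lemma root_pow_eq_1_iff: "\<xi> ^ i = 1 \<longleftrightarrow> q dvd i"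
proof
  assume "q dvd i" then show "\<xi> ^ i = 1" using root by (auto simp: power_mult elim!: dvdE)
next
  assume i: "\<xi> ^ i = 1"
  show "q dvd i"
  proof (rule ccontr)
    assume "\<not> q dvd i"
    then have cop: "coprime i q" using prime_imp_coprime[OF prime_q, of i] by (simp add: coprime_commute)
    have "i \<noteq> 0" using \<open>\<not> q dvd i\<close> by (metis dvd_0_right)
    then obtain a b where "i * a = q * b + 1" using bezout_nat[of i q] cop by (auto simp: coprime_iff_gcd_eq_1)
    then have "\<xi> ^ (i * a) = \<xi> ^ (q * b + 1)" by simp
    then show False using i root root_neq by (simp add: power_mult power_add)
  qed
qed

lemma root_pow_inj: "i < q \<Longrightarrow> j < q \<Longrightarrow> \<xi> ^ i = \<xi> ^ j \<longleftrightarrow> i = j"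
proof -
  have *: "i = j" if "i \<le> j" "j < q" "\<xi> ^ i = \<xi> ^ j" for i j
  proof -
    have "\<xi> ^ j = \<xi> ^ i * \<xi> ^ (j - i)" using that by (metis le_add_diff_inverse power_add)
    then have "q dvd (j - i)" using that root_neq_0 by (simp flip: root_pow_eq_1_iff)
    then show ?thesis using that by (auto dest!: dvd_imp_le)
  qed
  assume "i < q" "j < q" then show ?thesis using *[of i j] *[of j i] by (metis linear)
qed

text \<open>The polynomial \<open>t ^ q - 1\<close> has at most \<open>q\<close> roots, and the
  powers of \<xi> already provide \<open>q\<close> of them.\<close>

lemma pow_root_cancel: "z ^ q = a ^ q \<Longrightarrow> a \<noteq> 0 \<Longrightarrow> \<exists>i<q. z = a * \<xi> ^ i"
proof -
  assume z: "z ^ q = a ^ q" and a: "a \<noteq> 0"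
  let ?p = "monom 1 q - [:1:] :: 'a poly"
  have deg: "degree ?p = q" using q_pos by (intro antisym degree_diff_le le_degree) (auto simp: degree_monom_le coeff_eq_0)
  have p: "?p \<noteq> 0" using deg q_pos by auto
  have fin: "finite {x. poly ?p x = 0}" using p by (rule poly_roots_finite)
  have sub: "(\<lambda>i. \<xi> ^ i) ` {..<q} \<subseteq> {x. poly ?p x = 0}"
    using root by (auto simp: poly_monom) (metis power_mult mult.commute power_one)
  have "card ((\<lambda>i. \<xi> ^ i) ` {..<q}) = q" using root_pow_inj by (subst card_image) (auto simp: inj_on_def)
  then have "(\<lambda>i. \<xi> ^ i) ` {..<q} = {x. poly ?p x = 0}"
    using card_poly_roots_bound[OF p] deg card_mono[OF fin sub] by (intro card_subset_eq fin sub) auto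
  moreover have "poly ?p (z / a) = 0" using z a by (simp add: poly_monom power_divide)
  ultimately obtain i where "i < q" "z / a = \<xi> ^ i" by auto
  then show ?thesis using a by (auto simp: field_simps)
qed

text \<open>Both sides are monic of degree \<open>q\<close> and vanish at the \<open>q\<close>
  distinct points \<open>a * \<xi> ^ i\<close>.\<close>

lemma kummer_poly_factor: "monom 1 q - [:a ^ q:] = (\<Prod>i<q. [:- (a * \<xi> ^ i), 1:])" if "a \<noteq> 0"
proof (rule poly_eqI_degree_lead_coeff[where A = "(\<lambda>i. a * \<xi> ^ i) ` {..<q}" and n = q])
  show "degree (monom 1 q - [:a ^ q:]) \<le> q" by (intro degree_diff_le degree_monom_le) auto
  show "degree (\<Prod>i<q. [:- (a * \<xi> ^ i), 1:]) \<le> q" by (rule order_trans[OF degree_prod_sum_le]) auto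
  have "lead_coeff (\<Prod>i<q. [:- (a * \<xi> ^ i), 1:]) = 1" by (simp add: lead_coeff_prod)
  moreover have "degree (\<Prod>i<q. [:- (a * \<xi> ^ i), 1:]) = q" by (subst degree_prod_eq_sum_degree) auto
  ultimately show "poly.coeff (monom 1 q - [:a ^ q:]) q = poly.coeff (\<Prod>i<q. [:- (a * \<xi> ^ i), 1:]) q"
    using q_pos by (simp add: coeff_eq_0)
  show "q \<le> card ((\<lambda>i. a * \<xi> ^ i) ` {..<q})"
    using root_pow_inj that by (subst card_image) (auto simp: inj_on_def)
  fix x assume "x \<in> (\<lambda>i. a * \<xi> ^ i) ` {..<q}"
  then obtain i where i: "i < q" "x = a * \<xi> ^ i" by auto
  have "(\<xi> ^ i) ^ q = 1" using root by (metis power_mult mult.commute power_one)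
  then have "poly (monom 1 q - [:a ^ q:]) x = 0" using i by (simp add: poly_monom power_mult_distrib)
  moreover have "poly (\<Prod>i<q. [:- (a * \<xi> ^ i), 1:]) x = 0" using i by (auto simp: poly_prod)
  ultimately show "poly (monom 1 q - [:a ^ q:]) x = poly (\<Prod>i<q. [:- (a * \<xi> ^ i), 1:]) x" by simp
qed

text \<open>For odd \<open>q\<close> the exponent \<open>q * ((q - 1) div 2)\<close> is a multiple
  of \<open>q\<close>; for \<open>q = 2\<close> the root is \<open>-1\<close>. The sign reappears in
  \<open>det_I_mat\<close>.\<close>

lemma prod_root_pow: "(\<Prod>i<q. \<xi> ^ i) = (if q = 2 then -1 else 1)"
proof (cases "q = 2")
  case True
  then have "(\<xi> - 1) * (\<xi> + 1) = 0" using root by (simp add: algebra_simps power2_eq_square)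
  then have "\<xi> = -1" using root_neq by (simp add: eq_neg_iff_add_eq_0)
  then show ?thesis using True by (simp add: numeral_2_eq_2)
next
  case False
  then have odd: "odd q" using prime_q primes_dvd_imp_eq[of 2 q] by auto
  have "(\<Prod>i<q. \<xi> ^ i) = \<xi> ^ (\<Sum>i<q. i)" by (simp add: power_sum)
  also have "(\<Sum>i<q. i) = q * ((q - 1) div 2)"
  proof -
    obtain b where b: "q = Suc (2 * b)" using odd by (auto elim: oddE)
    have "(\<Sum>i<Suc (2 * b). i) = Suc (2 * b) * b" by (induction b) auto
    then show ?thesis by (simp add: b)
  qed
  finally show ?thesis using False root by (simp add: power_mult)
qed

end

interpretation to_ac: field_hom to_ac
  by unfold_locales auto

interpretation to_ac: inj_comm_ring_hom to_ac
  by unfold_locales auto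

interpretation to_ac_poly: map_poly_inj_comm_ring_hom to_ac ..

lemma map_poly_to_ac_kummer: "map_poly to_ac (monom 1 n - [:c:]) = monom 1 n - [:to_ac c:]"
  by (simp add: to_ac_poly.hom_minus to_ac.map_poly_hom_monom to_ac.map_poly_pCons_hom)

lemma prime_root_to_ac: "prime_root q \<xi> \<Longrightarrow> prime_root q (to_ac \<xi>)"
  unfolding prime_root_def by (metis to_ac_1 to_ac_eq_iff to_ac_power)

lemma alg_closed_root_exists: "n > 0 \<Longrightarrow> \<exists>a :: 'a::alg_closed_field. a ^ n = c"
proof -
  assume n: "n > 0"
  let ?p = "monom 1 n - [:c:]"
  have "degree ?p > 0" using n by (intro le_degree[THEN less_le_trans[OF n]]) (simp add: coeff_eq_0)
  then obtain a where "poly ?p a = 0" using alg_closed_imp_poly_has_root by blast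
  then show ?thesis by (auto simp: poly_monom)
qed

lemma poly_prod_mset_root: "x \<in># A \<Longrightarrow> poly (\<Prod>x\<in>#A. [:-x, 1:]) (x :: 'a::field) = 0"
  by (induction A) auto

text \<open>The constant coefficient of a factor of degree \<open>n\<close> of \<open>t\<^sup>q - \<alpha>\<close> is a product of \<open>n\<close>
  roots up to sign, so its \<open>q\<close>-th power is \<open>\<alpha>\<^sup>n\<close> up to sign.\<close>

lemma kummer_degree:
  fixes \<alpha> :: "'a::field" and p :: "'a poly"
  assumes q: "Factorial_Ring.prime q" and \<alpha>: "\<And>c. c ^ q \<noteq> \<alpha>"
    and p: "degree p < q" and a: "a ^ q = to_ac \<alpha>" "poly (map_poly to_ac p) a = 0"
  shows "p = 0"
proof (rule ccontr)
  assume "p \<noteq> 0"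
  define P where "P r \<longleftrightarrow> r \<noteq> 0 \<and> poly (map_poly to_ac r) a = 0" for r
  have "P p" using \<open>p \<noteq> 0\<close> a by (simp add: P_def)
  \<comment> \<open>The minimal polynomial of \<open>a\<close> up to a constant factor. It divides
    \<open>?K\<close>, because the remainder also vanishes at \<open>a\<close> and has smaller
    degree.\<close>
  define r where "r = arg_min degree P"
  have r: "P r" "\<And>s. P s \<Longrightarrow> degree r \<le> degree s"
    unfolding r_def using \<open>P p\<close> by (auto intro: arg_min_natI arg_min_nat_le)
  define n where "n = degree r"
  have nq: "n < q" using r(2)[OF \<open>P p\<close>] p by (simp add: n_def)
  have r0: "r \<noteq> 0" using r by (simp add: P_def)
  let ?K = "monom 1 q - [:\<alpha>:]"
  have "\<not> P (?K mod r)"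
  proof
    assume P: "P (?K mod r)"
    then have "degree (?K mod r) < degree r" using degree_mod_less[OF r0, of ?K] by (auto simp: P_def)
    then show False using r(2)[OF P] by simp
  qed
  moreover have "poly (map_poly to_ac (?K mod r)) a = 0"
  proof -
    have "map_poly to_ac ?K = map_poly to_ac (?K div r * r + ?K mod r)" by simp
    then have "map_poly to_ac ?K = map_poly to_ac (?K div r) * map_poly to_ac r + map_poly to_ac (?K mod r)"
      by (simp only: to_ac_poly.hom_add to_ac_poly.hom_mult)
    moreover have "poly (map_poly to_ac ?K) a = 0"
      using a by (simp add: map_poly_to_ac_kummer poly_monom)
    ultimately show ?thesis using r by (simp add: P_def)
  qed
  ultimately have "?K mod r = 0" by (simp add: P_def)
  then have dvd: "r dvd ?K" by (simp add: mod_eq_0_iff_dvd)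
  define R where "R = map_poly to_ac r"
  have R: "R \<noteq> 0" "degree R = n" "lead_coeff R = to_ac (lead_coeff r)" using r0 by (simp_all add: R_def n_def)
  obtain A where A: "size A = n" "R = smult (lead_coeff R) (\<Prod>x\<in>#A. [:-x, 1:])"
    using alg_closed_imp_factorization[OF R(1)] R by auto
  have root: "x ^ q = to_ac \<alpha>" if "x \<in># A" for x
  proof -
    have "poly (\<Prod>x\<in>#A. [:-x, 1:]) x = 0" using that by (rule poly_prod_mset_root)
    then have "poly R x = 0" using arg_cong[OF A(2), of "\<lambda>r. poly r x"] by simp
    moreover have "R dvd map_poly to_ac ?K"
      using dvd unfolding R_def by (auto elim!: dvdE simp: to_ac_poly.hom_mult)
    ultimately have "poly (map_poly to_ac ?K) x = 0" by (auto elim!: dvdE)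
    then show ?thesis by (simp add: map_poly_to_ac_kummer poly_monom)
  qed
  have "n > 0"
  proof (rule ccontr)
    assume "\<not> n > 0"
    then obtain c where "r = [:c:]" unfolding n_def by (auto elim: degree_eq_zeroE)
    then show False using r by (simp add: P_def to_ac.map_poly_pCons_hom)
  qed
  have "poly R 0 = lead_coeff R * (\<Prod>x\<in>#A. - x)"
    using arg_cong[OF A(2), of "\<lambda>r. poly r 0"] by (simp add: poly_prod_mset image_mset.compositionality comp_def)
  moreover have "(\<Prod>x\<in>#A. - x) ^ q = ((- 1) ^ q * to_ac \<alpha>) ^ size A"
    using root
  proof (induction A)
    case (add x A)
    then show ?case by (simp add: power_mult_distrib power_minus[of "x * (\<Prod>x\<in>#A. - x)" q])
  qed simp
  ultimately have "(poly R 0 / lead_coeff R) ^ q = ((- 1) ^ q * to_ac \<alpha>) ^ n"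
    using R(1) A(1) by simp
  moreover have "poly R 0 = to_ac (poly r 0)" by (simp add: R_def poly_0_coeff_0)
  ultimately have "to_ac ((poly r 0 / lead_coeff r) ^ q) = to_ac (((- 1) ^ q * \<alpha>) ^ n)" using R(3) by simp
  then have "(poly r 0 / lead_coeff r) ^ q = ((- 1) ^ n) ^ q * \<alpha> ^ n"
    by (simp only: to_ac_eq_iff power_mult_distrib) (simp add: mult.commute flip: power_mult)
  then have 1: "((- 1) ^ n * (poly r 0 / lead_coeff r)) ^ q = (((- 1) ^ n) ^ q * ((- 1) ^ n) ^ q) * \<alpha> ^ n"
    by (simp only: power_mult_distrib mult.assoc)
  have "((- 1 :: 'a) ^ n) ^ q * ((- 1) ^ n) ^ q = ((- 1 * - 1) ^ n) ^ q" by (simp only: power_mult_distrib)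
  also have "\<dots> = 1" by simp
  finally have 2: "((- 1 :: 'a) ^ n) ^ q * ((- 1) ^ n) ^ q = 1" .
  define c where "c = (- 1) ^ n * (poly r 0 / lead_coeff r)"
  have c: "c ^ q = \<alpha> ^ n" using 1 unfolding 2 c_def by simp
  have "\<not> q dvd n" using nq \<open>n > 0\<close> by (auto dest: dvd_imp_le)
  then have "coprime n q" using prime_imp_coprime[OF q, of n] by (simp add: coprime_commute)
  \<comment> \<open>From \<open>c ^ q = \<alpha> ^ n\<close> with \<open>n\<close> prime to
    \<open>q\<close>, Bezout coefficients produce a \<open>q\<close>-th root of \<alpha> itself,
    namely \<open>c ^ s / \<alpha> ^ t\<close>.\<close>
  then obtain s t where st: "n * s = q * t + 1" using bezout_nat[of n q] \<open>n > 0\<close> by (auto simp: coprime_iff_gcd_eq_1)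
  have \<alpha>0: "\<alpha> \<noteq> 0" using \<alpha>[of 0] q by (auto simp: power_0_left)
  have "(c ^ s / \<alpha> ^ t) ^ q = (\<alpha> ^ n) ^ s / \<alpha> ^ (q * t)"
    using c by (simp add: power_divide flip: power_mult) (simp add: power_mult mult.commute flip: c)
  also have "\<dots> = \<alpha>" using st \<alpha>0 by (simp flip: power_mult)
  finally show False using \<alpha> by blast
qed

section \<open>Cyclic vectors and eigenvectors\<close>

text \<open>The value of \<open>p\<close> at \<open>A\<close> applied to \<open>v\<close>, by
  Horner's scheme on vectors: the module structure over the polynomial ring that \<open>A\<close>
  defines.\<close>

definition poly_act :: "'a::field mat \<Rightarrow> 'a poly \<Rightarrow> 'a vec \<Rightarrow> 'a vec" where
  "poly_act A p v = fold_coeffs (\<lambda>c u. c \<cdot>\<^sub>v v + A *\<^sub>v u) p (0\<^sub>v (dim_vec v))"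

lemma poly_act_0: "v \<in> carrier_vec n \<Longrightarrow> poly_act A 0 v = 0\<^sub>v n"
  by (simp add: poly_act_def)

lemma smult_zero_vec: "v \<in> carrier_vec n \<Longrightarrow> (0::'a::field) \<cdot>\<^sub>v v = 0\<^sub>v n"
  by (intro eq_vecI) auto

lemma mult_mat_zero_vec: "A \<in> carrier_mat m n \<Longrightarrow> A *\<^sub>v 0\<^sub>v n = 0\<^sub>v m"
  by (intro eq_vecI) auto

lemma poly_act_pCons:
  assumes "A \<in> carrier_mat n n" "v \<in> carrier_vec n"
  shows "poly_act A (pCons c p) v = c \<cdot>\<^sub>v v + A *\<^sub>v poly_act A p v"
proof (cases "c = 0 \<and> p = 0")
  case True
  then show ?thesis using assms by (simp add: poly_act_0[OF assms(2)] mult_mat_zero_vec[OF assms(1)] smult_zero_vec[OF assms(2)])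
next
  case False
  then show ?thesis by (cases "c = 0") (auto simp: poly_act_def)
qed

lemma poly_act_closed:
  assumes "A \<in> carrier_mat n n" "v \<in> carrier_vec n"
  shows "poly_act A p v \<in> carrier_vec n"
proof (induction p)
  case 0 then show ?case using poly_act_0[OF assms(2)] by simp
next
  case (pCons a p) then show ?case using poly_act_pCons[OF assms] assms by simp
qed

lemma poly_act_add:
  assumes A: "A \<in> carrier_mat n n" and v: "v \<in> carrier_vec n"
  shows "poly_act A (p + r) v = poly_act A p v + poly_act A r v"
proof (induction p r rule: poly_induct2)
  case 0 then show ?case using v by (simp add: poly_act_0[OF v])
next
  case (pCons a p b r)
  have c: "poly_act A p v \<in> carrier_vec n" "poly_act A r v \<in> carrier_vec n" using poly_act_closed[OF A v] by auto
  have "A *\<^sub>v (poly_act A p v + poly_act A r v) = A *\<^sub>v poly_act A p v + A *\<^sub>v poly_act A r v"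
    by (rule mult_add_distrib_mat_vec[OF A c])
  then show ?case using pCons c A v
    by (simp add: poly_act_pCons[OF A v]) (intro eq_vecI, auto simp: algebra_simps)
qed

lemma poly_act_smult:
  assumes A: "A \<in> carrier_mat n n" and v: "v \<in> carrier_vec n"
  shows "poly_act A (Polynomial.smult c p) v = c \<cdot>\<^sub>v poly_act A p v"
proof (induction p)
  case 0 then show ?case using poly_act_0[OF v, of A] by (auto intro!: eq_vecI)
next
  case (pCons a p)
  have p: "poly_act A p v \<in> carrier_vec n" by (rule poly_act_closed[OF A v])
  show ?case using A v p
    by (simp add: poly_act_pCons[OF A v] pCons mult_mat_vec[OF A p] smult_add_distrib_vec[of _ n] smult_smult_assoc)
qed

lemma poly_act_mult:
  assumes A: "A \<in> carrier_mat n n" and v: "v \<in> carrier_vec n"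
  shows "poly_act A (p * r) v = poly_act A p (poly_act A r v)"
proof (induction p)
  case 0 then show ?case using poly_act_0[OF v] poly_act_0[OF poly_act_closed[OF A v]] by simp
next
  case (pCons a p)
  have r: "poly_act A r v \<in> carrier_vec n" by (rule poly_act_closed[OF A v])
  have pr: "poly_act A p (poly_act A r v) \<in> carrier_vec n" by (rule poly_act_closed[OF A r])
  have "poly_act A (pCons a p * r) v = a \<cdot>\<^sub>v poly_act A r v + (0 \<cdot>\<^sub>v v + A *\<^sub>v poly_act A p (poly_act A r v))"
    by (simp add: mult_pCons_left poly_act_add[OF A v] poly_act_smult[OF A v] poly_act_pCons[OF A v] pCons)
  also have "0 \<cdot>\<^sub>v v + A *\<^sub>v poly_act A p (poly_act A r v) = A *\<^sub>v poly_act A p (poly_act A r v)"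
    using A v pr by auto
  finally show ?case by (simp add: poly_act_pCons[OF A r])
qed

lemma pow_mat_Suc_left: "A \<in> carrier_mat n n \<Longrightarrow> A ^\<^sub>m Suc k = A * A ^\<^sub>m k"
proof (induction k)
  case (Suc k)
  then have "A ^\<^sub>m Suc (Suc k) = (A * A ^\<^sub>m k) * A" by simp
  also have "\<dots> = A * (A ^\<^sub>m k * A)" using Suc.prems by (intro assoc_mult_mat[of _ n n _ n _ n]) auto
  finally show ?case by simp
qed auto

lemma pow_mat_vec_Suc:
  "A \<in> carrier_mat n n \<Longrightarrow> v \<in> carrier_vec n \<Longrightarrow> A ^\<^sub>m Suc k *\<^sub>v v = A *\<^sub>v (A ^\<^sub>m k *\<^sub>v v)"
  by (simp only: pow_mat_Suc_left) (rule assoc_mult_mat_vec, auto)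

lemma poly_act_monom:
  assumes A: "A \<in> carrier_mat n n" and v: "v \<in> carrier_vec n"
  shows "poly_act A (monom c k) v = c \<cdot>\<^sub>v (A ^\<^sub>m k *\<^sub>v v)"
proof (induction k)
  case 0
  have "poly_act A [:c:] v = c \<cdot>\<^sub>v v"
    using A v by (simp add: poly_act_pCons[OF A v] poly_act_0[OF v] mult_mat_zero_vec[OF A])
  then show ?case using A v by (simp add: monom_0)
next
  case (Suc k)
  have k: "A ^\<^sub>m k *\<^sub>v v \<in> carrier_vec n" by (rule mult_mat_vec_carrier[OF pow_carrier_mat[OF A] v])
  have "poly_act A (monom c (Suc k)) v = 0 \<cdot>\<^sub>v v + A *\<^sub>v (c \<cdot>\<^sub>v (A ^\<^sub>m k *\<^sub>v v))"
    by (simp add: monom_Suc poly_act_pCons[OF A v] Suc)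
  also have "\<dots> = c \<cdot>\<^sub>v (A *\<^sub>v (A ^\<^sub>m k *\<^sub>v v))"
    using A v k by (simp add: mult_mat_vec[OF A k] smult_zero_vec[OF v] del: index_mult_mat_vec)
  finally show ?case using pow_mat_vec_Suc[OF A v] by simp
qed

lemma poly_act_kummer:
  assumes A: "A \<in> carrier_mat n n" and v: "v \<in> carrier_vec n" and eq: "A ^\<^sub>m k *\<^sub>v v = c \<cdot>\<^sub>v v"
  shows "poly_act A (monom 1 k - [:c:]) v = 0\<^sub>v n"
proof -
  have "poly_act A (monom 1 k + monom (- c) 0) v = 1 \<cdot>\<^sub>v (A ^\<^sub>m k *\<^sub>v v) + (- c) \<cdot>\<^sub>v (A ^\<^sub>m 0 *\<^sub>v v)"
    by (simp only: poly_act_add[OF A v] poly_act_monom[OF A v])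
  also have "\<dots> = 0\<^sub>v n" using A v unfolding eq by auto
  also have "monom 1 k + monom (- c) 0 = monom 1 k - [:c:]" by (simp add: monom_0)
  finally show ?thesis .
qed

lemma poly_act_linear_factor:
  assumes A: "A \<in> carrier_mat n n" and v: "v \<in> carrier_vec n"
  shows "poly_act A [:- \<mu>, 1:] v = A *\<^sub>v v + (- \<mu>) \<cdot>\<^sub>v v"
proof -
  have "poly_act A (monom 1 1 + monom (- \<mu>) 0) v = 1 \<cdot>\<^sub>v (A ^\<^sub>m 1 *\<^sub>v v) + (- \<mu>) \<cdot>\<^sub>v (A ^\<^sub>m 0 *\<^sub>v v)"
    by (simp only: poly_act_add[OF A v] poly_act_monom[OF A v])
  then show ?thesis using A v by (simp add: monom_0 monom_Suc)
qed

lemma poly_act_eigenvector: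
  assumes A: "A \<in> carrier_mat n n" and v: "v \<in> carrier_vec n" and ev: "A *\<^sub>v v = \<mu> \<cdot>\<^sub>v v"
  shows "poly_act A p v = poly p \<mu> \<cdot>\<^sub>v v"
proof (induction p)
  case 0 then show ?case using poly_act_0[OF v, of A] v by auto
next
  case (pCons a p)
  have "poly_act A (pCons a p) v = a \<cdot>\<^sub>v v + poly p \<mu> \<cdot>\<^sub>v (\<mu> \<cdot>\<^sub>v v)"
    by (simp add: poly_act_pCons[OF A v] pCons mult_mat_vec[OF A v] ev)
  then show ?case using v by (auto intro!: eq_vecI simp: algebra_simps)
qed

lemma poly_act_vec_smult_add:
  assumes A: "A \<in> carrier_mat n n" and v: "v \<in> carrier_vec n" and w: "w \<in> carrier_vec n"
  shows "poly_act A p (v + w) = poly_act A p v + poly_act A p w"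
    and "poly_act A p (c \<cdot>\<^sub>v v) = c \<cdot>\<^sub>v poly_act A p v"
    and "poly_act A p (A *\<^sub>v v) = A *\<^sub>v poly_act A p v"
proof -
  have vw: "v + w \<in> carrier_vec n" "c \<cdot>\<^sub>v v \<in> carrier_vec n" "A *\<^sub>v v \<in> carrier_vec n" using A v w by auto
  show "poly_act A p (v + w) = poly_act A p v + poly_act A p w"
  proof (induction p)
    case 0 then show ?case using poly_act_0[OF vw(1)] poly_act_0[OF v] poly_act_0[OF w] by simp
  next
    case (pCons a p)
    have c: "poly_act A p v \<in> carrier_vec n" "poly_act A p w \<in> carrier_vec n" using poly_act_closed[OF A] v w by auto
    show ?case using A v w c mult_add_distrib_mat_vec[OF A c]
      by (simp add: poly_act_pCons[OF A] vw pCons) (intro eq_vecI, auto simp: algebra_simps)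
  qed
  show "poly_act A p (c \<cdot>\<^sub>v v) = c \<cdot>\<^sub>v poly_act A p v"
  proof (induction p)
    case 0 then show ?case using poly_act_0[OF vw(2), of A] poly_act_0[OF v, of A] by auto
  next
    case (pCons a p)
    have p: "poly_act A p v \<in> carrier_vec n" using poly_act_closed[OF A v] .
    show ?case using A v p mult_mat_vec[OF A p, of c]
      by (simp add: poly_act_pCons[OF A] vw pCons) (intro eq_vecI, auto simp: algebra_simps)
  qed
  have "poly_act A p (poly_act A (monom 1 1) v) = poly_act A (monom 1 1) (poly_act A p v)"
    by (simp only: poly_act_mult[OF A v, symmetric] mult.commute)
  then show "poly_act A p (A *\<^sub>v v) = A *\<^sub>v poly_act A p v"
    using A v poly_act_closed[OF A v, of p] by (simp add: poly_act_monom[OF A])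
qed

text \<open>The linear factors are peeled off one at a time: either the last factor kills
  \<open>u\<close>, which is then an eigenvector, or it maps \<open>u\<close> to a nonzero element
  of \<open>W\<close> killed by a shorter product.\<close>

lemma eigenvector_in_invariant_subspace:
  assumes A: "A \<in> carrier_mat n n" and W: "W \<subseteq> carrier_vec n"
    and inv: "\<And>w c. w \<in> W \<Longrightarrow> A *\<^sub>v w + c \<cdot>\<^sub>v w \<in> W"
  shows "u \<in> W \<Longrightarrow> u \<noteq> 0\<^sub>v n \<Longrightarrow> poly_act A (\<Prod>i<(m::nat). [:- \<mu> i, 1:]) u = 0\<^sub>v n \<Longrightarrow>
    \<exists>i<m. \<exists>w \<in> W. w \<noteq> 0\<^sub>v n \<and> A *\<^sub>v w = \<mu> i \<cdot>\<^sub>v w"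
proof (induction m arbitrary: u)
  case 0
  have u: "u \<in> carrier_vec n" using 0 W by auto
  have "poly_act A [:1:] u = u"
    using A u by (simp add: poly_act_pCons[OF A u] poly_act_0[OF u] mult_mat_zero_vec[OF A])
  then show ?case using 0 by (simp add: one_pCons)
next
  case (Suc m)
  have u: "u \<in> carrier_vec n" using Suc.prems W by auto
  define u' where "u' = poly_act A [:- \<mu> m, 1:] u"
  have u': "u' = A *\<^sub>v u + (- \<mu> m) \<cdot>\<^sub>v u" unfolding u'_def by (rule poly_act_linear_factor[OF A u])
  have z: "poly_act A (\<Prod>i<m. [:- \<mu> i, 1:]) u' = 0\<^sub>v n"
    using Suc.prems(3) by (simp only: prod.lessThan_Suc poly_act_mult[OF A u] u'_def)
  show ?case
  proof (cases "u' = 0\<^sub>v n")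
    case True
    have Au: "A *\<^sub>v u \<in> carrier_vec n" using A u by auto
    have "A *\<^sub>v u = \<mu> m \<cdot>\<^sub>v u"
    proof (rule eq_vecI)
      show "dim_vec (A *\<^sub>v u) = dim_vec (\<mu> m \<cdot>\<^sub>v u)" using Au u A by simp
      fix i assume i: "i < dim_vec (\<mu> m \<cdot>\<^sub>v u)"
      have "(A *\<^sub>v u + (- \<mu> m) \<cdot>\<^sub>v u) $ i = 0" using True i u unfolding u' by simp
      then show "(A *\<^sub>v u) $ i = (\<mu> m \<cdot>\<^sub>v u) $ i" using carrier_vecD[OF Au] carrier_vecD[OF u] i by (simp del: index_mult_mat_vec dim_mult_mat_vec)
    qed
    then show ?thesis using Suc.prems by blast
  next
    case False
    have "u' \<in> W" unfolding u' by (rule inv[OF Suc.prems(1)])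
    from Suc.IH[OF this False z] show ?thesis using less_SucI by blast
  qed
qed

text \<open>The polynomial \<open>t ^ q - a ^ q\<close> kills \<open>u\<close> and splits into
  linear factors over the given field.\<close>

lemma (in prime_root) kummer_eigenvector:
  assumes A: "A \<in> carrier_mat n n" and W: "W \<subseteq> carrier_vec n"
    and inv: "\<And>w c. w \<in> W \<Longrightarrow> A *\<^sub>v w + c \<cdot>\<^sub>v w \<in> W"
    and u: "u \<in> W" "u \<noteq> 0\<^sub>v n" and eq: "A ^\<^sub>m q *\<^sub>v u = a ^ q \<cdot>\<^sub>v u" and a: "a \<noteq> 0"
  shows "\<exists>i<q. \<exists>w \<in> W. w \<noteq> 0\<^sub>v n \<and> A *\<^sub>v w = (a * \<xi> ^ i) \<cdot>\<^sub>v w"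
  using poly_act_kummer[OF A _ eq] u W
  by (intro eigenvector_in_invariant_subspace[OF A W inv u]) (auto simp flip: kummer_poly_factor[OF a])

subsection \<open>The matrices \<open>I_mat\<close> and Krylov bases\<close>

lemma I_mat_carrier: "n > 0 \<Longrightarrow> I_mat n \<alpha> \<in> carrier_mat n n"
  by (rule carrier_matI) (simp_all add: I_mat_def)

lemma I_mat_index:
  assumes "i < n" "j < n"
  shows "I_mat n \<alpha> $$ (i, j) = (if j = Suc i then 1 else if Suc i = n \<and> j = 0 then \<alpha> else 0)"
  using assms unfolding I_mat_def by (auto simp: not_less less_Suc_eq)

lemma mult_I_mat_index:
  assumes M: "M \<in> carrier_mat m n" and i: "i < m" "j < n"
  shows "(M * I_mat n \<alpha>) $$ (i, j) = (if j = 0 then \<alpha> * M $$ (i, n - 1) else M $$ (i, j - 1))"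
proof -
  have n: "n > 0" using i by simp
  note I = I_mat_carrier[OF n, of \<alpha>]
  have "(M * I_mat n \<alpha>) $$ (i, j) = (\<Sum>k = 0..<n. M $$ (i, k) * I_mat n \<alpha> $$ (k, j))"
    using M I i by (simp add: scalar_prod_def)
  also have "\<dots> = (\<Sum>k = 0..<n. if k = (if j = 0 then n - 1 else j - 1) then
      (if j = 0 then \<alpha> * M $$ (i, k) else M $$ (i, k)) else 0)"
    using i by (intro sum.cong refl) (auto simp: I_mat_index)
  also have "\<dots> = (if j = 0 then \<alpha> * M $$ (i, n - 1) else M $$ (i, j - 1))"
    using i by (subst sum.delta) auto
  finally show ?thesis .
qed

lemma I_mat_mult_index:
  assumes M: "M \<in> carrier_mat n m" and i: "i < n" "j < m"
  shows "(I_mat n \<alpha> * M) $$ (i, j) = (if Suc i = n then \<alpha> * M $$ (0, j) else M $$ (Suc i, j))"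
proof -
  have n: "n > 0" using i by simp
  note I = I_mat_carrier[OF n, of \<alpha>]
  have "(I_mat n \<alpha> * M) $$ (i, j) = (\<Sum>k = 0..<n. I_mat n \<alpha> $$ (i, k) * M $$ (k, j))"
    using M I i by (simp add: scalar_prod_def)
  also have "\<dots> = (\<Sum>k = 0..<n. if k = (if Suc i = n then 0 else Suc i) then
      (if Suc i = n then \<alpha> * M $$ (k, j) else M $$ (k, j)) else 0)"
    using i by (intro sum.cong refl) (auto simp: I_mat_index)
  also have "\<dots> = (if Suc i = n then \<alpha> * M $$ (0, j) else M $$ (Suc i, j))"
    using i by (subst sum.delta) auto
  finally show ?thesis .
qed

text \<open>The columns are \<open>h\<close>-powers of \<open>v\<close> in decreasing order, so that \<open>h\<close> becomes \<open>I_mat\<close> in this basis.\<close>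

definition krylov :: "nat \<Rightarrow> 'a::field mat \<Rightarrow> 'a vec \<Rightarrow> 'a mat" where
  "krylov n h v = mat n n (\<lambda>(i, j). (h ^\<^sub>m (n - 1 - j) *\<^sub>v v) $ i)"

lemma krylov_carrier [simp]: "krylov n h v \<in> carrier_mat n n"
  by (simp add: krylov_def)

lemma krylov_col:
  assumes "h \<in> carrier_mat n n" "v \<in> carrier_vec n" "j < n"
  shows "col (krylov n h v) j = h ^\<^sub>m (n - 1 - j) *\<^sub>v v"
  using assms by (intro eq_vecI) (auto simp: krylov_def simp del: index_mult_mat_vec)

lemma mult_krylov_index:
  assumes "A \<in> carrier_mat n n" "h \<in> carrier_mat n n" "v \<in> carrier_vec n" "i < n" "j < n"
  shows "(A * krylov n h v) $$ (i, j) = (A *\<^sub>v (h ^\<^sub>m (n - 1 - j) *\<^sub>v v)) $ i"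
proof -
  have "(A * krylov n h v) $$ (i, j) = row A i \<bullet> col (krylov n h v) j"
    using assms carrier_matD[OF krylov_carrier[of n h v]] by (intro index_mult_mat) auto
  then show ?thesis using assms by (simp add: krylov_col)
qed

lemma krylov_I_mat:
  assumes h: "h \<in> carrier_mat n n" and v: "v \<in> carrier_vec n" and n: "n > 0"
    and hn: "h ^\<^sub>m n *\<^sub>v v = \<beta> \<cdot>\<^sub>v v"
  shows "h * krylov n h v = krylov n h v * I_mat n \<beta>"
proof (rule eq_matI)
  note I = I_mat_carrier[OF n, of \<beta>]
  show "dim_row (h * krylov n h v) = dim_row (krylov n h v * I_mat n \<beta>)"
    "dim_col (h * krylov n h v) = dim_col (krylov n h v * I_mat n \<beta>)" using h I by (auto simp: krylov_def)
  fix i j assume "i < dim_row (krylov n h v * I_mat n \<beta>)" "j < dim_col (krylov n h v * I_mat n \<beta>)"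
  then have ij: "i < n" "j < n" using I by (auto simp: krylov_def)
  have "(h * krylov n h v) $$ (i, j) = (h ^\<^sub>m Suc (n - 1 - j) *\<^sub>v v) $ i"
    using pow_mat_vec_Suc[OF h v] mult_krylov_index[OF h h v ij] by simp
  also have "\<dots> = (krylov n h v * I_mat n \<beta>) $$ (i, j)"
  proof (cases "j = 0")
    case True
    then have "(h ^\<^sub>m Suc (n - 1 - j) *\<^sub>v v) $ i = (\<beta> \<cdot>\<^sub>v v) $ i" using n by (simp flip: hn)
    also have "\<dots> = \<beta> * krylov n h v $$ (i, n - 1)" using ij v h by (simp add: krylov_def)
    finally show ?thesis using mult_I_mat_index[OF krylov_carrier ij, of h v \<beta>] True by simp
  next
    case False
    then have "Suc (n - 1 - j) = n - 1 - (j - 1)" using ij by auto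
    then show ?thesis using mult_I_mat_index[OF krylov_carrier ij, of h v \<beta>] False ij by (simp add: krylov_def)
  qed
  finally show "(h * krylov n h v) $$ (i, j) = (krylov n h v * I_mat n \<beta>) $$ (i, j)" .
qed

section \<open>Weyl pairs of matrices\<close>

lemma carrier_GL: "A \<in> carrier (GL n) \<longleftrightarrow> A \<in> carrier_mat n n \<and> det A \<noteq> 0"
  using unit_imp_det_non_zero[of A n "()"] det_non_zero_imp_unit[of A n "()"]
  by (auto simp: GL_def units_of_carrier Units_def ring_mat_simps)

lemma GL_simps [simp]: "x \<otimes>\<^bsub>GL n\<^esub> y = x * y" "\<one>\<^bsub>GL n\<^esub> = 1\<^sub>m n"
  by (simp_all add: GL_def units_of_mult units_of_one ring_mat_simps)

lemma group_GL: "group (GL n)"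
  unfolding GL_def by (intro monoid.units_group ring.is_monoid ring_mat)

lemma GL_carrier_mat: "A \<in> carrier (GL n) \<Longrightarrow> A \<in> carrier_mat n n"
  by (simp add: carrier_GL)

lemma GL_pow: "A \<in> carrier (GL n) \<Longrightarrow> A [^]\<^bsub>GL n\<^esub> k = A ^\<^sub>m k"
proof (induction k)
  case 0
  then show ?case using carrier_matD(1)[of A n n] by (simp add: carrier_GL)
next
  case (Suc k)
  then show ?case by (simp add: nat_pow_Suc)
qed

lemma GL_inverse:
  fixes g :: "'a::field mat"
  assumes "g \<in> carrier_mat n n" "det g \<noteq> 0"
  shows "\<exists>g'. g' \<in> carrier_mat n n \<and> g * g' = 1\<^sub>m n \<and> g' * g = 1\<^sub>m n"
  using det_non_zero_imp_unit[OF assms, of "()"] by (auto simp: Units_def ring_mat_simps)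

lemma smult_zero_vec_right: "(c :: 'a::field) \<cdot>\<^sub>v 0\<^sub>v n = 0\<^sub>v n"
  by (intro eq_vecI) auto

lemma smult_mat_mult_vec:
  fixes A :: "'a::field mat"
  assumes "A \<in> carrier_mat m n" "w \<in> carrier_vec n"
  shows "(c \<cdot>\<^sub>m A) *\<^sub>v w = c \<cdot>\<^sub>v (A *\<^sub>v w)"
  by (rule eq_vecI) (use assms in \<open>simp_all add: scalar_prod_def sum_distrib_left mult.assoc\<close>)

lemma det_mat_diag: "det (mat_diag n f) = (\<Prod>i<n. f i)"
proof -
  have "det (mat_diag n f) = prod_list (diag_mat (mat_diag n f))"
    by (rule det_upper_triangular[of _ n]) (auto simp: mat_diag_def)
  also have "\<dots> = (\<Prod>i<n. f i)"
    by (simp add: prod_list_diag_prod mat_diag_def atLeast0LessThan)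
  finally show ?thesis .
qed

lemma mat_diag_index: "i < n \<Longrightarrow> j < n \<Longrightarrow> mat_diag n f $$ (i, j) = (if i = j then f j else 0)"
  by (simp add: mat_diag_def)

lemma mat_diag_mult_vec_index:
  assumes "w \<in> carrier_vec n" "i < n"
  shows "(mat_diag n f *\<^sub>v w) $ i = f i * w $ i"
proof -
  have "(mat_diag n f *\<^sub>v w) $ i = (\<Sum>k = 0..<n. mat_diag n f $$ (i, k) * w $ k)"
    using assms carrier_matD[OF mat_diag_dim[of n f]] by (simp add: scalar_prod_def)
  also have "\<dots> = (\<Sum>k = 0..<n. if k = i then f k * w $ k else 0)"
    using assms by (intro sum.cong refl) (auto simp: mat_diag_index)
  also have "\<dots> = f i * w $ i" using assms by (subst sum.delta) auto
  finally show ?thesis .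
qed

lemma mat_diag_pow: "mat_diag n f ^\<^sub>m k = mat_diag n (\<lambda>i. f i ^ k)"
proof (induction k)
  case 0
  show ?case using carrier_matD[OF mat_diag_dim[of n f]] by simp
next
  case (Suc k) then show ?case by (simp add: power_Suc2 del: power_Suc)
qed

lemma mat_diag_cong: "(\<And>i. i < n \<Longrightarrow> f i = g i) \<Longrightarrow> mat_diag n f = mat_diag n g"
  by (intro eq_matI) (auto simp: mat_diag_def)

lemma mat_diag_const: "mat_diag n (\<lambda>_. c :: 'a::field) = c \<cdot>\<^sub>m 1\<^sub>m n"
  by (intro eq_matI) (auto simp: mat_diag_def)

lemma smult_mat_diag: "(c :: 'a::field) \<cdot>\<^sub>m mat_diag n f = mat_diag n (\<lambda>i. c * f i)"
  by (intro eq_matI) (auto simp: mat_diag_def)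

lemma comm_mat_diag:
  fixes A :: "'a::field mat"
  assumes A: "A \<in> carrier_mat n n" and comm: "A * mat_diag n f = mat_diag n f * A"
    and inj: "inj_on f {..<n}"
  shows "A = mat_diag n (\<lambda>i. A $$ (i, i))"
proof (rule eq_matI)
  fix i j assume "i < dim_row (mat_diag n (\<lambda>i. A $$ (i, i)))" "j < dim_col (mat_diag n (\<lambda>i. A $$ (i, i)))"
  then have ij: "i < n" "j < n" by (auto simp: mat_diag_def)
  have "A $$ (i, j) * f j = f i * A $$ (i, j)"
    using arg_cong[OF comm, of "\<lambda>B. B $$ (i, j)"] ij
    by (simp add: mat_diag_mult_left[OF A] mat_diag_mult_right[OF A])
  then have "i = j \<or> A $$ (i, j) = 0" using inj ij by (auto simp: inj_on_def)
  then show "A $$ (i, j) = mat_diag n (\<lambda>i. A $$ (i, i)) $$ (i, j)" using ij by (auto simp: mat_diag_index)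
qed (use A in \<open>auto simp: mat_diag_def\<close>)

lemma mult_mat_vec_single:
  fixes g :: "'a::field mat"
  assumes g: "g \<in> carrier_mat n n" and w: "w \<in> carrier_vec n" and j: "j < n"
    and z: "\<And>k. k < n \<Longrightarrow> k \<noteq> j \<Longrightarrow> w $ k = 0"
  shows "g *\<^sub>v w = w $ j \<cdot>\<^sub>v col g j"
proof (rule eq_vecI)
  fix i assume "i < dim_vec (w $ j \<cdot>\<^sub>v col g j)"
  then have i: "i < n" using g by simp
  have "(g *\<^sub>v w) $ i = (\<Sum>k = 0..<n. g $$ (i, k) * w $ k)"
    using g w i by (simp add: scalar_prod_def)
  also have "\<dots> = (\<Sum>k = 0..<n. if k = j then g $$ (i, k) * w $ k else 0)"
    using z by (intro sum.cong refl) auto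
  also have "\<dots> = g $$ (i, j) * w $ j" using j by (subst sum.delta) auto
  finally show "(g *\<^sub>v w) $ i = (w $ j \<cdot>\<^sub>v col g j) $ i" using g i j by (simp add: mult.commute)
qed (use g in simp)

lemma GL_mult_vec_eq_0:
  fixes A :: "'a::field mat"
  assumes "A \<in> carrier_mat n n" "det A \<noteq> 0" "v \<in> carrier_vec n" "A *\<^sub>v v = 0\<^sub>v n"
  shows "v = 0\<^sub>v n"
  using det_0_iff_vec_prod_zero[OF assms(1)] assms by blast

lemma GL_pow_mult_vec_neq_0:
  fixes A :: "'a::field mat"
  assumes "A \<in> carrier_mat n n" "det A \<noteq> 0" "v \<in> carrier_vec n" "v \<noteq> 0\<^sub>v n"
  shows "A ^\<^sub>m k *\<^sub>v v \<noteq> 0\<^sub>v n"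
proof (induction k)
  case 0 then show ?case using assms by simp
next
  case (Suc k)
  have "A ^\<^sub>m k *\<^sub>v v \<in> carrier_vec n" by (rule mult_mat_vec_carrier[OF pow_carrier_mat[OF assms(1)] assms(3)])
  then show ?case using GL_mult_vec_eq_0[OF assms(1,2)] Suc pow_mat_vec_Suc[OF assms(1,3), of k] by auto
qed

lemma smult_vec_cancel: "a \<cdot>\<^sub>v v = b \<cdot>\<^sub>v v \<Longrightarrow> v \<in> carrier_vec n \<Longrightarrow> v \<noteq> 0\<^sub>v n \<Longrightarrow> a = (b::'a::field)"
proof -
  assume eq: "a \<cdot>\<^sub>v v = b \<cdot>\<^sub>v v" and v: "v \<in> carrier_vec n" "v \<noteq> 0\<^sub>v n"
  have "\<exists>i<n. v $ i \<noteq> 0"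
  proof (rule ccontr)
    assume "\<not> ?thesis"
    then have "v = 0\<^sub>v n" using v(1) by (intro eq_vecI) auto
    then show False using v by simp
  qed
  then obtain i where i: "i < n" "v $ i \<noteq> 0" by blast
  then show ?thesis using arg_cong[OF eq, of "\<lambda>u. u $ i"] v by simp
qed

section \<open>Diagonal form of a Weyl pair with an eigenvector\<close>

context prime_root
begin

context
  fixes x h :: "'a mat" and a :: 'a and v
  assumes x: "x \<in> carrier_mat q q" and h: "h \<in> carrier_mat q q" "det h \<noteq> 0"
    and hx: "h * x = \<xi> \<cdot>\<^sub>m (x * h)"
    and v: "v \<in> carrier_vec q" "v \<noteq> 0\<^sub>v q" and ev: "x *\<^sub>v v = a \<cdot>\<^sub>v v" and a: "a \<noteq> 0"
begin

text \<open>The relation \<open>h x = \<xi> x h\<close> makes \<open>h\<close> move eigenvectors of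
  \<open>x\<close> to eigenvectors, dividing the eigenvalue by \<xi>.\<close>

lemma weyl_eigenvector_pow: "x *\<^sub>v (h ^\<^sub>m k *\<^sub>v v) = (a / \<xi> ^ k) \<cdot>\<^sub>v (h ^\<^sub>m k *\<^sub>v v)"
proof (induction k)
  case 0 then show ?case using h v ev by simp
next
  case (Suc k)
  let ?u = "h ^\<^sub>m k *\<^sub>v v"
  have u: "?u \<in> carrier_vec q" by (rule mult_mat_vec_carrier[OF pow_carrier_mat[OF h(1)] v(1)])
  have xu: "x *\<^sub>v ?u \<in> carrier_vec q" "h *\<^sub>v ?u \<in> carrier_vec q" using x h u by auto
  have xh: "x * h \<in> carrier_mat q q" using x h by auto
  have xhu: "x *\<^sub>v (h *\<^sub>v ?u) \<in> carrier_vec q" using x xu by auto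
  have "\<xi> \<cdot>\<^sub>v (x *\<^sub>v (h *\<^sub>v ?u)) = (\<xi> \<cdot>\<^sub>m (x * h)) *\<^sub>v ?u"
    unfolding smult_mat_mult_vec[OF xh u] assoc_mult_mat_vec[OF x h(1) u] ..
  also have "\<dots> = h *\<^sub>v (x *\<^sub>v ?u)" unfolding hx[symmetric] by (rule assoc_mult_mat_vec[OF h(1) x u])
  also have "\<dots> = (a / \<xi> ^ k) \<cdot>\<^sub>v (h *\<^sub>v ?u)" unfolding Suc by (rule mult_mat_vec[OF h(1) u])
  finally have 1: "\<xi> \<cdot>\<^sub>v (x *\<^sub>v (h *\<^sub>v ?u)) = (a / \<xi> ^ k) \<cdot>\<^sub>v (h *\<^sub>v ?u)" .
  have "x *\<^sub>v (h *\<^sub>v ?u) = inverse \<xi> \<cdot>\<^sub>v (\<xi> \<cdot>\<^sub>v (x *\<^sub>v (h *\<^sub>v ?u)))"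
    using root_neq_0 by (simp add: smult_smult_assoc)
  also have "\<dots> = (inverse \<xi> * (a / \<xi> ^ k)) \<cdot>\<^sub>v (h *\<^sub>v ?u)" unfolding 1 by (simp add: smult_smult_assoc)
  also have "inverse \<xi> * (a / \<xi> ^ k) = a / \<xi> ^ Suc k" using root_neq_0 by (simp add: field_simps)
  finally show ?case using pow_mat_vec_Suc[OF h(1) v(1), of k] by simp
qed

text \<open>Column \<open>j\<close> of \<open>krylov q h v\<close> belongs to the power
  \<open>q - 1 - j\<close> of \<open>h\<close>, hence to the eigenvalue
  \<open>a / \<xi> ^ (q - 1 - j)\<close> of \<open>x\<close>. As \<xi> has order \<open>q\<close>,
  this equals \<open>a * \<xi> ^ Suc j\<close>.\<close>

definition eigval :: "nat \<Rightarrow> 'a" where "eigval j = a * \<xi> ^ Suc j"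

lemma eigval_inj: "inj_on eigval {..<q}"
  using root_pow_inj a root_neq_0 by (auto simp: inj_on_def eigval_def)

lemma eigval_krylov: "j < q \<Longrightarrow> a / \<xi> ^ (q - 1 - j) = eigval j"
proof -
  assume "j < q"
  then have e: "Suc j + (q - 1 - j) = q" by simp
  have "\<xi> ^ Suc j * \<xi> ^ (q - 1 - j) = \<xi> ^ (Suc j + (q - 1 - j))" by (simp only: power_add)
  then have "\<xi> ^ Suc j * \<xi> ^ (q - 1 - j) = 1" unfolding e root .
  then show ?thesis using root_neq_0 by (simp add: eigval_def field_simps)
qed

lemma eigval_range: "\<exists>j<q. a * \<xi> ^ i = eigval j"
proof -
  define z where "z = \<xi> ^ (i + (q - 1))"
  have "z ^ q = 1 ^ q" unfolding z_def by (metis power_mult mult.commute root power_one)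
  then obtain j where j: "j < q" "z = 1 * \<xi> ^ j" using pow_root_cancel[of z 1] by auto
  have e: "Suc (i + (q - 1)) = i + q" using q_pos by simp
  have "\<xi> ^ i = \<xi> ^ (i + q)" using root by (simp add: power_add)
  also have "\<dots> = \<xi> * z" unfolding e[symmetric] z_def by (rule power_Suc)
  finally have "\<xi> ^ i = \<xi> ^ Suc j" using j by simp
  then show ?thesis using j by (auto simp: eigval_def)
qed

lemma mat_diag_eigval_single:
  assumes w: "w \<in> carrier_vec q" and ev: "mat_diag q eigval *\<^sub>v w = eigval j \<cdot>\<^sub>v w" and j: "j < q"
  shows "\<And>k. k < q \<Longrightarrow> k \<noteq> j \<Longrightarrow> w $ k = 0"
proof -
  fix k assume k: "k < q" "k \<noteq> j"
  have "eigval k * w $ k = eigval j * w $ k"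
    using arg_cong[OF ev, of "\<lambda>v. v $ k"] mat_diag_mult_vec_index[OF w k(1), of eigval] w k by simp
  moreover have "eigval k \<noteq> eigval j" using eigval_inj k j by (auto simp: inj_on_def)
  ultimately show "w $ k = 0" by simp
qed

lemma krylov_diag: "x * krylov q h v = krylov q h v * mat_diag q eigval"
proof (rule eq_matI)
  let ?g = "krylov q h v"
  show "dim_row (x * ?g) = dim_row (?g * mat_diag q eigval)" "dim_col (x * ?g) = dim_col (?g * mat_diag q eigval)"
    using x by (auto simp: krylov_def mat_diag_def)
  fix i j assume "i < dim_row (?g * mat_diag q eigval)" "j < dim_col (?g * mat_diag q eigval)"
  then have ij: "i < q" "j < q" by (auto simp: krylov_def mat_diag_def)
  have u: "h ^\<^sub>m (q - 1 - j) *\<^sub>v v \<in> carrier_vec q" by (rule mult_mat_vec_carrier[OF pow_carrier_mat[OF h(1)] v(1)])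
  have "(x * ?g) $$ (i, j) = (eigval j \<cdot>\<^sub>v (h ^\<^sub>m (q - 1 - j) *\<^sub>v v)) $ i"
    unfolding mult_krylov_index[OF x h(1) v(1) ij] weyl_eigenvector_pow eigval_krylov[OF ij(2)] ..
  also have "\<dots> = ?g $$ (i, j) * eigval j" using ij u carrier_vecD[OF u] by (simp add: krylov_def del: index_mult_mat_vec)
  also have "\<dots> = (?g * mat_diag q eigval) $$ (i, j)"
    using ij by (simp add: mat_diag_mult_right[OF krylov_carrier])
  finally show "(x * ?g) $$ (i, j) = (?g * mat_diag q eigval) $$ (i, j)" .
qed

text \<open>The kernel of the Krylov matrix is invariant under the diagonal matrix, since the latter
  is intertwined with \<open>x\<close>. A nonzero kernel would contain an eigenvector of the
  diagonal matrix, that is, a multiple of a unit vector, and then some column \<open>h ^ k v\<close>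
  would be zero.\<close>

lemma krylov_det: "det (krylov q h v) \<noteq> 0"
proof
  let ?g = "krylov q h v" let ?D = "mat_diag q eigval"
  assume "det ?g = 0"
  then obtain u where u: "u \<in> carrier_vec q" "u \<noteq> 0\<^sub>v q" "?g *\<^sub>v u = 0\<^sub>v q"
    using det_0_iff_vec_prod_zero[OF krylov_carrier] by blast
  define W where "W = {w \<in> carrier_vec q. ?g *\<^sub>v w = 0\<^sub>v q}"
  have D: "?D \<in> carrier_mat q q" by simp
  have inv: "?D *\<^sub>v w + c \<cdot>\<^sub>v w \<in> W" if "w \<in> W" for w c
  proof -
    have w: "w \<in> carrier_vec q" "?g *\<^sub>v w = 0\<^sub>v q" using that by (auto simp: W_def)
    have Dw: "?D *\<^sub>v w \<in> carrier_vec q" using D w by (intro mult_mat_vec_carrier)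
    have cw: "c \<cdot>\<^sub>v w \<in> carrier_vec q" using w by simp
    have "?g *\<^sub>v (?D *\<^sub>v w) = x *\<^sub>v (?g *\<^sub>v w)"
      using assoc_mult_mat_vec[OF krylov_carrier[of q h v] D w(1)] assoc_mult_mat_vec[OF x krylov_carrier[of q h v] w(1)] krylov_diag by metis
    then have 1: "?g *\<^sub>v (?D *\<^sub>v w) = 0\<^sub>v q" using w(2) mult_mat_zero_vec[OF x] by simp
    have 2: "?g *\<^sub>v (c \<cdot>\<^sub>v w) = 0\<^sub>v q" using mult_mat_vec[OF krylov_carrier[of q h v] w(1)] w(2) by (simp add: smult_zero_vec_right)
    have "?g *\<^sub>v (?D *\<^sub>v w + c \<cdot>\<^sub>v w) = 0\<^sub>v q"
      using mult_add_distrib_mat_vec[OF krylov_carrier Dw cw] 1 2 by simp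
    then show ?thesis using Dw cw by (simp add: W_def)
  qed
  have "?D ^\<^sub>m q *\<^sub>v u = a ^ q \<cdot>\<^sub>v u"
  proof -
    have "eigval i ^ q = a ^ q" for i
    proof -
      have "(\<xi> ^ Suc i) ^ q = 1" by (metis power_mult mult.commute root power_one)
      then show ?thesis by (simp add: eigval_def power_mult_distrib)
    qed
    then have "?D ^\<^sub>m q = mat_diag q (\<lambda>_. a ^ q)" by (simp add: mat_diag_pow)
    then have "(?D ^\<^sub>m q *\<^sub>v u) $ i = (a ^ q \<cdot>\<^sub>v u) $ i" if "i < q" for i
      using mat_diag_mult_vec_index[OF u(1) that, of "\<lambda>_. a ^ q"] u(1) that by (simp del: index_mult_mat_vec)
    then show ?thesis using u(1) carrier_vecD[OF mult_mat_vec_carrier[OF pow_carrier_mat[OF D, of q] u(1)]]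
      by (intro eq_vecI) (simp_all del: index_mult_mat_vec dim_mult_mat_vec)
  qed
  then obtain i w where w: "w \<in> W" "w \<noteq> 0\<^sub>v q" "?D *\<^sub>v w = (a * \<xi> ^ i) \<cdot>\<^sub>v w"
    using kummer_eigenvector[OF D _ inv, of u a] u a by (auto simp: W_def)
  obtain j where j: "j < q" "a * \<xi> ^ i = eigval j" using eigval_range by blast
  have wc: "w \<in> carrier_vec q" "?g *\<^sub>v w = 0\<^sub>v q" using w by (auto simp: W_def)
  have single: "\<And>k. k < q \<Longrightarrow> k \<noteq> j \<Longrightarrow> w $ k = 0"
    using mat_diag_eigval_single[OF wc(1) _ j(1)] w(3) j by simp
  have "w $ j \<cdot>\<^sub>v (h ^\<^sub>m (q - 1 - j) *\<^sub>v v) = 0\<^sub>v q"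
    using mult_mat_vec_single[OF krylov_carrier wc(1) j(1) single] wc(2) krylov_col[OF h(1) v(1) j(1)] by simp
  also have "\<dots> = 0 \<cdot>\<^sub>v (h ^\<^sub>m (q - 1 - j) *\<^sub>v v)"
    by (rule smult_zero_vec[symmetric]) (rule mult_mat_vec_carrier[OF pow_carrier_mat[OF h(1)] v(1)])
  finally have "w $ j = 0"
    by (rule smult_vec_cancel) (rule mult_mat_vec_carrier[OF pow_carrier_mat[OF h(1)] v(1)], rule GL_pow_mult_vec_neq_0[OF h v])
  then have "w = 0\<^sub>v q" using single wc by (intro eq_vecI) auto
  then show False using w by simp
qed

text \<open>After \<open>q\<close> steps the eigenvalue is \<open>a\<close> again. In the Krylov
  basis \<open>x\<close> is diagonal with distinct entries, so \<open>h ^ q v\<close> is a multiple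
  of the only column for \<open>a\<close>, the last one, which is \<open>v\<close>.\<close>

lemma krylov_scalar_pow: "\<exists>\<beta>. h ^\<^sub>m q *\<^sub>v v = \<beta> \<cdot>\<^sub>v v"
proof -
  let ?g = "krylov q h v" let ?D = "mat_diag q eigval"
  have D: "?D \<in> carrier_mat q q" by simp
  let ?u = "h ^\<^sub>m q *\<^sub>v v"
  have u: "?u \<in> carrier_vec q" by (rule mult_mat_vec_carrier[OF pow_carrier_mat[OF h(1)] v(1)])
  obtain g' where g': "g' \<in> carrier_mat q q" "?g * g' = 1\<^sub>m q" "g' * ?g = 1\<^sub>m q"
    using GL_inverse[OF krylov_carrier krylov_det] by blast
  define w where "w = g' *\<^sub>v ?u"
  have w: "w \<in> carrier_vec q" unfolding w_def by (rule mult_mat_vec_carrier[OF g'(1) u])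
  have gw: "?g *\<^sub>v w = ?u"
    unfolding w_def using assoc_mult_mat_vec[OF krylov_carrier[of q h v] g'(1) u] g'(2) u by simp
  have j: "q - 1 < q" using q_pos by simp
  have e: "eigval (q - 1) = a" using root q_pos by (simp add: eigval_def)
  have Dw: "?D *\<^sub>v w \<in> carrier_vec q" using D w by (intro mult_mat_vec_carrier)
  have "?g *\<^sub>v (?D *\<^sub>v w) = x *\<^sub>v (?g *\<^sub>v w)"
    using assoc_mult_mat_vec[OF krylov_carrier[of q h v] D w(1)] assoc_mult_mat_vec[OF x krylov_carrier[of q h v] w(1)] krylov_diag by metis
  also have "\<dots> = a \<cdot>\<^sub>v (?g *\<^sub>v w)" unfolding gw using weyl_eigenvector_pow[of q] root by simp
  finally have "g' *\<^sub>v (?g *\<^sub>v (?D *\<^sub>v w)) = g' *\<^sub>v (a \<cdot>\<^sub>v (?g *\<^sub>v w))" by simp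
  also have "g' *\<^sub>v (a \<cdot>\<^sub>v (?g *\<^sub>v w)) = a \<cdot>\<^sub>v (g' *\<^sub>v (?g *\<^sub>v w))"
    unfolding gw by (rule mult_mat_vec[OF g'(1) u])
  finally have "?D *\<^sub>v w = eigval (q - 1) \<cdot>\<^sub>v w"
    using assoc_mult_mat_vec[OF g'(1) krylov_carrier[of q h v] w] assoc_mult_mat_vec[OF g'(1) krylov_carrier[of q h v] Dw] g'(3) w Dw e by simp
  from mult_mat_vec_single[OF krylov_carrier w j mat_diag_eigval_single[OF w this j], of h v]
  have "?u = w $ (q - 1) \<cdot>\<^sub>v v" using gw krylov_col[OF h(1) v(1) j] h v by simp
  then show ?thesis by blast
qed

end

lemma weyl_diagonal_form:
  assumes "x \<in> carrier_mat q q" "h \<in> carrier_mat q q" "det h \<noteq> 0" "h * x = \<xi> \<cdot>\<^sub>m (x * h)"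
    and "v \<in> carrier_vec q" "v \<noteq> 0\<^sub>v q" "x *\<^sub>v v = a \<cdot>\<^sub>v v" "a \<noteq> 0"
  shows "det (krylov q h v) \<noteq> 0"
    and "x * krylov q h v = krylov q h v * mat_diag q (\<lambda>j. a * \<xi> ^ Suc j)"
    and "\<exists>\<beta>. h * krylov q h v = krylov q h v * I_mat q \<beta>"
  using krylov_det[OF assms] krylov_diag[OF assms] krylov_scalar_pow[OF assms] krylov_I_mat[OF assms(2,5) q_pos]
    eigval_def[OF assms, abs_def] by auto

end

section \<open>Transfer to the algebraic closure\<close>

lemma intertwine_commute:
  fixes g :: "'a::field mat"
  assumes c: "g \<in> carrier_mat n n" "g' \<in> carrier_mat n n" "A \<in> carrier_mat n n" "D \<in> carrier_mat n n" "B \<in> carrier_mat n n"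
    and gg: "g * g' = 1\<^sub>m n" "g' * g = 1\<^sub>m n" and AD: "A * g = g * D" and BA: "B * A = A * B"
  shows "(g' * B * g) * D = D * (g' * B * g)" and "g * (g' * B * g) * g' = B"
proof -
  note a = assoc_mult_mat[of _ n n _ n _ n]
  have lc: "g' * (g * C) = C" "g * (g' * C) = C" if "C \<in> carrier_mat n n" for C
    using a[of g' g C] a[of g g' C] gg c that by auto
  have "g' * A = g' * (A * (g * g'))" using gg c by simp
  also have "\<dots> = g' * (A * g * g')" using a[of A g g'] c by simp
  also have "\<dots> = g' * (g * (D * g'))" unfolding AD using a[of g D g'] c by simp
  also have "\<dots> = D * g'" using lc c by simp
  finally have g'A: "g' * A = D * g'" .
  have "(g' * B * g) * D = g' * (B * (g * D))" using c by (simp add: a)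
  also have "\<dots> = g' * (B * A * g)" unfolding AD[symmetric] using c by (simp add: a)
  also have "\<dots> = g' * A * (B * g)" unfolding BA using c by (simp add: a)
  also have "\<dots> = D * (g' * B * g)" unfolding g'A using c by (simp add: a)
  finally show "(g' * B * g) * D = D * (g' * B * g)" .
  show "g * (g' * B * g) * g' = B" using c gg lc by (simp add: a)
qed

lemma conjugate_mult:
  fixes g :: "'a::field mat"
  assumes c: "g \<in> carrier_mat n n" "g' \<in> carrier_mat n n" "C \<in> carrier_mat n n" "D \<in> carrier_mat n n"
    and gg: "g' * g = 1\<^sub>m n"
  shows "(g * C * g') * (g * D * g') = g * (C * D) * g'"
proof -
  note a = assoc_mult_mat[of _ n n _ n _ n]
  have Dg': "D * g' \<in> carrier_mat n n" using c by auto
  have "(g * C * g') * (g * D * g') = g * (C * (g' * (g * (D * g'))))" using c by (simp add: a)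
  also have "g' * (g * (D * g')) = D * g'" using a[OF c(2,1) Dg'] left_mult_one_mat[OF Dg'] unfolding gg by simp
  finally show ?thesis using c by (simp add: a)
qed

lemma alg_closed_eigenvector:
  fixes A :: "'a::alg_closed_field mat"
  assumes A: "A \<in> carrier_mat n n" and n: "n > 0"
  shows "\<exists>v a. v \<in> carrier_vec n \<and> v \<noteq> 0\<^sub>v n \<and> A *\<^sub>v v = a \<cdot>\<^sub>v v"
proof -
  have "degree (char_poly A) > 0" using degree_monic_char_poly[OF A] n by simp
  then obtain a where "poly (char_poly A) a = 0" using alg_closed_imp_poly_has_root by blast
  then have "eigenvalue A a" using eigenvalue_root_char_poly[OF A] by simp
  then show ?thesis using A by (auto simp: eigenvalue_def eigenvector_def)
qed

abbreviation ac_mat :: "'a::field mat \<Rightarrow> 'a alg_closure mat" where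
  "ac_mat \<equiv> map_mat to_ac"

lemma map_mat_smult_to_ac: "ac_mat (c \<cdot>\<^sub>m A) = to_ac c \<cdot>\<^sub>m ac_mat A"
  by (intro eq_matI) auto

lemma ac_mat_scalar:
  assumes y: "y \<in> carrier_mat n n" and eq: "ac_mat y = c \<cdot>\<^sub>m 1\<^sub>m n" and n: "n > 0"
  shows "y = (y $$ (0, 0)) \<cdot>\<^sub>m 1\<^sub>m n"
proof (rule eq_matI)
  have e: "to_ac (y $$ (i, j)) = (if i = j then c else 0)" if "i < n" "j < n" for i j
    using arg_cong[OF eq, of "\<lambda>B. B $$ (i, j)"] that y by simp
  fix i j assume "i < dim_row (y $$ (0, 0) \<cdot>\<^sub>m 1\<^sub>m n)" "j < dim_col (y $$ (0, 0) \<cdot>\<^sub>m 1\<^sub>m n)"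
  then have ij: "i < n" "j < n" by auto
  have "to_ac (y $$ (i, j)) = to_ac ((y $$ (0, 0) \<cdot>\<^sub>m 1\<^sub>m n) $$ (i, j))" using ij e[OF ij] e[OF n n] by simp
  then show "y $$ (i, j) = (y $$ (0, 0) \<cdot>\<^sub>m 1\<^sub>m n) $$ (i, j)" by simp
qed (use y in auto)

context prime_root
begin

context
  fixes x h :: "'a mat"
  assumes x: "x \<in> carrier_mat q q" "det x \<noteq> 0" and h: "h \<in> carrier_mat q q" "det h \<noteq> 0"
    and hx: "h * x = \<xi> \<cdot>\<^sub>m (x * h)"
begin

lemma ac_weyl: "ac_mat x \<in> carrier_mat q q" "ac_mat h \<in> carrier_mat q q" "det (ac_mat x) \<noteq> 0" "det (ac_mat h) \<noteq> 0"
  "ac_mat h * ac_mat x = to_ac \<xi> \<cdot>\<^sub>m (ac_mat x * ac_mat h)"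
proof -
  show "ac_mat h * ac_mat x = to_ac \<xi> \<cdot>\<^sub>m (ac_mat x * ac_mat h)"
    using arg_cong[OF hx, of ac_mat] to_ac.mat_hom_mult[OF h(1) x(1)] to_ac.mat_hom_mult[OF x(1) h(1)]
    by (simp add: map_mat_smult_to_ac)
qed (use x h in auto)

lemma ac_weyl_diagonal_form:
  "\<exists>g g' f \<beta>. g \<in> carrier_mat q q \<and> g' \<in> carrier_mat q q \<and> g * g' = 1\<^sub>m q \<and> g' * g = 1\<^sub>m q \<and>
    inj_on f {..<q} \<and> ac_mat x * g = g * mat_diag q f \<and> ac_mat h * g = g * I_mat q \<beta>"
proof -
  interpret ac: prime_root q "to_ac \<xi>" using prime_root_to_ac prime_root_axioms by blast
  obtain v a where v: "v \<in> carrier_vec q" "v \<noteq> 0\<^sub>v q" "ac_mat x *\<^sub>v v = a \<cdot>\<^sub>v v"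
    using alg_closed_eigenvector[OF ac_weyl(1) q_pos] by blast
  have a: "a \<noteq> 0"
  proof
    assume "a = 0"
    then have "ac_mat x *\<^sub>v v = 0\<^sub>v q" using v smult_zero_vec by simp
    then show False using GL_mult_vec_eq_0[OF ac_weyl(1,3) v(1)] v(2) by blast
  qed
  note d = ac.weyl_diagonal_form[OF ac_weyl(1,2,4,5) v a]
  obtain g' where "g' \<in> carrier_mat q q" "krylov q (ac_mat h) v * g' = 1\<^sub>m q" "g' * krylov q (ac_mat h) v = 1\<^sub>m q"
    using GL_inverse[OF krylov_carrier d(1)] by blast
  moreover have "inj_on (\<lambda>j. a * to_ac \<xi> ^ Suc j) {..<q}"
    by (rule ac.eigval_inj[OF ac_weyl(1,2,4,5) v a, unfolded ac.eigval_def[OF ac_weyl(1,2,4,5) v a, abs_def]])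
  ultimately show ?thesis using d(2,3) krylov_carrier by blast
qed

text \<open>Over the algebraic closure \<open>x\<close> is diagonalizable with distinct eigenvalues,
  so everything that centralizes it becomes diagonal in the same basis.\<close>

lemma weyl_matrix_cent_abelian:
  assumes y: "y \<in> carrier_mat q q" "y * x = x * y" and z: "z \<in> carrier_mat q q" "z * x = x * z"
  shows "y * z = z * y"
proof -
  obtain g g' f \<beta> where g: "g \<in> carrier_mat q q" "g' \<in> carrier_mat q q" "g * g' = 1\<^sub>m q" "g' * g = 1\<^sub>m q"
    "inj_on f {..<q}" "ac_mat x * g = g * mat_diag q f"
    using ac_weyl_diagonal_form by blast
  have conj: "\<exists>e. g * mat_diag q e * g' = ac_mat y" if y: "y \<in> carrier_mat q q" "y * x = x * y" for y
  proof -
    have "ac_mat y * ac_mat x = ac_mat x * ac_mat y"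
      using arg_cong[OF y(2), of ac_mat] to_ac.mat_hom_mult[OF y(1) x(1)] to_ac.mat_hom_mult[OF x(1) y(1)] by simp
    from y(1) have "ac_mat y \<in> carrier_mat q q" by simp
    note i = intertwine_commute[OF g(1,2) ac_weyl(1) mat_diag_dim this g(3,4,6) \<open>ac_mat y * ac_mat x = ac_mat x * ac_mat y\<close>]
    have M: "g' * ac_mat y * g \<in> carrier_mat q q" using g y by auto
    from comm_mat_diag[OF M i(1) g(5)] obtain e where e: "g' * ac_mat y * g = mat_diag q e" by (rule that)
    show ?thesis using i(2) unfolding e by blast
  qed
  obtain e e' where e: "g * mat_diag q e * g' = ac_mat y" "g * mat_diag q e' * g' = ac_mat z"
    using conj[OF y] conj[OF z] by blast
  note m = conjugate_mult[OF g(1,2) mat_diag_dim mat_diag_dim g(4)]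
  have "ac_mat (y * z) = ac_mat y * ac_mat z" by (rule to_ac.mat_hom_mult[OF y(1) z(1)])
  also have "\<dots> = ac_mat z * ac_mat y" unfolding e[symmetric] m by (simp add: mult.commute)
  also have "\<dots> = ac_mat (z * y)" by (rule to_ac.mat_hom_mult[OF z(1) y(1), symmetric])
  finally show ?thesis by (rule to_ac.mat_hom_inj)
qed

text \<open>In the basis that diagonalizes \<open>x\<close>, the matrix \<open>y\<close> is diagonal
  and commutes with the shift \<open>I_mat q \<beta>\<close>. Comparing the entries just above the
  diagonal makes neighbouring diagonal entries equal.\<close>

lemma weyl_matrix_cent_scalar:
  assumes y: "y \<in> carrier_mat q q" "y * x = x * y" "y * h = h * y"
  shows "\<exists>c. y = c \<cdot>\<^sub>m 1\<^sub>m q"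
proof -
  obtain g g' f \<beta> where g: "g \<in> carrier_mat q q" "g' \<in> carrier_mat q q" "g * g' = 1\<^sub>m q" "g' * g = 1\<^sub>m q"
    "inj_on f {..<q}" "ac_mat x * g = g * mat_diag q f" "ac_mat h * g = g * I_mat q \<beta>"
    using ac_weyl_diagonal_form by blast
  have yx: "ac_mat y * ac_mat x = ac_mat x * ac_mat y"
    using arg_cong[OF y(2), of ac_mat] to_ac.mat_hom_mult[OF y(1) x(1)] to_ac.mat_hom_mult[OF x(1) y(1)] by simp
  have yh: "ac_mat y * ac_mat h = ac_mat h * ac_mat y"
    using arg_cong[OF y(3), of ac_mat] to_ac.mat_hom_mult[OF y(1) h(1)] to_ac.mat_hom_mult[OF h(1) y(1)] by simp
  have Y: "ac_mat y \<in> carrier_mat q q" using y by simp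
  let ?M = "g' * ac_mat y * g"
  have M: "?M \<in> carrier_mat q q" using g Y by auto
  note i1 = intertwine_commute[OF g(1,2) ac_weyl(1) mat_diag_dim Y g(3,4,6) yx]
  note i2 = intertwine_commute[OF g(1,2) ac_weyl(2) I_mat_carrier[OF q_pos] Y g(3,4,7) yh]
  define e where "e i = ?M $$ (i, i)" for i
  have Me: "?M = mat_diag q e" unfolding e_def by (rule comm_mat_diag[OF M i1(1) g(5)])
  have step: "e (Suc i) = e i" if "Suc i < q" for i
  proof -
    have "(mat_diag q e * I_mat q \<beta>) $$ (i, Suc i) = (I_mat q \<beta> * mat_diag q e) $$ (i, Suc i)"
      using i2(1) unfolding Me by simp
    then show ?thesis using that
      by (simp add: mult_I_mat_index[OF mat_diag_dim] I_mat_mult_index[OF mat_diag_dim] mat_diag_index)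
  qed
  have E: "i < q \<Longrightarrow> e i = e 0" for i by (induction i) (use step in auto)
  have "mat_diag q e = mat_diag q (\<lambda>_. e 0)" by (rule mat_diag_cong) (rule E)
  then have "?M = e 0 \<cdot>\<^sub>m 1\<^sub>m q" unfolding Me mat_diag_const .
  then have "ac_mat y = g * (e 0 \<cdot>\<^sub>m 1\<^sub>m q) * g'" using i1(2) by simp
  also have "\<dots> = e 0 \<cdot>\<^sub>m (g * g')" using g(1,2) by (simp add: mult_smult_distrib[OF g(1) one_carrier_mat] mult_smult_assoc_mat[OF g(1,2)])
  also have "\<dots> = e 0 \<cdot>\<^sub>m 1\<^sub>m q" using g by simp
  finally show ?thesis using ac_mat_scalar[OF y(1) _ q_pos] by blast
qed

end

end

subsection \<open>Scalar matrices\<close>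

lemma carrier_Fx [simp]: "x \<in> carrier Fx \<longleftrightarrow> x \<noteq> (0 :: 'a::field)"
  by (auto simp: class_ring_simps)

lemma scalar_group_iff: "z \<in> scalar_group n \<longleftrightarrow> (\<exists>c. c \<noteq> 0 \<and> z = c \<cdot>\<^sub>m 1\<^sub>m n)"
  by (auto simp: scalar_group_def)

lemma scalar_mat_mult: "A \<in> carrier_mat n n \<Longrightarrow> (c \<cdot>\<^sub>m 1\<^sub>m n) * A = c \<cdot>\<^sub>m A"
  "A \<in> carrier_mat n n \<Longrightarrow> A * (c \<cdot>\<^sub>m 1\<^sub>m n) = c \<cdot>\<^sub>m (A :: 'a::field mat)"
  by (simp_all add: mult_smult_assoc_mat[of _ n n _ n] mult_smult_distrib[of _ n n _ n])

lemma scalar_group_carrier: "z \<in> scalar_group n \<Longrightarrow> z \<in> carrier (GL n)"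
  by (auto simp: scalar_group_iff carrier_GL)

lemma scalar_mat_eq_iff: "n > 0 \<Longrightarrow> c \<cdot>\<^sub>m 1\<^sub>m n = d \<cdot>\<^sub>m 1\<^sub>m n \<longleftrightarrow> c = (d :: 'a::field)"
proof
  assume n: "n > 0" and eq: "c \<cdot>\<^sub>m 1\<^sub>m n = d \<cdot>\<^sub>m 1\<^sub>m n"
  show "c = d" using arg_cong[OF eq, of "\<lambda>B. B $$ (0, 0)"] n by simp
qed simp

lemma one_smult: "(1 :: 'a::field) \<cdot>\<^sub>m A = A"
  by (intro eq_matI) auto

lemma scalar_mat_eq_one_iff: "n > 0 \<Longrightarrow> c \<cdot>\<^sub>m 1\<^sub>m n = 1\<^sub>m n \<longleftrightarrow> c = (1 :: 'a::field)"
  using scalar_mat_eq_iff[of n c 1] unfolding one_smult .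

lemma scalar_mat_pow: "(c \<cdot>\<^sub>m 1\<^sub>m n) ^\<^sub>m k = (c :: 'a::field) ^ k \<cdot>\<^sub>m 1\<^sub>m n"
  unfolding mat_diag_const[symmetric] mat_diag_pow ..

lemma smult_smult_mat: "a \<cdot>\<^sub>m (b \<cdot>\<^sub>m A) = (a * b) \<cdot>\<^sub>m (A :: 'a::field mat)"
  by (intro eq_matI) (auto simp: mult.assoc)

lemma scalar_group_subgroup: "subgroup (scalar_group n) (GL n :: 'a::field mat monoid)"
proof (rule group.subgroupI[OF group_GL])
  show "scalar_group n \<subseteq> carrier (GL n :: 'a mat monoid)" using scalar_group_carrier by blast
  have "(1::'a) \<cdot>\<^sub>m 1\<^sub>m n \<in> scalar_group n" unfolding scalar_group_iff by (intro exI[of _ 1]) auto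
  then show "scalar_group n \<noteq> ({} :: 'a mat set)" by blast
  fix z :: "'a mat" assume "z \<in> scalar_group n"
  then obtain c where c: "c \<noteq> 0" "z = c \<cdot>\<^sub>m 1\<^sub>m n" by (auto simp: scalar_group_iff)
  have "(inverse c \<cdot>\<^sub>m 1\<^sub>m n) * z = 1\<^sub>m n"
    using c by (simp add: scalar_mat_mult smult_smult_mat) (intro eq_matI, auto)
  then have "inv\<^bsub>GL n\<^esub> z = inverse c \<cdot>\<^sub>m 1\<^sub>m n"
    using c by (intro group.inv_equality[OF group_GL]) (auto simp: carrier_GL)
  then show "inv\<^bsub>GL n\<^esub> z \<in> scalar_group n" unfolding scalar_group_iff using c by (intro exI[of _ "inverse c"]) auto
  fix w :: "'a mat" assume "w \<in> scalar_group n"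
  then obtain d where d: "d \<noteq> 0" "w = d \<cdot>\<^sub>m 1\<^sub>m n" by (auto simp: scalar_group_iff)
  then show "z \<otimes>\<^bsub>GL n\<^esub> w \<in> scalar_group n"
    unfolding scalar_group_iff using c by (intro exI[of _ "c * d"]) (auto simp: scalar_mat_mult smult_smult_mat)
qed

context prime_root
begin

lemma weyl_context_GL: "weyl_context (GL q :: 'a mat monoid) (scalar_group q) q"
proof (intro weyl_context.intro weyl_context_axioms.intro group_GL scalar_group_subgroup prime_q)
  fix z g :: "'a mat" assume "z \<in> scalar_group q" "g \<in> carrier (GL q)"
  then show "g \<otimes>\<^bsub>GL q\<^esub> z = z \<otimes>\<^bsub>GL q\<^esub> g" by (auto simp: scalar_group_iff carrier_GL scalar_mat_mult)
next
  fix g x z :: "'a mat"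
  assume g: "g \<in> carrier (GL q)" and x: "x \<in> carrier (GL q)" and z: "z \<in> scalar_group q"
    and eq: "g \<otimes>\<^bsub>GL q\<^esub> x = z \<otimes>\<^bsub>GL q\<^esub> (x \<otimes>\<^bsub>GL q\<^esub> g)"
  obtain c where c: "c \<noteq> 0" "z = c \<cdot>\<^sub>m 1\<^sub>m q" using z by (auto simp: scalar_group_iff)
  have gc: "g \<in> carrier_mat q q" "det g \<noteq> 0" and xc: "x \<in> carrier_mat q q" "det x \<noteq> 0"
    using g x by (auto simp: carrier_GL)
  have xg: "x * g \<in> carrier_mat q q" using gc xc by auto
  have e: "g * x = c \<cdot>\<^sub>m (x * g)" using eq c scalar_mat_mult(1)[OF xg] by simp
  \<comment> \<open>Taking determinants turns the commutation relation into
    \<open>c ^ q = 1\<close>.\<close>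
  have "det g * det x = c ^ q * (det x * det g)"
    using arg_cong[OF e, of det] det_mult[OF gc(1) xc(1)] det_mult[OF xc(1) gc(1)] carrier_matD[OF gc(1)] by simp
  then have cq: "c ^ q = 1" using gc xc by simp
  show zq: "z [^]\<^bsub>GL q\<^esub> q = \<one>\<^bsub>GL q\<^esub>"
    using GL_pow[OF scalar_group_carrier[OF z], of q] unfolding c(2) scalar_mat_pow cq GL_simps one_smult .
  {
    assume "z \<noteq> \<one>\<^bsub>GL q\<^esub>"
    then have "c \<noteq> 1" using c by (auto simp: one_smult)
    \<comment> \<open>The commutation scalar itself plays the role of the primitive root, so the
      matrix lemmas apply to this pair as it stands.\<close>
    then interpret r: prime_root q c using cq prime_q by unfold_locales
    fix y assume y: "y \<in> carrier (GL q)" "y \<otimes>\<^bsub>GL q\<^esub> x = x \<otimes>\<^bsub>GL q\<^esub> y"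
    have yc: "y \<in> carrier_mat q q" "det y \<noteq> 0" using y(1) by (simp_all add: carrier_GL)
    have yx: "y * x = x * y" using y(2) unfolding GL_simps .
    {
      fix y' assume y': "y' \<in> carrier (GL q)" "y' \<otimes>\<^bsub>GL q\<^esub> x = x \<otimes>\<^bsub>GL q\<^esub> y'"
      show "y \<otimes>\<^bsub>GL q\<^esub> y' = y' \<otimes>\<^bsub>GL q\<^esub> y"
        unfolding GL_simps
        by (rule r.weyl_matrix_cent_abelian[OF xc gc e yc(1) yx GL_carrier_mat[OF y'(1)] y'(2)[unfolded GL_simps]])
    next
      assume yg: "y \<otimes>\<^bsub>GL q\<^esub> g = g \<otimes>\<^bsub>GL q\<^esub> y"
      obtain d where ys: "y = d \<cdot>\<^sub>m 1\<^sub>m q"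
        using r.weyl_matrix_cent_scalar[OF xc gc e yc(1) yx yg[unfolded GL_simps]] by blast
      moreover have "d \<noteq> 0"
      proof
        assume "d = 0"
        then have "det y = 0 ^ q" using ys by simp
        then show False using yc q_pos by simp
      qed
      ultimately show "y \<in> scalar_group q" unfolding scalar_group_iff by blast
    }
  }
next
  fix z w :: "'a mat"
  assume z: "z \<in> scalar_group q" "z [^]\<^bsub>GL q\<^esub> q = \<one>\<^bsub>GL q\<^esub>" and w: "w \<in> scalar_group q" "w [^]\<^bsub>GL q\<^esub> q = \<one>\<^bsub>GL q\<^esub>" "w \<noteq> \<one>\<^bsub>GL q\<^esub>"
  obtain c d where c: "c \<noteq> 0" "z = c \<cdot>\<^sub>m 1\<^sub>m q" and d: "d \<noteq> 0" "w = d \<cdot>\<^sub>m 1\<^sub>m q" using z w by (auto simp: scalar_group_iff)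
  have cq: "c ^ q = 1"
    using trans[OF GL_pow[OF scalar_group_carrier[OF z(1)], symmetric] z(2)]
    unfolding c(2) scalar_mat_pow GL_simps scalar_mat_eq_one_iff[OF q_pos] .
  have dq: "d ^ q = 1"
    using trans[OF GL_pow[OF scalar_group_carrier[OF w(1)], symmetric] w(2)]
    unfolding d(2) scalar_mat_pow GL_simps scalar_mat_eq_one_iff[OF q_pos] .
  have "d \<noteq> 1" using w(3) d by (simp add: scalar_mat_eq_one_iff[OF q_pos])
  then interpret r: prime_root q d using dq prime_q by unfold_locales
  obtain i where "i < q" "c = 1 * d ^ i" using r.pow_root_cancel[of c 1] cq by auto
  then show "\<exists>i<q. z = w [^]\<^bsub>GL q\<^esub> i"
    using c d GL_pow[OF scalar_group_carrier[OF w(1)]] by (auto simp: scalar_mat_pow)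
qed

end

section \<open>Absolute irreducibility\<close>

lemma vec_subspace_iff:
  "vec_subspace n W \<longleftrightarrow> W \<subseteq> carrier_vec n \<and> 0\<^sub>v n \<in> W \<and>
    (\<forall>v \<in> W. \<forall>w \<in> W. v + w \<in> W) \<and> (\<forall>c. \<forall>v \<in> W. c \<cdot>\<^sub>v (v :: 'a::field vec) \<in> W)"
  unfolding vec_subspace_def VectorSpace.subspace_def LinearCombinations.submodule_def
  using vec_vs[of n, where 'a = 'a] vec_module[of n, where 'a = 'a]
  by (auto simp: module_vec_simps class_ring_simps)

lemma mult_mat_vec_in_subspace:
  fixes g :: "'a::field mat"
  assumes W: "vec_subspace n W" and g: "g \<in> carrier_mat n n" "\<And>j. j < n \<Longrightarrow> col g j \<in> W" and u: "u \<in> carrier_vec n"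
  shows "g *\<^sub>v u \<in> W"
proof -
  define p where "p k = vec n (\<lambda>i. if i < k then u $ i else 0)" for k
  have pc: "p k \<in> carrier_vec n" for k by (simp add: p_def)
  have "k \<le> n \<Longrightarrow> g *\<^sub>v p k \<in> W" for k
  proof (induction k)
    case 0
    have "p 0 = 0\<^sub>v n" by (auto simp: p_def)
    then show ?case using W mult_mat_zero_vec[OF g(1)] by (simp add: vec_subspace_iff)
  next
    case (Suc k)
    define s where "s = vec n (\<lambda>i. if i = k then u $ i else 0)"
    have sc: "s \<in> carrier_vec n" by (simp add: s_def)
    have "p (Suc k) = p k + s" by (auto simp: p_def s_def less_Suc_eq)
    then have "g *\<^sub>v p (Suc k) = g *\<^sub>v p k + g *\<^sub>v s" using mult_add_distrib_mat_vec[OF g(1) pc sc] by simp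
    also have "g *\<^sub>v s = s $ k \<cdot>\<^sub>v col g k"
      by (rule mult_mat_vec_single[OF g(1) sc]) (use Suc.prems in \<open>auto simp: s_def\<close>)
    finally show ?case using Suc W g(2)[of k] by (simp add: vec_subspace_iff)
  qed
  moreover have "p n = u" using u by (auto simp: p_def)
  ultimately show ?thesis by (metis order_refl)
qed

lemma vec_subspace_eq_carrier:
  fixes g :: "'a::field mat"
  assumes W: "vec_subspace n W" and g: "g \<in> carrier_mat n n" "det g \<noteq> 0" "\<And>j. j < n \<Longrightarrow> col g j \<in> W"
  shows "W = carrier_vec n"
proof
  obtain g' where g': "g' \<in> carrier_mat n n" "g * g' = 1\<^sub>m n" using GL_inverse[OF g(1,2)] by blast
  show "carrier_vec n \<subseteq> W"
  proof
    fix v :: "'a vec" assume v: "v \<in> carrier_vec n"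
    have "g *\<^sub>v (g' *\<^sub>v v) = v" using assoc_mult_mat_vec[OF g(1) g'(1) v] g'(2) v by simp
    moreover have "g *\<^sub>v (g' *\<^sub>v v) \<in> W"
      by (rule mult_mat_vec_in_subspace[OF W g(1,3)]) (use g'(1) v in auto)
    ultimately show "v \<in> W" by simp
  qed
qed (use W in \<open>simp add: vec_subspace_iff\<close>)

lemma pow_mult_vec_in_invariant:
  assumes "h \<in> carrier_mat n n" "w \<in> W" "W \<subseteq> carrier_vec n" "\<And>v. v \<in> W \<Longrightarrow> h *\<^sub>v v \<in> W"
  shows "h ^\<^sub>m k *\<^sub>v w \<in> W"
proof (induction k)
  case 0 then show ?case using assms by auto
next
  case (Suc k) then show ?case using assms pow_mat_vec_Suc[OF assms(1), of w k] by auto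
qed

lemma vec_subspace_krylov:
  fixes h :: "'a::field mat"
  assumes W: "vec_subspace n W" and h: "h \<in> carrier_mat n n" "\<And>v. v \<in> W \<Longrightarrow> h *\<^sub>v v \<in> W" and w: "w \<in> W"
    and det: "det (krylov n h w) \<noteq> 0"
  shows "W = carrier_vec n"
proof (rule vec_subspace_eq_carrier[OF W krylov_carrier det])
  fix j assume "j < n"
  then show "col (krylov n h w) j \<in> W"
    using krylov_col[OF h(1), of w j] pow_mult_vec_in_invariant[OF h(1) w _ h(2), of "n - 1 - j"] W w
    by (auto simp: vec_subspace_iff)
qed

text \<open>Over the algebraic closure a nonzero invariant subspace contains an eigenvector of
  \<open>x\<close>, because \<open>x ^ q\<close> is scalar. The images of this vector under the
  powers of \<open>h\<close> form a basis.\<close>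

lemma (in prime_root) absolutely_irreducible_weyl:
  assumes x: "x \<in> K" "x \<in> carrier_mat q q" "det x \<noteq> 0" and h: "h \<in> K" "h \<in> carrier_mat q q" "det h \<noteq> 0"
    and hx: "h * x = \<xi> \<cdot>\<^sub>m (x * h)" and \<alpha>: "x ^\<^sub>m q = \<alpha> \<cdot>\<^sub>m 1\<^sub>m q"
  shows "absolutely_irreducible q K"
  unfolding absolutely_irreducible_def irreducible_lin_def
proof (intro conjI allI impI q_pos)
  interpret ac: prime_root q "to_ac \<xi>" using prime_root_to_ac prime_root_axioms by blast
  note ac = ac_weyl[OF x(2,3) h(2,3) hx]
  fix W assume WK: "vec_subspace q W \<and> (\<forall>g \<in> ac_mat ` K. \<forall>w \<in> W. g *\<^sub>v w \<in> W)"
  then have W: "vec_subspace q W" and Wx: "\<And>w. w \<in> W \<Longrightarrow> ac_mat x *\<^sub>v w \<in> W" and Wh: "\<And>w. w \<in> W \<Longrightarrow> ac_mat h *\<^sub>v w \<in> W"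
    using x(1) h(1) by auto
  have Wc: "W \<subseteq> carrier_vec q" using W by (simp add: vec_subspace_iff)
  show "W = {0\<^sub>v q} \<or> W = carrier_vec q"
  proof (cases "W = {0\<^sub>v q}")
    case False
    then obtain u where u: "u \<in> W" "u \<noteq> 0\<^sub>v q" using W unfolding vec_subspace_iff by blast
    have uc: "u \<in> carrier_vec q" using u Wc by blast
    have pow: "ac_mat x ^\<^sub>m q = to_ac \<alpha> \<cdot>\<^sub>m 1\<^sub>m q"
      using arg_cong[OF \<alpha>, of ac_mat] to_ac.mat_hom_pow[OF x(2), of q] by (simp add: map_mat_smult_to_ac to_ac.mat_hom_one)
    obtain a where a: "a ^ q = to_ac \<alpha>" using alg_closed_root_exists[OF q_pos] by blast
    have "a \<noteq> 0"
    proof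
      assume "a = 0"
      then have "\<alpha> = 0" using a zero_power[OF q_pos, where 'a = "'a alg_closure"] by simp
      then have "ac_mat x ^\<^sub>m q *\<^sub>v u = 0\<^sub>v q" unfolding pow using smult_mat_mult_vec[OF one_carrier_mat uc, of 0] uc smult_zero_vec[OF uc] by simp
      then show False using GL_pow_mult_vec_neq_0[OF ac(1,3) uc u(2)] by blast
    qed
    moreover have "ac_mat x ^\<^sub>m q *\<^sub>v u = a ^ q \<cdot>\<^sub>v u"
      unfolding pow a using smult_mat_mult_vec[OF one_carrier_mat uc, of "to_ac \<alpha>"] uc by simp
    moreover have "ac_mat x *\<^sub>v w + c \<cdot>\<^sub>v w \<in> W" if "w \<in> W" for w c
      using W Wx[OF that] that by (simp add: vec_subspace_iff)
    ultimately obtain i w where w: "w \<in> W" "w \<noteq> 0\<^sub>v q" "ac_mat x *\<^sub>v w = (a * to_ac \<xi> ^ i) \<cdot>\<^sub>v w"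
      using ac.kummer_eigenvector[OF ac(1) Wc _ u] by blast
    have "a * to_ac \<xi> ^ i \<noteq> 0" using \<open>a \<noteq> 0\<close> ac.root_neq_0 by simp
    then have "det (krylov q (ac_mat h) w) \<noteq> 0"
      using ac.weyl_diagonal_form(1)[OF ac(1,2,4,5) _ w(2,3)] w(1) Wc by blast
    then show ?thesis using vec_subspace_krylov[OF W ac(2) Wh w(1)] by blast
  qed blast
qed

text \<open>Schur's lemma: an eigenspace of \<open>y\<close> over the algebraic closure is invariant
  under \<open>K\<close>, hence everything, and a matrix that is scalar there is scalar over the
  ground field.\<close>

lemma absolutely_irreducible_commutant:
  fixes y :: "'a::field mat"
  assumes irr: "absolutely_irreducible n K" and K: "K \<subseteq> carrier_mat n n"
    and y: "y \<in> carrier_mat n n" "\<And>k. k \<in> K \<Longrightarrow> y * k = k * y"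
  shows "\<exists>c. y = c \<cdot>\<^sub>m 1\<^sub>m n"
proof -
  have n: "n > 0" using irr by (simp add: absolutely_irreducible_def irreducible_lin_def)
  have Y: "ac_mat y \<in> carrier_mat n n" using y by simp
  obtain v a where v: "v \<in> carrier_vec n" "v \<noteq> 0\<^sub>v n" "ac_mat y *\<^sub>v v = a \<cdot>\<^sub>v v"
    using alg_closed_eigenvector[OF Y n] by blast
  define W where "W = {w \<in> carrier_vec n. ac_mat y *\<^sub>v w = a \<cdot>\<^sub>v w}"
  have "vec_subspace n W"
    unfolding vec_subspace_iff W_def
    using mult_mat_zero_vec[OF Y] smult_zero_vec_right[of a n] mult_add_distrib_mat_vec[OF Y] mult_mat_vec[OF Y]
    by (auto simp: smult_add_distrib_vec[of _ n] smult_smult_assoc mult.commute)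
  moreover have "ac_mat k *\<^sub>v w \<in> W" if k: "k \<in> K" and w: "w \<in> W" for k w
  proof -
    have kc: "k \<in> carrier_mat n n" using K k by blast
    have kc': "ac_mat k \<in> carrier_mat n n" using kc by simp
    have wc: "w \<in> carrier_vec n" "ac_mat y *\<^sub>v w = a \<cdot>\<^sub>v w" using w by (auto simp: W_def)
    have "ac_mat y * ac_mat k = ac_mat k * ac_mat y"
      using arg_cong[OF y(2)[OF k], of ac_mat] to_ac.mat_hom_mult[OF y(1) kc] to_ac.mat_hom_mult[OF kc y(1)] by simp
    then have "ac_mat y *\<^sub>v (ac_mat k *\<^sub>v w) = ac_mat k *\<^sub>v (ac_mat y *\<^sub>v w)"
      using assoc_mult_mat_vec[OF Y kc' wc(1)] assoc_mult_mat_vec[OF kc' Y wc(1)] by simp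
    also have "\<dots> = a \<cdot>\<^sub>v (ac_mat k *\<^sub>v w)" unfolding wc(2) by (rule mult_mat_vec[OF kc' wc(1)])
    finally show ?thesis using kc' wc(1) by (auto simp: W_def)
  qed
  ultimately have "W = {0\<^sub>v n} \<or> W = carrier_vec n"
    using irr unfolding absolutely_irreducible_def irreducible_lin_def by blast
  moreover have "v \<in> W" using v by (simp add: W_def)
  ultimately have W: "W = carrier_vec n" using v(2) by blast
  have "ac_mat y = a \<cdot>\<^sub>m 1\<^sub>m n"
  proof (rule eq_matI)
    fix i j assume "i < dim_row (a \<cdot>\<^sub>m 1\<^sub>m n)" "j < dim_col (a \<cdot>\<^sub>m 1\<^sub>m n)"
    then have ij: "i < n" "j < n" by auto
    have "unit_vec n j \<in> W" unfolding W by simp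
    then have "ac_mat y *\<^sub>v unit_vec n j = a \<cdot>\<^sub>v unit_vec n j" by (simp add: W_def)
    moreover have "ac_mat y *\<^sub>v unit_vec n j = unit_vec n j $ j \<cdot>\<^sub>v col (ac_mat y) j"
      by (rule mult_mat_vec_single[OF Y]) (use ij in auto)
    ultimately have "a \<cdot>\<^sub>v unit_vec n j = col (ac_mat y) j" using ij Y by (simp add: one_smult_vec)
    from arg_cong[OF this, of "\<lambda>v. v $ i"] show "ac_mat y $$ (i, j) = (a \<cdot>\<^sub>m 1\<^sub>m n) $$ (i, j)"
      using ij y(1) by auto
  qed (use Y in auto)
  then show ?thesis using ac_mat_scalar[OF y(1) _ n] by blast
qed

text \<open>Commuting with \<open>b\<close> is a system of linear equations in the entries of a matrix, so finitely
  many of the equations coming from \<open>K\<close> imply all of them.\<close>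

lemma finite_commutant:
  fixes K :: "'a::field mat set"
  assumes K: "K \<subseteq> carrier_mat n n"
  shows "\<exists>B. finite B \<and> B \<subseteq> K \<and>
    (\<forall>y \<in> carrier_mat n n. (\<forall>b \<in> B. y * b = b * y) \<longrightarrow> (\<forall>b \<in> K. y * b = b * y))"
proof -
  interpret V: vector_space "\<lambda>(c::'a) (f :: nat \<times> nat \<Rightarrow> 'a) p. c * f p"
    by unfold_locales (auto simp: fun_eq_iff algebra_simps plus_fun_def)
  define S where "S = {..<n} \<times> {..<n}"
  \<comment> \<open>The coefficients of entry \<open>(i, j)\<close> of \<open>y * b - b * y\<close>
    as a linear form in the entries of \<open>y\<close>, extended by zero outside \<open>S\<close>;
    \<open>ev\<close> evaluates such a form at a matrix.\<close>
  define \<phi> where "\<phi> = (\<lambda>(b :: 'a mat, i, j) (k, l). if (k, l) \<in> S then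
      (if k = i then b $$ (l, j) else 0) - (if l = j then b $$ (i, k) else 0) else 0)"
  define ev where "ev = (\<lambda>(y :: 'a mat) f. \<Sum>p\<in>S. f p * y $$ p)"
  have fin: "finite S" by (simp add: S_def)
  have ev\<phi>: "ev y (\<phi> (b, i, j)) = (y * b) $$ (i, j) - (b * y) $$ (i, j)"
    if "b \<in> carrier_mat n n" "y \<in> carrier_mat n n" "i < n" "j < n" for b y i j
  proof -
    have "ev y (\<phi> (b, i, j)) = (\<Sum>k<n. \<Sum>l<n. ((if k = i then b $$ (l, j) else 0) - (if l = j then b $$ (i, k) else 0)) * y $$ (k, l))"
      by (simp only: sum.cartesian_product ev_def S_def) (intro sum.cong refl, auto simp: \<phi>_def S_def)
    also have "\<dots> = (\<Sum>k<n. \<Sum>l<n. (if k = i then b $$ (l, j) * y $$ (k, l) else 0)) - (\<Sum>k<n. \<Sum>l<n. (if l = j then b $$ (i, k) * y $$ (k, l) else 0))"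
      unfolding sum_subtractf[symmetric] by (intro sum.cong refl) (auto simp: algebra_simps)
    also have "(\<Sum>k<n. \<Sum>l<n. (if k = i then b $$ (l, j) * y $$ (k, l) else 0)) = (\<Sum>l<n. y $$ (i, l) * b $$ (l, j))"
      by (subst sum.swap) (use that in \<open>simp add: mult.commute\<close>)
    also have "(\<Sum>k<n. \<Sum>l<n. (if l = j then b $$ (i, k) * y $$ (k, l) else 0)) = (\<Sum>k<n. b $$ (i, k) * y $$ (k, j))"
      using that by simp
    finally show ?thesis using that by (simp add: scalar_prod_def atLeast0LessThan)
  qed
  define R where "R = \<phi> ` (K \<times> S)"
  obtain B0 where B0: "B0 \<subseteq> R" "V.independent B0" "R \<subseteq> V.span B0"
    by (rule V.maximal_independent_subset)
  \<comment> \<open>The unit functions at the positions in \<open>S\<close> span all these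
    coefficient functions, which bounds the independent set \<open>B0\<close>.\<close>
  define T where "T = (\<lambda>p q. if q = p then 1 else 0 :: 'a) ` S"
  have "R \<subseteq> V.span T"
  proof
    fix f assume "f \<in> R"
    then have supp: "f p = 0" if "p \<notin> S" for p using that by (cases p) (auto simp: R_def \<phi>_def)
    have "(\<Sum>p\<in>S. (\<lambda>q. f p * (if q = p then 1 else 0))) = f"
    proof
      fix q
      have "(\<Sum>p\<in>S. (\<lambda>q. f p * (if q = p then 1 else 0))) q = (\<Sum>p\<in>S. f p * (if q = p then 1 else 0))"
        using fin by (induction S rule: finite_induct) (auto simp: plus_fun_def zero_fun_def)
      also have "\<dots> = (\<Sum>p\<in>S. if q = p then f p else 0)" by (intro sum.cong) auto
      also have "\<dots> = f q" using fin supp by auto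
      finally show "(\<Sum>p\<in>S. (\<lambda>q. f p * (if q = p then 1 else 0))) q = f q" .
    qed
    moreover have "(\<Sum>p\<in>S. (\<lambda>q. f p * (if q = p then 1 else 0))) \<in> V.span T"
      by (intro V.span_sum V.span_scale V.span_base) (auto simp: T_def)
    ultimately show "f \<in> V.span T" by simp
  qed
  then have "finite B0" using V.independent_span_bound[OF _ B0(2), of T] B0(1) fin by (auto simp: T_def)
  then obtain C where C: "C \<subseteq> K \<times> S" "finite C" "B0 = \<phi> ` C"
    using finite_subset_image[of B0 \<phi> "K \<times> S"] B0(1) unfolding R_def by blast
  show ?thesis
  proof (intro exI[of _ "fst ` C"] conjI ballI impI)
    show "finite (fst ` C)" "fst ` C \<subseteq> K" using C by auto
    fix y b assume y: "y \<in> carrier_mat n n" "\<forall>b \<in> fst ` C. y * b = b * y" and b: "b \<in> K"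
    have "V.subspace {f. ev y f = 0}"
      by (rule V.subspaceI) (auto simp: ev_def algebra_simps sum.distrib plus_fun_def zero_fun_def mult.assoc simp flip: sum_distrib_left)
    moreover have "B0 \<subseteq> {f. ev y f = 0}"
    proof
      fix f assume "f \<in> B0"
      then obtain b i j where bij: "(b, i, j) \<in> C" "f = \<phi> (b, i, j)" using C(3) by auto
      then have "b \<in> K" "i < n" "j < n" "y * b = b * y" using C(1) y(2) by (force simp: S_def)+
      then show "f \<in> {f. ev y f = 0}" using ev\<phi>[of b y i j] K y(1) bij(2) by auto
    qed
    ultimately have R: "R \<subseteq> {f. ev y f = 0}" using B0(3) V.span_minimal by blast
    show "y * b = b * y"
    proof (rule eq_matI)
      have bc: "b \<in> carrier_mat n n" using b K by blast
      show "dim_row (y * b) = dim_row (b * y)" "dim_col (y * b) = dim_col (b * y)" using bc y by auto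
      fix i j assume "i < dim_row (b * y)" "j < dim_col (b * y)"
      then have ij: "i < n" "j < n" using bc y by auto
      have "\<phi> (b, i, j) \<in> R" using b ij by (auto simp: R_def S_def)
      then have "ev y (\<phi> (b, i, j)) = 0" using R by blast
      then show "(y * b) $$ (i, j) = (b * y) $$ (i, j)" using ev\<phi>[OF bc y(1) ij] by simp
    qed
  qed
qed

section \<open>The centralizers of \<open>I_mat\<close> and of \<open>d_mat\<close>\<close>

text \<open>Commuting with the shift expresses row \<open>Suc i\<close> through row
  \<open>i\<close>, so the first row determines the matrix. By \<open>I_mat_pow_row\<close> the
  powers of \<open>I_mat\<close> realize all unit vectors as first rows.\<close>

lemma comm_I_mat_eqI:
  fixes y z :: "'a::field mat"
  assumes y: "y \<in> carrier_mat n n" "y * I_mat n \<alpha> = I_mat n \<alpha> * y"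
    and z: "z \<in> carrier_mat n n" "z * I_mat n \<alpha> = I_mat n \<alpha> * z"
    and row: "\<And>j. j < n \<Longrightarrow> y $$ (0, j) = z $$ (0, j)"
  shows "y = z"
proof -
  have "i < n \<Longrightarrow> \<forall>j<n. y $$ (i, j) = z $$ (i, j)" for i
  proof (induction i)
    case 0 then show ?case using row by simp
  next
    case (Suc i)
    have *: "u $$ (Suc i, j) = (if j = 0 then \<alpha> * u $$ (i, n - 1) else u $$ (i, j - 1))"
      if "u \<in> carrier_mat n n" "u * I_mat n \<alpha> = I_mat n \<alpha> * u" "j < n" for u j
    proof -
      have "u $$ (Suc i, j) = (I_mat n \<alpha> * u) $$ (i, j)"
        using I_mat_mult_index[OF that(1), of i j \<alpha>] that Suc.prems by simp
      also have "\<dots> = (u * I_mat n \<alpha>) $$ (i, j)" using that by simp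
      finally show ?thesis using mult_I_mat_index[OF that(1), of i j \<alpha>] that Suc.prems by simp
    qed
    show ?case using *[OF y] *[OF z] Suc by auto
  qed
  then show ?thesis using y z by (intro eq_matI) auto
qed

lemma I_mat_pow_row:
  "k < n \<Longrightarrow> j < n \<Longrightarrow> (I_mat n \<alpha> ^\<^sub>m k) $$ (0, j) = (if j = k then 1 else 0 :: 'a::field)"
proof (induction k arbitrary: j)
  case 0
  then show ?case using carrier_matD(1)[OF I_mat_carrier[of n \<alpha>]] by simp
next
  case (Suc k)
  have "I_mat n \<alpha> ^\<^sub>m k \<in> carrier_mat n n" using Suc.prems by (intro pow_carrier_mat I_mat_carrier) simp
  from mult_I_mat_index[OF this, of 0 j \<alpha>] Suc show ?case by auto
qed

lemma I_mat_pow_comm: "n > 0 \<Longrightarrow> I_mat n \<alpha> ^\<^sub>m k * I_mat n \<alpha> = I_mat n \<alpha> * I_mat n \<alpha> ^\<^sub>m k"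
  using pow_mat_Suc_left[OF I_mat_carrier, of n \<alpha> k] by simp

lemma I_mat_pow_n:
  assumes n: "n > 0"
  shows "I_mat n \<alpha> ^\<^sub>m n = \<alpha> \<cdot>\<^sub>m (1\<^sub>m n :: 'a::field mat)"
proof (rule comm_I_mat_eqI[where \<alpha> = \<alpha>])
  note I = I_mat_carrier[OF n, of \<alpha>]
  show "I_mat n \<alpha> ^\<^sub>m n \<in> carrier_mat n n" using I by simp
  show "I_mat n \<alpha> ^\<^sub>m n * I_mat n \<alpha> = I_mat n \<alpha> * I_mat n \<alpha> ^\<^sub>m n" by (rule I_mat_pow_comm[OF n])
  show "\<alpha> \<cdot>\<^sub>m 1\<^sub>m n * I_mat n \<alpha> = I_mat n \<alpha> * (\<alpha> \<cdot>\<^sub>m 1\<^sub>m n)" using scalar_mat_mult[OF I] by simp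
  fix j assume j: "j < n"
  have "I_mat n \<alpha> ^\<^sub>m (n - 1) \<in> carrier_mat n n" using I by simp
  from mult_I_mat_index[OF this n j, of \<alpha>]
  have "(I_mat n \<alpha> ^\<^sub>m (n - 1) * I_mat n \<alpha>) $$ (0, j) = (if j = 0 then \<alpha> else 0)"
    using I_mat_pow_row[of "n - 1" n _ \<alpha>] j n by auto
  also have "I_mat n \<alpha> ^\<^sub>m (n - 1) * I_mat n \<alpha> = I_mat n \<alpha> ^\<^sub>m n"
    using pow_mat.simps(2)[of "I_mat n \<alpha>" "n - 1"] n by simp
  finally show "(I_mat n \<alpha> ^\<^sub>m n) $$ (0, j) = (\<alpha> \<cdot>\<^sub>m 1\<^sub>m n) $$ (0, j)" using n j by simp
qed auto

lemma I_mat_GL: "n > 0 \<Longrightarrow> \<alpha> \<noteq> 0 \<Longrightarrow> I_mat n \<alpha> \<in> carrier (GL n)"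
proof -
  assume n: "n > 0" "\<alpha> \<noteq> 0"
  have "det (I_mat n \<alpha>) \<noteq> 0"
  proof
    assume "det (I_mat n \<alpha>) = 0"
    then have "det (I_mat n \<alpha> ^\<^sub>m (n - 1) * I_mat n \<alpha>) = 0"
      using det_mult[OF pow_carrier_mat[OF I_mat_carrier[OF n(1), of \<alpha>]] I_mat_carrier[OF n(1), of \<alpha>], of "n - 1"] by simp
    then have "det (I_mat n \<alpha> ^\<^sub>m Suc (n - 1)) = 0" by simp
    then have "det (\<alpha> \<cdot>\<^sub>m (1\<^sub>m n :: 'a mat)) = 0" using I_mat_pow_n[OF n(1), of \<alpha>] n by simp
    then show False using n by simp
  qed
  then show ?thesis using I_mat_carrier[OF n(1)] by (simp add: carrier_GL)
qed

text \<open>A matrix commuting with \<open>I_mat\<close> is the polynomial in \<open>I_mat\<close>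
  that has the first row of the matrix as its coefficients.\<close>

lemma Delta_ring_carrier:
  assumes n: "n > 0"
  shows "carrier (Delta_ring n \<alpha>) = {y \<in> carrier_mat n n. y * I_mat n \<alpha> = I_mat n \<alpha> * (y :: 'a::field mat)}"
    (is "_ = ?C")
proof
  note I = I_mat_carrier[OF n, of \<alpha>]
  let ?H = "insert (I_mat n \<alpha>) {c \<cdot>\<^sub>m 1\<^sub>m n | c. True}"
  interpret R: ring "Mat_ring n :: 'a mat ring" by (rule ring_mat)
  note simps = ring_mat_simps
  have carr: "carrier (Delta_ring n \<alpha>) = generate_ring (Mat_ring n) ?H" by (simp add: Delta_ring_def)
  note a = assoc_mult_mat[of _ n n _ n _ n]
  have "y \<in> ?C" if "y \<in> generate_ring (Mat_ring n) ?H" for y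
    using that
  proof (induction rule: generate_ring.induct)
    case one then show ?case using I by (simp add: simps)
  next
    case (incl h)
    then show ?case using I scalar_mat_mult[OF I] by auto
  next
    case (a_inv h)
    have h: "h \<in> carrier_mat n n" using a_inv by simp
    have "\<ominus>\<^bsub>Mat_ring n\<^esub> h = - h"
    proof (rule R.minus_equality)
      show "- h \<oplus>\<^bsub>Mat_ring n\<^esub> h = \<zero>\<^bsub>Mat_ring n\<^esub>" using h by (simp add: simps)
    qed (use h in \<open>auto simp: simps\<close>)
    then show ?case using a_inv carrier_matD[OF I] carrier_matD[OF h] by (simp add: uminus_mult_left_mat uminus_mult_right_mat)
  next
    case (eng_add h1 h2)
    then show ?case using add_mult_distrib_mat[of h1 n n h2 "I_mat n \<alpha>" n] mult_add_distrib_mat[of "I_mat n \<alpha>" n n h1 n h2] I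
      by (simp add: simps)
  next
    case (eng_mult h1 h2)
    then have "h1 * h2 * I_mat n \<alpha> = h1 * (I_mat n \<alpha> * h2)" using I by (simp add: a)
    also have "\<dots> = I_mat n \<alpha> * (h1 * h2)" using eng_mult I by (simp flip: a)
    finally show ?case using eng_mult mult_carrier_mat[of h1 n n h2 n] by (simp add: simps)
  qed
  then show "carrier (Delta_ring n \<alpha>) \<subseteq> ?C" unfolding carr by blast
  show "?C \<subseteq> carrier (Delta_ring n \<alpha>)"
  proof
    fix y assume y: "y \<in> ?C"
    have scal: "c \<cdot>\<^sub>m 1\<^sub>m n \<in> generate_ring (Mat_ring n) ?H" for c by (rule generate_ring.incl) auto
    have pow: "I_mat n \<alpha> ^\<^sub>m k \<in> generate_ring (Mat_ring n) ?H" for k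
    proof (induction k)
      case 0 then show ?case using generate_ring.one[of "Mat_ring n" ?H] carrier_matD[OF I] by (simp add: simps)
    next
      case (Suc k)
      then show ?case using generate_ring.eng_mult[OF Suc generate_ring.incl[of "I_mat n \<alpha>" ?H]] by (simp add: simps)
    qed
    \<comment> \<open>Partial sums of the polynomial with coefficients \<open>y $$ (0, k)\<close>;
      the sum over all \<open>k < n\<close> has the same first row as \<open>y\<close>.\<close>
    have "k \<le> n \<Longrightarrow> \<exists>s. s \<in> generate_ring (Mat_ring n) ?H \<and> s \<in> ?C \<and> (\<forall>j<n. s $$ (0, j) = (if j < k then y $$ (0, j) else 0))" for k
    proof (induction k)
      case 0
      have "0 \<cdot>\<^sub>m 1\<^sub>m n \<in> ?C" using scalar_mat_mult[OF I] by auto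
      then show ?case using scal[of 0] n by (intro exI[of _ "0 \<cdot>\<^sub>m 1\<^sub>m n"]) auto
    next
      case (Suc k)
      then obtain s where s: "s \<in> generate_ring (Mat_ring n) ?H" "s \<in> ?C" "\<And>j. j < n \<Longrightarrow> s $$ (0, j) = (if j < k then y $$ (0, j) else 0)"
        by auto
      let ?t = "(y $$ (0, k) \<cdot>\<^sub>m 1\<^sub>m n) * I_mat n \<alpha> ^\<^sub>m k"
      have Ik: "I_mat n \<alpha> ^\<^sub>m k \<in> carrier_mat n n" using I by simp
      have t: "?t = y $$ (0, k) \<cdot>\<^sub>m I_mat n \<alpha> ^\<^sub>m k" by (rule scalar_mat_mult[OF Ik])
      have tg: "?t \<in> generate_ring (Mat_ring n) ?H"
        using generate_ring.eng_mult[OF scal pow] by (simp add: simps)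
      have st: "s + ?t \<in> generate_ring (Mat_ring n) ?H" using generate_ring.eng_add[OF s(1) tg] by (simp add: simps)
      then have "s + ?t \<in> ?C" using \<open>\<And>y. y \<in> generate_ring (Mat_ring n) ?H \<Longrightarrow> y \<in> ?C\<close> by blast
      moreover have "(s + ?t) $$ (0, j) = (if j < Suc k then y $$ (0, j) else 0)" if j: "j < n" for j
        using s(2) s(3)[OF j] I_mat_pow_row[of k n j \<alpha>] j Suc.prems carrier_matD[OF I] n unfolding t by (auto simp: less_Suc_eq)
      ultimately show ?case using st by blast
    qed
    from this[of n] obtain s where s: "s \<in> generate_ring (Mat_ring n) ?H" "s \<in> ?C" "\<And>j. j < n \<Longrightarrow> s $$ (0, j) = y $$ (0, j)"
      by auto
    have "s = y" by (rule comm_I_mat_eqI[of _ n \<alpha>]) (use s y in auto)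
    then show "y \<in> carrier (Delta_ring n \<alpha>)" using s carr by simp
  qed
qed

lemma d_mat_GL: "\<xi> \<noteq> 0 \<Longrightarrow> d_mat n \<xi> \<in> carrier (GL n)"
  by (simp add: carrier_GL d_mat_def det_mat_diag)

lemma Syl_Fx_iff: "Factorial_Ring.prime q \<Longrightarrow> x \<in> Syl q Fx \<longleftrightarrow> x \<noteq> (0 :: 'a::field) \<and> (\<exists>k. x ^ (q ^ k) = 1)"
proof -
  assume q: "Factorial_Ring.prime q"
  interpret F: group "Fx :: 'a monoid"
    using field.field_mult_group[OF class_field] by (simp add: mult_of_def Multiplicative_Group.mult_of_def)
  have pow: "x [^]\<^bsub>Fx\<^esub> (n::nat) = x ^ n" for n :: nat by (induction n) (auto simp: nat_pow_Suc class_ring_simps mult.commute)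
  have one: "\<one>\<^bsub>Fx\<^esub> = (1::'a)" by (simp add: class_ring_simps)
  have "(\<exists>k. F.ord x = q ^ k) \<longleftrightarrow> (\<exists>k. x ^ (q ^ k) = 1)" if "x \<noteq> 0"
  proof
    assume "\<exists>k. F.ord x = q ^ k"
    then obtain k where "F.ord x = q ^ k" by blast
    then have "x [^]\<^bsub>Fx\<^esub> (q ^ k) = \<one>\<^bsub>Fx\<^esub>" using F.pow_eq_id[of x "q ^ k"] that by (simp del: carrier_mult_of)
    then show "\<exists>k. x ^ (q ^ k) = 1" using pow one by auto
  next
    assume "\<exists>k. x ^ (q ^ k) = 1"
    then obtain k where "x [^]\<^bsub>Fx\<^esub> (q ^ k) = \<one>\<^bsub>Fx\<^esub>" using pow one by auto
    then have "F.ord x dvd q ^ k" using F.pow_eq_id[of x "q ^ k"] that by (simp del: carrier_mult_of)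
    then show "\<exists>k. F.ord x = q ^ k" using divides_primepow_nat[OF q] by blast
  qed
  then show ?thesis by (auto simp: Syl_def simp del: carrier_mult_of)
qed

section \<open>The groups of the classification as Weyl groups\<close>

context prime_root
begin

sublocale W: weyl_context "GL q :: 'a mat monoid" "scalar_group q" q
  by (rule weyl_context_GL)

lemma I_d_commute: "I_mat q \<alpha> * d_mat q \<xi> = \<xi> \<cdot>\<^sub>m (d_mat q \<xi> * I_mat q \<alpha>)"
proof (rule eq_matI)
  note I = I_mat_carrier[OF q_pos, of \<alpha>]
  show "dim_row (I_mat q \<alpha> * d_mat q \<xi>) = dim_row (\<xi> \<cdot>\<^sub>m (d_mat q \<xi> * I_mat q \<alpha>))"
    "dim_col (I_mat q \<alpha> * d_mat q \<xi>) = dim_col (\<xi> \<cdot>\<^sub>m (d_mat q \<xi> * I_mat q \<alpha>))"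
    using I by (auto simp: d_mat_def mat_diag_def)
  fix i j assume "i < dim_row (\<xi> \<cdot>\<^sub>m (d_mat q \<xi> * I_mat q \<alpha>))" "j < dim_col (\<xi> \<cdot>\<^sub>m (d_mat q \<xi> * I_mat q \<alpha>))"
  then have ij: "i < q" "j < q" using I by (auto simp: d_mat_def mat_diag_def)
  have "Suc i = q \<Longrightarrow> \<xi> * \<xi> ^ i = 1" using root by (metis power_Suc)
  then show "(I_mat q \<alpha> * d_mat q \<xi>) $$ (i, j) = (\<xi> \<cdot>\<^sub>m (d_mat q \<xi> * I_mat q \<alpha>)) $$ (i, j)"
    using ij I carrier_matD[OF I] by (simp add: d_mat_def mat_diag_mult_left[OF I] mat_diag_mult_right[OF I] I_mat_index)
qed

lemma scalar_root_mem: "\<xi> \<cdot>\<^sub>m 1\<^sub>m q \<in> scalar_group q" "\<xi> \<cdot>\<^sub>m 1\<^sub>m q \<noteq> 1\<^sub>m q"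
  using root_neq root_neq_0 by (auto simp: scalar_group_iff scalar_mat_eq_one_iff[OF q_pos])

lemma weyl_d_I:
  assumes "\<alpha> \<noteq> 0"
  shows "W.weyl (\<xi> \<cdot>\<^sub>m 1\<^sub>m q) (d_mat q \<xi>) (I_mat q \<alpha>)"
proof -
  have c: "d_mat q \<xi> * I_mat q \<alpha> \<in> carrier_mat q q"
    unfolding d_mat_def by (rule mult_carrier_mat[OF mat_diag_dim I_mat_carrier[OF q_pos]])
  show ?thesis
    using I_mat_GL[OF q_pos assms] d_mat_GL[OF root_neq_0] scalar_root_mem I_d_commute[of \<alpha>] scalar_mat_mult(1)[OF c]
    by (simp add: W.weyl_def)
qed

lemma weyl_I_db:
  assumes "\<alpha> \<noteq> 0" and b: "b \<in> W.cent (I_mat q \<alpha>)"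
  shows "\<exists>w. W.weyl w (I_mat q \<alpha>) (d_mat q \<xi> * b)"
proof -
  note w = W.weyl_sym[OF weyl_d_I[OF assms(1)]]
  have "W.semi (inv\<^bsub>GL q\<^esub> (\<xi> \<cdot>\<^sub>m 1\<^sub>m q) \<otimes>\<^bsub>GL q\<^esub> \<one>\<^bsub>GL q\<^esub>) (I_mat q \<alpha>) (d_mat q \<xi> \<otimes>\<^bsub>GL q\<^esub> b)"
    using w b W.semi_cent[OF W.weyl_closed(1)[OF w]] by (intro W.semi_mult) (auto simp: W.weyl_semi)
  then show ?thesis using w unfolding W.weyl_semi
    by (metis GL_simps(1) W.r_one W.semi_def W.Z_closed)
qed

lemma Delta_units_eq:
  assumes "\<alpha> \<noteq> 0"
  shows "Delta_units q \<alpha> = (GL q)\<lparr>carrier := W.cent (I_mat q \<alpha>)\<rparr>"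
proof -
  note I = I_mat_carrier[OF q_pos, of \<alpha>]
  let ?C = "{y \<in> carrier_mat q q. y * I_mat q \<alpha> = I_mat q \<alpha> * y}"
  have "Units (Delta_ring q \<alpha>) = {y \<in> ?C. \<exists>y' \<in> ?C. y' * y = 1\<^sub>m q \<and> y * y' = 1\<^sub>m q}"
    unfolding Units_def Delta_ring_carrier[OF q_pos] by (simp add: Delta_ring_def ring_mat_simps)
  also have "\<dots> = W.cent (I_mat q \<alpha>)"
  proof (intro equalityI subsetI)
    fix y assume "y \<in> {y \<in> ?C. \<exists>y' \<in> ?C. y' * y = 1\<^sub>m q \<and> y * y' = 1\<^sub>m q}"
    then obtain y' where y: "y \<in> ?C" "y' \<in> ?C" "y' * y = 1\<^sub>m q" by blast
    then have "det y' * det y = 1" using det_mult[of y' q y] by simp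
    then show "y \<in> W.cent (I_mat q \<alpha>)" using y by (auto simp: W.cent_def carrier_GL)
  next
    fix y assume y: "y \<in> W.cent (I_mat q \<alpha>)"
    have Ic: "I_mat q \<alpha> \<in> carrier (GL q)" using I_mat_GL[OF q_pos assms] .
    have "inv\<^bsub>GL q\<^esub> y \<in> W.cent (I_mat q \<alpha>)" using W.cent_subgroup[OF Ic] y subgroup.m_inv_closed by metis
    moreover have "y \<in> carrier (GL q)" using y by (simp add: W.cent_def)
    then have "inv\<^bsub>GL q\<^esub> y * y = 1\<^sub>m q" "y * inv\<^bsub>GL q\<^esub> y = 1\<^sub>m q" using W.l_inv[of y] W.r_inv[of y] by simp_all
    ultimately show "y \<in> {y \<in> ?C. \<exists>y' \<in> ?C. y' * y = 1\<^sub>m q \<and> y * y' = 1\<^sub>m q}"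
      using y by (auto simp: W.cent_def carrier_GL)
  qed
  finally show ?thesis unfolding Delta_units_def GL_def units_of_def by (simp add: Delta_ring_def)
qed

lemma Delta_units_carrier: "\<alpha> \<noteq> 0 \<Longrightarrow> carrier (Delta_units q \<alpha>) = W.cent (I_mat q \<alpha>)"
  by (simp add: Delta_units_eq)

text \<open>A power of a coset is trivial exactly if the same power of a representative is scalar,
  and the divisors of \<open>q ^ m\<close> are again powers of \<open>q\<close>; so the Sylow
  condition in the quotient is torsion modulo scalars.\<close>

lemma A_grp_eq:
  assumes \<alpha>: "\<alpha> \<noteq> 0"
  shows "A_grp q \<alpha> = W.torsion_cent (I_mat q \<alpha>)"
proof -
  let ?D = "(GL q)\<lparr>carrier := W.cent (I_mat q \<alpha>)\<rparr>" let ?Z = "scalar_group q :: 'a mat set"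
  have I: "I_mat q \<alpha> \<in> carrier (GL q)" using I_mat_GL[OF q_pos \<alpha>] .
  have C: "subgroup (W.cent (I_mat q \<alpha>)) (GL q)" using W.cent_subgroup[OF I] .
  interpret D: group ?D by (rule subgroup.subgroup_is_group[OF C group_GL])
  have ZC: "?Z \<subseteq> W.cent (I_mat q \<alpha>)" using W.Z_subset_cent[OF I] .
  have Zs: "subgroup ?Z ?D" using W.subgroup_incl[OF scalar_group_subgroup C ZC] .
  have Cc: "y \<in> W.cent (I_mat q \<alpha>) \<Longrightarrow> y \<in> carrier (GL q)" for y by (rule W.cent_closed)
  interpret N: normal ?Z ?D
  proof (rule D.normal_invI[OF Zs])
    fix x h assume "x \<in> carrier ?D" "h \<in> ?Z"
    then have "x \<otimes>\<^bsub>?D\<^esub> h \<otimes>\<^bsub>?D\<^esub> inv\<^bsub>?D\<^esub> x = h \<otimes>\<^bsub>?D\<^esub> (x \<otimes>\<^bsub>?D\<^esub> inv\<^bsub>?D\<^esub> x)"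
      using D.m_assoc[of h x "inv\<^bsub>?D\<^esub> x"] W.Z_central[of h x] Cc ZC D.inv_closed[of x] by auto
    then show "x \<otimes>\<^bsub>?D\<^esub> h \<otimes>\<^bsub>?D\<^esub> inv\<^bsub>?D\<^esub> x \<in> ?Z"
      using \<open>x \<in> carrier ?D\<close> \<open>h \<in> ?Z\<close> D.r_inv[of x] D.r_one[of h] ZC by auto
  qed
  interpret M: group "?D Mod ?Z" by (rule N.factorgroup_is_group)
  interpret hom: group_hom ?D "?D Mod ?Z" "\<lambda>a. ?Z #>\<^bsub>?D\<^esub> a"
    by (intro group_hom.intro group_hom_axioms.intro D.is_group M.is_group N.r_coset_hom_Mod)
  have pow: "(?Z #>\<^bsub>?D\<^esub> x) [^]\<^bsub>?D Mod ?Z\<^esub> (n::nat) = \<one>\<^bsub>?D Mod ?Z\<^esub> \<longleftrightarrow> x [^]\<^bsub>GL q\<^esub> n \<in> ?Z" if x: "x \<in> carrier ?D" for x and n :: nat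
  proof -
    have "(?Z #>\<^bsub>?D\<^esub> x) [^]\<^bsub>?D Mod ?Z\<^esub> n = ?Z #>\<^bsub>?D\<^esub> (x [^]\<^bsub>?D\<^esub> n)" using hom.hom_nat_pow[OF x] by simp
    moreover have "x [^]\<^bsub>?D\<^esub> n = x [^]\<^bsub>GL q\<^esub> n" by (rule W.nat_pow_consistent[symmetric])
    moreover have "\<one>\<^bsub>?D Mod ?Z\<^esub> = ?Z" by (simp add: FactGroup_def)
    moreover have "?Z #>\<^bsub>?D\<^esub> y = ?Z \<longleftrightarrow> y \<in> ?Z" if "y \<in> carrier ?D" for y
      using D.coset_join1[OF _ that Zs] D.coset_join2[OF that Zs] by auto
    ultimately show ?thesis using D.nat_pow_closed[OF x, of n] by simp
  qed
  have "?Z #>\<^bsub>?D\<^esub> x \<in> Syl q (?D Mod ?Z) \<longleftrightarrow> (\<exists>m. x [^]\<^bsub>GL q\<^esub> (q ^ m) \<in> ?Z)" if x: "x \<in> carrier ?D" for x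
  proof -
    have cx: "?Z #>\<^bsub>?D\<^esub> x \<in> carrier (?D Mod ?Z)" using hom.hom_closed[OF x] .
    have "(\<exists>k. l = q ^ k) \<longleftrightarrow> (\<exists>m. l dvd q ^ m)" for l
      using divides_primepow_nat[OF prime_q, of l] by auto
    then show ?thesis using cx M.pow_eq_id[OF cx] pow[OF x] by (auto simp: Syl_def)
  qed
  then show ?thesis
    unfolding A_grp_def Delta_units_eq[OF \<alpha>] W.torsion_cent_def W.torsion_level_def by auto
qed

text \<open>What commutes with \<open>d_mat\<close> is diagonal, its entries being distinct. If the
  \<open>q ^ m\<close>-th power is scalar, the quotients of the entries by the entry
  \<open>f 0\<close> have \<open>q\<close>-power order, and \<open>f 0\<close> becomes the common
  factor.\<close>

lemma D_set_eq: "D_set q = W.torsion_cent (d_mat q \<xi>)"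
proof (intro equalityI subsetI)
  have dG: "d_mat q \<xi> \<in> carrier (GL q)" by (rule d_mat_GL[OF root_neq_0])
  {
    fix y :: "'a mat" assume "y \<in> D_set q"
    then obtain \<beta> \<gamma> where y: "y = mat_diag q (\<lambda>i. \<beta> * \<gamma> i)" "\<beta> \<noteq> 0" "\<And>i. i < q \<Longrightarrow> \<gamma> i \<in> Syl q Fx"
      by (auto simp: D_set_def simp del: carrier_mult_of)
    have \<gamma>: "\<gamma> i \<noteq> 0" "\<exists>k. \<gamma> i ^ (q ^ k) = 1" if "i < q" for i using y(3)[OF that] Syl_Fx_iff[OF prime_q] by auto
    obtain k where k: "\<And>i. i < q \<Longrightarrow> \<gamma> i ^ (q ^ k i) = 1" using \<gamma>(2) by metis
    \<comment> \<open>Only a common upper bound of the exponents is wanted; the sum is one.\<close>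
    define m where "m = (\<Sum>i<q. k i)"
    have gm: "\<gamma> i ^ (q ^ m) = 1" if "i < q" for i
    proof -
      have "k i \<le> m" unfolding m_def using that by (intro member_le_sum) auto
      then have "q ^ m = q ^ k i * q ^ (m - k i)" by (simp flip: power_add)
      then show ?thesis using k[OF that] by (simp add: power_mult)
    qed
    have yG: "y \<in> carrier (GL q)" using y \<gamma> by (simp add: carrier_GL det_mat_diag)
    have "y * d_mat q \<xi> = d_mat q \<xi> * y" unfolding y(1) d_mat_def by (simp add: mult.commute)
    moreover have "y [^]\<^bsub>GL q\<^esub> (q ^ m) = \<beta> ^ (q ^ m) \<cdot>\<^sub>m 1\<^sub>m q"
      unfolding GL_pow[OF yG] unfolding y(1) mat_diag_pow mat_diag_const[symmetric]
      by (rule mat_diag_cong) (use gm in \<open>simp add: power_mult_distrib\<close>)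
    moreover have "\<beta> ^ (q ^ m) \<cdot>\<^sub>m 1\<^sub>m q \<in> scalar_group q" 
      unfolding scalar_group_iff using y(2) by (intro exI[of _ "\<beta> ^ (q ^ m)"]) simp
    ultimately have "y \<in> W.torsion_level m (d_mat q \<xi>)"
      using yG by (simp add: W.torsion_level_def W.cent_def)
    then show "y \<in> W.torsion_cent (d_mat q \<xi>)" unfolding W.torsion_cent_def by blast
  next
    fix y assume "y \<in> W.torsion_cent (d_mat q \<xi>)"
    then obtain m where y: "y \<in> carrier (GL q)" "y * d_mat q \<xi> = d_mat q \<xi> * y" "y [^]\<^bsub>GL q\<^esub> (q ^ m) \<in> scalar_group q"
      by (auto simp: W.torsion_cent_def W.torsion_level_def W.cent_def)
    have yc: "y \<in> carrier_mat q q" "det y \<noteq> 0" using y(1) by (auto simp: carrier_GL)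
    have inj: "inj_on (\<lambda>i. \<xi> ^ i) {..<q}" using root_pow_inj by (auto simp: inj_on_def)
    define f where "f i = y $$ (i, i)" for i
    have yf: "y = mat_diag q f" unfolding f_def
      by (rule comm_mat_diag[OF yc(1) _ inj]) (use y(2) in \<open>simp add: d_mat_def\<close>)
    obtain c where c: "c \<noteq> 0" "mat_diag q (\<lambda>i. f i ^ (q ^ m)) = c \<cdot>\<^sub>m 1\<^sub>m q"
      using y(3) unfolding GL_pow[OF y(1)] scalar_group_iff unfolding yf mat_diag_pow by blast
    have fc: "f i ^ (q ^ m) = c" if "i < q" for i
      using arg_cong[OF c(2), of "\<lambda>B. B $$ (i, i)"] that by (simp add: mat_diag_index)
    have f0: "f i \<noteq> 0" if "i < q" for i using yc(2) that unfolding yf det_mat_diag by auto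
    have "f i / f 0 \<in> Syl q Fx" if "i < q" for i
      unfolding Syl_Fx_iff[OF prime_q] using f0[OF that] f0[OF q_pos] fc[OF that] fc[OF q_pos] c(1)
      by (auto simp: power_divide intro!: exI[of _ m])
    moreover have "y = mat_diag q (\<lambda>i. f 0 * (f i / f 0))" unfolding yf
      by (rule mat_diag_cong) (use f0[OF q_pos] in simp)
    ultimately show "y \<in> D_set q" unfolding D_set_def using f0[OF q_pos]
      by (auto simp del: carrier_mult_of intro!: exI[of _ "f 0"] exI[of _ "\<lambda>i. f i / f 0"])
  }
qed

lemma H_grp_eq: "\<alpha> \<noteq> 0 \<Longrightarrow> H_grp q \<alpha> = W.weyl_group (d_mat q \<xi>) (I_mat q \<alpha>)"
  unfolding H_grp_def D_set_eq W.weyl_group_generate[OF weyl_d_I] ..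

lemma G_grp_eq:
  assumes "\<alpha> \<noteq> 0" "b \<in> W.cent (I_mat q \<alpha>)"
  shows "G_grp q \<xi> \<alpha> b = W.weyl_group (I_mat q \<alpha>) (d_mat q \<xi> * b)"
proof -
  obtain w where w: "W.weyl w (I_mat q \<alpha>) (d_mat q \<xi> * b)" using weyl_I_db[OF assms] by blast
  show ?thesis unfolding G_grp_def A_grp_eq[OF assms(1)] W.weyl_group_generate[OF w] ..
qed

end

section \<open>Kummer theory for \<open>I_mat\<close>\<close>

lemma poly_act_sum_monom_index:
  assumes A: "A \<in> carrier_mat n n" and v: "v \<in> carrier_vec n" and i: "i < n"
  shows "poly_act A (\<Sum>j<(N::nat). monom (c j) (e j)) v $ i = (\<Sum>j<N. c j * (A ^\<^sub>m e j *\<^sub>v v) $ i)"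
proof (induction N)
  case 0 then show ?case using poly_act_0[OF v, of A] i by simp
next
  case (Suc N)
  have u: "A ^\<^sub>m e N *\<^sub>v v \<in> carrier_vec n" by (rule mult_mat_vec_carrier[OF pow_carrier_mat[OF A] v])
  have "poly_act A (\<Sum>j<Suc N. monom (c j) (e j)) v = poly_act A (\<Sum>j<N. monom (c j) (e j)) v + c N \<cdot>\<^sub>v (A ^\<^sub>m e N *\<^sub>v v)"
    by (simp add: poly_act_add[OF A v] poly_act_monom[OF A v])
  then show ?case using Suc i carrier_vecD[OF u] by (simp del: index_mult_mat_vec dim_mult_mat_vec)
qed

lemma krylov_mult_vec:
  assumes h: "h \<in> carrier_mat n n" and v: "v \<in> carrier_vec n" and w: "w \<in> carrier_vec n"
  shows "krylov n h v *\<^sub>v w = poly_act h (\<Sum>j<n. monom (w $ j) (n - 1 - j)) v"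
proof (rule eq_vecI)
  show "dim_vec (krylov n h v *\<^sub>v w) = dim_vec (poly_act h (\<Sum>j<n. monom (w $ j) (n - 1 - j)) v)"
    using carrier_vecD[OF poly_act_closed[OF h v]] by (simp add: krylov_def)
  fix i assume "i < dim_vec (poly_act h (\<Sum>j<n. monom (w $ j) (n - 1 - j)) v)"
  then have i: "i < n" using carrier_vecD[OF poly_act_closed[OF h v]] by simp
  have "(krylov n h v *\<^sub>v w) $ i = (\<Sum>j = 0..<n. krylov n h v $$ (i, j) * w $ j)"
    using i w carrier_matD[OF krylov_carrier[of n h v]] by (simp add: scalar_prod_def)
  also have "\<dots> = (\<Sum>j<n. w $ j * (h ^\<^sub>m (n - 1 - j) *\<^sub>v v) $ i)"
    unfolding atLeast0LessThan using i by (intro sum.cong refl) (simp add: krylov_def mult.commute)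
  finally show "(krylov n h v *\<^sub>v w) $ i = poly_act h (\<Sum>j<n. monom (w $ j) (n - 1 - j)) v $ i"
    using poly_act_sum_monom_index[OF h v i] by simp
qed

lemma poly_act_ac:
  assumes A: "A \<in> carrier_mat n n" and v: "v \<in> carrier_vec n"
  shows "map_vec to_ac (poly_act A p v) = poly_act (ac_mat A) (map_poly to_ac p) (map_vec to_ac v)"
proof (induction p)
  case 0
  have v': "map_vec to_ac v \<in> carrier_vec n" using v by simp
  show ?case using poly_act_0[OF v, of A] poly_act_0[OF v', of "ac_mat A"] by (auto intro!: eq_vecI)
next
  case (pCons a p)
  have v': "map_vec to_ac v \<in> carrier_vec n" and A': "ac_mat A \<in> carrier_mat n n" using v A by auto
  have p: "poly_act A p v \<in> carrier_vec n" by (rule poly_act_closed[OF A v])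
  have Ap: "A *\<^sub>v poly_act A p v \<in> carrier_vec n" by (rule mult_mat_vec_carrier[OF A p])
  have "map_vec to_ac (a \<cdot>\<^sub>v v + A *\<^sub>v poly_act A p v) = to_ac a \<cdot>\<^sub>v map_vec to_ac v + map_vec to_ac (A *\<^sub>v poly_act A p v)"
    using carrier_vecD[OF Ap] v by (intro eq_vecI) (simp_all del: index_mult_mat_vec dim_mult_mat_vec)
  then show ?case
    by (simp add: to_ac.map_poly_pCons_hom poly_act_pCons[OF A v] poly_act_pCons[OF A' v'] to_ac.mult_mat_vec_hom[OF A p] pCons)
qed

lemma I_mat_mult_vec_index:
  assumes v: "v \<in> carrier_vec n" and i: "i < n"
  shows "(I_mat n \<alpha> *\<^sub>v v) $ i = (if Suc i = n then \<alpha> * v $ 0 else v $ Suc i)"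
proof -
  have n: "n > 0" using i by simp
  note I = I_mat_carrier[OF n, of \<alpha>]
  have "(I_mat n \<alpha> *\<^sub>v v) $ i = (\<Sum>k = 0..<n. I_mat n \<alpha> $$ (i, k) * v $ k)"
    using v I i by (simp add: scalar_prod_def)
  also have "\<dots> = (\<Sum>k = 0..<n. if k = (if Suc i = n then 0 else Suc i) then
      (if Suc i = n then \<alpha> * v $ k else v $ k) else 0)"
    using i by (intro sum.cong refl) (auto simp: I_mat_index)
  also have "\<dots> = (if Suc i = n then \<alpha> * v $ 0 else v $ Suc i)"
    using i by (subst sum.delta) auto
  finally show ?thesis .
qed

lemma I_mat_eigenvector: "n > 0 \<Longrightarrow> I_mat n (a ^ n) *\<^sub>v vec n (\<lambda>i. a ^ i) = a \<cdot>\<^sub>v vec n (\<lambda>i. (a::'a::field) ^ i)"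
proof (rule eq_vecI)
  assume n: "n > 0"
  fix i assume "i < dim_vec (a \<cdot>\<^sub>v vec n (\<lambda>i. a ^ i))"
  then have i: "i < n" by simp
  show "(I_mat n (a ^ n) *\<^sub>v vec n (\<lambda>i. a ^ i)) $ i = (a \<cdot>\<^sub>v vec n (\<lambda>i. a ^ i)) $ i"
    using I_mat_mult_vec_index[of "vec n (\<lambda>i. a ^ i)" n i "a ^ n"] i by (auto simp flip: power_Suc)
qed (simp add: carrier_matD[OF I_mat_carrier])

lemma ac_I_mat: "n > 0 \<Longrightarrow> ac_mat (I_mat n \<alpha>) = I_mat n (to_ac \<alpha>)"
  using I_mat_carrier[of n \<alpha>] I_mat_carrier[of n "to_ac \<alpha>"] by (intro eq_matI) (auto simp: I_mat_index)

definition is_power :: "nat \<Rightarrow> 'a::field \<Rightarrow> bool" where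
  "is_power q \<alpha> \<longleftrightarrow> (\<exists>c. c ^ q = \<alpha>)"

context prime_root
begin

text \<open>A singular Krylov matrix gives a polynomial \<open>p\<close> of degree below
  \<open>q\<close> with \<open>p(x) v = 0\<close>. Over the algebraic closure the kernel of
  \<open>p(x)\<close> is invariant under \<open>x\<close> and nonzero, so it contains an eigenvector
  of \<open>x\<close>; its eigenvalue is a \<open>q\<close>-th root of \<alpha> at which
  \<open>p\<close> vanishes, and \<open>kummer_degree\<close> makes \<open>p\<close> zero.\<close>

lemma kummer_cyclic:
  fixes x :: "'a mat"
  assumes x: "x \<in> carrier_mat q q" and xq: "x ^\<^sub>m q = \<alpha> \<cdot>\<^sub>m 1\<^sub>m q" and \<alpha>: "\<not> is_power q \<alpha>"
    and v: "v \<in> carrier_vec q" "v \<noteq> 0\<^sub>v q"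
  shows "det (krylov q x v) \<noteq> 0"
proof
  interpret ac: prime_root q "to_ac \<xi>" using prime_root_to_ac prime_root_axioms by blast
  assume "det (krylov q x v) = 0"
  then obtain u where u: "u \<in> carrier_vec q" "u \<noteq> 0\<^sub>v q" "krylov q x v *\<^sub>v u = 0\<^sub>v q"
    using det_0_iff_vec_prod_zero[OF krylov_carrier] by blast
  define p where "p = (\<Sum>j<q. monom (u $ j) (q - 1 - j))"
  have pv: "poly_act x p v = 0\<^sub>v q" using krylov_mult_vec[OF x v(1) u(1)] u(3) by (simp add: p_def)
  obtain a :: "'a alg_closure" where a: "a ^ q = to_ac \<alpha>" using alg_closed_root_exists[OF q_pos] by blast
  have a0: "a \<noteq> 0"
  proof
    assume "a = 0"
    then have "to_ac \<alpha> = 0" using a zero_power[OF q_pos, where 'a = "'a alg_closure"] by simp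
    then have "0 ^ q = \<alpha>" using zero_power[OF q_pos, where 'a = 'a] by simp
    then show False using \<alpha> by (auto simp: is_power_def)
  qed
  let ?X = "ac_mat x" let ?p = "map_poly to_ac p" let ?v = "map_vec to_ac v"
  have X: "?X \<in> carrier_mat q q" using x by simp
  have vc: "?v \<in> carrier_vec q" using v by simp
  have v0: "?v \<noteq> 0\<^sub>v q"
  proof
    assume "?v = 0\<^sub>v q"
    then have "v = 0\<^sub>v q" using to_ac.vec_hom_zero[of q] to_ac.vec_hom_inj by metis
    then show False using v by simp
  qed
  define V where "V = {w \<in> carrier_vec q. poly_act ?X ?p w = 0\<^sub>v q}"
  have inv: "?X *\<^sub>v w + c \<cdot>\<^sub>v w \<in> V" if "w \<in> V" for w c
  proof -
    have w: "w \<in> carrier_vec q" "poly_act ?X ?p w = 0\<^sub>v q" using that by (auto simp: V_def)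
    have c: "?X *\<^sub>v w \<in> carrier_vec q" "c \<cdot>\<^sub>v w \<in> carrier_vec q" using X w by auto
    have "poly_act ?X ?p (?X *\<^sub>v w) = 0\<^sub>v q" "poly_act ?X ?p (c \<cdot>\<^sub>v w) = 0\<^sub>v q"
      using poly_act_vec_smult_add(3)[OF X w(1) w(1)] poly_act_vec_smult_add(2)[OF X w(1) w(1)] w(2) mult_mat_zero_vec[OF X] smult_zero_vec_right
      by simp_all
    then show ?thesis using poly_act_vec_smult_add(1)[OF X c] c by (simp add: V_def)
  qed
  have "?X ^\<^sub>m q = to_ac \<alpha> \<cdot>\<^sub>m 1\<^sub>m q"
    using arg_cong[OF xq, of ac_mat] to_ac.mat_hom_pow[OF x, of q] by (simp add: map_mat_smult_to_ac to_ac.mat_hom_one)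
  then have "?X ^\<^sub>m q *\<^sub>v ?v = a ^ q \<cdot>\<^sub>v ?v"
    using smult_mat_mult_vec[OF one_carrier_mat vc, of "to_ac \<alpha>"] vc a by simp
  moreover have "?v \<in> V" using poly_act_ac[OF x v(1), of p] pv vc by (simp add: V_def to_ac.vec_hom_zero)
  ultimately obtain i w where w: "w \<in> V" "w \<noteq> 0\<^sub>v q" "?X *\<^sub>v w = (a * to_ac \<xi> ^ i) \<cdot>\<^sub>v w"
    using ac.kummer_eigenvector[OF X _ inv _ v0 _ a0] by (auto simp: V_def)
  have wc: "w \<in> carrier_vec q" using w by (simp add: V_def)
  have "poly ?p (a * to_ac \<xi> ^ i) \<cdot>\<^sub>v w = 0 \<cdot>\<^sub>v w"
    using poly_act_eigenvector[OF X wc w(3), of ?p] w(1) smult_zero_vec[OF wc] by (simp add: V_def)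
  then have root0: "poly ?p (a * to_ac \<xi> ^ i) = 0" by (rule smult_vec_cancel[OF _ wc w(2)])
  have "(to_ac \<xi> ^ i) ^ q = 1" by (metis power_mult mult.commute ac.root power_one)
  then have e: "(a * to_ac \<xi> ^ i) ^ q = to_ac \<alpha>" using a by (simp add: power_mult_distrib)
  have "degree p \<le> q - 1" unfolding p_def
    by (intro degree_sum_le) (auto intro: order_trans[OF degree_monom_le])
  then have "p = 0" using kummer_degree[OF prime_q _ _ e root0] \<alpha> q_pos by (auto simp: is_power_def)
  have "u $ j = 0" if j: "j < q" for j
  proof -
    have "0 = poly.coeff p (q - 1 - j)" using \<open>p = 0\<close> by simp
    also have "\<dots> = (\<Sum>k<q. if k = j then u $ k else 0)"
      unfolding p_def coeff_sum using j by (intro sum.cong refl) auto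
    also have "\<dots> = u $ j" using j by simp
    finally show ?thesis by simp
  qed
  then have "u = 0\<^sub>v q" using u(1) by (intro eq_vecI) auto
  then show False using u by simp
qed

lemma conjg_inv_eq:
  assumes "k \<in> carrier (GL q)" "x \<in> carrier (GL q)" "y \<in> carrier (GL q)" "x * k = k * y"
  shows "W.conjg (inv\<^bsub>GL q\<^esub> k) x = y"
proof -
  have "W.conjg (inv\<^bsub>GL q\<^esub> k) x = inv\<^bsub>GL q\<^esub> k \<otimes>\<^bsub>GL q\<^esub> (x \<otimes>\<^bsub>GL q\<^esub> k)"
    using assms W.m_assoc[of "inv\<^bsub>GL q\<^esub> k" x k] by (simp add: W.conjg_def del: GL_simps)
  also have "x \<otimes>\<^bsub>GL q\<^esub> k = k \<otimes>\<^bsub>GL q\<^esub> y" using assms(4) by simp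
  finally show ?thesis using assms W.inv_cancel_left by (simp del: GL_simps)
qed

lemma pow_in_Z_iff: "x \<in> carrier (GL q) \<Longrightarrow> x [^]\<^bsub>GL q\<^esub> n \<in> scalar_group q \<longleftrightarrow> (\<exists>c. c \<noteq> 0 \<and> x ^\<^sub>m n = c \<cdot>\<^sub>m 1\<^sub>m q)"
  by (simp add: scalar_group_iff GL_pow)

lemma conjg_I_mat:
  assumes x: "x \<in> carrier (GL q)" and xq: "x ^\<^sub>m q = \<alpha> \<cdot>\<^sub>m 1\<^sub>m q" and \<alpha>: "\<not> is_power q \<alpha>"
  shows "\<exists>g \<in> carrier (GL q). W.conjg g x = I_mat q \<alpha>"
proof -
  have xc: "x \<in> carrier_mat q q" using x by (simp add: carrier_GL)
  let ?v = "unit_vec q 0 :: 'a vec"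
  have v: "?v \<in> carrier_vec q" "?v \<noteq> 0\<^sub>v q" using q_pos by auto
  have \<alpha>0: "\<alpha> \<noteq> 0" using \<alpha> zero_power[OF q_pos, where 'a = 'a] by (auto simp: is_power_def)
  have k: "krylov q x ?v \<in> carrier (GL q)" using kummer_cyclic[OF xc xq \<alpha> v] by (simp add: carrier_GL)
  have "x ^\<^sub>m q *\<^sub>v ?v = \<alpha> \<cdot>\<^sub>v ?v" unfolding xq using smult_mat_mult_vec[OF one_carrier_mat v(1), of \<alpha>] v by simp
  from krylov_I_mat[OF xc v(1) q_pos this] show ?thesis
    using conjg_inv_eq[OF k x I_mat_GL[OF q_pos \<alpha>0]] k by blast
qed

text \<open>On the eigenvector \<open>(1, a, a^2, ...)\<close> of \<open>I_mat\<close> the matrix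
  \<open>y\<close> acts by some \<mu> with \<open>\<mu> ^ q = 1\<close>, hence by a power of \<xi>,
  which lies in the ground field. The first row of \<open>y\<close> consists of its coefficients as
  a polynomial in \<open>I_mat\<close>; subtracting that constant leaves a polynomial of degree
  below \<open>q\<close> vanishing at \<open>a\<close>, which is zero by
  \<open>kummer_degree\<close>.\<close>

lemma I_mat_cent_torsion_scalar:
  fixes y :: "'a mat"
  assumes \<alpha>: "\<not> is_power q \<alpha>" and y: "y \<in> carrier_mat q q" "y * I_mat q \<alpha> = I_mat q \<alpha> * y" and yq: "y ^\<^sub>m q = 1\<^sub>m q"
  shows "\<exists>c. y = c \<cdot>\<^sub>m 1\<^sub>m q"
proof -
  interpret ac: prime_root q "to_ac \<xi>" using prime_root_to_ac prime_root_axioms by blast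
  obtain a :: "'a alg_closure" where a: "a ^ q = to_ac \<alpha>" using alg_closed_root_exists[OF q_pos] by blast
  let ?I = "I_mat q (to_ac \<alpha>)" and ?Y = "ac_mat y"
  note I = I_mat_carrier[OF q_pos, of \<alpha>] note I' = I_mat_carrier[OF q_pos, of "to_ac \<alpha>"]
  define v where "v = vec q (\<lambda>i. a ^ i)"
  have v: "v \<in> carrier_vec q" by (simp add: v_def)
  have v0: "v \<noteq> 0\<^sub>v q"
  proof
    assume "v = 0\<^sub>v q"
    then have "v $ 0 = 0" using q_pos by simp
    then show False using q_pos by (simp add: v_def)
  qed
  have Iv: "?I *\<^sub>v v = a \<cdot>\<^sub>v v" using I_mat_eigenvector[OF q_pos, of a] a by (simp add: v_def)
  have Y: "?Y \<in> carrier_mat q q" using y by simp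
  have YI: "?Y * ?I = ?I * ?Y"
    using arg_cong[OF y(2), of ac_mat] to_ac.mat_hom_mult[OF y(1) I] to_ac.mat_hom_mult[OF I y(1)] ac_I_mat[OF q_pos, of \<alpha>] by simp
  define u where "u = ?Y *\<^sub>v v"
  have u: "u \<in> carrier_vec q" unfolding u_def by (rule mult_mat_vec_carrier[OF Y v])
  have "?I *\<^sub>v u = ?Y *\<^sub>v (?I *\<^sub>v v)"
    unfolding u_def using assoc_mult_mat_vec[OF I' Y v] assoc_mult_mat_vec[OF Y I' v] YI by simp
  also have "\<dots> = a \<cdot>\<^sub>v u" unfolding Iv u_def by (rule mult_mat_vec[OF Y v])
  finally have Iu: "?I *\<^sub>v u = a \<cdot>\<^sub>v u" .
  \<comment> \<open>The eigenvalue equation for \<open>I_mat\<close> is a recursion from each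
    coordinate to the next, so an eigenvector is determined by its first coordinate and
    \<open>u\<close> is a multiple of \<open>v\<close>.\<close>
  have ui: "i < q \<Longrightarrow> u $ i = a ^ i * u $ 0" for i
  proof (induction i)
    case (Suc i)
    have "u $ Suc i = (?I *\<^sub>v u) $ i" using I_mat_mult_vec_index[OF u, of i "to_ac \<alpha>"] Suc.prems by simp
    also have "\<dots> = a * u $ i" unfolding Iu using Suc.prems u by simp
    finally show ?case using Suc by simp
  qed simp
  define \<mu> where "\<mu> = u $ 0"
  have Yv: "?Y *\<^sub>v v = \<mu> \<cdot>\<^sub>v v" unfolding u_def[symmetric]
  proof (rule eq_vecI)
    fix i assume "i < dim_vec (\<mu> \<cdot>\<^sub>v v)"
    then have i: "i < q" using v by simp
    show "u $ i = (\<mu> \<cdot>\<^sub>v v) $ i" unfolding ui[OF i] using i by (simp add: v_def \<mu>_def)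
  qed (use u v in simp)
  have "?Y ^\<^sub>m k *\<^sub>v v = \<mu> ^ k \<cdot>\<^sub>v v" for k
  proof (induction k)
    case 0 then show ?case using carrier_matD[OF Y] v by (simp add: one_smult_vec)
  next
    case (Suc k)
    then show ?case unfolding pow_mat_vec_Suc[OF Y v] using mult_mat_vec[OF Y v, of "\<mu> ^ k"] Yv
      by (simp add: smult_smult_assoc mult.commute)
  qed
  moreover have "?Y ^\<^sub>m q = 1\<^sub>m q" using arg_cong[OF yq, of ac_mat] to_ac.mat_hom_pow[OF y(1), of q] by (simp add: to_ac.mat_hom_one)
  ultimately have "\<mu> ^ q \<cdot>\<^sub>v v = 1 \<cdot>\<^sub>v v" using v by (metis one_mult_mat_vec one_smult_vec)
  then have "\<mu> ^ q = 1" by (rule smult_vec_cancel[OF _ v v0])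
  then obtain i where i: "\<mu> = to_ac (\<xi> ^ i)" using ac.pow_root_cancel[of \<mu> 1] by auto
  define p where "p = (\<Sum>j<q. monom (y $$ (0, j)) j) - [:\<xi> ^ i:]"
  have coeff: "poly.coeff (\<Sum>j<q. monom (y $$ (0, j)) j) k = (if k < q then y $$ (0, k) else 0)" for k
    by (simp add: coeff_sum)
  have "\<mu> = (\<Sum>j = 0..<q. to_ac (y $$ (0, j)) * a ^ j)"
    unfolding \<mu>_def u_def using y q_pos v by (simp add: scalar_prod_def v_def)
  then have "poly (map_poly to_ac p) a = 0"
    unfolding p_def i by (simp add: to_ac_poly.hom_minus to_ac_poly.hom_sum to_ac.map_poly_hom_monom to_ac.map_poly_pCons_hom poly_sum poly_monom atLeast0LessThan)
  moreover have "degree p < q" unfolding p_def using q_pos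
    by (intro degree_diff_less degree_sum_less) (auto intro: le_less_trans[OF degree_monom_le])
  ultimately have p0: "p = 0" using kummer_degree[OF prime_q _ _ a, of p] \<alpha> by (auto simp: is_power_def)
  have "y $$ (0, j) = (\<xi> ^ i \<cdot>\<^sub>m 1\<^sub>m q) $$ (0, j)" if "j < q" for j
  proof -
    have "poly.coeff (\<Sum>j<q. monom (y $$ (0, j)) j) j = poly.coeff [:\<xi> ^ i:] j" using p0 by (simp add: p_def)
    then have "y $$ (0, j) = poly.coeff [:\<xi> ^ i:] j" using coeff[of j] that by simp
    then show ?thesis using that q_pos by (cases j) auto
  qed
  then have "y = \<xi> ^ i \<cdot>\<^sub>m 1\<^sub>m q"
    by (intro comm_I_mat_eqI[OF y]) (use scalar_mat_mult[OF I] in auto)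
  then show ?thesis by blast
qed

text \<open>The determinant is the product of all \<open>q\<close>-th roots of \<alpha> in the
  algebraic closure. They are read off from \<open>weyl_diagonal_form\<close> with
  \<open>I_mat\<close> as \<open>x\<close> and \<open>d_mat\<close> as \<open>h\<close>; this
  exchange replaces \<xi> by its inverse \<eta>.\<close>

lemma det_I_mat: "\<alpha> \<noteq> (0 :: 'a) \<Longrightarrow> det (I_mat q \<alpha>) = \<alpha> * (if q = 2 then - 1 else 1)"
proof -
  assume \<alpha>: "\<alpha> \<noteq> 0"
  interpret ac: prime_root q "to_ac \<xi>" using prime_root_to_ac prime_root_axioms by blast
  define \<eta> where "\<eta> = inverse (to_ac \<xi>)"
  have "\<eta> ^ q = 1" "\<eta> \<noteq> 1" using ac.root ac.root_neq by (simp_all add: \<eta>_def power_inverse)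
  then interpret e: prime_root q \<eta> using prime_q by unfold_locales
  obtain a :: "'a alg_closure" where a: "a ^ q = to_ac \<alpha>" using alg_closed_root_exists[OF q_pos] by blast
  let ?I = "I_mat q (to_ac \<alpha>)" and ?d = "d_mat q (to_ac \<xi>)"
  have a0: "a \<noteq> 0"
  proof
    assume "a = 0"
    then have "to_ac \<alpha> = 0" using a zero_power[OF q_pos, where 'a = "'a alg_closure"] by simp
    then show False using \<alpha> by simp
  qed
  have I: "?I \<in> carrier_mat q q" "det ?I \<noteq> 0" using I_mat_GL[OF q_pos, of "to_ac \<alpha>"] \<alpha> by (auto simp: carrier_GL)
  have d: "?d \<in> carrier_mat q q" "det ?d \<noteq> 0" using d_mat_GL[OF ac.root_neq_0, of q] by (auto simp: carrier_GL)
  have "\<eta> \<cdot>\<^sub>m (?I * ?d) = (\<eta> * to_ac \<xi>) \<cdot>\<^sub>m (?d * ?I)" using ac.I_d_commute[of "to_ac \<alpha>"] by (simp add: smult_smult_mat)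
  then have dI: "?d * ?I = \<eta> \<cdot>\<^sub>m (?I * ?d)" using ac.root_neq_0 by (simp add: \<eta>_def one_smult)
  define v where "v = vec q (\<lambda>i. a ^ i)"
  have v: "v \<in> carrier_vec q" by (simp add: v_def)
  have v0: "v \<noteq> 0\<^sub>v q"
  proof
    assume "v = 0\<^sub>v q"
    then have "v $ 0 = 0" using q_pos by simp
    then show False using q_pos by (simp add: v_def)
  qed
  have Iv: "?I *\<^sub>v v = a \<cdot>\<^sub>v v" using I_mat_eigenvector[OF q_pos, of a] a by (simp add: v_def)
  note f = e.weyl_diagonal_form[OF I(1) d dI v v0 Iv a0]
  have "det ?I * det (krylov q ?d v) = det (krylov q ?d v) * det (mat_diag q (\<lambda>j. a * \<eta> ^ Suc j))"
    using arg_cong[OF f(2), of det] det_mult[OF I(1) krylov_carrier] det_mult[OF krylov_carrier mat_diag_dim] by simp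
  then have "det ?I = (\<Prod>j<q. a * \<eta> ^ Suc j)" using f(1) by (simp add: det_mat_diag)
  also have "\<dots> = to_ac \<alpha> * ((\<Prod>j<q. \<eta> ^ j) * \<eta> ^ q)" using a by (simp add: prod.distrib)
  also have "\<dots> = to_ac (\<alpha> * (if q = 2 then - 1 else 1))" using e.prod_root_pow e.root by simp
  also have "det ?I = to_ac (det (I_mat q \<alpha>))" using ac_I_mat[OF q_pos, of \<alpha>] to_ac.hom_det by metis
  finally show ?thesis by (simp only: to_ac_eq_iff)
qed

end

section \<open>Normal forms\<close>

lemma det_pow_mat: "A \<in> carrier_mat n n \<Longrightarrow> det (A ^\<^sub>m k) = det (A :: 'a::field mat) ^ k"
proof (induction k)
  case 0 then show ?case using carrier_matD(1)[of A n n] by simp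
next
  case (Suc k) then show ?case using det_mult[OF pow_carrier_mat[of A n k] Suc.prems] by simp
qed

lemma is_power_coprime:
  assumes q: "Factorial_Ring.prime q" and d: "d \<noteq> 0" and p: "is_power q (d ^ a)" and a: "\<not> q dvd a"
  shows "is_power q d"
proof -
  have "coprime a q" using prime_imp_coprime[OF q a] by (simp add: coprime_commute)
  moreover have "a \<noteq> 0" using a by (metis dvd_0_right)
  ultimately obtain s t where st: "a * s = q * t + 1" using bezout_nat[of a q] by (auto simp: coprime_iff_gcd_eq_1)
  obtain c where c: "c ^ q = d ^ a" using p by (auto simp: is_power_def)
  have "(c ^ s) ^ q = (c ^ q) ^ s" by (simp only: power_mult[symmetric] mult.commute)
  also have "\<dots> = d ^ (q * t + 1)" unfolding c st[symmetric] by (simp only: power_mult)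
  also have "\<dots> = (d ^ t) ^ q * d" by (simp add: power_add mult.commute flip: power_mult)
  finally have "(c ^ s / d ^ t) ^ q = d" using d by (simp add: power_divide)
  then show ?thesis by (auto simp: is_power_def)
qed

context prime_root
begin

lemma weyl_pow_scalar: "W.weyl w x h \<Longrightarrow> \<exists>\<alpha>. \<alpha> \<noteq> 0 \<and> x ^\<^sub>m q = \<alpha> \<cdot>\<^sub>m 1\<^sub>m q"
  using W.weyl_pow_Z[OF W.weyl_sym, of w x h q] pow_in_Z_iff[OF W.weyl_closed(1), of w x h q] by auto

text \<open>Every possible scalar is a power of \<open>w\<close>, and the same power of
  \<open>h\<close> is again a partner of \<open>x\<close> inside the group. This makes it possible
  to work with one fixed commutation scalar.\<close>

lemma weyl_normalize:
  assumes w: "W.weyl w x h" and z: "z \<in> scalar_group q" "z [^]\<^bsub>GL q\<^esub> q = \<one>\<^bsub>GL q\<^esub>" "z \<noteq> \<one>\<^bsub>GL q\<^esub>"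
  shows "\<exists>h'. W.weyl z x h' \<and> W.weyl_group x h' = W.weyl_group x h"
proof -
  obtain i where i: "z = w [^]\<^bsub>GL q\<^esub> (i::nat)"
    using W.torsion_cyclic[OF z(1) W.weyl_closed(3)[OF w] z(2)] w W.semi_torsion unfolding W.weyl_semi by blast
  let ?h = "h [^]\<^bsub>GL q\<^esub> i"
  have wz: "W.weyl z x ?h" using W.weyl_semi_pow[OF w, of i] i z by (simp add: W.weyl_semi)
  interpret E: subgroup "W.weyl_group x h" "GL q" by (rule W.weyl_group_subgroup[OF w])
  have "h [^]\<^bsub>GL q\<^esub> k \<in> W.weyl_group x h" for k :: nat
  proof (induction k)
    case 0 then show ?case using E.one_closed by simp
  next
    case (Suc k)
    then show ?case using E.m_closed[OF Suc W.weyl_group_incl(2)[OF w]] by simp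
  qed
  moreover have "?h \<notin> W.cent x"
    using wz W.semi_cent[OF W.weyl_closed(1)[OF w], of ?h] W.semi_unique unfolding W.weyl_semi by blast
  ultimately show ?thesis using W.weyl_group_change[OF w] wz by blast
qed

text \<open>The commutator \<open>u\<close> of \<open>h\<close> and \<open>y\<close> satisfies
  \<open>u ^ q = 1\<close> because \<open>y ^ q\<close> is scalar, so it is a scalar by
  \<open>I_mat_cent_torsion_scalar\<close>. Thus \<open>y\<close> commutes up to scalars with both
  members of the pair and \<open>semi_pair\<close> applies; a power of \<open>h\<close> cannot occur
  since \<open>y\<close> centralizes \<open>I_mat\<close>.\<close>

lemma I_mat_root_step:
  assumes \<alpha>: "\<not> is_power q \<alpha>" and w: "W.weyl w (I_mat q \<alpha>) h"
    and y: "y \<in> W.cent (I_mat q \<alpha>)" "y [^]\<^bsub>GL q\<^esub> q \<in> scalar_group q"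
  shows "\<exists>c \<in> scalar_group q. \<exists>a. y = c \<otimes>\<^bsub>GL q\<^esub> I_mat q \<alpha> [^]\<^bsub>GL q\<^esub> (a::nat)"
proof -
  let ?G = "GL q :: 'a mat monoid" let ?I = "I_mat q \<alpha>"
  have hc: "h \<in> carrier ?G" and Ic: "?I \<in> carrier ?G" using W.weyl_closed[OF w] by auto
  have yc: "y \<in> carrier ?G" using y(1) W.cent_closed by blast
  interpret C: subgroup "W.cent ?I" ?G by (rule W.cent_subgroup[OF Ic])
  have y': "W.conjg h y \<in> W.cent ?I" using W.weyl_cent_conjg[OF w y(1)] .
  define u where "u = W.conjg h y \<otimes>\<^bsub>?G\<^esub> inv\<^bsub>?G\<^esub> y"
  have u: "u \<in> W.cent ?I" unfolding u_def using y(1) y' by (intro C.m_closed C.m_inv_closed)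
  have "u [^]\<^bsub>?G\<^esub> q = W.conjg h y [^]\<^bsub>?G\<^esub> q \<otimes>\<^bsub>?G\<^esub> (inv\<^bsub>?G\<^esub> y) [^]\<^bsub>?G\<^esub> q"
    unfolding u_def using W.weyl_cent_abelian[OF w y' C.m_inv_closed[OF y(1)]] y' yc hc by (intro W.pow_mult_distrib) auto
  also have "\<dots> = W.conjg h (y [^]\<^bsub>?G\<^esub> q) \<otimes>\<^bsub>?G\<^esub> inv\<^bsub>?G\<^esub> (y [^]\<^bsub>?G\<^esub> q)"
    using hc yc by (simp add: W.conjg_pow W.nat_pow_inv del: GL_simps)
  also have "\<dots> = \<one>\<^bsub>?G\<^esub>" using hc y(2) yc by (simp del: GL_simps)
  finally have uq: "u [^]\<^bsub>?G\<^esub> q = \<one>\<^bsub>?G\<^esub>" .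
  have uG: "u \<in> carrier ?G" using W.cent_closed[OF u] .
  obtain c where c: "u = c \<cdot>\<^sub>m 1\<^sub>m q"
    using I_mat_cent_torsion_scalar[OF \<alpha>, of u] u uq GL_pow[OF uG, of q] by (auto simp: W.cent_def carrier_GL)
  have "c \<noteq> 0"
  proof
    assume "c = 0"
    then have "det u = 0" using c q_pos by simp
    then show False using uG by (simp add: carrier_GL)
  qed
  then have uZ: "u \<in> scalar_group q" using c by (auto simp: scalar_group_iff)
  have "h \<otimes>\<^bsub>?G\<^esub> y = u \<otimes>\<^bsub>?G\<^esub> (y \<otimes>\<^bsub>?G\<^esub> h)"
    unfolding u_def W.conjg_swap[OF hc yc] using hc yc by (simp add: W.m_assoc W.inv_cancel_left del: GL_simps)
  then have "W.semi u y h" using uZ hc yc by (simp add: W.semi_def)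
  then have s1: "W.semi (inv\<^bsub>?G\<^esub> u) h y" by (rule W.semi_sym)
  have s2: "W.semi \<one>\<^bsub>?G\<^esub> ?I y" using W.semi_cent[OF Ic] y(1) by blast
  obtain z a b where z: "z \<in> scalar_group q" "b < q" "y = z \<otimes>\<^bsub>?G\<^esub> (?I [^]\<^bsub>?G\<^esub> (a::nat) \<otimes>\<^bsub>?G\<^esub> h [^]\<^bsub>?G\<^esub> (b::nat))"
    using W.semi_pair[OF w s2 s1] by blast
  have "W.semi \<one>\<^bsub>?G\<^esub> ?I z" using z(1) W.Z_subset_cent[OF Ic] W.semi_cent[OF Ic] by blast
  moreover have "W.semi \<one>\<^bsub>?G\<^esub> ?I (?I [^]\<^bsub>?G\<^esub> a)"
    using W.semi_cent[OF Ic] W.cent_pow[OF Ic W.weyl_x_cent[OF w]] by blast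
  ultimately have "W.semi (\<one>\<^bsub>?G\<^esub> \<otimes>\<^bsub>?G\<^esub> (\<one>\<^bsub>?G\<^esub> \<otimes>\<^bsub>?G\<^esub> w [^]\<^bsub>?G\<^esub> b)) ?I y"
    unfolding z(3) by (intro W.semi_mult W.weyl_semi_pow[OF w])
  then have "w [^]\<^bsub>?G\<^esub> b = \<one>\<^bsub>?G\<^esub>" using W.semi_unique[OF _ s2] W.weyl_closed[OF w] by (simp del: GL_simps)
  then have "q dvd b" using W.weyl_root_pow[OF w] by blast
  then have "b = 0" using z(2) by (auto dest: dvd_imp_le)
  then have "y = z \<otimes>\<^bsub>?G\<^esub> ?I [^]\<^bsub>?G\<^esub> a" using z(3) W.nat_pow_closed[OF Ic, of a] by (simp del: GL_simps)
  then show ?thesis using z(1) by blast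
qed

text \<open>Induction on the torsion level. If \<open>y ^ q = e * I_mat ^ a\<close>, determinants
  show that \<open>det I_mat ^ a\<close> is a \<open>q\<close>-th power. The hypotheses say that
  \<open>det I_mat\<close> is not one, so \<open>q\<close> divides \<open>a\<close>,
  \<open>y ^ q\<close> is scalar, and \<open>I_mat_root_step\<close> applies.\<close>

lemma small_I_mat:
  assumes \<alpha>: "\<not> is_power q \<alpha>" and star: "\<not> (q = 2 \<and> is_power q (- \<alpha>))" and w: "W.weyl w (I_mat q \<alpha>) h"
  shows "W.small (I_mat q \<alpha>)"
proof -
  let ?G = "GL q :: 'a mat monoid" let ?I = "I_mat q \<alpha>"
  have Ic: "?I \<in> carrier ?G" using W.weyl_closed[OF w] by auto
  have I: "?I \<in> carrier_mat q q" "det ?I \<noteq> 0" using Ic by (auto simp: carrier_GL)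
  have \<alpha>0: "\<alpha> \<noteq> 0" using \<alpha> zero_power[OF q_pos, where 'a = 'a] by (auto simp: is_power_def)
  have "\<not> is_power q (det ?I)" using \<alpha> star det_I_mat[OF \<alpha>0] by auto
  then have nd: "\<not> is_power q (det ?I ^ a)" if "\<not> q dvd a" for a using is_power_coprime[OF prime_q I(2) _ that] by blast
  have "y \<in> W.torsion_level m ?I \<Longrightarrow> \<exists>c \<in> scalar_group q. \<exists>a. y = c \<otimes>\<^bsub>?G\<^esub> ?I [^]\<^bsub>?G\<^esub> (a::nat)" for m y
  proof (induction m arbitrary: y)
    case 0
    then have yZ: "y \<in> scalar_group q" using W.cent_closed[of y] by (auto simp: W.torsion_level_def simp del: GL_simps)
    moreover have "y = y \<otimes>\<^bsub>?G\<^esub> ?I [^]\<^bsub>?G\<^esub> (0::nat)" using W.Z_closed[OF yZ] by (simp del: GL_simps)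
    ultimately show ?case by blast
  next
    case (Suc m)
    have y: "y \<in> W.cent ?I" "y [^]\<^bsub>?G\<^esub> (q ^ Suc m) \<in> scalar_group q" using Suc.prems by (auto simp: W.torsion_level_def)
    have yc: "y \<in> carrier ?G" using y W.cent_closed by blast
    have "y [^]\<^bsub>?G\<^esub> q \<in> W.torsion_level m ?I"
      using y yc W.cent_pow[OF Ic y(1), of q] by (simp add: W.torsion_level_def W.nat_pow_pow)
    then obtain c a where c: "c \<in> scalar_group q" "y [^]\<^bsub>?G\<^esub> q = c \<otimes>\<^bsub>?G\<^esub> ?I [^]\<^bsub>?G\<^esub> (a::nat)" using Suc.IH by blast
    obtain e where e: "e \<noteq> 0" "c = e \<cdot>\<^sub>m 1\<^sub>m q" using c(1) by (auto simp: scalar_group_iff)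
    have ym: "y \<in> carrier_mat q q" using yc by (simp add: carrier_GL)
    have Ia: "?I ^\<^sub>m a \<in> carrier_mat q q" using I by simp
    have "y ^\<^sub>m q = e \<cdot>\<^sub>m ?I ^\<^sub>m a" using c(2) GL_pow[OF yc, of q] GL_pow[OF Ic, of a] e scalar_mat_mult(1)[OF Ia, of e] by simp
    then have "det y ^ q = e ^ q * det ?I ^ a"
      using det_pow_mat[OF ym, of q] det_pow_mat[OF I(1), of a] det_smult[of e "?I ^\<^sub>m a"] carrier_matD(2)[OF Ia] by (simp del: pow_mat_dim)
    then have "(det y / e) ^ q = det ?I ^ a" using e by (simp add: power_divide)
    then have "is_power q (det ?I ^ a)" unfolding is_power_def by blast
    then have "q dvd a" using nd by blast
    then have "?I [^]\<^bsub>?G\<^esub> a \<in> scalar_group q" using W.weyl_pow_Z[OF W.weyl_sym[OF w]] by blast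
    then have "y [^]\<^bsub>?G\<^esub> q \<in> scalar_group q" using c W.Z_mult by metis
    then show ?case using I_mat_root_step[OF \<alpha> w y(1)] by blast
  qed
  then show ?thesis unfolding W.small_def W.torsion_cent_def by blast
qed

text \<open>Powers of \<open>d_mat\<close> have diagonals in geometric progression. For
  \<open>q > 2\<close> the element with diagonal \<open>\<xi>, 1, ..., 1\<close> violates this; for
  \<open>q = 2\<close> and \<open>s ^ 2 = -1\<close> the diagonal \<open>1, s\<close> has a ratio
  that is no power of \<xi>.\<close>

lemma small_d_mat_imp:
  assumes small: "W.small (d_mat q \<xi>)"
  shows "q = 2 \<and> \<not> is_power 2 (- 1 :: 'a)"
proof -
  have dG: "d_mat q \<xi> \<in> carrier (GL q)" by (rule d_mat_GL[OF root_neq_0])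
  have diag: "\<exists>c k. \<forall>i<q. f i = c * \<xi> ^ (i * k)" if f: "\<And>i. i < q \<Longrightarrow> f i \<in> Syl q Fx" for f
  proof -
    have "mat_diag q f \<in> D_set q" unfolding D_set_def
      using f by (auto intro!: exI[of _ 1] exI[of _ f])
    then obtain z k where z: "z \<in> scalar_group q" "mat_diag q f = z \<otimes>\<^bsub>GL q\<^esub> d_mat q \<xi> [^]\<^bsub>GL q\<^esub> (k::nat)"
      using small unfolding W.small_def D_set_eq by blast
    obtain c where c: "z = c \<cdot>\<^sub>m 1\<^sub>m q" using z(1) by (auto simp: scalar_group_iff)
    have "mat_diag q f = mat_diag q (\<lambda>i. c * \<xi> ^ (i * k))"
      using z(2) GL_pow[OF dG, of k] scalar_mat_mult(1)[OF mat_diag_dim[of q "\<lambda>i. (\<xi> ^ i) ^ k"], of c]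
      unfolding c by (simp add: d_mat_def mat_diag_pow smult_mat_diag power_mult)
    then have "f i = c * \<xi> ^ (i * k)" if "i < q" for i
      using arg_cong[of _ _ "\<lambda>B. B $$ (i, i)"] that by (metis mat_diag_index)
    then show ?thesis by blast
  qed
  have q2: "q = 2"
  proof (rule ccontr)
    assume "q \<noteq> 2"
    then have q3: "2 < q" using q_gt_1 by simp
    have "\<xi> ^ (q ^ 1) = 1" "(1::'a) ^ (q ^ 1) = 1" using root by simp_all
    then have "\<xi> \<in> Syl q Fx" "(1::'a) \<in> Syl q Fx"
      unfolding Syl_Fx_iff[OF prime_q] using root_neq_0 one_neq_zero[where 'a = 'a] by blast+
    then have "(if i = 0 then \<xi> else 1) \<in> Syl q Fx" for i :: nat by simp
    then obtain c k where ck: "\<And>i. i < q \<Longrightarrow> (if i = 0 then \<xi> else 1) = c * \<xi> ^ (i * k)" using diag[of "\<lambda>i. if i = 0 then \<xi> else 1"] by blast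
    have "c = \<xi>" using ck[of 0] q_pos by simp
    moreover have "1 = c * \<xi> ^ k" using ck[of 1] q3 by simp
    moreover have "1 = c * \<xi> ^ (2 * k)" using ck[of 2] q3 by simp
    then have "1 = c * \<xi> ^ k * \<xi> ^ k" by (simp add: mult_2 power_add mult.assoc)
    ultimately show False using root_neq by simp
  qed
  moreover have "\<not> is_power 2 (- 1 :: 'a)"
  proof
    assume "is_power 2 (- 1 :: 'a)"
    then obtain s :: 'a where s: "s ^ 2 = - 1" by (auto simp: is_power_def)
    have s4: "s ^ (q ^ 2) = 1" unfolding q2 using s power_mult[of s 2 2] by (simp add: power2_eq_square[of "2::nat"])
    have "s \<noteq> 0" using s by auto
    moreover have "(1::'a) ^ (q ^ 1) = 1" by simp
    ultimately have "s \<in> Syl q Fx" "(1::'a) \<in> Syl q Fx"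
      unfolding Syl_Fx_iff[OF prime_q] using s4 one_neq_zero[where 'a = 'a] by blast+
    then have "(if i = 0 then 1 else s) \<in> Syl q Fx" for i :: nat by simp
    then obtain c k where ck: "\<And>i. i < q \<Longrightarrow> (if i = 0 then 1 else s) = c * \<xi> ^ (i * k)" using diag[of "\<lambda>i. if i = 0 then 1 else s"] by blast
    have "c = 1" using ck[of 0] q_pos by simp
    then have "s = \<xi> ^ k" using ck[of 1] q2 by simp
    then have "s ^ 2 = (\<xi> ^ 2) ^ k" by (simp add: mult.commute flip: power_mult)
    also have "\<dots> = 1" using root q2 by simp
    \<comment> \<open>Now \<open>1 = -1\<close>, and in characteristic two the equation
      \<open>\<xi> ^ 2 = 1\<close> has only the solution 1.\<close>
    finally have "\<xi> ^ 2 = 1 \<and> (1::'a) = - 1" using s root q2 by simp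
    then have "(\<xi> - 1) * (\<xi> - 1) = 0" by (simp add: algebra_simps power2_eq_square)
    then show False using root_neq by simp
  qed
  ultimately show ?thesis by blast
qed

text \<open>Without a square root of \<open>-1\<close> the only elements of 2-power order are
  \<open>1\<close> and \<open>-1\<close>, so up to scalars \<open>D_set\<close> contains nothing but
  the identity and \<open>d_mat\<close>, which has diagonal \<open>1, -1\<close>.\<close>

lemma small_d_mat:
  assumes q2: "q = 2" and n: "\<not> is_power 2 (- 1 :: 'a)"
  shows "W.small (d_mat q \<xi>)"
proof -
  have dG: "d_mat q \<xi> \<in> carrier (GL q)" by (rule d_mat_GL[OF root_neq_0])
  have pm: "x = 1 \<or> x = -1" if "x ^ (2 ^ k) = 1" for x :: 'a and k
    using that
  proof (induction k)
    case (Suc k)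
    then have "(x ^ (2 ^ k) - 1) * (x ^ (2 ^ k) + 1) = 0" by (simp add: algebra_simps power2_eq_square power_mult)
    then have "x ^ (2 ^ k) = 1 \<or> x ^ (2 ^ k) = - 1" by (auto simp: eq_neg_iff_add_eq_0)
    moreover have "x = 1 \<or> x = - 1" if e: "x ^ (2 ^ k) = - 1"
    proof (cases k)
      case 0 then show ?thesis using e by simp
    next
      case (Suc j)
      then have "(x ^ (2 ^ j)) ^ 2 = - 1" using e by (simp add: mult.commute flip: power_mult)
      then show ?thesis using n by (auto simp: is_power_def)
    qed
    ultimately show ?case using Suc.IH by blast
  qed simp
  have \<xi>: "\<xi> = - 1" using prod_root_pow q2 by (simp add: numeral_2_eq_2)
  show ?thesis unfolding W.small_def D_set_eq[symmetric]
  proof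
    fix y :: "'a mat" assume "y \<in> D_set q"
    then obtain \<beta> :: 'a and \<gamma> where y: "y = mat_diag q (\<lambda>i. \<beta> * \<gamma> i)" "\<beta> \<noteq> 0" "\<And>i. i < q \<Longrightarrow> \<gamma> i \<in> Syl q Fx"
      by (auto simp: D_set_def simp del: carrier_mult_of)
    have g: "\<gamma> i = 1 \<or> \<gamma> i = - 1" if "i < q" for i
      using y(3)[OF that] Syl_Fx_iff[OF prime_q, of "\<gamma> i"] q2 pm by auto
    define k where "k = (if \<gamma> 1 = \<gamma> 0 then 0 else 1 :: nat)"
    define c where "c = \<beta> * \<gamma> 0"
    have c0: "c \<noteq> 0" using y(2) g[OF q_pos] by (auto simp: c_def)
    have "y = mat_diag q (\<lambda>i. c * (\<xi> ^ i) ^ k)" unfolding y(1)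
    proof (rule mat_diag_cong)
      fix i assume "i < q"
      then have "i = 0 \<or> i = 1" using q2 by auto
      then show "\<beta> * \<gamma> i = c * (\<xi> ^ i) ^ k"
        using g[of 0] g[of 1] q2 \<xi> by (auto simp: c_def k_def)
    qed
    also have "\<dots> = (c \<cdot>\<^sub>m 1\<^sub>m q) \<otimes>\<^bsub>GL q\<^esub> d_mat q \<xi> [^]\<^bsub>GL q\<^esub> k"
      unfolding GL_pow[OF dG] using scalar_mat_mult(1)[OF mat_diag_dim[of q "\<lambda>i. (\<xi> ^ i) ^ k"], of c]
      by (simp add: d_mat_def mat_diag_pow smult_mat_diag)
    finally show "\<exists>z \<in> scalar_group q. \<exists>i. y = z \<otimes>\<^bsub>GL q\<^esub> d_mat q \<xi> [^]\<^bsub>GL q\<^esub> (i::nat)"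
      using c0 by (intro bexI[of _ "c \<cdot>\<^sub>m 1\<^sub>m q"] exI[of _ k]) (auto simp: scalar_group_iff)
  qed
qed

text \<open>With \<open>i\<close> for the matrix \<open>I_mat q (-1)\<close>, of square
  \<open>-1\<close>, the element is \<open>1 + i\<close>: its square \<open>2 i\<close> is not
  scalar, its fourth power is \<open>-4\<close>.\<close>

lemma not_small_star:
  assumes q2: "q = 2" and \<alpha>: "\<alpha> = (- 1 :: 'a)"
  shows "\<exists>y \<in> W.torsion_cent (I_mat q \<alpha>). y [^]\<^bsub>GL q\<^esub> q \<notin> scalar_group q \<and> y * y = 2 \<cdot>\<^sub>m I_mat q \<alpha>"
proof -
  have \<xi>: "\<xi> = - 1" using prod_root_pow q2 by (simp add: numeral_2_eq_2)
  then have two: "(2::'a) \<noteq> 0" using root_neq by (metis add_eq_0_iff one_add_one)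
  let ?I = "I_mat q \<alpha>"
  have I: "?I \<in> carrier_mat q q" by (rule I_mat_carrier[OF q_pos])
  define y where "y = 1\<^sub>m q + ?I"
  have yc: "y \<in> carrier_mat q q" using I by (simp add: y_def)
  have II: "?I * ?I = - 1 \<cdot>\<^sub>m 1\<^sub>m q" using I_mat_pow_n[OF q_pos, of \<alpha>] I q2 \<alpha> by (simp add: numeral_2_eq_2)
  have "y * y = 1\<^sub>m q * y + ?I * y" unfolding y_def using I by (intro add_mult_distrib_mat[of _ q q]) auto
  also have "?I * y = ?I * 1\<^sub>m q + ?I * ?I" unfolding y_def using I by (intro mult_add_distrib_mat[of _ q q]) auto
  finally have "y * y = y + (?I + - 1 \<cdot>\<^sub>m 1\<^sub>m q)" using I yc II by simp
  also have "\<dots> = 2 \<cdot>\<^sub>m ?I" using I unfolding y_def by (intro eq_matI) auto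
  finally have yy: "y * y = 2 \<cdot>\<^sub>m ?I" .
  have Ic: "?I \<in> carrier (GL q)" using I_mat_GL[OF q_pos, of \<alpha>] \<alpha> by simp
  have "det y * det y = 2 ^ q * det ?I" using arg_cong[OF yy, of det] det_mult[OF yc yc] carrier_matD[OF I] by simp
  then have "det y \<noteq> 0" using two Ic by (auto simp: carrier_GL)
  then have yG: "y \<in> carrier (GL q)" using yc by (simp add: carrier_GL)
  have comm: "y * ?I = ?I * y"
    unfolding y_def using I add_mult_distrib_mat[of "1\<^sub>m q" q q ?I ?I q] mult_add_distrib_mat[of ?I q q "1\<^sub>m q" q ?I] by simp
  have y2: "y [^]\<^bsub>GL q\<^esub> q = 2 \<cdot>\<^sub>m ?I" using yy q2 yc by (simp add: GL_pow[OF yG] numeral_2_eq_2)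
  have "y [^]\<^bsub>GL q\<^esub> (q ^ 2) = (2 \<cdot>\<^sub>m ?I) [^]\<^bsub>GL q\<^esub> q" using yG y2 by (simp add: power2_eq_square flip: W.nat_pow_pow)
  also have "\<dots> = (2 \<cdot>\<^sub>m ?I) * (2 \<cdot>\<^sub>m ?I)" using q2 y2 W.nat_pow_closed[OF yG, of q] I by (simp add: numeral_2_eq_2)
  also have "\<dots> = (- 4) \<cdot>\<^sub>m 1\<^sub>m q" using I II by (simp add: mult_smult_assoc_mat[of _ q q _ q] mult_smult_distrib[of _ q q _ q] smult_smult_mat)
  finally have "y [^]\<^bsub>GL q\<^esub> (q ^ 2) = (- 4) \<cdot>\<^sub>m 1\<^sub>m q" .
  moreover have "(- 4 :: 'a) \<noteq> 0" using two by (metis mult_2 mult_eq_0_iff neg_equal_0_iff_equal numeral_Bit0_eq_double)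
  ultimately have "y [^]\<^bsub>GL q\<^esub> (q ^ 2) \<in> scalar_group q" unfolding scalar_group_iff by blast
  then have "y \<in> W.torsion_level 2 ?I" using yG comm by (simp add: W.torsion_level_def W.cent_def)
  then have "y \<in> W.torsion_cent ?I" unfolding W.torsion_cent_def by blast
  moreover have "2 \<cdot>\<^sub>m ?I \<notin> scalar_group q"
  proof
    assume "2 \<cdot>\<^sub>m ?I \<in> scalar_group q"
    then obtain c where "2 \<cdot>\<^sub>m ?I = c \<cdot>\<^sub>m 1\<^sub>m q" by (auto simp: scalar_group_iff)
    from arg_cong[OF this, of "\<lambda>B. B $$ (0, 1)"] show False using q2 two I by (simp add: I_mat_index carrier_matD[OF I])
  qed
  ultimately show ?thesis by (intro bexI[of _ y] conjI) (use y2 yy in simp_all)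
qed

text \<open>As \<open>x ^ q\<close> is the scalar \<open>a ^ q\<close>, an eigenvector exists over
  the ground field and \<open>weyl_diagonal_form\<close> applies there. The diagonal matrix obtained
  is a scalar times \<open>d_mat\<close>, and the scalar does not affect the centralizer.\<close>

lemma weyl_type_power:
  assumes w: "W.weyl w x h" and xq: "x ^\<^sub>m q = a ^ q \<cdot>\<^sub>m 1\<^sub>m q" and a: "a \<noteq> 0"
  shows "\<exists>g \<in> carrier (GL q). \<exists>\<beta>. \<beta> \<noteq> 0 \<and> W.conjg g ` W.weyl_group x h = H_grp q \<beta> \<and>
    (\<exists>z \<in> scalar_group q. W.conjg g x = z \<otimes>\<^bsub>GL q\<^esub> d_mat q \<xi>)"
proof -
  have \<xi>q: "(\<xi> \<cdot>\<^sub>m 1\<^sub>m q) [^]\<^bsub>GL q\<^esub> q = \<one>\<^bsub>GL q\<^esub>"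
    using weyl_d_I[of 1] W.semi_torsion unfolding W.weyl_semi by auto
  obtain h' where h': "W.weyl (\<xi> \<cdot>\<^sub>m 1\<^sub>m q) x h'" "W.weyl_group x h' = W.weyl_group x h"
    using weyl_normalize[OF w scalar_root_mem(1) \<xi>q] scalar_root_mem(2) by auto
  have x: "x \<in> carrier (GL q)" "x \<in> carrier_mat q q" "det x \<noteq> 0" and h: "h' \<in> carrier (GL q)" "h' \<in> carrier_mat q q" "det h' \<noteq> 0"
    using W.weyl_closed[OF h'(1)] by (auto simp: carrier_GL)
  have xh: "x * h' \<in> carrier_mat q q" using x h by auto
  have hx: "h' * x = \<xi> \<cdot>\<^sub>m (x * h')" using h'(1) scalar_mat_mult(1)[OF xh, of \<xi>] by (simp add: W.weyl_def)
  let ?v = "unit_vec q 0 :: 'a vec"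
  have v: "?v \<in> carrier_vec q" "?v \<noteq> 0\<^sub>v q" using q_pos by auto
  have "x ^\<^sub>m q *\<^sub>v ?v = a ^ q \<cdot>\<^sub>v ?v" unfolding xq using smult_mat_mult_vec[OF one_carrier_mat v(1), of "a ^ q"] v by simp
  moreover have "x *\<^sub>v u + c \<cdot>\<^sub>v u \<in> carrier_vec q" if "u \<in> carrier_vec q" for u c using x(2) that by auto
  ultimately obtain i u where u: "u \<in> carrier_vec q" "u \<noteq> 0\<^sub>v q" "x *\<^sub>v u = (a * \<xi> ^ i) \<cdot>\<^sub>v u"
    using kummer_eigenvector[OF x(2) subset_refl _ v _ a] by blast
  define c where "c = a * \<xi> ^ i"
  have c: "c \<noteq> 0" using a root_neq_0 by (simp add: c_def)
  let ?k = "krylov q h' u"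
  note f = weyl_diagonal_form[OF x(2) h(2,3) hx u(1,2) u(3)[folded c_def] c]
  have k: "?k \<in> carrier (GL q)" using f(1) by (simp add: carrier_GL)
  obtain \<beta> where \<beta>: "h' * ?k = ?k * I_mat q \<beta>" using f(3) by blast
  have "det h' * det ?k = det ?k * det (I_mat q \<beta>)"
    using arg_cong[OF \<beta>, of det] det_mult[OF h(2) krylov_carrier] det_mult[OF krylov_carrier I_mat_carrier[OF q_pos]] by simp
  then have dI: "det (I_mat q \<beta>) \<noteq> 0" using h(3) f(1) by auto
  have \<beta>0: "\<beta> \<noteq> 0"
  proof
    assume "\<beta> = 0"
    then have "det (I_mat q \<beta> ^\<^sub>m q) = 0" using I_mat_pow_n[OF q_pos, of \<beta>] q_pos by simp
    then show False using dI det_pow_mat[OF I_mat_carrier[OF q_pos, of \<beta>], of q] by simp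
  qed
  let ?z = "(c * \<xi>) \<cdot>\<^sub>m 1\<^sub>m q :: 'a mat"
  have z: "?z \<in> scalar_group q" using c root_neq_0 by (auto simp: scalar_group_iff intro!: exI[of _ "c * \<xi>"])
  have dG: "d_mat q \<xi> \<in> carrier (GL q)" by (rule d_mat_GL[OF root_neq_0])
  have "mat_diag q (\<lambda>j. c * \<xi> ^ Suc j) = ?z \<otimes>\<^bsub>GL q\<^esub> d_mat q \<xi>"
    using scalar_mat_mult(1)[OF mat_diag_dim[of q "\<lambda>i. \<xi> ^ i"], of "c * \<xi>"] by (simp add: d_mat_def smult_mat_diag mult.assoc)
  then have cx: "W.conjg (inv\<^bsub>GL q\<^esub> ?k) x = ?z \<otimes>\<^bsub>GL q\<^esub> d_mat q \<xi>"
    using conjg_inv_eq[OF k x(1), of "?z \<otimes>\<^bsub>GL q\<^esub> d_mat q \<xi>"] f(2) W.m_closed[OF scalar_group_carrier[OF z] dG] by simp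
  have ch: "W.conjg (inv\<^bsub>GL q\<^esub> ?k) h' = I_mat q \<beta>" by (rule conjg_inv_eq[OF k h(1) I_mat_GL[OF q_pos \<beta>0] \<beta>])
  have kG: "inv\<^bsub>GL q\<^esub> ?k \<in> carrier (GL q)" using k by (rule W.inv_closed)
  have "W.conjg (inv\<^bsub>GL q\<^esub> ?k) ` W.weyl_group x h = H_grp q \<beta>"
    unfolding h'(2)[symmetric] W.weyl_group_conjg[OF h'(1) kG] cx ch H_grp_eq[OF \<beta>0]
    by (rule W.weyl_group_eqI[OF W.cent_Z_mult[OF dG z]])
  then show ?thesis using cx kG \<beta>0 z by blast
qed

text \<open>The conjugate of \<open>h\<close> and \<open>d_mat\<close> have the same commutation
  scalar with \<open>I_mat\<close>, so their quotient \<open>b\<close> centralizes it. The image of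
  \<open>h\<close> is recorded because \<open>exceptional_conj_psubset\<close> needs its
  determinant.\<close>

lemma weyl_type_nonpower_root:
  assumes w: "W.weyl (inv\<^bsub>GL q\<^esub> (\<xi> \<cdot>\<^sub>m 1\<^sub>m q)) x h" and xq: "x ^\<^sub>m q = \<alpha> \<cdot>\<^sub>m 1\<^sub>m q" and \<alpha>: "\<not> is_power q \<alpha>"
  shows "\<exists>g \<in> carrier (GL q). \<exists>b \<in> W.cent (I_mat q \<alpha>). W.conjg g x = I_mat q \<alpha> \<and>
    W.conjg g h = d_mat q \<xi> * b \<and> W.conjg g ` W.weyl_group x h = G_grp q \<xi> \<alpha> b"
proof -
  have \<alpha>0: "\<alpha> \<noteq> 0" using \<alpha> zero_power[OF q_pos, where 'a = 'a] by (auto simp: is_power_def)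
  let ?z = "inv\<^bsub>GL q\<^esub> (\<xi> \<cdot>\<^sub>m 1\<^sub>m q) :: 'a mat"
  have wd: "W.weyl ?z (I_mat q \<alpha>) (d_mat q \<xi>)" by (rule W.weyl_sym[OF weyl_d_I[OF \<alpha>0]])
  obtain g where g: "g \<in> carrier (GL q)" "W.conjg g x = I_mat q \<alpha>"
    using conjg_I_mat[OF W.weyl_closed(1)[OF w] xq \<alpha>] by blast
  let ?h = "W.conjg g h"
  have wh: "W.weyl ?z (I_mat q \<alpha>) ?h" using W.weyl_conjg[OF w g(1)] g(2) by simp
  have c: "d_mat q \<xi> \<in> carrier (GL q)" "?h \<in> carrier (GL q)" "I_mat q \<alpha> \<in> carrier (GL q)" "?z \<in> carrier (GL q)"
    using W.weyl_closed[OF wd] W.weyl_closed[OF wh] scalar_group_carrier by auto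
  define b where "b = inv\<^bsub>GL q\<^esub> d_mat q \<xi> \<otimes>\<^bsub>GL q\<^esub> ?h"
  have "W.semi (inv\<^bsub>GL q\<^esub> ?z \<otimes>\<^bsub>GL q\<^esub> ?z) (I_mat q \<alpha>) b"
    unfolding b_def using wd wh by (intro W.semi_mult W.semi_inv) (auto simp: W.weyl_semi)
  then have b: "b \<in> W.cent (I_mat q \<alpha>)" using W.semi_cent[OF c(3), of b] W.l_inv[OF c(4)] by simp
  have "d_mat q \<xi> \<otimes>\<^bsub>GL q\<^esub> b = ?h" unfolding b_def by (rule W.inv_cancel_left(1)[OF c(1,2)])
  then have db: "W.conjg g h = d_mat q \<xi> * b" by simp
  then have "W.conjg g ` W.weyl_group x h = G_grp q \<xi> \<alpha> b"
    unfolding G_grp_eq[OF \<alpha>0 b] W.weyl_group_conjg[OF w g(1)] g(2) by simp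
  then show ?thesis using g b db by blast
qed

lemma weyl_type_nonpower:
  assumes w: "W.weyl w x h" and xq: "x ^\<^sub>m q = \<alpha> \<cdot>\<^sub>m 1\<^sub>m q" and \<alpha>: "\<not> is_power q \<alpha>"
  shows "\<exists>g \<in> carrier (GL q). \<exists>b \<in> W.cent (I_mat q \<alpha>). W.conjg g x = I_mat q \<alpha> \<and> W.conjg g ` W.weyl_group x h = G_grp q \<xi> \<alpha> b"
proof -
  have \<alpha>0: "\<alpha> \<noteq> 0" using \<alpha> zero_power[OF q_pos, where 'a = 'a] by (auto simp: is_power_def)
  let ?z = "inv\<^bsub>GL q\<^esub> (\<xi> \<cdot>\<^sub>m 1\<^sub>m q) :: 'a mat"
  have wd: "W.weyl ?z (I_mat q \<alpha>) (d_mat q \<xi>)" by (rule W.weyl_sym[OF weyl_d_I[OF \<alpha>0]])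
  have "?z [^]\<^bsub>GL q\<^esub> q = \<one>\<^bsub>GL q\<^esub>" using wd W.semi_torsion unfolding W.weyl_semi by blast
  then obtain h' where h': "W.weyl ?z x h'" "W.weyl_group x h' = W.weyl_group x h"
    using weyl_normalize[OF w W.weyl_closed(3)[OF wd] _ W.weyl_closed(4)[OF wd]] by blast
  then show ?thesis using weyl_type_nonpower_root[OF h'(1) xq \<alpha>] by auto
qed

text \<open>Conjugation by the diagonal matrix of powers of \<open>inverse r\<close> absorbs the
  factor \<open>r ^ q\<close>, and the factor \<open>s\<close> goes into the element
  \<open>Y\<close> of \<open>D_set\<close>. So \<open>I_mat q \<beta>\<close> becomes
  \<open>Y * I_mat q 1\<close>, another partner of \<open>d_mat\<close> inside
  \<open>H_grp q 1\<close>.\<close>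

lemma H_grp_conj_1:
  assumes "\<beta> \<in> S_set q"
  shows "\<exists>g \<in> carrier (GL q). W.conjg g ` H_grp q \<beta> = H_grp q 1"
proof -
  obtain s r where s: "s \<in> Syl q Fx" "r \<noteq> 0" "\<beta> = s * r ^ q" using assms by (auto simp: S_set_def Fx_powers_def simp del: carrier_mult_of)
  have s0: "s \<noteq> 0" using s(1) Syl_Fx_iff[OF prime_q] by blast
  have \<beta>0: "\<beta> \<noteq> 0" using s s0 by simp
  let ?d = "d_mat q \<xi>"
  define g where "g = mat_diag q (\<lambda>i. inverse r ^ i)"
  define Y where "Y = mat_diag q (\<lambda>i. r * (if Suc i = q then s else 1))"
  have "1 \<in> Syl q (Fx :: 'a monoid)" using Syl_Fx_iff[OF prime_q, of "1::'a"] by simp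
  then have "Y \<in> D_set q" unfolding D_set_def Y_def using s by (auto intro!: exI[of _ r] exI[of _ "\<lambda>i. if Suc i = q then s else 1"])
  then have Y: "Y \<in> W.torsion_cent ?d" by (simp add: D_set_eq)
  have gG: "g \<in> carrier (GL q)" using s by (simp add: g_def carrier_GL det_mat_diag)
  note I\<beta> = I_mat_carrier[OF q_pos, of \<beta>] and I1 = I_mat_carrier[OF q_pos, of "1::'a"]
  have YI: "Y * I_mat q 1 \<in> carrier_mat q q" using I1 by (auto simp: Y_def intro: mult_carrier_mat[OF mat_diag_dim])
  have eq: "g * I_mat q \<beta> = (Y * I_mat q 1) * g"
  proof (rule eq_matI)
    show "dim_row (g * I_mat q \<beta>) = dim_row ((Y * I_mat q 1) * g)" "dim_col (g * I_mat q \<beta>) = dim_col ((Y * I_mat q 1) * g)"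
      using I\<beta> YI by (auto simp: g_def Y_def mat_diag_def)
    fix i j assume "i < dim_row ((Y * I_mat q 1) * g)" "j < dim_col ((Y * I_mat q 1) * g)"
    then have ij: "i < q" "j < q" by (auto simp: g_def Y_def mat_diag_def)
    have r: "r * inverse r ^ Suc i = inverse r ^ i" using s by simp
    have "Suc i = q \<Longrightarrow> inverse r ^ i * r ^ q = r" using s by (auto simp: power_inverse field_simps)
    then show "(g * I_mat q \<beta>) $$ (i, j) = ((Y * I_mat q 1) * g) $$ (i, j)"
      unfolding g_def mat_diag_mult_left[OF I\<beta>] mat_diag_mult_right[OF YI] using ij r s(3)
      by (simp add: Y_def mat_diag_mult_left[OF I1] I_mat_index)
  qed
  have dc: "?d \<in> carrier (GL q)" by (rule d_mat_GL[OF root_neq_0])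
  have Yc: "Y \<in> carrier (GL q)" using Y W.torsion_cent_cent[OF weyl_d_I[of 1]] W.cent_closed by auto
  have I1G: "I_mat q (1::'a) \<in> carrier (GL q)" and IbG: "I_mat q \<beta> \<in> carrier (GL q)" using I_mat_GL[OF q_pos one_neq_zero] I_mat_GL[OF q_pos \<beta>0] by auto
  have cd: "W.conjg g ?d = ?d" using gG dc by (intro W.conjg_commute) (auto simp: g_def d_mat_def mult.commute)
  have "W.conjg g (I_mat q \<beta>) = (Y \<otimes>\<^bsub>GL q\<^esub> I_mat q 1) \<otimes>\<^bsub>GL q\<^esub> g \<otimes>\<^bsub>GL q\<^esub> inv\<^bsub>GL q\<^esub> g" using eq by (simp add: W.conjg_def)
  also have "\<dots> = Y \<otimes>\<^bsub>GL q\<^esub> I_mat q 1"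
    using W.m_assoc[OF W.m_closed[OF Yc I1G] gG W.inv_closed[OF gG]] W.r_inv[OF gG] W.r_one[OF W.m_closed[OF Yc I1G]] by metis
  finally have cI: "W.conjg g (I_mat q \<beta>) = Y \<otimes>\<^bsub>GL q\<^esub> I_mat q 1" .
  have w1: "W.weyl (\<xi> \<cdot>\<^sub>m 1\<^sub>m q) ?d (I_mat q 1)" by (rule weyl_d_I) simp
  have wb: "W.weyl (\<xi> \<cdot>\<^sub>m 1\<^sub>m q) ?d (I_mat q \<beta>)" by (rule weyl_d_I[OF \<beta>0])
  have wY: "W.weyl (\<xi> \<cdot>\<^sub>m 1\<^sub>m q) ?d (Y \<otimes>\<^bsub>GL q\<^esub> I_mat q 1)" using W.weyl_conjg[OF wb gG] unfolding cd cI .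
  have "Y \<otimes>\<^bsub>GL q\<^esub> I_mat q 1 \<in> W.weyl_group ?d (I_mat q 1)"
    using W.weyl_group_incl[OF w1] Y subgroup.m_closed[OF W.weyl_group_subgroup[OF w1]] by blast
  moreover have "Y \<otimes>\<^bsub>GL q\<^esub> I_mat q 1 \<notin> W.cent ?d"
    using wY W.semi_cent[OF dc] W.semi_unique unfolding W.weyl_semi by blast
  ultimately have "W.weyl_group ?d (Y \<otimes>\<^bsub>GL q\<^esub> I_mat q 1) = W.weyl_group ?d (I_mat q 1)" by (rule W.weyl_group_change[OF w1])
  then have "W.conjg g ` H_grp q \<beta> = H_grp q 1"
    unfolding H_grp_eq[OF \<beta>0] H_grp_eq[OF one_neq_zero] W.weyl_group_conjg[OF wb gG] cd cI .
  then show ?thesis using gG by blast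
qed

end

section \<open>Systems of imprimitivity\<close>

lemma funpow_fixed_mult: "(f ^^ N) a = a \<Longrightarrow> (f ^^ (N * t)) a = a"
  by (induction t) (simp_all add: funpow_add)

text \<open>The least period divides \<open>q ^ m\<close> and is not one. In detail, a return after
  \<open>l < q\<close> steps combines with the period \<open>q ^ m\<close> by Bezout to give
  \<open>f a = a\<close>.\<close>

lemma prime_power_orbit_inj:
  assumes q: "Factorial_Ring.prime (q::nat)" and N: "(f ^^ (q ^ m)) a = a" and fa: "f a \<noteq> a"
  shows "inj_on (\<lambda>i. (f ^^ i) a) {..<q}"
proof -
  let ?N = "q ^ m"
  have N0: "1 \<le> ?N" using prime_gt_0_nat[OF q] by simp
  have ne: "(f ^^ i) a \<noteq> (f ^^ j) a" if ij: "i < j" "j < q" for i j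
  proof
    assume e: "(f ^^ i) a = (f ^^ j) a"
    define l where "l = j - i"
    \<comment> \<open>Cancelling \<open>f ^^ i\<close> is replaced by applying \<open>f\<close>
      further times, until \<open>i\<close> is completed to a multiple of the period.\<close>
    have "1 * i \<le> ?N * i" by (rule mult_le_mono1[OF N0])
    then have i: "?N * i - i + i = ?N * i" and l: "?N * i - i + j = l + ?N * i" using ij by (simp_all add: l_def)
    have "(f ^^ (?N * i - i)) ((f ^^ i) a) = (f ^^ (?N * i - i)) ((f ^^ j) a)" using e by simp
    then have "(f ^^ (?N * i - i + i)) a = (f ^^ (?N * i - i + j)) a" unfolding funpow_add comp_def .
    then have la: "(f ^^ l) a = a" unfolding i l funpow_add comp_def funpow_fixed_mult[OF N] by simp
    have "0 < l" "l < q" using ij by (auto simp: l_def)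
    then have "\<not> q dvd l" by (auto dest: dvd_imp_le)
    then have "coprime l ?N" using prime_imp_coprime[OF q, of l] by (simp add: coprime_commute)
    then obtain s t where st: "l * s = ?N * t + 1" using \<open>0 < l\<close> bezout_nat[of l ?N] by (auto simp: coprime_iff_gcd_eq_1)
    have "a = (f ^^ (1 + ?N * t)) a" using funpow_fixed_mult[OF la, of s] unfolding st by (simp add: add.commute)
    also have "\<dots> = f a" unfolding funpow_add comp_def funpow_fixed_mult[OF N] by simp
    finally show False using fa by simp
  qed
  show ?thesis
  proof (rule inj_onI)
    fix i j assume "i \<in> {..<q}" "j \<in> {..<q}" "(f ^^ i) a = (f ^^ j) a"
    then show "i = j" using ne[of i j] ne[of j i] by (cases i j rule: linorder_cases) auto
  qed
qed

lemma direct_decomposition_unique: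
  fixes f f' :: "'a::field vec set \<Rightarrow> 'a vec"
  assumes D: "direct_decomposition n \<V>" and f: "\<And>V. V \<in> \<V> \<Longrightarrow> f V \<in> V" "\<And>V. V \<in> \<V> \<Longrightarrow> f' V \<in> V"
    and eq: "\<And>r. r < n \<Longrightarrow> (\<Sum>V\<in>\<V>. f V $ r) = (\<Sum>V\<in>\<V>. f' V $ r)" and V: "V \<in> \<V>"
  shows "f V = f' V"
proof -
  have fin: "finite \<V>" and sub: "\<And>V. V \<in> \<V> \<Longrightarrow> V \<subseteq> carrier_vec n"
    using D by (auto simp: direct_decomposition_def vec_subspace_iff)
  have car: "finsum_vec TYPE('a) n (restrict e \<V>) \<V> \<in> carrier_vec n"
    and idx: "\<And>r. r < n \<Longrightarrow> finsum_vec TYPE('a) n (restrict e \<V>) \<V> $ r = (\<Sum>V\<in>\<V>. e V $ r)"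
    if e: "\<And>V. V \<in> \<V> \<Longrightarrow> e V \<in> V" for e
  proof -
    have c: "restrict e \<V> \<in> \<V> \<rightarrow> carrier_vec n" using e sub by auto
    show "finsum_vec TYPE('a) n (restrict e \<V>) \<V> \<in> carrier_vec n" by (rule finsum_vec_closed[OF c])
    show "finsum_vec TYPE('a) n (restrict e \<V>) \<V> $ r = (\<Sum>V\<in>\<V>. e V $ r)" if "r < n" for r
      unfolding index_finsum_vec[OF fin that c] by (rule sum.cong) auto
  qed
  let ?v = "finsum_vec TYPE('a) n (restrict f \<V>) \<V>"
  have "?v = finsum_vec TYPE('a) n (restrict f' \<V>) \<V>"
    using car[of f] car[of f'] idx[of f] idx[of f'] f eq by (intro eq_vecI) auto
  moreover have "restrict f \<V> \<in> (\<Pi>\<^sub>E V \<in> \<V>. V)" "restrict f' \<V> \<in> (\<Pi>\<^sub>E V \<in> \<V>. V)" using f by auto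
  moreover have "\<exists>!g. g \<in> (\<Pi>\<^sub>E V \<in> \<V>. V) \<and> ?v = finsum_vec TYPE('a) n g \<V>"
    using D car[of f] f(1) by (simp add: direct_decomposition_def)
  ultimately have "restrict f \<V> = restrict f' \<V>" by blast
  then show ?thesis using V by (metis restrict_apply')
qed

text \<open>Both families are padded with zeros and compared componentwise. For an orbit of members
  the three conclusions yield independence of chosen vectors, the fact that the members are lines,
  and that the orbit exhausts the system.\<close>

lemma direct_decomposition_family:
  fixes w :: "nat \<Rightarrow> 'a::field vec"
  assumes D: "direct_decomposition n \<V>" and inj: "inj_on e {..<m}" and e: "\<And>i. i < m \<Longrightarrow> e i \<in> \<V>" "\<And>i. i < m \<Longrightarrow> w i \<in> e i"
    and V: "V \<in> \<V>" "x \<in> V" and eq: "\<And>r. r < n \<Longrightarrow> (\<Sum>i<m. w i $ r) = x $ r"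
  shows "i < m \<Longrightarrow> e i = V \<Longrightarrow> w i = x" and "i < m \<Longrightarrow> e i \<noteq> V \<Longrightarrow> w i = 0\<^sub>v n" and "V \<notin> e ` {..<m} \<Longrightarrow> x = 0\<^sub>v n"
proof -
  have fin: "finite \<V>" and sub: "\<And>W. W \<in> \<V> \<Longrightarrow> 0\<^sub>v n \<in> W \<and> W \<subseteq> carrier_vec n"
    using D by (auto simp: direct_decomposition_def vec_subspace_iff)
  define f where "f W = (if W \<in> e ` {..<m} then w (inv_into {..<m} e W) else 0\<^sub>v n)" for W
  define f' where "f' W = (if W = V then x else 0\<^sub>v n)" for W
  have fe: "f (e i) = w i" if "i < m" for i using that inv_into_f_f[OF inj, of i] by (simp add: f_def)
  have "f W = f' W" if W: "W \<in> \<V>" for W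
  proof (rule direct_decomposition_unique[OF D _ _ _ W])
    fix U assume U: "U \<in> \<V>"
    show "f U \<in> U"
    proof (cases "U \<in> e ` {..<m}")
      case True then show ?thesis using fe e(2) by auto
    next
      case False then show ?thesis using sub[OF U] by (simp add: f_def)
    qed
    show "f' U \<in> U" using V sub[OF U] by (simp add: f'_def)
  next
    fix r assume r: "r < n"
    have "(\<Sum>W\<in>\<V>. f W $ r) = (\<Sum>W\<in>e ` {..<m}. f W $ r)"
      using fin e(1) r by (intro sum.mono_neutral_right) (auto simp: f_def)
    also have "\<dots> = (\<Sum>i<m. w i $ r)" unfolding sum.reindex[OF inj] using fe by simp
    also have "\<dots> = x $ r" by (rule eq[OF r])
    also have "\<dots> = (\<Sum>W\<in>\<V>. if W = V then x $ r else 0)" using V fin by simp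
    also have "\<dots> = (\<Sum>W\<in>\<V>. f' W $ r)" using r by (intro sum.cong) (auto simp: f'_def)
    finally show "(\<Sum>W\<in>\<V>. f W $ r) = (\<Sum>W\<in>\<V>. f' W $ r)" .
  qed
  note ff = this
  show "i < m \<Longrightarrow> e i = V \<Longrightarrow> w i = x" using ff[OF e(1)[of i]] fe[of i] by (simp add: f'_def)
  show "i < m \<Longrightarrow> e i \<noteq> V \<Longrightarrow> w i = 0\<^sub>v n" using ff[OF e(1)[of i]] fe[of i] by (simp add: f'_def)
  show "V \<notin> e ` {..<m} \<Longrightarrow> x = 0\<^sub>v n" using ff[OF V(1)] by (simp add: f_def f'_def)
qed

definition column_line :: "'a::field mat \<Rightarrow> nat \<Rightarrow> 'a vec set" where
  "column_line g j = {c \<cdot>\<^sub>v col g j | c. True}"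

lemma vec_subspace_column_line: "g \<in> carrier_mat n n \<Longrightarrow> vec_subspace n (column_line g j)"
proof -
  assume g: "g \<in> carrier_mat n n"
  have c: "col g j \<in> carrier_vec n" using g by auto
  have "a \<cdot>\<^sub>v col g j + b \<cdot>\<^sub>v col g j \<in> column_line g j" for a b
    unfolding column_line_def add_smult_distrib_vec[symmetric] by blast
  moreover have "a \<cdot>\<^sub>v (b \<cdot>\<^sub>v col g j) \<in> column_line g j" for a b
    unfolding column_line_def smult_smult_assoc by blast
  moreover have "0\<^sub>v n \<in> column_line g j" unfolding column_line_def smult_zero_vec[OF c, symmetric] by blast
  moreover have "column_line g j \<subseteq> carrier_vec n" using c by (auto simp: column_line_def)
  ultimately show ?thesis unfolding vec_subspace_iff by (auto simp: column_line_def)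
qed

lemma sum_smult_col_index:
  fixes g :: "'a::field mat"
  assumes "g \<in> carrier_mat n n" "r < n"
  shows "(\<Sum>j<n. (c j \<cdot>\<^sub>v col g j) $ r) = (g *\<^sub>v vec n c) $ r"
  using assms by (auto simp: scalar_prod_def atLeast0LessThan mult.commute intro!: sum.cong)

lemma smult_col_eq: "g \<in> carrier_mat n n \<Longrightarrow> j < n \<Longrightarrow> c \<cdot>\<^sub>v col (g :: 'a::field mat) j = g *\<^sub>v (c \<cdot>\<^sub>v unit_vec n j)"
  using mult_mat_vec_single[of g n "c \<cdot>\<^sub>v unit_vec n j" j] by simp

lemma GL_mult_vec_cancel:
  fixes g :: "'a::field mat"
  assumes g: "g \<in> carrier_mat n n" "det g \<noteq> 0" and e: "g *\<^sub>v u = g *\<^sub>v v" and uv: "u \<in> carrier_vec n" "v \<in> carrier_vec n"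
  shows "u = v"
proof -
  obtain g' where g': "g' \<in> carrier_mat n n" "g' * g = 1\<^sub>m n" using GL_inverse[OF g] by blast
  have "g' *\<^sub>v (g *\<^sub>v w) = w" if "w \<in> carrier_vec n" for w
    using assoc_mult_mat_vec[OF g'(1) g(1) that] g'(2) that by simp
  then show ?thesis using e uv by metis
qed

lemma inj_on_column_line:
  fixes g :: "'a::field mat"
  assumes g: "g \<in> carrier_mat n n" "det g \<noteq> 0"
  shows "inj_on (column_line g) {..<n}"
proof (rule inj_onI)
  fix i j assume i: "i \<in> {..<n}" and j: "j \<in> {..<n}" and e: "column_line g i = column_line g j"
  have "1 \<cdot>\<^sub>v col g i \<in> column_line g i" unfolding column_line_def by blast
  then have "1 \<cdot>\<^sub>v col g i \<in> column_line g j" unfolding e .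
  then obtain c where "1 \<cdot>\<^sub>v col g i = c \<cdot>\<^sub>v col g j" unfolding column_line_def by blast
  then have "g *\<^sub>v (1 \<cdot>\<^sub>v unit_vec n i) = g *\<^sub>v (c \<cdot>\<^sub>v unit_vec n j)" unfolding smult_col_eq[OF g(1), symmetric] using i j smult_col_eq[OF g(1), of i 1] smult_col_eq[OF g(1), of j c] by simp
  then have "1 \<cdot>\<^sub>v unit_vec n i = c \<cdot>\<^sub>v unit_vec n j" by (rule GL_mult_vec_cancel[OF g]) auto
  from arg_cong[OF this, of "\<lambda>v. v $ i"] show "i = j" using i j by (auto split: if_splits)
qed

lemma direct_decomposition_column_lines:
  fixes g :: "'a::field mat"
  assumes g: "g \<in> carrier_mat n n" "det g \<noteq> 0"
  shows "direct_decomposition n (column_line g ` {..<n})"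
  unfolding direct_decomposition_def
proof (intro conjI ballI)
  let ?\<V> = "column_line g ` {..<n}"
  note inj = inj_on_column_line[OF g]
  show "finite ?\<V>" by simp
  fix V assume "V \<in> ?\<V>"
  then obtain j where j: "j < n" "V = column_line g j" by auto
  show "vec_subspace n V" unfolding j(2) by (rule vec_subspace_column_line[OF g(1)])
  show "V \<noteq> {0\<^sub>v n}"
  proof
    assume "V = {0\<^sub>v n}"
    moreover have "1 \<cdot>\<^sub>v col g j \<in> V" unfolding j(2) column_line_def by blast
    ultimately have "g *\<^sub>v (1 \<cdot>\<^sub>v unit_vec n j) = 0\<^sub>v n" using smult_col_eq[OF g(1) j(1), of 1] by simp
    then have "(1::'a) \<cdot>\<^sub>v unit_vec n j = 0\<^sub>v n" by (rule GL_mult_vec_eq_0[OF g, rotated]) simp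
    from arg_cong[OF this, of "\<lambda>v. v $ j"] show False using j by (simp del: one_smult_vec)
  qed
next
  let ?\<V> = "column_line g ` {..<n}"
  note inj = inj_on_column_line[OF g]
  have sub: "\<And>j. column_line g j \<subseteq> carrier_vec n" using vec_subspace_column_line[OF g(1)] by (auto simp: vec_subspace_iff)
  fix v :: "'a vec" assume v: "v \<in> carrier_vec n"
  obtain g' where g': "g' \<in> carrier_mat n n" "g * g' = 1\<^sub>m n" using GL_inverse[OF g] by blast
  define u where "u = g' *\<^sub>v v"
  have u: "u \<in> carrier_vec n" unfolding u_def by (rule mult_mat_vec_carrier[OF g'(1) v])
  have gu: "g *\<^sub>v u = v" unfolding u_def using assoc_mult_mat_vec[OF g(1) g'(1) v] g'(2) v by simp
  have idx: "finsum_vec TYPE('a) n f ?\<V> = g *\<^sub>v vec n c"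
    if f: "f \<in> (\<Pi>\<^sub>E V \<in> ?\<V>. V)" and c: "\<And>j. j < n \<Longrightarrow> f (column_line g j) = c j \<cdot>\<^sub>v col g j" for f c
  proof (rule eq_vecI)
    have fc: "f \<in> ?\<V> \<rightarrow> carrier_vec n" using f sub by fast
    show "dim_vec (finsum_vec TYPE('a) n f ?\<V>) = dim_vec (g *\<^sub>v vec n c)" using finsum_vec_closed[OF fc] g by simp
    fix r assume "r < dim_vec (g *\<^sub>v vec n c)"
    then have r: "r < n" using g by simp
    have "finsum_vec TYPE('a) n f ?\<V> $ r = (\<Sum>V\<in>?\<V>. f V $ r)" by (rule index_finsum_vec[OF _ r fc]) simp
    also have "\<dots> = (\<Sum>j<n. (c j \<cdot>\<^sub>v col g j) $ r)" unfolding sum.reindex[OF inj] using c by (intro sum.cong) auto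
    also have "\<dots> = (g *\<^sub>v vec n c) $ r" by (rule sum_smult_col_index[OF g(1) r])
    finally show "finsum_vec TYPE('a) n f ?\<V> $ r = (g *\<^sub>v vec n c) $ r" .
  qed
  define f0 where "f0 = restrict (\<lambda>V. u $ inv_into {..<n} (column_line g) V \<cdot>\<^sub>v col g (inv_into {..<n} (column_line g) V)) ?\<V>"
  have f0c: "f0 (column_line g j) = u $ j \<cdot>\<^sub>v col g j" if "j < n" for j
    using that inv_into_f_f[OF inj, of j] by (simp add: f0_def)
  have "f0 V \<in> V" if "V \<in> ?\<V>" for V using that f0c by (auto simp: column_line_def)
  then have f0: "f0 \<in> (\<Pi>\<^sub>E V \<in> ?\<V>. V)" by (auto simp: f0_def)
  show "\<exists>!f. f \<in> (\<Pi>\<^sub>E V \<in> ?\<V>. V) \<and> v = finsum_vec TYPE('a) n f ?\<V>"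
  proof (rule ex1I[of _ f0])
    have "vec n (\<lambda>j. u $ j) = u" using u by auto
    then show "f0 \<in> (\<Pi>\<^sub>E V \<in> ?\<V>. V) \<and> v = finsum_vec TYPE('a) n f0 ?\<V>" using f0 idx[OF f0 f0c] gu by simp
  next
    fix f assume f: "f \<in> (\<Pi>\<^sub>E V \<in> ?\<V>. V) \<and> v = finsum_vec TYPE('a) n f ?\<V>"
    then have "f (column_line g j) \<in> column_line g j" if "j < n" for j using PiE_mem[of f ?\<V> "\<lambda>V. V" "column_line g j"] that by blast
    then have "\<forall>j. \<exists>c. j < n \<longrightarrow> f (column_line g j) = c \<cdot>\<^sub>v col g j" unfolding column_line_def by blast
    then obtain c where c: "\<And>j. j < n \<Longrightarrow> f (column_line g j) = c j \<cdot>\<^sub>v col g j" by metis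
    have "g *\<^sub>v vec n c = g *\<^sub>v u" using idx[of f c] f c gu by simp
    then have "vec n c = u" by (rule GL_mult_vec_cancel[OF g _ _ u]) simp
    then have "c j = u $ j" if "j < n" for j using that by auto
    then have cu: "f (column_line g j) = f0 (column_line g j)" if "j < n" for j using c[OF that] f0c[OF that] that by simp
    show "f = f0"
    proof (rule PiE_ext[OF conjunct1[OF f] f0])
      fix V assume "V \<in> ?\<V>"
      then show "f V = f0 V" using cu by blast
    qed
  qed
qed

section \<open>Imprimitive groups and conjugates of \<open>H_grp\<close>\<close>

context prime_root
begin

lemma H_grp_monomial:
  fixes \<beta> :: 'a
  assumes \<beta>: "\<beta> \<noteq> 0" and y: "y \<in> H_grp q \<beta>" and j: "j < q"
  shows "\<exists>i<q. \<exists>c. c \<noteq> 0 \<and> y *\<^sub>v unit_vec q j = c \<cdot>\<^sub>v unit_vec q i"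
proof -
  define P where "P y \<longleftrightarrow> y \<in> carrier_mat q q \<and> (\<forall>j<q. \<exists>i<q. \<exists>c. c \<noteq> 0 \<and> y *\<^sub>v unit_vec q j = c \<cdot>\<^sub>v unit_vec q i)" for y :: "'a mat"
  have Pmult: "P (a * b)" if P: "P a" "P b" for a b
    unfolding P_def
  proof (intro conjI allI impI)
    have ab: "a \<in> carrier_mat q q" "b \<in> carrier_mat q q" using P by (auto simp: P_def)
    then show "a * b \<in> carrier_mat q q" by simp
    fix j assume "j < q"
    then obtain i c where i: "i < q" "c \<noteq> 0" "b *\<^sub>v unit_vec q j = c \<cdot>\<^sub>v unit_vec q i" using P(2) by (auto simp: P_def)
    obtain i' c' where i': "i' < q" "c' \<noteq> 0" "a *\<^sub>v unit_vec q i = c' \<cdot>\<^sub>v unit_vec q i'" using P(1) i(1) by (auto simp: P_def)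
    have "(a * b) *\<^sub>v unit_vec q j = a *\<^sub>v (c \<cdot>\<^sub>v unit_vec q i)" using assoc_mult_mat_vec[OF ab, of "unit_vec q j"] i(3) by simp
    also have "\<dots> = (c * c') \<cdot>\<^sub>v unit_vec q i'" using mult_mat_vec[OF ab(1), of "unit_vec q i" c] i'(3) by (simp add: smult_smult_assoc)
    finally show "\<exists>i<q. \<exists>c. c \<noteq> 0 \<and> (a * b) *\<^sub>v unit_vec q j = c \<cdot>\<^sub>v unit_vec q i" using i' i(2) by (metis mult_eq_0_iff)
  qed
  have col: "A *\<^sub>v unit_vec q j = col A j" if "A \<in> carrier_mat q q" "j < q" for A :: "'a mat" and j
    using smult_col_eq[OF that, of 1] by simp
  have PI: "P (I_mat q \<beta>)" unfolding P_def
  proof (intro conjI allI impI)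
    note I = I_mat_carrier[OF q_pos, of \<beta>]
    then show "I_mat q \<beta> \<in> carrier_mat q q" .
    fix j assume j: "j < q"
    have "I_mat q \<beta> *\<^sub>v unit_vec q j = (if j = 0 then \<beta> else 1) \<cdot>\<^sub>v unit_vec q (if j = 0 then q - 1 else j - 1)"
      unfolding col[OF I j] using j carrier_matD[OF I] by (intro eq_vecI) (auto simp: I_mat_index)
    moreover have "(if j = 0 then q - 1 else j - 1) < q" "(if j = 0 then \<beta> else 1) \<noteq> 0" using j \<beta> by auto
    ultimately show "\<exists>i<q. \<exists>c. c \<noteq> 0 \<and> I_mat q \<beta> *\<^sub>v unit_vec q j = c \<cdot>\<^sub>v unit_vec q i" by blast
  qed
  have P1: "P (1\<^sub>m q)" unfolding P_def
  proof (intro conjI allI impI)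
    fix j assume "j < q"
    then have "j < q \<and> (1::'a) \<noteq> 0 \<and> 1\<^sub>m q *\<^sub>v unit_vec q j = (1::'a) \<cdot>\<^sub>v unit_vec q j" by simp
    then show "\<exists>i<q. \<exists>c. c \<noteq> 0 \<and> 1\<^sub>m q *\<^sub>v unit_vec q j = (c::'a) \<cdot>\<^sub>v unit_vec q i" by blast
  qed simp
  have Ppow: "P (I_mat q \<beta> ^\<^sub>m i)" for i
  proof (induction i)
    case 0 then show ?case using P1 carrier_matD[OF I_mat_carrier[OF q_pos, of \<beta>]] by simp
  next
    case (Suc i) then show ?case using Pmult[OF Suc PI] by simp
  qed
  have PD: "P a" if "a \<in> D_set q" for a
  proof -
    obtain b :: 'a and \<gamma> where a: "a = mat_diag q (\<lambda>i. b * \<gamma> i)" "b \<noteq> 0" "\<And>i. i < q \<Longrightarrow> \<gamma> i \<in> Syl q Fx"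
      using \<open>a \<in> D_set q\<close> by (auto simp: D_set_def simp del: carrier_mult_of)
    have ac: "a \<in> carrier_mat q q" unfolding a(1) by simp
    show ?thesis unfolding P_def
    proof (intro conjI allI impI)
      show "a \<in> carrier_mat q q" by (rule ac)
      fix j assume j: "j < q"
      have "b * \<gamma> j \<noteq> 0" using a(2) a(3)[OF j] Syl_Fx_iff[OF prime_q, of "\<gamma> j"] by simp
      moreover have "a *\<^sub>v unit_vec q j = (b * \<gamma> j) \<cdot>\<^sub>v unit_vec q j"
        unfolding col[OF ac j] using j carrier_matD[OF ac] unfolding a(1) by (intro eq_vecI) (auto simp: mat_diag_index)
      ultimately show "\<exists>i<q. \<exists>c. c \<noteq> 0 \<and> a *\<^sub>v unit_vec q j = c \<cdot>\<^sub>v unit_vec q i" using j by blast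
    qed
  qed
  obtain a i where "a \<in> D_set q" "y = a \<otimes>\<^bsub>GL q\<^esub> I_mat q \<beta> [^]\<^bsub>GL q\<^esub> (i::nat)"
    using y unfolding H_grp_eq[OF \<beta>] W.weyl_group_def W.ext_def D_set_eq[symmetric] by blast
  then have "P y" using Pmult[OF PD Ppow] GL_pow[OF I_mat_GL[OF q_pos \<beta>], of i] by simp
  then show ?thesis using j by (simp add: P_def)
qed

text \<open>Elements of \<open>H_grp\<close> are monomial, so their conjugates by \<open>g\<close>
  permute the lines spanned by the columns of \<open>g\<close>.\<close>

lemma imprimitive_subset_H_grp:
  fixes \<beta> :: 'a
  assumes \<beta>: "\<beta> \<noteq> 0" and g: "g \<in> carrier (GL q)" and K: "K \<subseteq> W.conjg g ` H_grp q \<beta>"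
  shows "\<not> primitive_lin q K"
proof -
  let ?\<V> = "column_line g ` {..<q}"
  have gm: "g \<in> carrier_mat q q" "det g \<noteq> 0" using g by (auto simp: carrier_GL)
  have "card ?\<V> = q" using card_image[OF inj_on_column_line[OF gm]] by simp
  moreover have "(\<lambda>v. k *\<^sub>v v) ` V \<in> ?\<V>" if k: "k \<in> K" and V: "V \<in> ?\<V>" for k V
  proof -
    obtain j where j: "j < q" "V = column_line g j" using V by auto
    obtain y where y: "y \<in> H_grp q \<beta>" "k = W.conjg g y" using k K by blast
    have yG: "y \<in> carrier (GL q)" using y(1) subgroup.mem_carrier[OF W.weyl_group_subgroup[OF weyl_d_I[OF \<beta>]]] H_grp_eq[OF \<beta>] by blast
    have ym: "y \<in> carrier_mat q q" using yG by (simp add: carrier_GL)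
    have km: "k \<in> carrier_mat q q" using W.conjg_closed[OF g yG] y(2) by (simp add: carrier_GL)
    have kg: "k * g = g * y" using W.conjg_swap[OF g yG] y(2) by simp
    obtain i c where i: "i < q" "c \<noteq> 0" "y *\<^sub>v unit_vec q j = c \<cdot>\<^sub>v unit_vec q i" using H_grp_monomial[OF \<beta> y(1) j(1)] by blast
    have im: "k *\<^sub>v (a \<cdot>\<^sub>v col g j) = (a * c) \<cdot>\<^sub>v col g i" for a
    proof -
      have "k *\<^sub>v (a \<cdot>\<^sub>v col g j) = (k * g) *\<^sub>v (a \<cdot>\<^sub>v unit_vec q j)"
        unfolding smult_col_eq[OF gm(1) j(1)] by (rule assoc_mult_mat_vec[OF km gm(1), symmetric]) simp
      also have "\<dots> = g *\<^sub>v (y *\<^sub>v (a \<cdot>\<^sub>v unit_vec q j))" unfolding kg by (rule assoc_mult_mat_vec[OF gm(1) ym]) simp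
      also have "y *\<^sub>v (a \<cdot>\<^sub>v unit_vec q j) = (a * c) \<cdot>\<^sub>v unit_vec q i" using mult_mat_vec[OF ym, of "unit_vec q j" a] i(3) by (simp add: smult_smult_assoc)
      finally show ?thesis unfolding smult_col_eq[OF gm(1) i(1)] .
    qed
    have "(\<lambda>v. k *\<^sub>v v) ` V = column_line g i" unfolding j(2)
    proof (intro equalityI subsetI)
      fix u assume "u \<in> (\<lambda>v. k *\<^sub>v v) ` column_line g j"
      then obtain a where "u = k *\<^sub>v (a \<cdot>\<^sub>v col g j)" unfolding column_line_def by blast
      then show "u \<in> column_line g i" unfolding im column_line_def by blast
    next
      fix u assume "u \<in> column_line g i"
      then obtain a where "u = a \<cdot>\<^sub>v col g i" unfolding column_line_def by blast
      then have "u = k *\<^sub>v ((a / c) \<cdot>\<^sub>v col g j)" unfolding im using i(2) by simp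
      then show "u \<in> (\<lambda>v. k *\<^sub>v v) ` column_line g j" unfolding column_line_def by blast
    qed
    then show ?thesis using i(1) by blast
  qed
  ultimately have "system_of_imprimitivity q K ?\<V>"
    unfolding system_of_imprimitivity_def using direct_decomposition_column_lines[OF gm] q_gt_1 by auto
  then show ?thesis unfolding primitive_lin_def by blast
qed

text \<open>Some \<open>k\<close> in \<open>K\<close> moves a member, and its orbit has at least
  \<open>q\<close> members because \<open>k\<close> acts with \<open>q\<close>-power period.
  Dimension \<open>q\<close> forces these to be lines and to be the whole system. In the basis
  \<open>k ^ i v\<close> the matrix \<open>k\<close> becomes some \<open>I_mat q \<beta>\<close>,
  and every element of \<open>K\<close> is a power of \<open>k\<close> times an element fixing all
  the lines, which becomes diagonal and, being torsion, lies in \<open>D_set\<close>.\<close>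

lemma imprimitive_torsion_subset_H_grp:
  assumes K: "subgroup K (GL q)" and tors: "\<And>k. k \<in> K \<Longrightarrow> \<exists>m. k [^]\<^bsub>GL q\<^esub> (q ^ m) \<in> scalar_group q"
    and irr: "irreducible_lin q K" and sys: "system_of_imprimitivity q K \<V>"
  shows "\<exists>g \<in> carrier (GL q). \<exists>\<beta>. \<beta> \<noteq> 0 \<and> K \<subseteq> W.conjg g ` H_grp q \<beta>"
proof -
  interpret K: subgroup K "GL q" by (rule K)
  define act :: "'a mat \<Rightarrow> 'a vec set \<Rightarrow> 'a vec set" where "act k V = (\<lambda>v. k *\<^sub>v v) ` V" for k V
  have D: "direct_decomposition q \<V>" and card: "1 < card \<V>" and inv: "\<And>k V. k \<in> K \<Longrightarrow> V \<in> \<V> \<Longrightarrow> act k V \<in> \<V>"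
    using sys by (auto simp: system_of_imprimitivity_def act_def)
  have fin: "finite \<V>" and sub: "\<And>V. V \<in> \<V> \<Longrightarrow> vec_subspace q V" and nz: "\<And>V. V \<in> \<V> \<Longrightarrow> V \<noteq> {0\<^sub>v q}"
    using D by (auto simp: direct_decomposition_def)
  have Vc: "V \<subseteq> carrier_vec q" if "V \<in> \<V>" for V using sub[OF that] by (simp add: vec_subspace_iff)
  have ex: "\<exists>v \<in> V. v \<noteq> 0\<^sub>v q" if "V \<in> \<V>" for V using sub[OF that] nz[OF that] by (auto simp: vec_subspace_iff)
  have KG: "k \<in> carrier (GL q)" "k \<in> carrier_mat q q" "det k \<noteq> 0" if "k \<in> K" for k
    using K.mem_carrier[OF that] by (auto simp: carrier_GL)
  have Kpow: "k ^\<^sub>m i \<in> K" if k: "k \<in> K" for k i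
  proof (induction i)
    case 0 then show ?case using K.one_closed KG(2)[OF k] by simp
  next
    case (Suc i) then show ?case using K.m_closed[OF Suc k] by simp
  qed
  have act_mult: "act (a * b) V = act a (act b V)" if "a \<in> K" "b \<in> K" "V \<in> \<V>" for a b V
    unfolding act_def image_image using assoc_mult_mat_vec[OF KG(2)[OF that(1)] KG(2)[OF that(2)]] Vc[OF that(3)] by (intro image_cong) auto
  have act_pow: "(act k ^^ i) V = act (k ^\<^sub>m i) V" if k: "k \<in> K" and V: "V \<in> \<V>" for k i V
  proof (induction i)
    case 0
    have "act (1\<^sub>m q) V = id ` V" unfolding act_def using Vc[OF V] by (intro image_cong) auto
    then show ?case using KG(2)[OF k] by simp
  next
    case (Suc i)
    have "act (k ^\<^sub>m Suc i) V = act k (act (k ^\<^sub>m i) V)" unfolding pow_mat_Suc_left[OF KG(2)[OF k]] by (rule act_mult[OF k Kpow[OF k] V])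
    then show ?case using Suc by simp
  qed
  have act_closed: "(act k ^^ i) V \<in> \<V>" if k: "k \<in> K" and V: "V \<in> \<V>" for k i V
    using inv[OF Kpow[OF k, of i] V] act_pow[OF k V, of i] by simp
  have act_torsion: "\<exists>m. \<forall>V \<in> \<V>. (act k ^^ (q ^ m)) V = V" if k: "k \<in> K" for k
  proof -
    obtain m c where c: "c \<noteq> 0" "k ^\<^sub>m (q ^ m) = c \<cdot>\<^sub>m 1\<^sub>m q" using tors[OF k] pow_in_Z_iff[OF KG(1)[OF k]] by blast
    have "(act k ^^ (q ^ m)) V = V" if V: "V \<in> \<V>" for V
    proof -
      have s: "(c \<cdot>\<^sub>m 1\<^sub>m q) *\<^sub>v v = c \<cdot>\<^sub>v v" if "v \<in> V" for v
        using smult_mat_mult_vec[OF one_carrier_mat, of v q c] Vc[OF V] that by auto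
      have "act (c \<cdot>\<^sub>m 1\<^sub>m q) V = V"
      proof (intro equalityI subsetI)
        fix v assume "v \<in> act (c \<cdot>\<^sub>m 1\<^sub>m q) V"
        then show "v \<in> V" using s sub[OF V] by (auto simp: act_def vec_subspace_iff)
      next
        fix v assume v: "v \<in> V"
        have 1: "inverse c \<cdot>\<^sub>v v \<in> V" using v sub[OF V] by (simp add: vec_subspace_iff)
        have "(c \<cdot>\<^sub>m 1\<^sub>m q) *\<^sub>v (inverse c \<cdot>\<^sub>v v) = v" unfolding s[OF 1] using c(1) by (simp add: smult_smult_assoc)
        then show "v \<in> act (c \<cdot>\<^sub>m 1\<^sub>m q) V" unfolding act_def using 1 by (metis imageI)
      qed
      then show ?thesis using act_pow[OF k V, of "q ^ m"] c(2) by simp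
    qed
    then show ?thesis by blast
  qed
  have act_inj: "V = V'" if k: "k \<in> K" and V: "V \<in> \<V>" "V' \<in> \<V>" and e: "act k V = act k V'" for k V V'
  proof -
    obtain m where m: "\<And>V. V \<in> \<V> \<Longrightarrow> (act k ^^ (q ^ m)) V = V" using act_torsion[OF k] by blast
    obtain N where N: "q ^ m = Suc N" using q_pos by (metis Suc_pred zero_less_power)
    have "(act k ^^ N) (act k V) = (act k ^^ N) (act k V')" using e by simp
    then have "(act k ^^ Suc N) V = (act k ^^ Suc N) V'" by (simp only: funpow_Suc_right comp_def)
    then show ?thesis using m V N by metis
  qed
  \<comment> \<open>If all members were invariant, irreducibility would make one of them the whole
    space, and a second nonzero member would be impossible.\<close>
  have "\<exists>k \<in> K. \<exists>V \<in> \<V>. act k V \<noteq> V"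
  proof (rule ccontr)
    assume "\<not> ?thesis"
    then have fix1: "\<And>k V. k \<in> K \<Longrightarrow> V \<in> \<V> \<Longrightarrow> act k V = V" by blast
    obtain V V' where V: "V \<in> \<V>" "V' \<in> \<V>" "V \<noteq> V'" using card by (metis card_le_Suc0_iff_eq[OF fin] One_nat_def not_le)
    have "\<forall>g \<in> K. \<forall>w \<in> V. g *\<^sub>v w \<in> V" using fix1[OF _ V(1)] unfolding act_def by blast
    then have Vfull: "V = carrier_vec q" using irr sub[OF V(1)] nz[OF V(1)] unfolding irreducible_lin_def by blast
    obtain x where x: "x \<in> V'" "x \<noteq> 0\<^sub>v q" using ex[OF V(2)] by blast
    have "x = 0\<^sub>v q"
      by (rule direct_decomposition_family(2)[OF D, of "\<lambda>_. V" 1 "\<lambda>_. x" V' x 0])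
        (use V x Vc[OF V(2)] Vfull in \<open>auto simp: inj_on_def\<close>)
    then show False using x by simp
  qed
  then obtain k V0 where k: "k \<in> K" and V0: "V0 \<in> \<V>" and kV: "act k V0 \<noteq> V0" by blast
  define e where "e i = (act k ^^ i) V0" for i
  have eV: "e i \<in> \<V>" for i unfolding e_def by (rule act_closed[OF k V0])
  have e0: "e 0 = V0" by (simp add: e_def)
  have eS: "e (Suc i) = act k (e i)" for i by (simp add: e_def)
  obtain mk where mk: "\<And>V. V \<in> \<V> \<Longrightarrow> (act k ^^ (q ^ mk)) V = V" using act_torsion[OF k] by blast
  have e_inj: "inj_on e {..<q}" using prime_power_orbit_inj[OF prime_q mk[OF V0] kV] unfolding e_def .
  obtain v where v: "v \<in> V0" "v \<noteq> 0\<^sub>v q" using ex[OF V0] by blast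
  have vc: "v \<in> carrier_vec q" using v Vc[OF V0] by blast
  have we: "k ^\<^sub>m i *\<^sub>v v \<in> e i" for i unfolding e_def act_pow[OF k V0] unfolding act_def using v by blast
  have wc: "k ^\<^sub>m i *\<^sub>v v \<in> carrier_vec q" for i using we Vc[OF eV] by blast
  have w0: "k ^\<^sub>m i *\<^sub>v v \<noteq> 0\<^sub>v q" for i by (rule GL_pow_mult_vec_neq_0[OF KG(2,3)[OF k] vc v(2)])
  have cwe: "c \<cdot>\<^sub>v (k ^\<^sub>m i *\<^sub>v v) \<in> e i" for c i using we sub[OF eV] by (simp add: vec_subspace_iff)
  let ?kr = "krylov q k v"
  have kr_sum: "(\<Sum>i<q. (u $ (q - Suc i) \<cdot>\<^sub>v (k ^\<^sub>m i *\<^sub>v v)) $ r) = (?kr *\<^sub>v u) $ r" if u: "u \<in> carrier_vec q" and r: "r < q" for u r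
  proof -
    have "(\<Sum>i<q. (u $ (q - Suc i) \<cdot>\<^sub>v (k ^\<^sub>m i *\<^sub>v v)) $ r) = (\<Sum>i<q. (u $ (q - Suc i) \<cdot>\<^sub>v col ?kr (q - Suc i)) $ r)"
      using krylov_col[OF KG(2)[OF k] vc] by (intro sum.cong) auto
    also have "\<dots> = (\<Sum>j<q. (u $ j \<cdot>\<^sub>v col ?kr j) $ r)" by (rule sum.nat_diff_reindex)
    also have "\<dots> = (?kr *\<^sub>v vec q (\<lambda>j. u $ j)) $ r" by (rule sum_smult_col_index[OF krylov_carrier r])
    also have "vec q (\<lambda>j. u $ j) = u" using u by auto
    finally show ?thesis .
  qed
  \<comment> \<open>The vectors \<open>k ^ i v\<close> lie in \<open>q\<close> distinct members of
    the decomposition, hence are independent.\<close>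
  have det: "det ?kr \<noteq> 0"
  proof
    assume "det ?kr = 0"
    then obtain u where u: "u \<in> carrier_vec q" "u \<noteq> 0\<^sub>v q" "?kr *\<^sub>v u = 0\<^sub>v q" using det_0_iff_vec_prod_zero[OF krylov_carrier] by blast
    have z: "0\<^sub>v q \<in> V0" using sub[OF V0] by (simp add: vec_subspace_iff)
    have s: "(\<Sum>i<q. (u $ (q - Suc i) \<cdot>\<^sub>v (k ^\<^sub>m i *\<^sub>v v)) $ r) = 0\<^sub>v q $ r" if "r < q" for r using kr_sum[OF u(1) that] u(3) by simp
    have "u $ (q - Suc i) \<cdot>\<^sub>v (k ^\<^sub>m i *\<^sub>v v) = 0 \<cdot>\<^sub>v (k ^\<^sub>m i *\<^sub>v v)" if "i < q" for i
      unfolding smult_zero_vec[OF wc]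
      using direct_decomposition_family(1,2)[OF D e_inj eV cwe V0 z s that] by (cases "e i = V0") auto
    then have "u $ (q - Suc i) = 0" if "i < q" for i using smult_vec_cancel[OF _ wc w0] that by blast
    moreover have "r < q \<Longrightarrow> \<exists>i<q. r = q - Suc i" for r by (rule exI[of _ "q - Suc r"]) auto
    ultimately have "u = 0\<^sub>v q" using u(1) by (intro eq_vecI) auto
    then show False using u(2) by simp
  qed
  have krG: "?kr \<in> carrier (GL q)" using det by (simp add: carrier_GL)
  \<comment> \<open>Expressed in the basis \<open>k ^ i v\<close>, a nonzero vector of
    \<open>V\<close> has components only in \<open>V\<close> itself; so \<open>V\<close> is on the
    orbit and every vector of it is a multiple of one basis vector.\<close>
  have span: "V \<in> e ` {..<q} \<and> (\<forall>i<q. e i = V \<longrightarrow> (\<exists>c. x = c \<cdot>\<^sub>v (k ^\<^sub>m i *\<^sub>v v)))" if V: "V \<in> \<V>" and x: "x \<in> V" "x \<noteq> 0\<^sub>v q" for V x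
  proof -
    have xc: "x \<in> carrier_vec q" using x Vc[OF V] by blast
    obtain g' where g': "g' \<in> carrier_mat q q" "?kr * g' = 1\<^sub>m q" using GL_inverse[OF krylov_carrier det] by blast
    define u where "u = g' *\<^sub>v x"
    have u: "u \<in> carrier_vec q" unfolding u_def by (rule mult_mat_vec_carrier[OF g'(1) xc])
    have ku: "?kr *\<^sub>v u = x" unfolding u_def using assoc_mult_mat_vec[OF krylov_carrier g'(1) xc, of k v] g'(2) xc by simp
    have s: "(\<Sum>i<q. (u $ (q - Suc i) \<cdot>\<^sub>v (k ^\<^sub>m i *\<^sub>v v)) $ r) = x $ r" if "r < q" for r using kr_sum[OF u that] ku by simp
    note f = direct_decomposition_family[OF D e_inj eV cwe V x(1) s]
    have "V \<in> e ` {..<q}" using f(3) x(2) by blast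
    moreover have "\<exists>c. x = c \<cdot>\<^sub>v (k ^\<^sub>m i *\<^sub>v v)" if "i < q" "e i = V" for i using f(1)[OF _ that] by metis
    ultimately show ?thesis by blast
  qed
  have Ve: "\<V> = e ` {..<q}" using span ex eV by blast
  have line: "\<exists>c. x = c \<cdot>\<^sub>v (k ^\<^sub>m i *\<^sub>v v)" if "i < q" "x \<in> e i" for x i
  proof (cases "x = 0\<^sub>v q")
    case True then show ?thesis using smult_zero_vec[OF wc, of i] by metis
  next
    case False then show ?thesis using span[OF eV that(2)] that(1) by blast
  qed
  have "e q \<in> \<V>" by (rule eV)
  then obtain i where i: "i < q" "e q = e i" unfolding Ve by auto
  \<comment> \<open>As \<open>k\<close> acts injectively on the members, the orbit closes up at its
    starting point.\<close>
  have "i = 0"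
  proof (cases i)
    case (Suc i')
    have "act k (e (q - 1)) = act k (e i')" using i(2) q_pos eS[of "q - 1"] eS[of i'] Suc by simp
    then have "e (q - 1) = e i'" by (rule act_inj[OF k eV eV])
    then have "q - 1 = i'" using e_inj i(1) Suc by (auto simp: inj_on_def)
    then show ?thesis using i(1) Suc by simp
  qed
  then have "k ^\<^sub>m q *\<^sub>v v \<in> e 0" using we[of q] i(2) by simp
  then obtain \<beta> where "k ^\<^sub>m q *\<^sub>v v = \<beta> \<cdot>\<^sub>v (k ^\<^sub>m 0 *\<^sub>v v)" using line[OF q_pos] by blast
  then have \<beta>: "k ^\<^sub>m q *\<^sub>v v = \<beta> \<cdot>\<^sub>v v" using KG(2)[OF k] vc by simp
  have \<beta>0: "\<beta> \<noteq> 0" using \<beta> w0[of q] smult_zero_vec[OF vc] by auto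
  have kI: "k * ?kr = ?kr * I_mat q \<beta>" by (rule krylov_I_mat[OF KG(2)[OF k] vc q_pos \<beta>])
  let ?g = "inv\<^bsub>GL q\<^esub> ?kr"
  have gG: "?g \<in> carrier (GL q)" by (rule W.inv_closed[OF krG])
  have cI: "W.conjg ?g k = I_mat q \<beta>" by (rule conjg_inv_eq[OF krG KG(1)[OF k] I_mat_GL[OF q_pos \<beta>0] kI])
  note wd = weyl_d_I[OF \<beta>0]
  interpret H: subgroup "H_grp q \<beta>" "GL q" unfolding H_grp_eq[OF \<beta>0] by (rule W.weyl_group_subgroup[OF wd])
  have DH: "D_set q \<subseteq> H_grp q \<beta>" and IH: "I_mat q \<beta> \<in> H_grp q \<beta>"
    unfolding D_set_eq H_grp_eq[OF \<beta>0] using W.weyl_group_incl[OF wd] by auto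
  have "W.conjg ?g y \<in> H_grp q \<beta>" if y: "y \<in> K" for y
  proof -
    have "act y V0 \<in> e ` {..<q}" using inv[OF y V0] Ve by simp
    then obtain i where i: "i < q" "act y V0 = e i" by auto
    have ki: "k ^\<^sub>m i \<in> K" by (rule Kpow[OF k])
    define t where "t = inv\<^bsub>GL q\<^esub> (k ^\<^sub>m i) \<otimes>\<^bsub>GL q\<^esub> y"
    have t: "t \<in> K" unfolding t_def by (rule K.m_closed[OF K.m_inv_closed[OF ki] y])
    have yt: "y = k ^\<^sub>m i \<otimes>\<^bsub>GL q\<^esub> t" unfolding t_def using W.inv_cancel_left(1)[OF KG(1)[OF ki] KG(1)[OF y]] by simp
    have "act (k ^\<^sub>m i) (act t V0) = act (k ^\<^sub>m i) V0"
      using act_mult[OF ki t V0] yt i(2) act_pow[OF k V0, of i] by (simp add: e_def)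
    then have tV0: "act t V0 = V0" by (rule act_inj[OF ki inv[OF t V0] V0])
    \<comment> \<open>A member moved by \<open>t\<close> would have an orbit of \<open>q\<close>
      members, that is, the whole system, which contains \<open>V0\<close>; but \<open>t\<close>
      fixes \<open>V0\<close>.\<close>
    have tV: "act t V = V" if V: "V \<in> \<V>" for V
    proof (rule ccontr)
      assume ne: "act t V \<noteq> V"
      obtain m where m: "(act t ^^ (q ^ m)) V = V" using act_torsion[OF t] V by blast
      have "inj_on (\<lambda>i. (act t ^^ i) V) {..<q}" by (rule prime_power_orbit_inj[OF prime_q m ne])
      then have "card ((\<lambda>i. (act t ^^ i) V) ` {..<q}) = q" by (simp add: card_image)
      moreover have "card \<V> = q" unfolding Ve using card_image[OF e_inj] by simp
      moreover have "(\<lambda>i. (act t ^^ i) V) ` {..<q} \<subseteq> \<V>" using act_closed[OF t V] by auto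
      ultimately have "(\<lambda>i. (act t ^^ i) V) ` {..<q} = \<V>" using card_subset_eq[OF fin] by metis
      then obtain i where i: "V0 = (act t ^^ i) V" using V0 by blast
      have "1 * i \<le> q ^ m * i" using q_pos by (intro mult_le_mono1) (simp add: Suc_leI)
      then have N: "q ^ m * i = (q ^ m * i - i) + i" by simp
      have "V = (act t ^^ (q ^ m * i - i)) ((act t ^^ i) V)"
        using funpow_fixed_mult[OF m, of i] N by (metis comp_apply funpow_add)
      also have "\<dots> = V0" unfolding i[symmetric] using funpow_fixed_mult[of 1 "act t" V0 "q ^ m * i - i"] tV0 by simp
      finally show False using ne tV0 by simp
    qed
    have "\<exists>c. t *\<^sub>v (k ^\<^sub>m j *\<^sub>v v) = c \<cdot>\<^sub>v (k ^\<^sub>m j *\<^sub>v v)" if "j < q" for j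
      using line[OF that, of "t *\<^sub>v (k ^\<^sub>m j *\<^sub>v v)"] tV[OF eV, of j] we[of j] unfolding act_def by blast
    then obtain f where f: "\<And>j. j < q \<Longrightarrow> t *\<^sub>v (k ^\<^sub>m j *\<^sub>v v) = f j \<cdot>\<^sub>v (k ^\<^sub>m j *\<^sub>v v)" by metis
    \<comment> \<open>The index is reversed because the columns of \<open>krylov\<close> carry
      decreasing powers of \<open>k\<close>.\<close>
    let ?F = "mat_diag q (\<lambda>j. f (q - 1 - j))"
    have tF: "t * ?kr = ?kr * ?F"
    proof (rule eq_matI)
      show "dim_row (t * ?kr) = dim_row (?kr * ?F)" "dim_col (t * ?kr) = dim_col (?kr * ?F)"
        using KG(2)[OF t] by (auto simp: krylov_def mat_diag_def)
      fix r j assume "r < dim_row (?kr * ?F)" "j < dim_col (?kr * ?F)"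
      then have rj: "r < q" "j < q" by (auto simp: krylov_def mat_diag_def)
      show "(t * ?kr) $$ (r, j) = (?kr * ?F) $$ (r, j)"
        unfolding mult_krylov_index[OF KG(2)[OF t] KG(2)[OF k] vc rj] mat_diag_mult_right[OF krylov_carrier]
        using f[of "q - 1 - j"] rj carrier_vecD[OF wc] by (simp add: krylov_def mult.commute del: index_mult_mat_vec dim_mult_mat_vec)
    qed
    have "det t * det ?kr = det ?kr * det ?F"
      using arg_cong[OF tF, of det] det_mult[OF KG(2)[OF t] krylov_carrier] det_mult[OF krylov_carrier mat_diag_dim] by simp
    then have "det ?F \<noteq> 0" using KG(3)[OF t] det by auto
    then have FG: "?F \<in> carrier (GL q)" by (simp add: carrier_GL)
    have cF: "W.conjg ?g t = ?F" by (rule conjg_inv_eq[OF krG KG(1)[OF t] FG tF])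
    obtain m where "t [^]\<^bsub>GL q\<^esub> (q ^ m) \<in> scalar_group q" using tors[OF t] by blast
    then have "W.conjg ?g (t [^]\<^bsub>GL q\<^esub> (q ^ m)) \<in> scalar_group q" using W.conjg_mem_Z_iff[OF gG W.nat_pow_closed[OF KG(1)[OF t]]] by blast
    then have "?F [^]\<^bsub>GL q\<^esub> (q ^ m) \<in> scalar_group q" unfolding W.conjg_pow[OF gG KG(1)[OF t]] cF .
    moreover have "?F * d_mat q \<xi> = d_mat q \<xi> * ?F" by (simp add: d_mat_def mult.commute)
    ultimately have "?F \<in> W.torsion_level m (d_mat q \<xi>)" using FG by (simp add: W.torsion_level_def W.cent_def)
    then have FD: "?F \<in> D_set q" unfolding D_set_eq W.torsion_cent_def by blast
    have "W.conjg ?g (k ^\<^sub>m i) = I_mat q \<beta> [^]\<^bsub>GL q\<^esub> i"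
      unfolding GL_pow[OF KG(1)[OF k], symmetric] W.conjg_pow[OF gG KG(1)[OF k]] cI ..
    then have "W.conjg ?g y = I_mat q \<beta> [^]\<^bsub>GL q\<^esub> i \<otimes>\<^bsub>GL q\<^esub> ?F"
      unfolding yt W.conjg_mult[OF gG KG(1)[OF ki] KG(1)[OF t]] cF by simp
    moreover have "I_mat q \<beta> [^]\<^bsub>GL q\<^esub> i \<in> H_grp q \<beta>" 
    proof (induction i)
      case 0 then show ?case using H.one_closed by simp
    next
      case (Suc i) then show ?case using H.m_closed[OF Suc IH] by simp
    qed
    ultimately show ?thesis using FD DH H.m_closed by auto
  qed
  moreover have "y = W.conjg ?kr (W.conjg ?g y)" if "y \<in> K" for y
    using W.conjg_by_inv[OF gG KG(1)[OF that]] krG by simp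
  ultimately have "K \<subseteq> W.conjg ?kr ` H_grp q \<beta>" by blast
  then show ?thesis using krG \<beta>0 by blast
qed

end

section \<open>Maximality and the exceptions\<close>

context weyl_context
begin

lemma conjg_image_by_inv: "g \<in> carrier G \<Longrightarrow> A \<subseteq> carrier G \<Longrightarrow> conjg (inv g) ` conjg g ` A = A"
proof -
  assume g: "g \<in> carrier G" and A: "A \<subseteq> carrier G"
  have "(\<lambda>y. conjg (inv g) (conjg g y)) ` A = (\<lambda>y. y) ` A"
    by (rule image_cong) (use conjg_by_inv[OF g] A in auto)
  then show ?thesis by (simp add: image_image)
qed

lemma weyl_group_carrier: "weyl w x h \<Longrightarrow> weyl_group x h \<subseteq> carrier G"
  using weyl_group_subgroup subgroup.subset by blast

lemma weyl_group_subset_conj_small: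
  assumes w: "weyl w x h" and w': "weyl w' x' h'" and sub: "weyl_group x h \<subseteq> weyl_group x' h'" and g: "g \<in> carrier G"
    and e: "conjg g ` weyl_group x' h' = weyl_group a b" and wa: "weyl u a b" and small: "small a"
  shows "weyl_group x' h' \<subseteq> weyl_group x h"
proof -
  have "conjg g ` weyl_group x h \<subseteq> conjg g ` weyl_group x' h'" using sub by (rule image_mono)
  then have "weyl_group (conjg g x) (conjg g h) \<subseteq> weyl_group a b" unfolding weyl_group_conjg[OF w g] e .
  then have "weyl_group a b \<subseteq> weyl_group (conjg g x) (conjg g h)" by (rule small_weyl_group_subset[OF weyl_conjg[OF w g] wa _ small])
  then have "conjg g ` weyl_group x' h' \<subseteq> conjg g ` weyl_group x h" unfolding weyl_group_conjg[OF w g] e .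
  then have "conjg (inv g) ` conjg g ` weyl_group x' h' \<subseteq> conjg (inv g) ` conjg g ` weyl_group x h" by (rule image_mono)
  then show ?thesis unfolding conjg_image_by_inv[OF g weyl_group_carrier[OF w]] conjg_image_by_inv[OF g weyl_group_carrier[OF w']] .
qed

lemma conjg_image_mult: "g \<in> carrier G \<Longrightarrow> g' \<in> carrier G \<Longrightarrow> A \<subseteq> carrier G \<Longrightarrow> conjg g' ` conjg g ` A = conjg (g' \<otimes> g) ` A"
  unfolding image_image by (rule image_cong) (use conjg_conjg in auto)

lemma weyl_mult_left: "weyl w x h \<Longrightarrow> weyl w x (x \<otimes> h)"
proof -
  assume w: "weyl w x h"
  note c = weyl_closed[OF w]
  have "semi (\<one> \<otimes> w) x (x \<otimes> h)"
    using w semi_cent[OF c(1)] weyl_x_cent[OF w] unfolding weyl_semi by (intro semi_mult) auto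
  then show ?thesis unfolding weyl_semi using c by simp
qed

lemma weyl_Z_mult: "weyl w x h \<Longrightarrow> c \<in> Z \<Longrightarrow> weyl w (c \<otimes> x) h"
  unfolding weyl_semi using semi_mult_Z_iff[of c x w h] by (auto simp: semi_def)

lemma weyl_not_Z: "weyl w x h \<Longrightarrow> h \<notin> Z"
proof
  assume w: "weyl w x h" and "h \<in> Z"
  then have "semi \<one> x h" using Z_subset_cent[of x] semi_cent[of x h] weyl_closed(1)[OF w] by blast
  then show False using w semi_unique unfolding weyl_semi by blast
qed

lemma semi_mult_left: "\<exists>z. semi z u k \<Longrightarrow> \<exists>z. semi z v k \<Longrightarrow> \<exists>z. semi z (u \<otimes> v) k"
  using semi_sym semi_mult by blast

lemma semi_pow_left: "\<exists>z. semi z u k \<Longrightarrow> \<exists>z. semi z (u [^] (n::nat)) k"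
  using semi_sym semi_pow by blast

text \<open>The group is abelian modulo scalars and torsion modulo scalars, so for any Weyl pair
  inside it \<open>subset_weyl_group\<close> applies to the whole group. Passing to a pair whose
  \<open>y\<close> is not small makes the group strictly larger; this is the source of the
  exceptions.\<close>

lemma small_weyl_group_subset_swap:
  assumes w: "weyl w x h" and small: "small x" and w': "weyl w' y a" and mem: "y \<in> weyl_group x h" "a \<in> weyl_group x h"
  shows "weyl_group x h \<subseteq> weyl_group y a"
proof (rule subset_weyl_group[OF w' weyl_group_subgroup[OF w] mem(2)])
  fix k assume k: "k \<in> weyl_group x h"
  have kG: "k \<in> carrier G" using k weyl_group_carrier[OF w] by blast
  obtain u i where u: "u \<in> torsion_cent x" "y = u \<otimes> h [^] (i::nat)" using mem(1) by (auto simp: weyl_group_def ext_def)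
  obtain z j where z: "z \<in> Z" "u = z \<otimes> x [^] (j::nat)" using small u by (auto simp: small_def)
  note sk = small_weyl_group_semi[OF w small k]
  have "semi \<one> z k" using z(1) kG Z_central[OF z(1) kG] by (auto simp: semi_def)
  then show "\<exists>z. semi z y k" unfolding u(2) z(2) using semi_mult_left[OF semi_mult_left[OF _ semi_pow_left[OF sk(2)]] semi_pow_left[OF sk(1)]] by blast
  obtain m where "k [^] (q ^ m) \<in> Z" using weyl_group_torsion[OF w k] by blast
  then show "k \<in> torsion_cent y" if "k \<in> cent y" using that by (auto simp: torsion_cent_def torsion_level_def)
qed

end

lemma Fx_powers_iff: "k > 0 \<Longrightarrow> x \<in> Fx_powers k \<longleftrightarrow> x \<noteq> 0 \<and> is_power k x"
  by (auto simp: Fx_powers_def is_power_def simp del: carrier_mult_of)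

lemma uminus_Fx_powers_iff: "k > 0 \<Longrightarrow> x \<in> uminus ` Fx_powers k \<longleftrightarrow> x \<noteq> 0 \<and> is_power k (- x)"
proof -
  assume "k > 0"
  then have "- x \<in> Fx_powers k \<longleftrightarrow> x \<noteq> 0 \<and> is_power k (- x)" by (simp add: Fx_powers_iff)
  moreover have "x \<in> uminus ` Fx_powers k \<longleftrightarrow> - x \<in> Fx_powers k" by (metis imageE imageI minus_minus)
  ultimately show ?thesis by simp
qed

context prime_root
begin

lemma is_power_0: "is_power q (0 :: 'a)"
  using zero_power[OF q_pos, where 'a = 'a] by (auto simp: is_power_def)

lemma det_conjg: "g \<in> carrier (GL q) \<Longrightarrow> y \<in> carrier (GL q) \<Longrightarrow> det (W.conjg g y) = det y"
proof -
  assume g: "g \<in> carrier (GL q)" and y: "y \<in> carrier (GL q)"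
  have c: "g \<in> carrier_mat q q" "y \<in> carrier_mat q q" "W.conjg g y \<in> carrier_mat q q" "det g \<noteq> 0"
    using g y W.conjg_closed[OF g y] by (auto simp: carrier_GL)
  have "det g * det y = det (W.conjg g y) * det g"
    using arg_cong[OF W.conjg_swap[OF g y], of det] det_mult[OF c(1,2)] det_mult[OF c(3,1)] by simp
  then show ?thesis using c(4) by simp
qed

lemma scalar_root_pow: "(\<xi> \<cdot>\<^sub>m 1\<^sub>m q) [^]\<^bsub>GL q\<^esub> q = \<one>\<^bsub>GL q\<^esub>"
  using weyl_d_I[of 1] W.semi_torsion unfolding W.weyl_semi by auto

lemma weyl_group_absolutely_irreducible:
  assumes w: "W.weyl w x h"
  shows "absolutely_irreducible q (W.weyl_group x h)"
proof -
  obtain h' where h': "W.weyl (\<xi> \<cdot>\<^sub>m 1\<^sub>m q) x h'" "W.weyl_group x h' = W.weyl_group x h"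
    using weyl_normalize[OF w scalar_root_mem(1) scalar_root_pow] scalar_root_mem(2) by auto
  have c: "x \<in> carrier_mat q q" "det x \<noteq> 0" "h' \<in> carrier_mat q q" "det h' \<noteq> 0" using W.weyl_closed[OF h'(1)] by (auto simp: carrier_GL)
  have xh: "x * h' \<in> carrier_mat q q" using c by auto
  have "h' * x = \<xi> \<cdot>\<^sub>m (x * h')" using h'(1) scalar_mat_mult(1)[OF xh, of \<xi>] by (simp add: W.weyl_def)
  moreover obtain \<alpha> where "x ^\<^sub>m q = \<alpha> \<cdot>\<^sub>m 1\<^sub>m q" using weyl_pow_scalar[OF w] by blast
  ultimately show ?thesis
    unfolding h'(2)[symmetric] using absolutely_irreducible_weyl[OF W.weyl_group_x[OF h'(1)] c(1,2) W.weyl_group_incl(2)[OF h'(1)] c(3,4)] by blast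
qed

text \<open>Already \<open>x\<close> alone acts irreducibly, as every nonzero vector is cyclic for
  it. This is irreducibility over the ground field, the notion in
  \<open>primitive_lin\<close>.\<close>

lemma weyl_group_irreducible:
  assumes w: "W.weyl w x h" and xq: "x ^\<^sub>m q = \<alpha> \<cdot>\<^sub>m 1\<^sub>m q" and \<alpha>: "\<not> is_power q \<alpha>"
  shows "irreducible_lin q (W.weyl_group x h)"
  unfolding irreducible_lin_def
proof (intro conjI allI impI q_pos)
  fix V :: "'a vec set"
  assume V: "vec_subspace q V \<and> (\<forall>g \<in> W.weyl_group x h. \<forall>v \<in> V. g *\<^sub>v v \<in> V)"
  have xc: "x \<in> carrier_mat q q" using W.weyl_closed(1)[OF w] by (simp add: carrier_GL)
  show "V = {0\<^sub>v q} \<or> V = carrier_vec q"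
  proof (rule disjCI)
    assume "V \<noteq> carrier_vec q"
    moreover have "V = carrier_vec q" if v: "v \<in> V" "v \<noteq> 0\<^sub>v q" for v
    proof (rule vec_subspace_krylov[OF _ xc _ v(1)])
      show "vec_subspace q V" using V by blast
      show "\<And>v. v \<in> V \<Longrightarrow> x *\<^sub>v v \<in> V" using V W.weyl_group_x[OF w] by blast
      have "v \<in> carrier_vec q" using V v by (auto simp: vec_subspace_iff)
      then show "det (krylov q x v) \<noteq> 0" using kummer_cyclic[OF xc xq \<alpha> _ v(2)] by blast
    qed
    ultimately show "V = {0\<^sub>v q}" using V by (auto simp: vec_subspace_iff)
  qed
qed

lemma weyl_group_imprimitive:
  assumes w: "W.weyl w x h" and xq: "x ^\<^sub>m q = \<alpha> \<cdot>\<^sub>m 1\<^sub>m q" and \<alpha>: "\<not> is_power q \<alpha>"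
    and imp: "\<not> primitive_lin q (W.weyl_group x h)"
  shows "\<exists>g \<in> carrier (GL q). \<exists>\<beta>. \<beta> \<noteq> 0 \<and> W.weyl_group x h \<subseteq> W.conjg g ` H_grp q \<beta>"
proof -
  note irr = weyl_group_irreducible[OF w xq \<alpha>]
  then obtain \<V> where "system_of_imprimitivity q (W.weyl_group x h) \<V>" using imp by (auto simp: primitive_lin_def)
  then show ?thesis
    using imprimitive_torsion_subset_H_grp[OF W.weyl_group_subgroup[OF w] W.weyl_group_torsion[OF w] irr] by blast
qed

lemma quadratic_root: "q = 2 \<Longrightarrow> \<xi> = - 1"
  using prod_root_pow by (simp add: numeral_2_eq_2)

lemma det_d_mat: "q = 2 \<Longrightarrow> det (d_mat q \<xi>) = - 1"
  using quadratic_root by (simp add: d_mat_def det_mat_diag numeral_2_eq_2)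

lemma quadratic_weyl_root: "q = 2 \<Longrightarrow> W.weyl w x h \<Longrightarrow> w = (- 1) \<cdot>\<^sub>m 1\<^sub>m q"
proof -
  assume q2: "q = 2" and w: "W.weyl w x h"
  obtain c where c: "c \<noteq> 0" "w = c \<cdot>\<^sub>m 1\<^sub>m q" using W.weyl_closed(3)[OF w] by (auto simp: scalar_group_iff)
  have "w [^]\<^bsub>GL q\<^esub> q = \<one>\<^bsub>GL q\<^esub>" using w W.semi_torsion unfolding W.weyl_semi by blast
  then have "c ^ q \<cdot>\<^sub>m 1\<^sub>m q = (1\<^sub>m q :: 'a mat)" 
    using GL_pow[OF scalar_group_carrier[OF W.weyl_closed(3)[OF w]], of q] unfolding c(2) by (simp add: scalar_mat_pow)
  then have "c ^ 2 = 1" using scalar_mat_eq_one_iff[OF q_pos] q2 by metis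
  moreover have "c \<noteq> 1" using W.weyl_closed(4)[OF w] c(2) by auto
  ultimately have "(c - 1) * (c + 1) = 0" "c \<noteq> 1" by (auto simp: algebra_simps power2_eq_square)
  then have "c = - 1" by (auto simp: eq_neg_iff_add_eq_0)
  then show ?thesis using c(2) by simp
qed

text \<open>Both normal forms of \<open>x\<close> have this determinant:
  \<open>I_mat q \<gamma>\<close>, and \<open>e\<close> times \<open>d_mat\<close> with
  \<open>e ^ 2 = \<gamma>\<close>.\<close>

lemma quadratic_weyl_det:
  assumes q2: "q = 2" and w: "W.weyl w x h" and xq: "x ^\<^sub>m q = \<gamma> \<cdot>\<^sub>m 1\<^sub>m q"
  shows "det x = - \<gamma>"
proof (cases "is_power q \<gamma>")
  case False
  have \<gamma>0: "\<gamma> \<noteq> 0" using False is_power_0 by auto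
  obtain g where "g \<in> carrier (GL q)" "W.conjg g x = I_mat q \<gamma>" using conjg_I_mat[OF W.weyl_closed(1)[OF w] xq False] by blast
  then show ?thesis using det_conjg[of g x] W.weyl_closed(1)[OF w] det_I_mat[OF \<gamma>0] q2 by simp
next
  case True
  then obtain a where a: "\<gamma> = a ^ q" by (auto simp: is_power_def)
  have xG: "x \<in> carrier (GL q)" and xc: "x \<in> carrier_mat q q" "det x \<noteq> 0" using W.weyl_closed(1)[OF w] by (auto simp: carrier_GL)
  have a0: "a \<noteq> 0"
  proof
    assume "a = 0"
    then have "x ^\<^sub>m q = 0 \<cdot>\<^sub>m 1\<^sub>m q" using xq a zero_power[OF q_pos, where 'a = 'a] by simp
    then have "det x ^ q = 0" using det_pow_mat[OF xc(1), of q] q_pos zero_power[OF q_pos, where 'a = 'a] by simp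
    then show False using xc by simp
  qed
  obtain g z where g: "g \<in> carrier (GL q)" "z \<in> scalar_group q" "W.conjg g x = z \<otimes>\<^bsub>GL q\<^esub> d_mat q \<xi>"
    using weyl_type_power[OF w xq[unfolded a] a0] by blast
  obtain e where e: "z = e \<cdot>\<^sub>m 1\<^sub>m q" using g(2) by (auto simp: scalar_group_iff)
  have dG: "d_mat q \<xi> \<in> carrier (GL q)" by (rule d_mat_GL[OF root_neq_0])
  have dm: "d_mat q \<xi> \<in> carrier_mat q q" using dG by (simp add: carrier_GL)
  have cx: "W.conjg g x = mat_diag q (\<lambda>i. e * \<xi> ^ i)" using g(3) scalar_mat_mult(1)[OF dm, of e] e by (simp add: d_mat_def smult_mat_diag)
  have "det x = e ^ q * det (d_mat q \<xi>)" using det_conjg[OF g(1) xG] cx q2 by (simp add: det_mat_diag d_mat_def numeral_2_eq_2 mult.assoc)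
  then have dx: "det x = - (e ^ q)" using det_d_mat[OF q2] by simp
  have "W.conjg g (x [^]\<^bsub>GL q\<^esub> q) = x [^]\<^bsub>GL q\<^esub> q" using g(1) W.weyl_pow_Z[OF W.weyl_sym[OF w], of q] by (simp del: GL_simps)
  then have "mat_diag q (\<lambda>i. (e * \<xi> ^ i) ^ q) = \<gamma> \<cdot>\<^sub>m 1\<^sub>m q"
    using W.conjg_pow[OF g(1) xG, of q] GL_pow[OF xG, of q] GL_pow[OF W.conjg_closed[OF g(1) xG], of q] xq unfolding cx mat_diag_pow by simp
  from arg_cong[OF this, of "\<lambda>B. B $$ (0, 0)"] have "e ^ q = \<gamma>" using q_pos by (simp add: mat_diag_index)
  then show ?thesis using dx by simp
qed

text \<open>By \<open>I_mat_root_step\<close> the element \<open>y\<close> is conjugate to a scalar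
  times a power of \<open>I_mat\<close>, so its determinant is a square times a power of
  \<open>- \<alpha>\<close>, itself a square here.\<close>

lemma star_det_square:
  assumes w: "W.weyl w x h" and xq: "x ^\<^sub>m q = \<alpha> \<cdot>\<^sub>m 1\<^sub>m q" and \<alpha>: "\<not> is_power q \<alpha>" and star: "q = 2" "is_power q (- \<alpha>)"
    and y: "y \<in> W.cent x" "y [^]\<^bsub>GL q\<^esub> q \<in> scalar_group q"
  shows "is_power q (det y)"
proof -
  have \<alpha>0: "\<alpha> \<noteq> 0" using \<alpha> is_power_0 by auto
  obtain g where g: "g \<in> carrier (GL q)" "W.conjg g x = I_mat q \<alpha>" using conjg_I_mat[OF W.weyl_closed(1)[OF w] xq \<alpha>] by blast
  have wI: "W.weyl w (I_mat q \<alpha>) (W.conjg g h)" using W.weyl_conjg[OF w g(1)] g(2) by simp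
  have yG: "y \<in> carrier (GL q)" using y(1) W.cent_closed by blast
  have y1: "W.conjg g y \<in> W.cent (I_mat q \<alpha>)" using W.cent_conjg[OF w g(1) yG] g(2) y(1) by simp
  have y2: "W.conjg g y [^]\<^bsub>GL q\<^esub> q \<in> scalar_group q"
    using W.conjg_pow[OF g(1) yG, of q] W.conjg_mem_Z_iff[OF g(1) W.nat_pow_closed[OF yG, of q]] y(2) by simp
  obtain c a where c: "c \<in> scalar_group q" "W.conjg g y = c \<otimes>\<^bsub>GL q\<^esub> I_mat q \<alpha> [^]\<^bsub>GL q\<^esub> (a::nat)"
    using I_mat_root_step[OF \<alpha> wI y1 y2] by blast
  obtain e where e: "c = e \<cdot>\<^sub>m 1\<^sub>m q" using c(1) by (auto simp: scalar_group_iff)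
  have I: "I_mat q \<alpha> \<in> carrier_mat q q" by (rule I_mat_carrier[OF q_pos])
  have Ia: "I_mat q \<alpha> ^\<^sub>m a \<in> carrier_mat q q" using I by simp
  have "W.conjg g y = e \<cdot>\<^sub>m I_mat q \<alpha> ^\<^sub>m a"
    using c(2) GL_pow[OF I_mat_GL[OF q_pos \<alpha>0], of a] e scalar_mat_mult(1)[OF Ia, of e] by simp
  then have "det y = e ^ q * det (I_mat q \<alpha>) ^ a"
    using det_conjg[OF g(1) yG] det_smult[of e "I_mat q \<alpha> ^\<^sub>m a"] det_pow_mat[OF I, of a] carrier_matD(2)[OF Ia] by (simp del: pow_mat_dim)
  also have "det (I_mat q \<alpha>) = - \<alpha>" using det_I_mat[OF \<alpha>0] star(1) by simp
  finally have d: "det y = e ^ q * (- \<alpha>) ^ a" .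
  obtain s where s: "s ^ q = - \<alpha>" using star(2) by (auto simp: is_power_def)
  have "(e * s ^ a) ^ q = e ^ q * (s ^ q) ^ a" by (simp add: power_mult_distrib mult.commute flip: power_mult)
  then show ?thesis unfolding d s is_power_def by blast
qed

text \<open>The only nontrivial commutation scalar is \<open>-1\<close>, so the product of two
  elements that do not centralize \<open>x'\<close> does. Hence \<open>h\<close> or
  \<open>x h\<close> centralizes \<open>x'\<close>; its square is scalar, and
  \<open>star_det_square\<close> gives the determinant.\<close>

lemma weyl_star_subset:
  assumes q2: "q = 2" and w: "W.weyl w x h" and w': "W.weyl w' x' h'" and sub: "W.weyl_group x h \<subseteq> W.weyl_group x' h'"
    and xq: "x' ^\<^sub>m q = \<alpha> \<cdot>\<^sub>m 1\<^sub>m q" and \<alpha>: "\<not> is_power q \<alpha>" "is_power q (- \<alpha>)" and x: "x \<notin> W.cent x'"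
  shows "is_power q (det h) \<or> is_power q (det x * det h)"
proof -
  let ?m = "(- 1) \<cdot>\<^sub>m 1\<^sub>m q :: 'a mat"
  note c = W.weyl_closed[OF w] note c' = W.weyl_closed[OF w']
  have semi: "g \<in> W.cent x' \<or> W.weyl ?m x' g" if g: "g \<in> W.weyl_group x h" for g
  proof (cases "g \<in> W.cent x'")
    case False
    then obtain u where "W.weyl u x' g" using W.weyl_group_noncent[OF w'] g sub by blast
    then show ?thesis using quadratic_weyl_root[OF q2] by blast
  qed blast
  have xm: "W.weyl ?m x' x" using semi[OF W.weyl_group_x[OF w]] x by blast
  show ?thesis
  proof (cases "h \<in> W.cent x'")
    case True
    show ?thesis using star_det_square[OF w' xq \<alpha>(1) q2 \<alpha>(2) True W.weyl_pow_Z[OF w dvd_refl]] by (rule disjI1)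
  next
    case False
    then have "W.weyl ?m x' h" using semi[OF W.weyl_group_incl(2)[OF w]] by blast
    then have "W.semi (?m \<otimes>\<^bsub>GL q\<^esub> ?m) x' (x \<otimes>\<^bsub>GL q\<^esub> h)" using xm unfolding W.weyl_semi by (intro W.semi_mult) auto
    moreover have "?m \<otimes>\<^bsub>GL q\<^esub> ?m = \<one>\<^bsub>GL q\<^esub>"
    proof -
      have "W.semi ?m x' x" using xm unfolding W.weyl_semi by blast
      from W.semi_torsion[OF this] have "?m [^]\<^bsub>GL q\<^esub> (2::nat) = \<one>\<^bsub>GL q\<^esub>" unfolding q2 .
      then show ?thesis using W.l_one[OF scalar_group_carrier[OF W.weyl_closed(3)[OF xm]]] by (simp add: numeral_2_eq_2 del: GL_simps)
    qed
    ultimately have xh: "x \<otimes>\<^bsub>GL q\<^esub> h \<in> W.cent x'" using W.semi_cent[OF c'(1)] by simp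
    note wxh = W.weyl_mult_left[OF w]
    have "is_power q (det (x \<otimes>\<^bsub>GL q\<^esub> h))" by (rule star_det_square[OF w' xq \<alpha>(1) q2 \<alpha>(2) xh W.weyl_pow_Z[OF wxh dvd_refl]])
    moreover have "det (x * h) = det x * det h" using c(1,2) by (intro det_mult[of _ q]) (auto simp: carrier_GL)
    ultimately show ?thesis by simp
  qed
qed

text \<open>The outer group is conjugate to some \<open>H_grp q \<beta>\<close>, and
  \<open>d_mat\<close> is small by \<open>small_d_mat\<close>; such a group contains no proper Weyl
  subgroup.\<close>

lemma weyl_subset_power:
  assumes q2: "q = 2" "\<not> is_power 2 (- 1 :: 'a)"
    and w: "W.weyl w x h" and w': "W.weyl w' x' h'" and sub: "W.weyl_group x h \<subseteq> W.weyl_group x' h'"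
    and xq: "x' ^\<^sub>m q = a ^ q \<cdot>\<^sub>m 1\<^sub>m q" and a: "a \<noteq> 0"
  shows "W.weyl_group x' h' \<subseteq> W.weyl_group x h"
proof -
  obtain g \<beta> where g: "g \<in> carrier (GL q)" "\<beta> \<noteq> 0" "W.conjg g ` W.weyl_group x' h' = H_grp q \<beta>" using weyl_type_power[OF w' xq a] by blast
  show ?thesis using W.weyl_group_subset_conj_small[OF w w' sub g(1) g(3)[unfolded H_grp_eq[OF g(2)]] weyl_d_I[OF g(2)] small_d_mat[OF q2]] .
qed

lemma weyl_subset_nonstar:
  assumes w: "W.weyl w x h" and w': "W.weyl w' x' h'" and sub: "W.weyl_group x h \<subseteq> W.weyl_group x' h'"
    and xq: "x' ^\<^sub>m q = \<alpha> \<cdot>\<^sub>m 1\<^sub>m q" and \<alpha>: "\<not> is_power q \<alpha>" "\<not> (q = 2 \<and> is_power q (- \<alpha>))"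
  shows "W.weyl_group x' h' \<subseteq> W.weyl_group x h"
proof -
  have \<alpha>0: "\<alpha> \<noteq> 0" using \<alpha> is_power_0 by auto
  obtain g b where g: "g \<in> carrier (GL q)" "b \<in> W.cent (I_mat q \<alpha>)" "W.conjg g ` W.weyl_group x' h' = G_grp q \<xi> \<alpha> b"
    using weyl_type_nonpower[OF w' xq \<alpha>(1)] by blast
  obtain u where u: "W.weyl u (I_mat q \<alpha>) (d_mat q \<xi> * b)" using weyl_I_db[OF \<alpha>0 g(2)] by blast
  show ?thesis using W.weyl_group_subset_conj_small[OF w w' sub g(1) g(3)[unfolded G_grp_eq[OF \<alpha>0 g(2)]] u small_I_mat[OF \<alpha> u]] .
qed

end

section \<open>Maximality of the individual groups\<close>

context prime_root
begin

lemma S_set_quadratic: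
  fixes \<beta> :: 'a
  assumes q2: "q = 2" and \<beta>: "\<beta> \<noteq> 0" and p: "is_power q \<beta> \<or> is_power q (- \<beta>)"
  shows "\<beta> \<in> S_set q"
proof -
  have "(1::'a) ^ (q ^ 1) = 1" "(- 1 :: 'a) ^ (q ^ 1) = 1" using q2 by simp_all
  then have s: "(1::'a) \<in> Syl q Fx" "(- 1 :: 'a) \<in> Syl q Fx"
    unfolding Syl_Fx_iff[OF prime_q] using one_neq_zero[where 'a = 'a] neg_equal_0_iff_equal[of "1::'a"] by blast+
  have "\<beta> \<in> Fx_powers q \<or> - \<beta> \<in> Fx_powers q" using p \<beta> by (simp add: Fx_powers_iff[OF q_pos])
  moreover have "\<beta> = 1 * \<beta>" "\<beta> = (- 1) * (- \<beta>)" by simp_all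
  ultimately show ?thesis unfolding S_set_def using s by blast
qed

lemma is_power_obtain:
  assumes "is_power q \<alpha>" "\<alpha> \<noteq> (0 :: 'a)"
  obtains a where "\<alpha> = a ^ q" "a \<noteq> 0"
  using assms zero_power[OF q_pos, where 'a = 'a] unfolding is_power_def by metis

lemma det_d_mult: "q = 2 \<Longrightarrow> b \<in> carrier_mat q q \<Longrightarrow> det (d_mat q \<xi> * b) = - det b"
  using det_mult[of "d_mat q \<xi>" q b] det_d_mat by (simp add: d_mat_def)

text \<open>A proper enlargement requires \<open>d_mat\<close> to be small, so \<open>q = 2\<close>
  and \<open>-1\<close> is not a square. Then only an outer group with \<alpha> nonsquare and
  \<open>- \<alpha>\<close> square remains possible.\<close>

lemma maximal_H_grp:
  fixes \<beta> :: 'a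
  assumes \<beta>: "\<beta> \<noteq> 0" and S: "q = 2 \<Longrightarrow> \<not> is_power 2 (- 1 :: 'a) \<Longrightarrow> \<beta> \<notin> S_set q"
  shows "maximal_locally_nilpotent (H_grp q \<beta>) (GL q)"
  unfolding H_grp_eq[OF \<beta>] W.maximal_weyl_group_iff[OF weyl_d_I[OF \<beta>]]
proof (intro allI impI)
  fix w' x' h'
  assume w': "W.weyl w' x' h'" and sub: "W.weyl_group (d_mat q \<xi>) (I_mat q \<beta>) \<subseteq> W.weyl_group x' h'"
  from W.weyl_group_subset_cases[OF weyl_d_I[OF \<beta>] w' sub] show "W.weyl_group x' h' \<subseteq> W.weyl_group (d_mat q \<xi>) (I_mat q \<beta>)"
  proof
    assume d: "d_mat q \<xi> \<notin> W.cent x' \<and> W.small (d_mat q \<xi>)"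
    then have q2: "q = 2" and n: "\<not> is_power 2 (- 1 :: 'a)" using small_d_mat_imp by blast+
    obtain \<alpha> where \<alpha>: "\<alpha> \<noteq> 0" "x' ^\<^sub>m q = \<alpha> \<cdot>\<^sub>m 1\<^sub>m q" using weyl_pow_scalar[OF w'] by blast
    show ?thesis
    proof (cases "is_power q \<alpha>")
      case True
      then obtain a where a: "\<alpha> = a ^ q" "a \<noteq> 0" using is_power_obtain \<alpha>(1) by blast
      show ?thesis by (rule weyl_subset_power[OF q2 n weyl_d_I[OF \<beta>] w' sub \<alpha>(2)[unfolded a(1)] a(2)])
    next
      case False
      show ?thesis
      proof (cases "is_power q (- \<alpha>)")
        case True
        \<comment> \<open>The determinants of \<open>d_mat\<close> and \<open>I_mat\<close> are
          \<open>-1\<close> and \<open>- \<beta>\<close>, with product \<beta>. Either alternative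
          puts \<beta> into \<open>S_set\<close>, because \<open>-1\<close> has 2-power
          order.\<close>
        have "is_power q (- \<beta>) \<or> is_power q \<beta>"
          using weyl_star_subset[OF q2 weyl_d_I[OF \<beta>] w' sub \<alpha>(2) False True] d det_d_mat[OF q2] det_I_mat[OF \<beta>] q2 by simp
        then show ?thesis using S_set_quadratic[OF q2 \<beta>] S[OF q2 n] by blast
      next
        case nonstar: False
        show ?thesis by (rule weyl_subset_nonstar[OF weyl_d_I[OF \<beta>] w' sub \<alpha>(2) False]) (use nonstar in simp)
      qed
    qed
  qed simp
qed

text \<open>An outer group with diagonalizable \<open>x'\<close> contradicts primitivity, and one
  with small \<open>x'\<close> admits no proper Weyl subgroup. The remaining outer groups are
  excluded by the determinant condition.\<close>

lemma maximal_G_grp: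
  assumes \<alpha>: "\<not> is_power q \<alpha>" "\<not> (q = 2 \<and> is_power q (- \<alpha>))" and b: "b \<in> W.cent (I_mat q \<alpha>)"
    and prim: "primitive_lin q (G_grp q \<xi> \<alpha> b)"
    and ex: "q = 2 \<Longrightarrow> \<not> is_power 2 (- 1 :: 'a) \<Longrightarrow> \<not> is_power q (- det b) \<and> \<not> is_power q (\<alpha> * det b)"
  shows "maximal_locally_nilpotent (G_grp q \<xi> \<alpha> b) (GL q)"
proof -
  have \<alpha>0: "\<alpha> \<noteq> 0" using \<alpha> is_power_0 by auto
  obtain u where u: "W.weyl u (I_mat q \<alpha>) (d_mat q \<xi> * b)" using weyl_I_db[OF \<alpha>0 b] by blast
  have bm: "b \<in> carrier_mat q q" using W.cent_closed[OF b] by (simp add: carrier_GL)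
  show ?thesis
    unfolding G_grp_eq[OF \<alpha>0 b] W.maximal_weyl_group_iff[OF u]
  proof (intro allI impI)
    fix w' x' h'
    assume w': "W.weyl w' x' h'" and sub: "W.weyl_group (I_mat q \<alpha>) (d_mat q \<xi> * b) \<subseteq> W.weyl_group x' h'"
    from W.weyl_group_subset_cases[OF u w' sub] show "W.weyl_group x' h' \<subseteq> W.weyl_group (I_mat q \<alpha>) (d_mat q \<xi> * b)"
    proof
      assume d: "I_mat q \<alpha> \<notin> W.cent x' \<and> W.small (I_mat q \<alpha>)"
      obtain \<gamma> where \<gamma>: "\<gamma> \<noteq> 0" "x' ^\<^sub>m q = \<gamma> \<cdot>\<^sub>m 1\<^sub>m q" using weyl_pow_scalar[OF w'] by blast
      show ?thesis
      proof (cases "is_power q \<gamma>")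
        case True
        then obtain a where a: "\<gamma> = a ^ q" "a \<noteq> 0" using is_power_obtain \<gamma>(1) by blast
        obtain g \<beta> where g: "g \<in> carrier (GL q)" "\<beta> \<noteq> 0" "W.conjg g ` W.weyl_group x' h' = H_grp q \<beta>"
          using weyl_type_power[OF w' \<gamma>(2)[unfolded a(1)] a(2)] by blast
        have "W.weyl_group x' h' = W.conjg (inv\<^bsub>GL q\<^esub> g) ` H_grp q \<beta>"
          unfolding g(3)[symmetric] W.conjg_image_by_inv[OF g(1) W.weyl_group_carrier[OF w']] ..
        then have "G_grp q \<xi> \<alpha> b \<subseteq> W.conjg (inv\<^bsub>GL q\<^esub> g) ` H_grp q \<beta>" using sub unfolding G_grp_eq[OF \<alpha>0 b] by blast
        then have "\<not> primitive_lin q (G_grp q \<xi> \<alpha> b)" by (rule imprimitive_subset_H_grp[OF g(2) W.inv_closed[OF g(1)]])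
        then show ?thesis using prim by blast
      next
        case False
        show ?thesis
        proof (cases "q = 2 \<and> is_power q (- \<gamma>)")
          case True
          then have q2: "q = 2" and p: "is_power q (- \<gamma>)" by auto
          \<comment> \<open>Here \<open>- \<gamma>\<close> is a square while \<gamma> is
            not.\<close>
          have n: "\<not> is_power 2 (- 1 :: 'a)"
          proof
            assume "is_power 2 (- 1 :: 'a)"
            then obtain s t where st: "s ^ q = (- 1 :: 'a)" "t ^ q = - \<gamma>" using p q2 by (auto simp: is_power_def)
            then have "(s * t) ^ q = \<gamma>" by (simp add: power_mult_distrib)
            then show False using False by (auto simp: is_power_def)
          qed
          \<comment> \<open>The determinants are \<open>- \<alpha>\<close> for
            \<open>I_mat q \<alpha>\<close> and \<open>- det b\<close> for
            \<open>d_mat q \<xi> * b\<close>; this is where the two conditions on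
            \<open>det b\<close> in the exceptions come from.\<close>
          have "is_power q (- det b) \<or> is_power q (\<alpha> * det b)"
            using weyl_star_subset[OF q2 u w' sub \<gamma>(2) False p] d det_d_mult[OF q2 bm] det_I_mat[OF \<alpha>0] q2 by simp
          then show ?thesis using ex[OF q2 n] by blast
        next
          case nonstar: False
          show ?thesis by (rule weyl_subset_nonstar[OF u w' sub \<gamma>(2) False nonstar])
        qed
      qed
    qed simp
  qed
qed

lemma G_minus_one_pow_notin:
  assumes "q = 2" and b: "b \<in> W.cent (I_mat q (- 1))"
  shows "\<exists>y \<in> G_grp q \<xi> (- 1) b. y [^]\<^bsub>GL q\<^esub> q \<notin> scalar_group q"
proof -
  have m: "(- 1 :: 'a) \<noteq> 0" by simp
  obtain u where u: "W.weyl u (I_mat q (- 1)) (d_mat q \<xi> * b)" using weyl_I_db[OF m b] by blast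
  show ?thesis
    unfolding G_grp_eq[OF m b] using not_small_star[OF assms(1) refl] W.weyl_group_incl(1)[OF u] by blast
qed

text \<open>A proper enlargement would need \<open>I_mat q (- 1)\<close> to be small, which the
  element \<open>1 + i\<close> of \<open>not_small_star\<close> prevents.\<close>

lemma maximal_G_minus_one:
  assumes q2: "q = 2" and b: "b \<in> W.cent (I_mat q (- 1))"
  shows "maximal_locally_nilpotent (G_grp q \<xi> (- 1) b) (GL q)"
proof -
  have m: "(- 1 :: 'a) \<noteq> 0" by simp
  obtain u where u: "W.weyl u (I_mat q (- 1)) (d_mat q \<xi> * b)" using weyl_I_db[OF m b] by blast
  have "\<not> W.small (I_mat q (- 1))"
    using G_minus_one_pow_notin[OF q2 b] W.small_weyl_group_semi(3)[OF u] unfolding G_grp_eq[OF m b] by blast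
  then show ?thesis
    unfolding G_grp_eq[OF m b] W.maximal_weyl_group_iff[OF u] using W.weyl_group_subset_cases[OF u] by blast
qed

text \<open>Otherwise the group lies in a conjugate of some \<open>H_grp q \<beta>\<close>, where
  all squares are scalar because \<open>d_mat\<close> is small; but \<open>1 + i\<close> has a
  nonscalar square.\<close>

lemma primitive_G_minus_one:
  assumes q2: "q = 2" and n: "\<not> is_power 2 (- 1 :: 'a)" and b: "b \<in> W.cent (I_mat q (- 1))"
  shows "primitive_lin q (G_grp q \<xi> (- 1) b)"
proof (rule ccontr)
  assume imp: "\<not> ?thesis"
  have m: "(- 1 :: 'a) \<noteq> 0" by simp
  obtain u where u: "W.weyl u (I_mat q (- 1)) (d_mat q \<xi> * b)" using weyl_I_db[OF m b] by blast
  have "\<not> is_power q (- 1 :: 'a)" using n q2 by simp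
  then obtain g \<beta> where g: "g \<in> carrier (GL q)" "\<beta> \<noteq> 0" "G_grp q \<xi> (- 1) b \<subseteq> W.conjg g ` H_grp q \<beta>"
    using weyl_group_imprimitive[OF u I_mat_pow_n[OF q_pos]] imp unfolding G_grp_eq[OF m b] by blast
  obtain y where y: "y \<in> G_grp q \<xi> (- 1) b" "y [^]\<^bsub>GL q\<^esub> q \<notin> scalar_group q" using G_minus_one_pow_notin[OF q2 b] by blast
  obtain k where k: "k \<in> H_grp q \<beta>" "y = W.conjg g k" using g(3) y(1) by blast
  have kG: "k \<in> carrier (GL q)" using k(1) W.weyl_group_carrier[OF weyl_d_I[OF g(2)]] unfolding H_grp_eq[OF g(2)] by blast
  have "k [^]\<^bsub>GL q\<^esub> q \<in> scalar_group q"
    by (rule W.small_weyl_group_semi(3)[OF weyl_d_I[OF g(2)] small_d_mat[OF q2 n] k(1)[unfolded H_grp_eq[OF g(2)]]])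
  then show False
    using y(2) W.conjg_pow[OF g(1) kG, of q] W.conjg_mem_Z_iff[OF g(1) W.nat_pow_closed[OF kG, of q]] unfolding k(2) by simp
qed

text \<open>Scaling by \<open>inverse s\<close> turns the square \<open>- (s ^ 2)\<close> into
  \<open>-1\<close> and changes neither the centralizer nor the group. Hence \<open>-1\<close>
  represents all parameters \<alpha> with \<open>- \<alpha>\<close> a square.\<close>

lemma weyl_rescale:
  assumes q2: "q = 2" and w: "W.weyl w x h" and xq: "x ^\<^sub>m q = \<gamma> \<cdot>\<^sub>m 1\<^sub>m q" and \<gamma>: "\<gamma> = - (s ^ q)" "s \<noteq> 0"
  shows "\<exists>c \<in> scalar_group q. W.weyl w (c \<otimes>\<^bsub>GL q\<^esub> x) h \<and> (c \<otimes>\<^bsub>GL q\<^esub> x) ^\<^sub>m q = (- 1) \<cdot>\<^sub>m 1\<^sub>m q"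
proof -
  define c where "c = inverse s \<cdot>\<^sub>m 1\<^sub>m q"
  have c: "c \<in> scalar_group q" unfolding c_def scalar_group_iff using \<gamma>(2) by (intro exI[of _ "inverse s"]) simp
  have x: "x \<in> carrier_mat q q" using W.weyl_closed(1)[OF w] by (simp add: carrier_GL)
  have cx: "c \<otimes>\<^bsub>GL q\<^esub> x = inverse s \<cdot>\<^sub>m x" unfolding c_def using scalar_mat_mult(1)[OF x] by simp
  have xx: "x * x = \<gamma> \<cdot>\<^sub>m 1\<^sub>m q" using xq x q2 by (simp add: numeral_2_eq_2)
  have "(inverse s \<cdot>\<^sub>m x) ^\<^sub>m q = (inverse s \<cdot>\<^sub>m x) * (inverse s \<cdot>\<^sub>m x)" using x q2 by (simp add: numeral_2_eq_2)
  also have "\<dots> = (inverse s * inverse s * \<gamma>) \<cdot>\<^sub>m 1\<^sub>m q"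
    using x xx by (simp add: mult_smult_assoc_mat[of _ q q _ q] mult_smult_distrib[of _ q q _ q] smult_smult_mat mult.assoc)
  also have "inverse s * inverse s * \<gamma> = - 1" using \<gamma> q2 by (simp add: field_simps power2_eq_square)
  finally have "(c \<otimes>\<^bsub>GL q\<^esub> x) ^\<^sub>m q = (- 1) \<cdot>\<^sub>m 1\<^sub>m q" unfolding cx .
  then show ?thesis using c W.weyl_Z_mult[OF w c] by blast
qed

section \<open>Normal forms, the classification and the exceptions\<close>

lemma weyl_group_normal_form:
  assumes w: "W.weyl w x h"
  shows "\<exists>g \<in> carrier (GL q). (\<exists>\<beta>. \<beta> \<noteq> 0 \<and> W.conjg g ` W.weyl_group x h = H_grp q \<beta>) \<or>
    (\<exists>\<alpha>. \<exists>b \<in> W.cent (I_mat q \<alpha>). \<not> is_power q \<alpha> \<and> (q = 2 \<and> is_power q (- \<alpha>) \<longrightarrow> \<alpha> = - 1) \<and>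
      W.conjg g ` W.weyl_group x h = G_grp q \<xi> \<alpha> b)"
proof -
  obtain \<gamma> where \<gamma>: "\<gamma> \<noteq> 0" "x ^\<^sub>m q = \<gamma> \<cdot>\<^sub>m 1\<^sub>m q" using weyl_pow_scalar[OF w] by blast
  show ?thesis
  proof (cases "is_power q \<gamma>")
    case True
    then obtain a where a: "\<gamma> = a ^ q" "a \<noteq> 0" using is_power_obtain \<gamma>(1) by blast
    show ?thesis using weyl_type_power[OF w \<gamma>(2)[unfolded a(1)] a(2)] by blast
  next
    case False
    show ?thesis
    proof (cases "q = 2 \<and> is_power q (- \<gamma>)")
      case True
      then obtain s where s: "- \<gamma> = s ^ q" "s \<noteq> 0" using is_power_obtain[of "- \<gamma>"] \<gamma>(1) by auto
      have g: "\<gamma> = - (s ^ q)" using s(1) by (metis minus_minus)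
      obtain c where c: "c \<in> scalar_group q" "W.weyl w (c \<otimes>\<^bsub>GL q\<^esub> x) h" "(c \<otimes>\<^bsub>GL q\<^esub> x) ^\<^sub>m q = (- 1) \<cdot>\<^sub>m 1\<^sub>m q"
        using weyl_rescale[OF _ w \<gamma>(2) g s(2)] True by blast
      have "\<not> is_power q (- 1 :: 'a)"
      proof
        assume "is_power q (- 1 :: 'a)"
        then obtain t where "t ^ q = (- 1 :: 'a)" by (auto simp: is_power_def)
        then have "(t * s) ^ q = \<gamma>" using g by (simp add: power_mult_distrib)
        then show False using False by (auto simp: is_power_def)
      qed
      moreover have "W.weyl_group (c \<otimes>\<^bsub>GL q\<^esub> x) h = W.weyl_group x h"
        by (rule W.weyl_group_eqI[OF W.cent_Z_mult[OF W.weyl_closed(1)[OF w] c(1)]])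
      ultimately show ?thesis using weyl_type_nonpower[OF c(2,3)] by metis
    next
      case nonstar: False
      then show ?thesis using weyl_type_nonpower[OF w \<gamma>(2) False] False by blast
    qed
  qed
qed

lemma conj_H_grp_N_family:
  assumes A: "A \<subseteq> carrier (GL q)" and g: "g \<in> carrier (GL q)" "W.conjg g ` A = H_grp q \<beta>" and \<beta>: "\<beta> \<noteq> 0"
  shows "\<exists>g \<in> carrier (GL q). W.conjg g ` A \<in> N_family q \<xi>"
proof (cases "\<beta> \<in> S_set q")
  case True
  then obtain g' where g': "g' \<in> carrier (GL q)" "W.conjg g' ` H_grp q \<beta> = H_grp q 1" using H_grp_conj_1 by blast
  have "W.conjg (g' \<otimes>\<^bsub>GL q\<^esub> g) ` A = H_grp q 1" unfolding W.conjg_image_mult[OF g(1) g'(1) A, symmetric] g(2) g'(2) ..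
  then show ?thesis using W.m_closed[OF g'(1) g(1)] unfolding N_family_def by blast
next
  case False
  then have "H_grp q \<beta> \<in> N_family q \<xi>" using \<beta> by (auto simp: N_family_def H_family_def simp del: carrier_mult_of)
  then show ?thesis using g by metis
qed

lemma maximal_conj_N_family:
  assumes w: "W.weyl w x h" and max: "maximal_locally_nilpotent (W.weyl_group x h) (GL q)"
  shows "\<exists>g \<in> carrier (GL q). W.conjg g ` W.weyl_group x h \<in> N_family q \<xi>"
proof -
  note A = W.weyl_group_carrier[OF w]
  obtain g where g: "g \<in> carrier (GL q)" and "(\<exists>\<beta>. \<beta> \<noteq> 0 \<and> W.conjg g ` W.weyl_group x h = H_grp q \<beta>) \<or>
    (\<exists>\<alpha>. \<exists>b \<in> W.cent (I_mat q \<alpha>). \<not> is_power q \<alpha> \<and> (q = 2 \<and> is_power q (- \<alpha>) \<longrightarrow> \<alpha> = - 1) \<and>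
      W.conjg g ` W.weyl_group x h = G_grp q \<xi> \<alpha> b)"
    using weyl_group_normal_form[OF w] by blast
  then consider (H) \<beta> where "\<beta> \<noteq> 0" "W.conjg g ` W.weyl_group x h = H_grp q \<beta>"
    | (G) \<alpha> b where "b \<in> W.cent (I_mat q \<alpha>)" "\<not> is_power q \<alpha>" "q = 2 \<and> is_power q (- \<alpha>) \<longrightarrow> \<alpha> = - 1"
      "W.conjg g ` W.weyl_group x h = G_grp q \<xi> \<alpha> b" by blast
  then show ?thesis
  proof cases
    case H then show ?thesis using conj_H_grp_N_family[OF A g] by blast
  next
    case G
    have \<alpha>0: "\<alpha> \<noteq> 0" using G(2) is_power_0 by auto
    show ?thesis
    proof (cases "primitive_lin q (G_grp q \<xi> \<alpha> b)")
      case True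
      have "G_grp q \<xi> \<alpha> b \<in> G_family q \<xi>"
      proof (cases "q = 2 \<and> is_power q (- \<alpha>)")
        case star: True
        then have "\<alpha> = - 1" using G(3) by blast
        moreover have "(- 1 :: 'a) \<notin> Fx_powers 2" using G(2) star \<open>\<alpha> = - 1\<close> Fx_powers_iff[of 2 "- 1 :: 'a"] by simp
        ultimately show ?thesis using True G(1) star Delta_units_carrier[of "- 1"] unfolding G_family_def by auto
      next
        case False
        then have "\<not> case_star q \<alpha>" using \<alpha>0 uminus_Fx_powers_iff[of 2 \<alpha>] by (auto simp: case_star_def)
        moreover have "\<alpha> \<in> carrier Fx - Fx_powers q" using \<alpha>0 G(2) Fx_powers_iff[OF q_pos, of \<alpha>] by simp
        ultimately show ?thesis using True G(1) Delta_units_carrier[OF \<alpha>0] unfolding G_family_def by blast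
      qed
      then show ?thesis using g unfolding G(4)[symmetric] N_family_def by blast
    next
      case False
      \<comment> \<open>An imprimitive group lies in a conjugate of some
        \<open>H_grp q \<beta>\<close>. As the latter is locally nilpotent, maximality forces
        equality, and the group belongs to the diagonal type after all.\<close>
      obtain u where u: "W.weyl u (I_mat q \<alpha>) (d_mat q \<xi> * b)" using weyl_I_db[OF \<alpha>0 G(1)] by blast
      obtain k \<beta> where k: "k \<in> carrier (GL q)" "\<beta> \<noteq> 0" "G_grp q \<xi> \<alpha> b \<subseteq> W.conjg k ` H_grp q \<beta>"
        using weyl_group_imprimitive[OF u I_mat_pow_n[OF q_pos] G(2)] False unfolding G_grp_eq[OF \<alpha>0 G(1)] by blast
      note wH = weyl_d_I[OF k(2)]
      have "maximal_locally_nilpotent (G_grp q \<xi> \<alpha> b) (GL q)"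
        using W.maximal_weyl_group_conjg[OF w g max] unfolding W.weyl_group_conjg[OF w g, symmetric] G(4) .
      moreover have "locally_nilpotent_subgroup (W.conjg k ` H_grp q \<beta>) (GL q)"
        unfolding H_grp_eq[OF k(2)] W.weyl_group_conjg[OF wH k(1)] by (rule W.weyl_group_locally_nilpotent[OF W.weyl_conjg[OF wH k(1)]])
      ultimately have "G_grp q \<xi> \<alpha> b = W.conjg k ` H_grp q \<beta>" using k(3) unfolding maximal_locally_nilpotent_def by blast
      then have "W.conjg (inv\<^bsub>GL q\<^esub> k) ` W.conjg g ` W.weyl_group x h = H_grp q \<beta>"
        unfolding G(4) using W.conjg_image_by_inv[OF k(1), of "H_grp q \<beta>"] W.weyl_group_carrier[OF wH] H_grp_eq[OF k(2)] by simp
      then have "W.conjg (inv\<^bsub>GL q\<^esub> k \<otimes>\<^bsub>GL q\<^esub> g) ` W.weyl_group x h = H_grp q \<beta>"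
        unfolding W.conjg_image_mult[OF g W.inv_closed[OF k(1)] A] .
      then show ?thesis by (rule conj_H_grp_N_family[OF A W.m_closed[OF W.inv_closed[OF k(1)] g] _ k(2)])
    qed
  qed
qed

text \<open>Schur's lemma makes the commutant of \<open>K\<close> scalar, and
  \<open>finite_commutant\<close> realizes it as the commutant of a finite \<open>B\<close>, as the
  embedding into a Weyl group demands.\<close>

lemma absolutely_irreducible_maximal_weyl:
  assumes K: "subgroup K (GL q)" and irr: "absolutely_irreducible q K" and max: "maximal_locally_nilpotent K (GL q)"
  shows "\<exists>w x h. W.weyl w x h \<and> K = W.weyl_group x h"
proof -
  have Km: "K \<subseteq> carrier_mat q q" using subgroup.subset[OF K] by (auto simp: carrier_GL)
  obtain B where B: "finite B" "B \<subseteq> K" "\<forall>y \<in> carrier_mat q q. (\<forall>b \<in> B. y * b = b * y) \<longrightarrow> (\<forall>b \<in> K. y * b = b * y)"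
    using finite_commutant[OF Km] by blast
  have cB: "y \<in> scalar_group q" if y: "y \<in> carrier (GL q)" "\<And>b. b \<in> B \<Longrightarrow> y \<otimes>\<^bsub>GL q\<^esub> b = b \<otimes>\<^bsub>GL q\<^esub> y" for y
  proof -
    have ym: "y \<in> carrier_mat q q" "det y \<noteq> 0" using y(1) by (auto simp: carrier_GL)
    obtain c where c: "y = c \<cdot>\<^sub>m 1\<^sub>m q" using absolutely_irreducible_commutant[OF irr Km ym(1)] B(3) ym(1) y(2) by auto
    have "c \<noteq> 0" using ym(2) q_pos unfolding c by auto
    then show ?thesis using c by (auto simp: scalar_group_iff)
  qed
  have "\<not> carrier (GL q) \<subseteq> (scalar_group q :: 'a mat set)"
    using W.weyl_not_Z[OF weyl_d_I[of 1]] W.weyl_closed(2)[OF weyl_d_I[of 1]] by auto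
  moreover have "locally_nilpotent_subgroup K (GL q)" using max by (simp add: maximal_locally_nilpotent_def)
  ultimately obtain w x h where w: "W.weyl w x h" "K \<subseteq> W.weyl_group x h"
    using W.locally_nilpotent_subset_weyl_group[OF _ _ B(1,2) cB] by blast
  then show ?thesis using max W.weyl_group_locally_nilpotent[OF w(1)] unfolding maximal_locally_nilpotent_def by blast
qed

text \<open>For \<open>q = 2\<close> the product of \<open>d_mat q \<xi>\<close> and
  \<open>I_mat q 1\<close> is \<open>I_mat q (- 1)\<close>, so \<open>I_mat q (- 1)\<close> and
  \<open>d_mat\<close> form a Weyl pair inside \<open>H_grp q 1\<close> and the pair can be swapped.
  The inclusion is proper because only the larger group has an element with nonscalar
  square.\<close>

lemma H_one_psubset_G_minus_one:
  assumes q2: "q = 2" and n: "\<not> is_power 2 (- 1 :: 'a)"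
  shows "H_grp q 1 \<subset> G_grp q \<xi> (- 1) (1\<^sub>m q)"
proof -
  have m: "(- 1 :: 'a) \<noteq> 0" and o: "(1 :: 'a) \<noteq> 0" by simp_all
  have IG: "I_mat q (- 1 :: 'a) \<in> carrier (GL q)" by (rule I_mat_GL[OF q_pos m])
  have one: "1\<^sub>m q \<in> W.cent (I_mat q (- 1 :: 'a))" using subgroup.one_closed[OF W.cent_subgroup[OF IG]] by simp
  have dm: "d_mat q \<xi> \<in> carrier_mat q q" by (simp add: d_mat_def)
  note I1 = I_mat_carrier[OF q_pos, of "1 :: 'a"] and Im = I_mat_carrier[OF q_pos, of "- 1 :: 'a"]
  have "d_mat q \<xi> * I_mat q 1 = I_mat q (- 1)"
    unfolding d_mat_def mat_diag_mult_left[OF I1] using q2 quadratic_root[OF q2] carrier_matD[OF Im]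
    by (intro eq_matI) (auto simp: I_mat_index less_Suc_eq numeral_2_eq_2)
  then have dI: "d_mat q \<xi> \<otimes>\<^bsub>GL q\<^esub> I_mat q 1 = I_mat q (- 1)" by simp
  note w1 = weyl_d_I[OF o] note wm = W.weyl_sym[OF weyl_d_I[OF m]]
  have H: "H_grp q 1 = W.weyl_group (d_mat q \<xi>) (I_mat q 1)" by (rule H_grp_eq[OF o])
  have G: "G_grp q \<xi> (- 1) (1\<^sub>m q) = W.weyl_group (I_mat q (- 1)) (d_mat q \<xi>)"
    unfolding G_grp_eq[OF m one] using dm by simp
  note mem = W.weyl_group_x[OF w1] W.weyl_group_incl(2)[OF w1]
  have "I_mat q (- 1) \<in> W.weyl_group (d_mat q \<xi>) (I_mat q 1)"
    unfolding dI[symmetric] by (rule subgroup.m_closed[OF W.weyl_group_subgroup[OF w1] mem])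
  then have "H_grp q 1 \<subseteq> G_grp q \<xi> (- 1) (1\<^sub>m q)"
    unfolding H G by (rule W.small_weyl_group_subset_swap[OF w1 small_d_mat[OF q2 n] wm _ mem(1)])
  moreover obtain y where "y \<in> G_grp q \<xi> (- 1) (1\<^sub>m q)" "y [^]\<^bsub>GL q\<^esub> q \<notin> scalar_group q" using G_minus_one_pow_notin[OF q2 one] by blast
  moreover have "y [^]\<^bsub>GL q\<^esub> q \<in> scalar_group q" if "y \<in> H_grp q 1" for y :: "'a mat"
    by (rule W.small_weyl_group_semi(3)[OF w1 small_d_mat[OF q2 n] that[unfolded H]])
  ultimately show ?thesis by blast
qed

text \<open>The condition on \<open>det b\<close> says that \<open>y = h\<close> or
  \<open>y = x h\<close> has square determinant \<open>t ^ 2\<close>, so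
  \<open>y ^ 2 = - (t ^ 2)\<close> by \<open>quadratic_weyl_det\<close>, and \<open>y\<close> can be
  rescaled to have square \<open>-1\<close>. After swapping the pair to \<open>(y, x)\<close> and
  conjugating \<open>y\<close> to \<open>I_mat q (- 1)\<close>, the old \<open>x\<close> takes the
  form \<open>d_mat q \<xi> * c\<close>; comparing determinants gives
  \<open>det c = \<alpha>\<close>.\<close>

lemma exceptional_conj_psubset:
  assumes q2: "q = 2" and n: "\<not> is_power 2 (- 1 :: 'a)" and \<alpha>: "\<not> is_power q \<alpha>" "\<not> is_power q (- \<alpha>)"
    and b: "b \<in> W.cent (I_mat q \<alpha>)" and ex: "is_power q (- det b) \<or> is_power q (\<alpha> * det b)"
  shows "\<exists>c \<in> W.cent (I_mat q (- 1)). det c = \<alpha> \<and>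
    (\<exists>g \<in> carrier (GL q). W.conjg g ` G_grp q \<xi> \<alpha> b \<subset> G_grp q \<xi> (- 1) c)"
proof -
  let ?x = "I_mat q \<alpha>" and ?h = "d_mat q \<xi> * b"
  have \<alpha>0: "\<alpha> \<noteq> 0" using \<alpha> is_power_0 by auto
  have n': "\<not> is_power q (- 1 :: 'a)" using n q2 by simp
  obtain u where u: "W.weyl u ?x ?h" using weyl_I_db[OF \<alpha>0 b] by blast
  have small: "W.small ?x" using small_I_mat[OF \<alpha>(1) _ u] \<alpha>(2) by blast
  have bm: "b \<in> carrier_mat q q" using W.cent_closed[OF b] by (simp add: carrier_GL)
  have xG: "?x \<in> carrier (GL q)" and hG: "?h \<in> carrier (GL q)" using W.weyl_closed[OF u] by auto
  have dx: "det ?x = - \<alpha>" using det_I_mat[OF \<alpha>0] q2 by simp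
  have dh: "det ?h = - det b" by (rule det_d_mult[OF q2 bm])
  have dxh: "det (?x \<otimes>\<^bsub>GL q\<^esub> ?h) = \<alpha> * det b" using det_mult[of ?x q ?h] xG hG dx dh by (simp add: carrier_GL)
  note mem = W.weyl_group_x[OF u] W.weyl_group_incl(2)[OF u]
  have xh: "?x \<otimes>\<^bsub>GL q\<^esub> ?h \<in> W.weyl_group ?x ?h" by (rule subgroup.m_closed[OF W.weyl_group_subgroup[OF u] mem])
  obtain y where y: "y \<in> W.weyl_group ?x ?h" "W.weyl u ?x y" "is_power q (det y)"
    using ex mem(2) u xh W.weyl_mult_left[OF u] unfolding dh[symmetric] dxh[symmetric] by blast
  have "det y \<noteq> 0" using W.weyl_closed(2)[OF y(2)] by (simp add: carrier_GL)
  then obtain t where t: "det y = t ^ q" "t \<noteq> 0" using is_power_obtain[OF y(3)] by blast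
  have wy: "W.weyl (inv\<^bsub>GL q\<^esub> u) y ?x" by (rule W.weyl_sym[OF y(2)])
  obtain \<gamma> where \<gamma>: "y ^\<^sub>m q = \<gamma> \<cdot>\<^sub>m 1\<^sub>m q" using weyl_pow_scalar[OF wy] by blast
  have "\<gamma> = - (t ^ q)" using quadratic_weyl_det[OF q2 wy \<gamma>] t(1) by simp
  then obtain c where c: "c \<in> scalar_group q" "W.weyl (inv\<^bsub>GL q\<^esub> u) (c \<otimes>\<^bsub>GL q\<^esub> y) ?x" "(c \<otimes>\<^bsub>GL q\<^esub> y) ^\<^sub>m q = (- 1) \<cdot>\<^sub>m 1\<^sub>m q"
    using weyl_rescale[OF q2 wy \<gamma> _ t(2)] by blast
  let ?y = "c \<otimes>\<^bsub>GL q\<^esub> y"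
  have cy: "?y \<in> W.weyl_group ?x ?h"
    by (rule subgroup.m_closed[OF W.weyl_group_subgroup[OF u] _ y(1)]) (use W.weyl_group_incl(3)[OF u] c(1) in blast)
  have sub: "W.weyl_group ?x ?h \<subseteq> W.weyl_group ?y ?x" by (rule W.small_weyl_group_subset_swap[OF u small c(2) cy mem(1)])
  have "inv\<^bsub>GL q\<^esub> u = inv\<^bsub>GL q\<^esub> (\<xi> \<cdot>\<^sub>m 1\<^sub>m q)"
    using quadratic_weyl_root[OF q2 c(2)] quadratic_weyl_root[OF q2 W.weyl_sym[OF weyl_d_I[of 1]]] by simp
  then have "W.weyl (inv\<^bsub>GL q\<^esub> (\<xi> \<cdot>\<^sub>m 1\<^sub>m q)) ?y ?x" using c(2) by (simp only:)
  from weyl_type_nonpower_root[OF this c(3) n'] obtain g e where g: "g \<in> carrier (GL q)" "e \<in> W.cent (I_mat q (- 1))"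
    "W.conjg g ?x = d_mat q \<xi> * e" "W.conjg g ` W.weyl_group ?y ?x = G_grp q \<xi> (- 1) e" by blast
  have em: "e \<in> carrier_mat q q" using W.cent_closed[OF g(2)] by (simp add: carrier_GL)
  have "- \<alpha> = - det e" using det_conjg[OF g(1) xG] dx unfolding g(3) det_d_mult[OF q2 em] by simp
  then have "det e = \<alpha>" by simp
  moreover have "W.conjg g ` G_grp q \<xi> \<alpha> b \<subseteq> G_grp q \<xi> (- 1) e"
    unfolding G_grp_eq[OF \<alpha>0 b] g(4)[symmetric] using sub by (rule image_mono)
  moreover have "W.conjg g ` G_grp q \<xi> \<alpha> b \<noteq> G_grp q \<xi> (- 1) e"
  proof
    assume e: "W.conjg g ` G_grp q \<xi> \<alpha> b = G_grp q \<xi> (- 1) e"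
    obtain k where k: "k \<in> W.weyl_group ?x ?h" "W.conjg g k [^]\<^bsub>GL q\<^esub> q \<notin> scalar_group q"
      using G_minus_one_pow_notin[OF q2 g(2)] unfolding e[symmetric] G_grp_eq[OF \<alpha>0 b] by blast
    have kG: "k \<in> carrier (GL q)" using k(1) W.weyl_group_carrier[OF u] by blast
    show False using k(2) W.small_weyl_group_semi(3)[OF u small k(1)] W.conjg_pow[OF g(1) kG, of q]
        W.conjg_mem_Z_iff[OF g(1) W.nat_pow_closed[OF kG, of q]] by simp
  qed
  ultimately show ?thesis using g(1,2) by blast
qed

lemma N_family_weyl:
  assumes "L \<in> N_family q \<xi>"
  shows "\<exists>w x h. W.weyl w x h \<and> L = W.weyl_group x h"
proof -
  have H: "\<exists>w x h. W.weyl w x h \<and> H_grp q \<beta> = W.weyl_group x h" if "\<beta> \<noteq> 0" for \<beta> :: 'a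
    using weyl_d_I[OF that] H_grp_eq[OF that] by blast
  have G: "\<exists>w x h. W.weyl w x h \<and> G_grp q \<xi> \<alpha> b = W.weyl_group x h" if "\<alpha> \<noteq> 0" "b \<in> carrier (Delta_units q \<alpha>)" for \<alpha> b
    using weyl_I_db[OF that(1)] G_grp_eq[OF that(1)] that(2) unfolding Delta_units_carrier[OF that(1)] by blast
  have "(1::'a) \<noteq> 0" "(- 1 :: 'a) \<noteq> 0" by simp_all
  then show ?thesis using assms H G unfolding N_family_def H_family_def G_family_def by (auto simp del: carrier_mult_of)
qed

lemma exceptional_params_iff:
  assumes "q = 2"
  shows "(\<alpha>, b) \<in> exceptional_params q \<xi> \<longleftrightarrow> G_grp q \<xi> \<alpha> b \<in> G_family q \<xi> \<and> \<not> is_power q \<alpha> \<and> \<not> is_power q (- \<alpha>) \<and>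
    b \<in> W.cent (I_mat q \<alpha>) \<and> (is_power q (- det b) \<or> is_power q (\<alpha> * det b))"
proof (cases "\<not> is_power q \<alpha> \<and> b \<in> W.cent (I_mat q \<alpha>)")
  case True
  have \<alpha>0: "\<alpha> \<noteq> 0" using True is_power_0 by auto
  have b0: "det b \<noteq> 0" using True W.cent_closed[of b] by (auto simp: carrier_GL)
  \<comment> \<open>Since the square of \<alpha> is a square, lying in the coset of \<alpha> means
    that the product with \<alpha> is a square.\<close>
  have "det b \<in> (\<lambda>x. \<alpha> * x) ` Fx_powers q \<longleftrightarrow> is_power q (\<alpha> * det b)"
  proof
    assume "det b \<in> (\<lambda>x. \<alpha> * x) ` Fx_powers q"
    then obtain x where x: "det b = \<alpha> * x" "x \<in> Fx_powers q" by blast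
    then obtain t where "t ^ q = x" unfolding Fx_powers_iff[OF q_pos] is_power_def by blast
    then have "det b = \<alpha> * t ^ q" using x(1) by simp
    then have "(\<alpha> * t) ^ q = \<alpha> * det b" using assms by (simp add: power2_eq_square)
    then show "is_power q (\<alpha> * det b)" by (auto simp: is_power_def)
  next
    assume "is_power q (\<alpha> * det b)"
    then obtain t where t: "\<alpha> * det b = t ^ q" "t \<noteq> 0" using is_power_obtain[of "\<alpha> * det b"] \<alpha>0 b0 by (metis mult_eq_0_iff)
    have "\<alpha> * (t / \<alpha>) ^ q = t ^ q / \<alpha>" using \<alpha>0 assms by (simp add: power2_eq_square)
    also have "\<dots> = det b" using \<alpha>0 by (simp flip: t(1))
    finally have "det b = \<alpha> * (t / \<alpha>) ^ q" by simp
    moreover have "(t / \<alpha>) ^ q \<in> Fx_powers q" using t(2) \<alpha>0 by (auto simp: Fx_powers_iff[OF q_pos] is_power_def)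
    ultimately show "det b \<in> (\<lambda>x. \<alpha> * x) ` Fx_powers q" by blast
  qed
  moreover have "\<alpha> \<in> carrier Fx - Fx_powers q" using True \<alpha>0 Fx_powers_iff[OF q_pos, of \<alpha>] by simp
  ultimately show ?thesis
    using True \<alpha>0 b0 uminus_Fx_powers_iff[OF q_pos, of \<alpha>] uminus_Fx_powers_iff[OF q_pos, of "det b"] Delta_units_carrier[OF \<alpha>0] assms
    unfolding exceptional_params_def by blast
next
  case False
  have "\<not> is_power q \<alpha> \<and> b \<in> W.cent (I_mat q \<alpha>)" if "\<alpha> \<in> carrier Fx - Fx_powers q" "b \<in> carrier (Delta_units q \<alpha>)"
    using that Fx_powers_iff[OF q_pos, of \<alpha>] Delta_units_carrier[of \<alpha>] by auto
  then show ?thesis using False unfolding exceptional_params_def by blast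
qed

lemma N_family_maximal:
  assumes L: "L \<in> N_family q \<xi>" "L \<notin> exceptions q \<xi>"
  shows "maximal_locally_nilpotent L (GL q)"
proof -
  have nsq: "\<not> is_power 2 (- 1 :: 'a) \<longleftrightarrow> \<not> (\<exists>x::'a. x ^ 2 = - 1)" by (simp add: is_power_def)
  consider "L = H_grp q 1" | \<beta> where "\<beta> \<in> carrier Fx - S_set q" "L = H_grp q \<beta>"
    | \<alpha> b where "\<alpha> \<in> carrier Fx - Fx_powers q" "b \<in> carrier (Delta_units q \<alpha>)" "primitive_lin q L" "\<not> case_star q \<alpha>" "L = G_grp q \<xi> \<alpha> b"
    | b where "q = 2" "b \<in> carrier (Delta_units q (- 1 :: 'a))" "L = G_grp q \<xi> (- 1) b"
    using L(1) unfolding N_family_def H_family_def G_family_def by blast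
  then show ?thesis
  proof cases
    case 1
    have "\<not> (q = 2 \<and> \<not> is_power 2 (- 1 :: 'a))" using L(2) nsq unfolding exceptions_def 1 by auto
    then show ?thesis unfolding 1 by (intro maximal_H_grp) auto
  next
    case 2
    then have \<beta>: "\<beta> \<noteq> 0" "\<beta> \<notin> S_set q" by auto
    show ?thesis unfolding 2(2) by (rule maximal_H_grp[OF \<beta>(1)]) (rule \<beta>(2))
  next
    case 3
    have \<alpha>: "\<alpha> \<noteq> 0" "\<not> is_power q \<alpha>" using 3(1) Fx_powers_iff[OF q_pos, of \<alpha>] by auto
    have b: "b \<in> W.cent (I_mat q \<alpha>)" using 3(2) Delta_units_carrier[OF \<alpha>(1)] by simp
    have ns: "\<not> (q = 2 \<and> is_power q (- \<alpha>))" using 3(4) uminus_Fx_powers_iff[OF q_pos, of \<alpha>] \<alpha>(1) by (auto simp: case_star_def)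
    have fam: "L \<in> G_family q \<xi>" unfolding G_family_def using 3 by blast
    have "\<not> is_power q (- det b) \<and> \<not> is_power q (\<alpha> * det b)" if q2: "q = 2" and n: "\<not> is_power 2 (- 1 :: 'a)"
    proof (rule ccontr)
      assume "\<not> ?thesis"
      then have "(\<alpha>, b) \<in> exceptional_params q \<xi>"
        unfolding exceptional_params_iff[OF q2] using \<alpha> b ns q2 fam 3(5) by blast
      then have "L \<in> exceptions q \<xi>" unfolding exceptions_def 3(5) using q2 n nsq by auto
      then show False using L(2) by blast
    qed
    then show ?thesis using maximal_G_grp[OF \<alpha>(2) ns b] 3(3) unfolding 3(5) by blast
  next
    case 4
    then show ?thesis using maximal_G_minus_one[of b] Delta_units_carrier[of "- 1"] by simp
  qed
qed

lemma exceptions_not_maximal: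
  assumes L: "L \<in> exceptions q \<xi>"
  shows "\<not> maximal_locally_nilpotent L (GL q)"
proof -
  have q2: "q = 2" and n: "\<not> is_power 2 (- 1 :: 'a)"
    using L by (auto simp: exceptions_def is_power_def split: if_splits)
  have m: "(- 1 :: 'a) \<noteq> 0" by simp
  have ln: "locally_nilpotent_subgroup (G_grp q \<xi> (- 1) b) (GL q)" if "b \<in> W.cent (I_mat q (- 1))" for b
    using maximal_G_minus_one[OF q2 that] by (simp add: maximal_locally_nilpotent_def)
  have IG: "I_mat q (- 1 :: 'a) \<in> carrier (GL q)" by (rule I_mat_GL[OF q_pos m])
  have one: "1\<^sub>m q \<in> W.cent (I_mat q (- 1 :: 'a))" using subgroup.one_closed[OF W.cent_subgroup[OF IG]] by simp
  from L consider "L = H_grp q 1" | \<alpha> b where "L = G_grp q \<xi> \<alpha> b" "(\<alpha>, b) \<in> exceptional_params q \<xi>"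
    by (auto simp: exceptions_def split: if_splits)
  then show ?thesis
  proof cases
    case 1
    then show ?thesis using H_one_psubset_G_minus_one[OF q2 n] ln[OF one] unfolding maximal_locally_nilpotent_def by blast
  next
    case 2
    have e: "\<not> is_power q \<alpha>" "\<not> is_power q (- \<alpha>)" "b \<in> W.cent (I_mat q \<alpha>)" "is_power q (- det b) \<or> is_power q (\<alpha> * det b)"
      using 2(2) unfolding exceptional_params_iff[OF q2] by auto
    obtain c g where c: "c \<in> W.cent (I_mat q (- 1))" "g \<in> carrier (GL q)" "W.conjg g ` L \<subset> G_grp q \<xi> (- 1) c"
      using exceptional_conj_psubset[OF q2 n e] unfolding 2(1) by blast
    have \<alpha>0: "\<alpha> \<noteq> 0" using e is_power_0 by auto
    obtain u where u: "W.weyl u (I_mat q \<alpha>) (d_mat q \<xi> * b)" using weyl_I_db[OF \<alpha>0 e(3)] by blast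
    show ?thesis
    proof
      assume "maximal_locally_nilpotent L (GL q)"
      then have "maximal_locally_nilpotent (W.conjg g ` L) (GL q)"
        unfolding 2(1) G_grp_eq[OF \<alpha>0 e(3)] W.weyl_group_conjg[OF u c(2)] by (rule W.maximal_weyl_group_conjg[OF u c(2)])
      then show False using c(3) ln[OF c(1)] unfolding maximal_locally_nilpotent_def by blast
    qed
  qed
qed

lemma absolutely_irreducible_maximal_iff:
  assumes K: "subgroup K (GL q)"
  shows "absolutely_irreducible q K \<and> maximal_locally_nilpotent K (GL q) \<longleftrightarrow>
    (\<exists>L \<in> N_family q \<xi> - exceptions q \<xi>. conjugate_in (GL q) L K)"
proof
  assume "absolutely_irreducible q K \<and> maximal_locally_nilpotent K (GL q)"
  then obtain w x h where w: "W.weyl w x h" "K = W.weyl_group x h" and max: "maximal_locally_nilpotent (W.weyl_group x h) (GL q)"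
    using absolutely_irreducible_maximal_weyl[OF K] by blast
  obtain g where g: "g \<in> carrier (GL q)" "W.conjg g ` K \<in> N_family q \<xi>" using maximal_conj_N_family[OF w(1) max] w(2) by blast
  have "maximal_locally_nilpotent (W.conjg g ` K) (GL q)"
    unfolding w(2) W.weyl_group_conjg[OF w(1) g(1)] by (rule W.maximal_weyl_group_conjg[OF w(1) g(1) max])
  then have "W.conjg g ` K \<notin> exceptions q \<xi>" using exceptions_not_maximal by blast
  moreover have "K = conj_set (GL q) (inv\<^bsub>GL q\<^esub> g) (W.conjg g ` K)"
    unfolding W.conj_set_conjg using W.conjg_image_by_inv[OF g(1)] W.weyl_group_carrier[OF w(1)] w(2) by simp
  ultimately show "\<exists>L \<in> N_family q \<xi> - exceptions q \<xi>. conjugate_in (GL q) L K"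
    unfolding conjugate_in_def using g W.inv_closed[OF g(1)] by blast
next
  assume "\<exists>L \<in> N_family q \<xi> - exceptions q \<xi>. conjugate_in (GL q) L K"
  then obtain L g where L: "L \<in> N_family q \<xi>" "L \<notin> exceptions q \<xi>" and g: "g \<in> carrier (GL q)" "K = W.conjg g ` L"
    unfolding conjugate_in_def W.conj_set_conjg by blast
  obtain w x h where w: "W.weyl w x h" "L = W.weyl_group x h" using N_family_weyl[OF L(1)] by blast
  have Kw: "K = W.weyl_group (W.conjg g x) (W.conjg g h)" unfolding g(2) w(2) by (rule W.weyl_group_conjg[OF w(1) g(1)])
  show "absolutely_irreducible q K \<and> maximal_locally_nilpotent K (GL q)"
    unfolding Kw using weyl_group_absolutely_irreducible[OF W.weyl_conjg[OF w(1) g(1)]]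
      W.maximal_weyl_group_conjg[OF w(1) g(1) N_family_maximal[OF L, unfolded w(2)]] by blast
qed

lemma exceptions_containments:
  assumes q2: "q = 2" and n: "\<not> (\<exists>x::'a. x ^ 2 = - 1)"
  shows "G_grp q \<xi> (- 1) (1\<^sub>m q) \<in> G_family q \<xi>" and "H_grp q 1 \<subset> G_grp q \<xi> (- 1) (1\<^sub>m q)"
    and "(\<alpha>, b) \<in> exceptional_params q \<xi> \<Longrightarrow> \<exists>c \<in> carrier (Delta_units q (- 1)). det c = \<alpha> \<and>
      (\<exists>g \<in> carrier (GL q). conj_set (GL q) g (G_grp q \<xi> \<alpha> b) \<subset> G_grp q \<xi> (- 1) c)"
proof -
  have n': "\<not> is_power 2 (- 1 :: 'a)" using n by (simp add: is_power_def)
  have m: "(- 1 :: 'a) \<noteq> 0" by simp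
  have IG: "I_mat q (- 1 :: 'a) \<in> carrier (GL q)" by (rule I_mat_GL[OF q_pos m])
  have one: "1\<^sub>m q \<in> W.cent (I_mat q (- 1 :: 'a))" using subgroup.one_closed[OF W.cent_subgroup[OF IG]] by simp
  have "(- 1 :: 'a) \<notin> Fx_powers 2" using n' Fx_powers_iff[of 2 "- 1 :: 'a"] by simp
  then show "G_grp q \<xi> (- 1) (1\<^sub>m q) \<in> G_family q \<xi>"
    unfolding G_family_def using q2 one Delta_units_carrier[OF m] primitive_G_minus_one[OF q2 n' one] by blast
  show "H_grp q 1 \<subset> G_grp q \<xi> (- 1) (1\<^sub>m q)" by (rule H_one_psubset_G_minus_one[OF q2 n'])
  assume "(\<alpha>, b) \<in> exceptional_params q \<xi>"
  then have e: "\<not> is_power q \<alpha>" "\<not> is_power q (- \<alpha>)" "b \<in> W.cent (I_mat q \<alpha>)" "is_power q (- det b) \<or> is_power q (\<alpha> * det b)"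
    unfolding exceptional_params_iff[OF q2] by auto
  show "\<exists>c \<in> carrier (Delta_units q (- 1)). det c = \<alpha> \<and>
      (\<exists>g \<in> carrier (GL q). conj_set (GL q) g (G_grp q \<xi> \<alpha> b) \<subset> G_grp q \<xi> (- 1) c)"
    unfolding Delta_units_carrier[OF m] W.conj_set_conjg by (rule exceptional_conj_psubset[OF q2 n' e])
qed

end

theorem theorem3p18:
  fixes q :: nat and \<xi> :: "'a::field"
  assumes "Factorial_Ring.prime q"
    and "\<xi> \<in> carrier Fx" and "group.ord Fx \<xi> = q"
  shows
    "(\<forall>K :: 'a mat set. subgroup K (GL q) \<longrightarrow>
        (absolutely_irreducible q K \<and> maximal_locally_nilpotent K (GL q) \<longleftrightarrow>
         (\<exists>L \<in> N_family q \<xi> - exceptions q \<xi>. conjugate_in (GL q) L K))) \<and>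
     (\<forall>L \<in> exceptions q \<xi>. \<not> maximal_locally_nilpotent L (GL q)) \<and>
     (q = 2 \<and> \<not> (\<exists>x::'a. x ^ 2 = - 1) \<longrightarrow>
        (G_grp q \<xi> (- 1) (1\<^sub>m q) \<in> G_family q \<xi> \<and>
         H_grp q 1 \<subset> G_grp q \<xi> (- 1) (1\<^sub>m q)) \<and>
        (\<forall>(\<alpha>, b) \<in> exceptional_params q \<xi>.
           \<exists>c \<in> carrier (Delta_units q (- 1)). det c = \<alpha> \<and>
             (\<exists>g \<in> carrier (GL q).
                conj_set (GL q) g (G_grp q \<xi> \<alpha> b) \<subset> G_grp q \<xi> (- 1) c)))"
proof -
  interpret prime_root q \<xi>
  proof
    interpret F: group "Fx :: 'a monoid"
      using field.field_mult_group[OF class_field] by (simp add: mult_of_def Multiplicative_Group.mult_of_def)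
    have pow: "\<xi> [^]\<^bsub>Fx\<^esub> (n::nat) = \<xi> ^ n" for n by (induction n) (auto simp: nat_pow_Suc class_ring_simps mult.commute)
    have one: "\<one>\<^bsub>Fx\<^esub> = (1::'a)" by (simp add: class_ring_simps)
    show "Factorial_Ring.prime q" by (rule assms(1))
    show "\<xi> ^ q = 1" using F.pow_ord_eq_1[OF assms(2)] assms(3) pow one by simp
    show "\<xi> \<noteq> 1" using F.ord_eq_1[OF assms(2)] one assms(1,3) by (auto simp: prime_nat_iff)
  qed
  show ?thesis
    using absolutely_irreducible_maximal_iff exceptions_not_maximal exceptions_containments by (intro conjI allI impI ballI) auto
qed

end
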